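(* Let $\mathcal T$ be a rooted metric tree with compact core and exactly $m_\infty$ attached half-lines, equipped with the Gaussian measure $\mu$, and let $\mathcal A^{\mathrm D}$ and $\mathcal A^{\mathrm N}$ be the Dirichlet and Neumann realisations of the Ornstein–Uhlenbeck operator (as in the context). Enumerate the eigenvalues of $\mathcal A^{\mathrm D}$ and $\mathcal A^{\mathrm N}$, repeated according to multiplicity, as $$0<\lambda_1^{\mathrm D}\le\lambda_2^{\mathrm D}\le\cdots\nearrow\infty\quad\text{and}\quad 0=\lambda_1^{\mathrm N}<\lambda_2^{\mathrm N}\le\lambda_3^{\mathrm N}\le\cdots\nearrow\infty,$$ respectively. Then $$\lambda_n^{\mathrm D}\sim\frac{2n}{m_\infty},\qquad\lambda_n^{\mathrm N}\sim\frac{2n}{m_\infty},\qquad n\to\infty.$$ In particular, $\lambda_n^{\mathrm D}=\mathcal O(n)$ and $\lambda_n^{\mathrm N}=\mathcal O(n)$.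
   Context: Here $a_n\sim b_n$ means $a_n/b_n\to1$. Tree. Let $\widetilde{\mathcal T}$ be a compact rooted metric tree (a finite tree whose edges have finite positive lengths) with vertex set $\mathsf V$ and root $\mathsf o\in\mathsf V$; let $\mathsf L\subset\mathsf V\setminus\{\mathsf o\}$, assumed nonempty, be the set of its leaves (vertices of degree one, excluding the root). $\mathcal T$ is obtained from $\widetilde{\mathcal T}$ by attaching to each vertex of $\mathsf L$ a finite non-zero number of half-lines; $m_\infty$ is the total number of attached half-lines. $\mathsf E$ is the edge set of $\mathcal T$ (including half-lines). For $x\in\mathcal T$, $|x|$ is the path distance from $x$ to $\mathsf o$. Each edge is parametrised by arc length in the direction away from the root, and $f'$ denotes the (weak) derivative in this coordinate. The normal derivative of $f$ at a vertex $\mathsf v$ along an incident edge $\mathsf e\sim\mathsf v$, pointing away from $\mathsf v$ into $\mathsf e$, is $\frac{\partial f_{\mathsf e}}{\partial n}(\mathsf v)=f_{\mathsf e}'$ at $\mathsf v$ if $\mathsf e$ starts at $\mathsf v$, and $-f'_{\mathsf e}$ at $\mathsf v$ if $\mathsf e$ terminates at $\mathsf v$. Operators. $\mu(\mathrm dx)=\frac{2}{\sqrt\pi}e^{-|x|^2}\,\mathrm dx$ with $\mathrm dx$ Lebesgue measure on edges; $\widetilde{H^2_\mu}(\mathcal T)=\bigoplus_{\mathsf e\in\mathsf E}H^2_\mu(\mathsf e)$. $(\mathcal Af)(x)=-\frac12 f''(x)+|x|f'(x)$ on edges. Standard conditions at $\mathsf v$: $f$ is continuous at $\mathsf v$ and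 $\sum_{\mathsf e\sim\mathsf v}\frac{\partial f_{\mathsf e}}{\partial n}(\mathsf v)=0$. On $L^2_\mu(\mathcal T)$, $\mathcal A^{\mathrm D}$ is $\mathcal A$ with domain $\{f\in\widetilde{H^2_\mu}(\mathcal T): f(\mathsf o)=0,\ f$ satisfies the standard conditions at all $\mathsf v\in\mathsf V\setminus\{\mathsf o\}\}$; $\mathcal A^{\mathrm N}$ is $\mathcal A$ with domain $\{f\in\widetilde{H^2_\mu}(\mathcal T): f$ satisfies the standard conditions at all $\mathsf v\in\mathsf V\}$. Both are self-adjoint, non-negative and have compact resolvent, so the spectra consist of real eigenvalues of finite multiplicity accumulating only at $+\infty$. Equivalently they are associated with the form $\frac12\int_{\mathcal T}f'\overline{g'}\,\mathrm d\mu$ on, respectively, $\{f\in H^1_\mu(\mathcal T):f(\mathsf o)=0\}$ and $H^1_\mu(\mathcal T)$, where $H^1_\mu(\mathcal T)$ consists of the continuous functions on $\mathcal T$ that are in $H^1_\mu(\mathsf e)$ for every edge. *)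

theory Defs
  imports
    "HOL-Analysis.Analysis"
    "HOL-Library.Landau_Symbols"
    "HOL-Library.Function_Algebras"
    "Graph_Theory.Shortest_Path"
begin

section \<open>Rooted metric trees with attached half-lines\<close>

text \<open>
  The compact core is a finite digraph whose arcs are oriented away from the root; the half-lines
  are indexed by the set \<open>rays\<close>, and \<open>foot r\<close> is the leaf to which the half-line \<open>r\<close> is attached.
\<close>

record ('v, 'e, 'r) ray_tree =
  core :: "('v, 'e) pre_digraph"
  root :: 'v
  len :: "'e \<Rightarrow> real"
  rays :: "'r set"
  foot :: "'r \<Rightarrow> 'v"

text \<open>Leaves of the core: degree one there (counting both directions), the root excluded.\<close>

definition leaves :: "('v, 'e, 'r) ray_tree \<Rightarrow> 'v set" where
  "leaves T = {v \<in> verts (core T) - {root T}. in_degree (core T) v + out_degree (core T) v = 1}"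

text \<open>
  Uniqueness of the directed walk from the root to every vertex says that the core is a tree and
  that all its arcs point away from the root.
\<close>

definition is_ray_tree :: "('v, 'e, 'r) ray_tree \<Rightarrow> bool" where
  "is_ray_tree T \<longleftrightarrow>
     fin_digraph (core T) \<and>
     root T \<in> verts (core T) \<and>
     (\<forall>v \<in> verts (core T). \<exists>!p. pre_digraph.awalk (core T) (root T) p v) \<and>
     (\<forall>e \<in> arcs (core T). len T e > 0) \<and>
     leaves T \<noteq> {} \<and>
     finite (rays T) \<and>
     foot T ` rays T = leaves T"

definition m_inf :: "('v, 'e, 'r) ray_tree \<Rightarrow> nat" where
  "m_inf T = card (rays T)"

text \<open>Distance of a vertex from the root.\<close>

definition rad :: "('v, 'e, 'r) ray_tree \<Rightarrow> 'v \<Rightarrow> real" where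
  "rad T v = real_of_ereal (wf_digraph.\<mu> (core T) (len T) (root T) v)"

text \<open>
  Edges of the full tree are \<open>Inl e\<close> for an arc \<open>e\<close> of the core and \<open>Inr r\<close> for a half-line \<open>r\<close>.
  As arc-length parameter on an edge we use the distance \<open>t = |x|\<close> to the root, so that an arc from
  \<open>u\<close> to \<open>v\<close> is the interval from \<open>rad T u\<close> to \<open>rad T v = rad T u + len T e\<close>, and a vertex \<open>v\<close> has
  parameter \<open>rad T v\<close> on each of its incident edges. A function on the tree is a map taking an edge
  and a parameter.
\<close>

definition edges :: "('v, 'e, 'r) ray_tree \<Rightarrow> ('e + 'r) set" where
  "edges T = arcs (core T) <+> rays T"

fun edge_span :: "('v, 'e, 'r) ray_tree \<Rightarrow> 'e + 'r \<Rightarrow> real set" where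
  "edge_span T (Inl e) = {rad T (tail (core T) e)..rad T (head (core T) e)}"
| "edge_span T (Inr r) = {rad T (foot T r)..}"

fun starts_at :: "('v, 'e, 'r) ray_tree \<Rightarrow> 'e + 'r \<Rightarrow> 'v \<Rightarrow> bool" where
  "starts_at T (Inl e) v \<longleftrightarrow> tail (core T) e = v"
| "starts_at T (Inr r) v \<longleftrightarrow> foot T r = v"

fun ends_at :: "('v, 'e, 'r) ray_tree \<Rightarrow> 'e + 'r \<Rightarrow> 'v \<Rightarrow> bool" where
  "ends_at T (Inl e) v \<longleftrightarrow> head (core T) e = v"
| "ends_at T (Inr r) v \<longleftrightarrow> False"

definition incident :: "('v, 'e, 'r) ray_tree \<Rightarrow> 'v \<Rightarrow> ('e + 'r) set" where
  "incident T v = {x \<in> edges T. starts_at T x v \<or> ends_at T x v}"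


section \<open>Gaussian-weighted Sobolev spaces\<close>

definition gauss :: "real measure" where
  "gauss = density lborel (\<lambda>t. ennreal (2 / sqrt pi * exp (- t\<^sup>2)))"

definition L2_gauss :: "real set \<Rightarrow> (real \<Rightarrow> complex) \<Rightarrow> bool" where
  "L2_gauss I f \<longleftrightarrow>
     set_borel_measurable borel I f \<and> set_integrable gauss I (\<lambda>t. (cmod (f t))\<^sup>2)"

text \<open>
  Weak derivatives are tested with \<open>C\<^sup>1\<close> functions of compact support; for locally integrable
  functions this gives the same notion as testing with smooth ones.
\<close>

definition test_fun :: "real set \<Rightarrow> (real \<Rightarrow> real) \<Rightarrow> (real \<Rightarrow> real) \<Rightarrow> bool" where
  "test_fun I \<phi> \<phi>' \<longleftrightarrow>
     (\<forall>t. (\<phi> has_real_derivative \<phi>' t) (at t)) \<and> continuous_on UNIV \<phi>' \<and>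
     (\<exists>K. compact K \<and> K \<subseteq> I \<and> (\<forall>t. t \<notin> K \<longrightarrow> \<phi> t = 0))"

definition loc_integrable :: "real set \<Rightarrow> (real \<Rightarrow> complex) \<Rightarrow> bool" where
  "loc_integrable I f \<longleftrightarrow> (\<forall>K. compact K \<and> K \<subseteq> I \<longrightarrow> set_integrable lborel K f)"

definition weak_deriv :: "real set \<Rightarrow> (real \<Rightarrow> complex) \<Rightarrow> (real \<Rightarrow> complex) \<Rightarrow> bool" where
  "weak_deriv I f g \<longleftrightarrow>
     loc_integrable I f \<and> loc_integrable I g \<and>
     (\<forall>\<phi> \<phi>'. test_fun I \<phi> \<phi>' \<longrightarrow>
        (LINT t:I|lborel. \<phi>' t *\<^sub>R f t) = - (LINT t:I|lborel. \<phi> t *\<^sub>R g t))"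

text \<open>
  \<open>f\<close> lies in the direct sum of the edgewise spaces \<open>H\<^sup>2\<close> with respect to the Gaussian measure, with
  weak derivatives \<open>f'\<close> and \<open>f''\<close>. The classes of \<open>f\<close> and \<open>f'\<close> on an edge are represented by their
  continuous representatives on the closed edge, which provide the values at the vertices. So that
  \<open>f\<close> is the only map representing its class, it vanishes at all arguments that are not points of
  the tree.
\<close>

definition H2 ::
  "('v, 'e, 'r) ray_tree \<Rightarrow> ('e + 'r \<Rightarrow> real \<Rightarrow> complex) \<Rightarrow>
   ('e + 'r \<Rightarrow> real \<Rightarrow> complex) \<Rightarrow> ('e + 'r \<Rightarrow> real \<Rightarrow> complex) \<Rightarrow> bool" where
  "H2 T f f' f'' \<longleftrightarrow>
     (\<forall>x t. x \<notin> edges T \<or> t \<notin> edge_span T x \<longrightarrow> f x t = 0) \<and>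
     (\<forall>x \<in> edges T.
        continuous_on (edge_span T x) (f x) \<and> continuous_on (edge_span T x) (f' x) \<and>
        L2_gauss (edge_span T x) (f x) \<and> L2_gauss (edge_span T x) (f' x) \<and>
        L2_gauss (edge_span T x) (f'' x) \<and>
        weak_deriv (interior (edge_span T x)) (f x) (f' x) \<and>
        weak_deriv (interior (edge_span T x)) (f' x) (f'' x))"


section \<open>The Ornstein-Uhlenbeck operators\<close>

text \<open>Derivative at \<open>v\<close> along the incident edge \<open>x\<close>, pointing from \<open>v\<close> into \<open>x\<close>.\<close>

definition normal_deriv ::
  "('v, 'e, 'r) ray_tree \<Rightarrow> ('e + 'r \<Rightarrow> real \<Rightarrow> complex) \<Rightarrow> 'v \<Rightarrow> 'e + 'r \<Rightarrow> complex" where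
  "normal_deriv T f' v x = (if starts_at T x v then f' x (rad T v) else - f' x (rad T v))"

definition std_cond ::
  "('v, 'e, 'r) ray_tree \<Rightarrow> ('e + 'r \<Rightarrow> real \<Rightarrow> complex) \<Rightarrow>
   ('e + 'r \<Rightarrow> real \<Rightarrow> complex) \<Rightarrow> 'v \<Rightarrow> bool" where
  "std_cond T f f' v \<longleftrightarrow>
     (\<forall>x \<in> incident T v. \<forall>y \<in> incident T v. f x (rad T v) = f y (rad T v)) \<and>
     (\<Sum>x \<in> incident T v. normal_deriv T f' v x) = 0"

definition vertex_cond_D ::
  "('v, 'e, 'r) ray_tree \<Rightarrow> ('e + 'r \<Rightarrow> real \<Rightarrow> complex) \<Rightarrow>
   ('e + 'r \<Rightarrow> real \<Rightarrow> complex) \<Rightarrow> bool" where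
  "vertex_cond_D T f f' \<longleftrightarrow>
     (\<forall>x \<in> incident T (root T). f x (rad T (root T)) = 0) \<and>
     (\<forall>v \<in> verts (core T) - {root T}. std_cond T f f' v)"

definition vertex_cond_N ::
  "('v, 'e, 'r) ray_tree \<Rightarrow> ('e + 'r \<Rightarrow> real \<Rightarrow> complex) \<Rightarrow>
   ('e + 'r \<Rightarrow> real \<Rightarrow> complex) \<Rightarrow> bool" where
  "vertex_cond_N T f f' \<longleftrightarrow> (\<forall>v \<in> verts (core T). std_cond T f f' v)"

text \<open>
  The operators are given by their graphs: \<open>OU_D T f g\<close> says that \<open>f\<close> is in the domain of the
  Dirichlet realisation and that its image is the class of \<open>g\<close>.
\<close>

definition OU_action ::
  "('v, 'e, 'r) ray_tree \<Rightarrow> ('e + 'r \<Rightarrow> real \<Rightarrow> complex) \<Rightarrow>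
   ('e + 'r \<Rightarrow> real \<Rightarrow> complex) \<Rightarrow> ('e + 'r \<Rightarrow> real \<Rightarrow> complex) \<Rightarrow> bool" where
  "OU_action T f' f'' g \<longleftrightarrow>
     (\<forall>x \<in> edges T. AE t in lborel. t \<in> edge_span T x \<longrightarrow>
        g x t = - (1 / 2) * f'' x t + complex_of_real t * f' x t)"

definition OU_D ::
  "('v, 'e, 'r) ray_tree \<Rightarrow> ('e + 'r \<Rightarrow> real \<Rightarrow> complex) \<Rightarrow>
   ('e + 'r \<Rightarrow> real \<Rightarrow> complex) \<Rightarrow> bool" where
  "OU_D T f g \<longleftrightarrow> (\<exists>f' f''. H2 T f f' f'' \<and> vertex_cond_D T f f' \<and> OU_action T f' f'' g)"

definition OU_N ::
  "('v, 'e, 'r) ray_tree \<Rightarrow> ('e + 'r \<Rightarrow> real \<Rightarrow> complex) \<Rightarrow>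
   ('e + 'r \<Rightarrow> real \<Rightarrow> complex) \<Rightarrow> bool" where
  "OU_N T f g \<longleftrightarrow> (\<exists>f' f''. H2 T f f' f'' \<and> vertex_cond_N T f f' \<and> OU_action T f' f'' g)"


section \<open>Eigenvalues\<close>

definition fscale :: "complex \<Rightarrow> ('x \<Rightarrow> real \<Rightarrow> complex) \<Rightarrow> 'x \<Rightarrow> real \<Rightarrow> complex" where
  "fscale c f = (\<lambda>x t. c * f x t)"

interpretation tfun: vector_space "fscale :: complex \<Rightarrow> ('x \<Rightarrow> real \<Rightarrow> complex) \<Rightarrow> _"
  by unfold_locales (auto simp: fscale_def fun_eq_iff algebra_simps)

definition eigenspace ::
  "(('x \<Rightarrow> real \<Rightarrow> complex) \<Rightarrow> ('x \<Rightarrow> real \<Rightarrow> complex) \<Rightarrow> bool) \<Rightarrow> complex \<Rightarrow>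
   ('x \<Rightarrow> real \<Rightarrow> complex) set" where
  "eigenspace A c = {f. A f (fscale c f)}"

text \<open>Being a finite dimension, as opposed to \<open>tfun.dim\<close>, which is \<open>0\<close> in the infinite case.\<close>

definition has_dim :: "('x \<Rightarrow> real \<Rightarrow> complex) set \<Rightarrow> nat \<Rightarrow> bool" where
  "has_dim S k \<longleftrightarrow> (\<exists>B. finite B \<and> card B = k \<and> tfun.independent B \<and> tfun.span B = S)"

text \<open>
  \<open>lam 1 \<le> lam 2 \<le> \<dots>\<close> lists the eigenvalues of \<open>A\<close>, each as often as its multiplicity; \<open>lam 0\<close>
  is irrelevant.
\<close>

definition enumerates_eigenvalues ::
  "(('x \<Rightarrow> real \<Rightarrow> complex) \<Rightarrow> ('x \<Rightarrow> real \<Rightarrow> complex) \<Rightarrow> bool) \<Rightarrow> (nat \<Rightarrow> real) \<Rightarrow> bool" where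
  "enumerates_eigenvalues A lam \<longleftrightarrow>
     mono_on {1..} lam \<and>
     (\<forall>c. finite {n \<in> {1..}. complex_of_real (lam n) = c} \<and>
          has_dim (eigenspace A c) (card {n \<in> {1..}. complex_of_real (lam n) = c}))"

end

theory Submission
  imports Defs "HOL-Computational_Algebra.Polynomial" "HOL-Real_Asymp.Real_Asymp"
begin

text \<open>
  Everything rests on comparing the Dirichlet form with the \<open>L\<^sup>2\<close> norm. Let \<open>k\<close> be large and
  \<open>H\<close> the Hermite polynomial of degree \<open>2 k + 1\<close>, so that \<open>- H'' / 2 + t H' = (2 k + 1) H\<close> and \<open>H\<close>
  has exactly \<open>k\<close> positive zeros. If \<open>f\<close> in the form domain vanishes at the feet of the half-lines,
  at the zeros of \<open>H\<close> on the half-lines, at the vertices and at the zeros of a suitable sine on the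
  compact edges, then Picone's identity on each nodal interval gives form \<open>\<ge> (2 k + 1)\<close> norm. These
  are \<open>m\<^sub>\<infinity> k + O(\<surd>k)\<close> point conditions, so at most that many eigenvalues lie below \<open>2 k + 1\<close>.
  Conversely, the restrictions of \<open>H\<close> to its nodal intervals on the half-lines span a space of
  dimension \<open>m\<^sub>\<infinity> k - O(\<surd>k)\<close> on which form \<open>=\<close> \<open>(2 k + 1)\<close> norm, so at least that many eigenvalues
  lie below or at \<open>2 k + 1\<close>. Sturm comparison shows that only \<open>O(\<surd>k)\<close> zeros of \<open>H\<close> lie in a fixed
  compact interval.

  The second count needs the existence of a minimiser of the Rayleigh quotient on the orthogonal
  complement of finitely many eigenfunctions. No compact embedding is used: the first count provides a
  spectral gap under finitely many point conditions, hence an inequality \<open>\<surd>\<Lambda> |f| \<le> |f'| + C \<Sum> |f(x\<^sub>i)|\<close>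
  up to constants, and along a minimising sequence the finitely many values \<open>f(x\<^sub>i)\<close> converge
  after passing to a subsequence, which makes it Cauchy. That the limit is an eigenfunction is read off from
  testing it with hat functions, i.e. from the Green function on short segments.
\<close>

section \<open>Pairs of quadratic forms\<close>

text \<open>\<open>enumerates_eigenvalues\<close> fixes multiplicities but gives no completeness of
  the eigenfunctions. So the two counts differ in kind: too many small eigenvalues are refuted by
  linear algebra among given eigenfunctions, too few only by producing a new eigenfunction. Raising
  k by one raises 2 k + 1 by 2 and adds one positive zero of H on every half-line, that is, one
  condition per half-line for two units of the spectrum; this is the slope 2 / m_inf. The core
  contributes only sine zeros, whose number grows like the frequency sqrt (4 k + 3) and disappears
  in the ratio. The forms are real bilinear although the functions are complex: minimisation then
  needs one real inner product, and complex multiples return through \<open>csc \<i>\<close>. The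
  form domain consists of continuous functions that are differentiable off finitely many points of
  each edge, a proper part of the Sobolev space. It contains all eigenfunctions and all test
  functions used, but it is not complete; the limit of a minimising sequence belongs to it only
  because that limit is shown to solve the differential equation.\<close>

lemma homogeneous_system_nontrivial:
  fixes A :: "'i \<Rightarrow> 'j \<Rightarrow> 'k::field"
  assumes "finite I" "finite J" "card I < card J"
  shows "\<exists>c. (\<exists>j\<in>J. c j \<noteq> 0) \<and> (\<forall>i\<in>I. (\<Sum>j\<in>J. A i j * c j) = 0)"
  using assms
proof (induction I arbitrary: J A rule: finite_induct)
  case empty
  then have "J \<noteq> {}" by auto
  then show ?case by (intro exI[of _ "\<lambda>_. 1"]) auto
next
  case (insert i I)
  have J: "finite J" "card J > Suc (card I)" using insert by auto
  show ?case
  proof (cases "\<exists>j\<in>J. A i j \<noteq> 0")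
    case False
    from insert.IH[of J A] J obtain c where c: "\<exists>j\<in>J. c j \<noteq> 0"
      "\<forall>i\<in>I. (\<Sum>j\<in>J. A i j * c j) = 0" by auto
    have "(\<Sum>j\<in>J. A i j * c j) = 0" using False by (intro sum.neutral) auto
    with c show ?thesis by (intro exI[of _ c]) auto
  next
    case True
    then obtain p where p: "p \<in> J" "A i p \<noteq> 0" by auto
    \<comment> \<open>Gaussian elimination: equation i is solved for the unknown p and subtracted
      from the others. One equation and one unknown disappear, so the strict inequality between the
      cardinalities survives.\<close>
    define J' where "J' = J - {p}"
    have J': "finite J'" "card I < card J'" using J p by (auto simp: J'_def)
    obtain c where c: "\<exists>j\<in>J'. c j \<noteq> 0"
      "\<forall>k\<in>I. (\<Sum>j\<in>J'. (A k j - A k p * A i j / A i p) * c j) = 0"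
      using insert.IH[OF J', of "\<lambda>k j. A k j - A k p * A i j / A i p"] by auto
    define s where "s = (\<Sum>j\<in>J'. A i j * c j)"
    define d where "d = (\<lambda>j. if j = p then - s / A i p else c j)"
    have split: "(\<Sum>j\<in>J. A k j * d j) = A k p * d p + (\<Sum>j\<in>J'. A k j * c j)" for k
    proof -
      have "(\<Sum>j\<in>J. A k j * d j) = A k p * d p + (\<Sum>j\<in>J'. A k j * d j)"
        unfolding J'_def using J p by (subst sum.remove[of J p]) auto
      also have "(\<Sum>j\<in>J'. A k j * d j) = (\<Sum>j\<in>J'. A k j * c j)"
        by (intro sum.cong) (auto simp: d_def J'_def)
      finally show ?thesis .
    qed
    have "(\<Sum>j\<in>J. A i j * d j) = 0" unfolding split using p by (simp add: d_def s_def)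
    moreover have "(\<Sum>j\<in>J. A k j * d j) = 0" if "k \<in> I" for k
    proof -
      have "0 = (\<Sum>j\<in>J'. (A k j - A k p * A i j / A i p) * c j)" using c that by auto
      also have "\<dots> = (\<Sum>j\<in>J'. A k j * c j - A k p / A i p * (A i j * c j))"
        by (intro sum.cong) (auto simp: algebra_simps)
      also have "\<dots> = (\<Sum>j\<in>J'. A k j * c j) - A k p / A i p * s"
        by (simp add: sum_subtractf sum_distrib_left s_def)
      finally show ?thesis unfolding split by (simp add: d_def)
    qed
    moreover have "\<exists>j\<in>J. d j \<noteq> 0" using c(1) by (auto simp: d_def J'_def)
    ultimately show ?thesis by (intro exI[of _ d]) auto
  qed
qed

text \<open>Bolzano-Weierstrass, one index at a time; convergence already reached survives the next
  extraction.\<close>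

lemma convergent_subseq_finite:
  fixes x :: "'i \<Rightarrow> nat \<Rightarrow> real"
  assumes "finite I" "\<And>i. i \<in> I \<Longrightarrow> bounded (range (x i))"
  shows "\<exists>r. strict_mono r \<and> (\<forall>i\<in>I. convergent (x i \<circ> r))"
  using assms
proof (induction I rule: finite_induct)
  case empty
  show ?case by (intro exI[of _ id]) (auto simp: strict_mono_def)
next
  case (insert i I)
  then obtain r where r: "strict_mono r" "\<forall>i\<in>I. convergent (x i \<circ> r)" by (metis insertCI)
  have "bounded (range (x i \<circ> r))"
    using insert.prems[of i] by (auto intro: bounded_subset)
  then obtain l s where s: "strict_mono s" "((x i \<circ> r) \<circ> s) \<longlonglongrightarrow> l"
    using bounded_imp_convergent_subsequence by blast
  have "convergent (x k \<circ> (r \<circ> s))" if "k \<in> insert i I" for k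
    using that r s convergent_subseq_convergent[OF _ s(1), of "x k \<circ> r"]
    by (auto simp: o_assoc convergent_def)
  then show ?case using r s strict_mono_o by blast
qed

text \<open>Semidefinite on purpose: the energy form can kill constants, and the weighted L2 space
  below consists of functions rather than classes. Linearity is asked only on F because integrals of
  non-integrable functions have a default value.\<close>

locale psd_form = vector_space sc
  for sc :: "real \<Rightarrow> 'f::ab_group_add \<Rightarrow> 'f" +
  fixes F :: "'f set" and b :: "'f \<Rightarrow> 'f \<Rightarrow> real"
  assumes F: "subspace F"
    and add: "f \<in> F \<Longrightarrow> g \<in> F \<Longrightarrow> h \<in> F \<Longrightarrow> b (f + g) h = b f h + b g h"
    and sc: "f \<in> F \<Longrightarrow> h \<in> F \<Longrightarrow> b (sc c f) h = c * b f h"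
    and sym: "b f g = b g f"
    and nonneg: "f \<in> F \<Longrightarrow> b f f \<ge> 0"
begin

definition nm :: "'f \<Rightarrow> real" where "nm f = sqrt (b f f)"

lemmas F_add = subspace_add[OF F] and F_diff = subspace_diff[OF F]
  and F_scale = subspace_scale[OF F] and F_0 = subspace_0[OF F]

lemma diff: "f \<in> F \<Longrightarrow> g \<in> F \<Longrightarrow> h \<in> F \<Longrightarrow> b (f - g) h = b f h - b g h"
  using add[of "f - g" g h] F_diff by (simp add: algebra_simps)

lemma add2: "f \<in> F \<Longrightarrow> g \<in> F \<Longrightarrow> h \<in> F \<Longrightarrow> b h (f + g) = b h f + b h g"
  using add sym by metis

lemma diff2: "f \<in> F \<Longrightarrow> g \<in> F \<Longrightarrow> h \<in> F \<Longrightarrow> b h (f - g) = b h f - b h g"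
  using diff sym by metis

lemma sc2: "f \<in> F \<Longrightarrow> h \<in> F \<Longrightarrow> b h (sc c f) = c * b h f"
  using sc sym by metis

lemma cauchy_schwarz:
  assumes f: "f \<in> F" and g: "g \<in> F"
  shows "\<bar>b f g\<bar> \<le> nm f * nm g"
proof -
  have q: "0 \<le> b f f + 2 * t * b f g + t\<^sup>2 * b g g" for t
  proof -
    have "0 \<le> b (f + sc t g) (f + sc t g)" by (intro nonneg F_add F_scale f g)
    also have "\<dots> = b f f + 2 * t * b f g + t\<^sup>2 * b g g"
      using f g by (simp add: add add2 F_add F_scale sc sc2 sym[of g f] power2_eq_square algebra_simps)
    finally show ?thesis .
  qed
  have "(b f g)\<^sup>2 \<le> b f f * b g g"
  proof (cases "b g g = 0")
    case True
    have "b f g = 0"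
    proof (rule ccontr)
      assume n: "b f g \<noteq> 0"
      \<comment> \<open>The quadratic is affine in t here, and this t gives it the value -1.\<close>
      show False using q[of "- (b f f + 1) / (2 * b f g)"] True n nonneg[OF f]
        by (simp add: field_simps)
    qed
    then show ?thesis using True by simp
  next
    case False
    with nonneg[OF g] have p: "b g g > 0" by simp
    \<comment> \<open>This t is the minimiser of the quadratic.\<close>
    have "0 \<le> b f f + 2 * (- b f g / b g g) * b f g + (- b f g / b g g)\<^sup>2 * b g g" by (rule q)
    also have "\<dots> = b f f - (b f g)\<^sup>2 / b g g" using p by (simp add: power2_eq_square field_simps)
    finally show ?thesis using p by (simp add: field_simps)
  qed
  then have "sqrt ((b f g)\<^sup>2) \<le> sqrt (b f f * b g g)" by (rule real_sqrt_le_mono)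
  then show ?thesis by (simp add: nm_def real_sqrt_mult)
qed

lemma nm_nonneg [simp]: "f \<in> F \<Longrightarrow> 0 \<le> nm f"
  using nonneg by (simp add: nm_def)

lemma nm_square: "f \<in> F \<Longrightarrow> (nm f)\<^sup>2 = b f f"
  using nonneg by (simp add: nm_def)

lemma nm_triangle:
  assumes f: "f \<in> F" and g: "g \<in> F"
  shows "nm (f + g) \<le> nm f + nm g"
proof -
  have "b (f + g) (f + g) = b f f + 2 * b f g + b g g"
    using f g by (simp add: add add2 F_add sym[of g f])
  also have "\<dots> \<le> (nm f)\<^sup>2 + 2 * (nm f * nm g) + (nm g)\<^sup>2"
    using cauchy_schwarz[OF f g] f g by (simp add: nm_square)
  also have "\<dots> = (nm f + nm g)\<^sup>2" by (simp add: power2_eq_square algebra_simps)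
  finally show ?thesis using f g by (simp add: nm_def[of "f + g"] real_le_lsqrt nonneg)
qed

lemma nm_scale: "f \<in> F \<Longrightarrow> nm (sc c f) = \<bar>c\<bar> * nm f"
  by (simp add: nm_def sc sc2 F_scale real_sqrt_mult mult.assoc[symmetric])

text \<open>The parallelogram law with one square dropped. Applied to the form \<open>q\<close> of
  the minimisation, it makes the difference of two near-minimisers small in
  \<open>q\<close>.\<close>

lemma parallelogram:
  assumes f: "f \<in> F" and g: "g \<in> F"
  shows "b (f - g) (f - g) \<le> 2 * b f f + 2 * b g g"
proof -
  have "b (f - g) (f - g) + b (f + g) (f + g) = 2 * b f f + 2 * b g g"
    using f g by (simp add: add add2 F_add diff diff2 F_diff)
  with nonneg[of "f + g"] F_add f g show ?thesis by simp
qed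

end

section \<open>Two forms on one domain: gap inequalities and minimisation of the Rayleigh
  quotient\<close>

locale form_pair = A: psd_form sc F a + B: psd_form sc F b
  for sc :: "real \<Rightarrow> 'f::ab_group_add \<Rightarrow> 'f" and F a b
begin

definition linear_on :: "('f \<Rightarrow> real) \<Rightarrow> bool" where
  "linear_on l \<longleftrightarrow> (\<forall>f\<in>F. \<forall>g\<in>F. \<forall>c. l (f - sc c g) = l f - c * l g)"

lemma combine_in: "f \<in> F \<Longrightarrow> g \<in> F \<Longrightarrow> f - sc c g \<in> F"
  by (intro B.F_diff B.F_scale)

text \<open>Splitting off one functional at a time turns a spectral gap on the common kernel into an
  inequality on the whole space.\<close>

lemma gap_inequality:
  assumes "finite I" "\<Lambda> \<ge> 0"
    and "\<And>i. i \<in> I \<Longrightarrow> linear_on (l i)"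
    and "\<And>f. f \<in> F \<Longrightarrow> (\<And>i. i \<in> I \<Longrightarrow> l i f = 0) \<Longrightarrow> \<Lambda> * b f f \<le> a f f"
  shows "\<exists>C\<ge>0. \<forall>f\<in>F. sqrt \<Lambda> * B.nm f \<le> A.nm f + C * (\<Sum>i\<in>I. \<bar>l i f\<bar>)"
proof -
  \<comment> \<open>J holds the functionals already released; those in \<open>I - J\<close> are
    still required to vanish. For J empty this is the spectral gap, for J = I the claim.\<close>
  have "finite J \<Longrightarrow> J \<subseteq> I \<Longrightarrow> \<exists>C\<ge>0. \<forall>f\<in>F. (\<forall>i\<in>I - J. l i f = 0) \<longrightarrow>
      sqrt \<Lambda> * B.nm f \<le> A.nm f + C * (\<Sum>i\<in>J. \<bar>l i f\<bar>)" for J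
  proof (induction J rule: finite_induct)
    case empty
    have "sqrt \<Lambda> * B.nm f \<le> A.nm f" if "f \<in> F" "\<forall>i\<in>I. l i f = 0" for f
      using assms(4)[of f] that real_sqrt_le_mono[of "\<Lambda> * b f f" "a f f"]
      by (simp add: A.nm_def B.nm_def real_sqrt_mult)
    then show ?case by (intro exI[of _ 0]) auto
  next
    case (insert j J)
    then obtain C where C: "C \<ge> 0" "\<And>f. f \<in> F \<Longrightarrow> \<forall>i\<in>I - J. l i f = 0 \<Longrightarrow>
      sqrt \<Lambda> * B.nm f \<le> A.nm f + C * (\<Sum>i\<in>J. \<bar>l i f\<bar>)" by auto
    have lin: "linear_on (l i)" if "i \<in> insert j J" for i using assms(3) insert.prems that by auto
    show ?case
    \<comment> \<open>Without such a \<psi> the condition \<open>l j f = 0\<close> follows from the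
      remaining ones and the old constant serves; otherwise a multiple of \<psi> is subtracted to
      make \<open>l j\<close> vanish.\<close>
    proof (cases "\<exists>\<psi>\<in>F. (\<forall>i\<in>I - insert j J. l i \<psi> = 0) \<and> l j \<psi> \<noteq> 0")
      case False
      show ?thesis
      proof (intro exI[of _ C] conjI ballI impI C)
        fix f assume f: "f \<in> F" "\<forall>i\<in>I - insert j J. l i f = 0"
        with False have "l j f = 0" by auto
        with f have "\<forall>i\<in>I - J. l i f = 0" by auto
        then have "sqrt \<Lambda> * B.nm f \<le> A.nm f + C * (\<Sum>i\<in>J. \<bar>l i f\<bar>)" using C f by auto
        also have "(\<Sum>i\<in>J. \<bar>l i f\<bar>) \<le> (\<Sum>i\<in>insert j J. \<bar>l i f\<bar>)" using insert by simp
        finally show "sqrt \<Lambda> * B.nm f \<le> A.nm f + C * (\<Sum>i\<in>insert j J. \<bar>l i f\<bar>)"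
          using C by (simp add: mult_left_mono)
      qed
    next
      case True
      then obtain \<psi> where \<psi>: "\<psi> \<in> F" "\<forall>i\<in>I - insert j J. l i \<psi> = 0" "l j \<psi> \<noteq> 0" by auto
      \<comment> \<open>The price, per unit of \<open>l j f\<close>, of subtracting the multiple of
        \<psi>: it collects what the triangle inequalities lose in both norms and in the functionals
        of J.\<close>
      define D where "D = (A.nm \<psi> + sqrt \<Lambda> * B.nm \<psi> + C * (\<Sum>i\<in>J. \<bar>l i \<psi>\<bar>)) / \<bar>l j \<psi>\<bar>"
      have D: "D \<ge> 0" unfolding D_def using \<psi> C assms(2)
        by (intro divide_nonneg_nonneg add_nonneg_nonneg mult_nonneg_nonneg sum_nonneg) auto
      show ?thesis
      proof (intro exI[of _ "C + D"] conjI ballI impI)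
        show "0 \<le> C + D" using C D by simp
        fix f assume f: "f \<in> F" "\<forall>i\<in>I - insert j J. l i f = 0"
        define t where "t = l j f / l j \<psi>"
        define g where "g = f - sc t \<psi>"
        have g: "g \<in> F" unfolding g_def using f \<psi> by (intro combine_in)
        have lg: "l i g = l i f - t * l i \<psi>" if "i \<in> I" for i
          unfolding g_def using assms(3)[OF that] f \<psi> by (auto simp: linear_on_def)
        have "l i g = 0" if "i \<in> I - J" for i
        proof (cases "i = j")
          case True then show ?thesis using lg[of j] that \<psi> by (simp add: t_def)
        next
          case False then show ?thesis using lg[of i] that f \<psi> by auto
        qed
        then have 1: "sqrt \<Lambda> * B.nm g \<le> A.nm g + C * (\<Sum>i\<in>J. \<bar>l i g\<bar>)" using C g by auto
        have fg: "f = g + sc t \<psi>" by (simp add: g_def)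
        have "g = f + sc (-t) \<psi>" by (simp add: g_def)
        then have 2: "A.nm g \<le> A.nm f + \<bar>t\<bar> * A.nm \<psi>"
          using A.nm_triangle[OF f(1) A.F_scale[OF \<psi>(1)], of "-t"] A.nm_scale[OF \<psi>(1), of "-t"] by simp
        have 3: "B.nm f \<le> B.nm g + \<bar>t\<bar> * B.nm \<psi>"
          using B.nm_triangle[OF g B.F_scale[OF \<psi>(1)], of t] B.nm_scale[OF \<psi>(1), of t] by (simp add: g_def)
        have 4: "(\<Sum>i\<in>J. \<bar>l i g\<bar>) \<le> (\<Sum>i\<in>J. \<bar>l i f\<bar>) + \<bar>t\<bar> * (\<Sum>i\<in>J. \<bar>l i \<psi>\<bar>)"
        proof -
          have "\<bar>l i g\<bar> \<le> \<bar>l i f\<bar> + \<bar>t\<bar> * \<bar>l i \<psi>\<bar>" if "i \<in> J" for i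
            using lg[of i] that insert.prems abs_triangle_ineq4[of "l i f" "t * l i \<psi>"]
            by (auto simp: abs_mult)
          then show ?thesis by (subst sum_distrib_left, subst sum.distrib[symmetric]) (rule sum_mono)
        qed
        have "sqrt \<Lambda> * B.nm f \<le> sqrt \<Lambda> * B.nm g + sqrt \<Lambda> * (\<bar>t\<bar> * B.nm \<psi>)"
          using mult_left_mono[OF 3, of "sqrt \<Lambda>"] assms(2) by (simp add: algebra_simps)
        also have "\<dots> \<le> A.nm f + \<bar>t\<bar> * A.nm \<psi> + C * ((\<Sum>i\<in>J. \<bar>l i f\<bar>) + \<bar>t\<bar> * (\<Sum>i\<in>J. \<bar>l i \<psi>\<bar>))
            + sqrt \<Lambda> * (\<bar>t\<bar> * B.nm \<psi>)"
          using 1 2 mult_left_mono[OF 4 C(1)] by linarith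
        also have "\<dots> = A.nm f + C * (\<Sum>i\<in>J. \<bar>l i f\<bar>) + \<bar>t\<bar> * (D * \<bar>l j \<psi>\<bar>)"
        proof -
          have "D * \<bar>l j \<psi>\<bar> = A.nm \<psi> + sqrt \<Lambda> * B.nm \<psi> + C * (\<Sum>i\<in>J. \<bar>l i \<psi>\<bar>)"
            using \<psi> by (simp add: D_def)
          then show ?thesis by (simp only:) (simp add: algebra_simps)
        qed
        also have "\<bar>t\<bar> * (D * \<bar>l j \<psi>\<bar>) = D * \<bar>l j f\<bar>" using \<psi> by (simp add: t_def abs_divide)
        also have "A.nm f + C * (\<Sum>i\<in>J. \<bar>l i f\<bar>) + D * \<bar>l j f\<bar>
            \<le> A.nm f + (C + D) * (\<Sum>i\<in>insert j J. \<bar>l i f\<bar>)"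
        proof -
          have "(\<Sum>i\<in>insert j J. \<bar>l i f\<bar>) = \<bar>l j f\<bar> + (\<Sum>i\<in>J. \<bar>l i f\<bar>)" using insert by simp
          moreover have "0 \<le> D * (\<Sum>i\<in>J. \<bar>l i f\<bar>)" "0 \<le> C * \<bar>l j f\<bar>"
            using D C by (auto intro!: mult_nonneg_nonneg sum_nonneg)
          ultimately show ?thesis by (simp add: algebra_simps)
        qed
        finally show "sqrt \<Lambda> * B.nm f \<le> A.nm f + (C + D) * (\<Sum>i\<in>insert j J. \<bar>l i f\<bar>)" .
      qed
    qed
  qed
  from this[of I] show ?thesis using assms(1) by simp
qed

text \<open>Gram-Schmidt for \<open>b\<close>, possibly with dependent vectors. The difference of
  \<psi> and \<phi> is a combination of U; the last two conclusions express this through pairings,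
  so that no coefficients have to be named.\<close>

lemma project_out:
  assumes "finite U" "U \<subseteq> F" "\<phi> \<in> F"
  shows "\<exists>\<psi>\<in>F. (\<forall>u\<in>U. b \<psi> u = 0) \<and>
    (\<forall>g\<in>F. (\<forall>u\<in>U. a g u = 0) \<longrightarrow> a g \<psi> = a g \<phi>) \<and>
    (\<forall>g\<in>F. (\<forall>u\<in>U. b g u = 0) \<longrightarrow> b g \<psi> = b g \<phi>)"
  using assms
proof (induction U arbitrary: \<phi> rule: finite_induct)
  case empty
  then show ?case by auto
next
  case (insert u U)
  have UF: "U \<subseteq> F" "u \<in> F" using insert.prems by auto
  from insert.IH[OF UF(1) insert.prems(2)] obtain \<psi> where \<psi>: "\<psi> \<in> F" "\<forall>v\<in>U. b \<psi> v = 0"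
    "\<And>g. g \<in> F \<Longrightarrow> \<forall>v\<in>U. a g v = 0 \<Longrightarrow> a g \<psi> = a g \<phi>"
    "\<And>g. g \<in> F \<Longrightarrow> \<forall>v\<in>U. b g v = 0 \<Longrightarrow> b g \<psi> = b g \<phi>" by auto
  \<comment> \<open>w is u made orthogonal to U, the one direction that still has to be removed from
    \<psi>.\<close>
  from insert.IH[OF UF] obtain w where w: "w \<in> F" "\<forall>v\<in>U. b w v = 0"
    "\<And>g. g \<in> F \<Longrightarrow> \<forall>v\<in>U. a g v = 0 \<Longrightarrow> a g w = a g u"
    "\<And>g. g \<in> F \<Longrightarrow> \<forall>v\<in>U. b g v = 0 \<Longrightarrow> b g w = b g u" by auto
  define t where "t = b \<psi> w / b w w"
  define \<eta> where "\<eta> = \<psi> - sc t w"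
  have \<eta>: "\<eta> \<in> F" unfolding \<eta>_def using \<psi> w by (intro combine_in)
  have U: "v \<in> F" if "v \<in> insert u U" for v using UF that by auto
  have o: "b \<eta> v = 0" if "v \<in> U" for v
    using that \<psi> w U by (simp add: \<eta>_def B.diff B.sc B.F_scale)
  \<comment> \<open>If \<open>b w w = 0\<close>, then t is 0 by the convention for division, and
    Cauchy-Schwarz gives the orthogonality.\<close>
  have "b \<eta> w = 0"
  proof (cases "b w w = 0")
    case True
    have "\<bar>b \<eta> w\<bar> \<le> B.nm \<eta> * B.nm w" using \<eta> w by (intro B.cauchy_schwarz)
    then show ?thesis using True by (simp add: B.nm_def)
  next
    case False
    then show ?thesis using \<psi> w by (simp add: \<eta>_def t_def B.diff B.sc B.F_scale)
  qed
  then have "b \<eta> u = 0" using w(4)[of \<eta>] \<eta> o by auto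
  moreover have "a g \<eta> = a g \<phi>" if "g \<in> F" "\<forall>v\<in>insert u U. a g v = 0" for g
    using that \<psi> w by (simp add: \<eta>_def A.diff2 A.sc2 A.F_scale)
  moreover have "b g \<eta> = b g \<phi>" if "g \<in> F" "\<forall>v\<in>insert u U. b g v = 0" for g
    using that \<psi> w by (simp add: \<eta>_def B.diff2 B.sc2 B.F_scale)
  ultimately show ?case using \<eta> o by blast
qed

text \<open>\<sigma> is the infimum of the Rayleigh quotient on the complement of U; the trial
  vector w keeps it at most \<kappa>, hence strictly below the gap \<Lambda>, and this strictness
  yields the Cauchy property. The limit is not formed here, since nothing makes F complete; instead
  the Euler-Lagrange equation is stated asymptotically along the sequence.\<close>

lemma minimizing_sequence:
  assumes U: "finite U" "U \<subseteq> F" "\<And>u f. u \<in> U \<Longrightarrow> f \<in> F \<Longrightarrow> a f u = \<mu> u * b f u"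
    and w: "w \<in> F" "\<And>u. u \<in> U \<Longrightarrow> b w u = 0" "b w w > 0" "a w w \<le> \<kappa> * b w w"
    and L: "finite I" "\<And>i. i \<in> I \<Longrightarrow> linear_on (l i)"
      "\<And>i f. i \<in> I \<Longrightarrow> f \<in> F \<Longrightarrow> \<bar>l i f\<bar> \<le> C i * (A.nm f + B.nm f)"
      "\<And>f. f \<in> F \<Longrightarrow> (\<And>i. i \<in> I \<Longrightarrow> l i f = 0) \<Longrightarrow> \<Lambda> * b f f \<le> a f f"
    and \<Lambda>: "\<kappa> < \<Lambda>"
  obtains \<sigma> f where "0 \<le> \<sigma>" "\<sigma> \<le> \<kappa>" "\<And>k::nat. f k \<in> F" "\<And>k. b (f k) (f k) = 1"
    "\<And>k u. u \<in> U \<Longrightarrow> b (f k) u = 0"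
    "\<And>\<phi>. \<phi> \<in> F \<Longrightarrow> (\<lambda>k. a (f k) \<phi> - \<sigma> * b (f k) \<phi>) \<longlonglongrightarrow> 0"
    "\<And>e. e > 0 \<Longrightarrow> \<exists>N. \<forall>i\<ge>N. \<forall>j\<ge>N. A.nm (f i - f j) < e \<and> B.nm (f i - f j) < e"
proof -
  define M where "M = {f \<in> F. \<forall>u\<in>U. b f u = 0}"
  have MF: "f \<in> F" if "f \<in> M" for f using that by (simp add: M_def)
  have M: "A.subspace M"
    unfolding A.subspace_def M_def
    using U(2) by (auto simp: B.F_0 B.F_add B.F_scale B.add B.sc subset_iff)
      (metis B.F_0 B.sc mult_zero_left A.scale_zero_left)
  define R where "R = {a f f |f. f \<in> M \<and> b f f = 1}"
  have normalise: "a (sc (1 / B.nm f) f) (sc (1 / B.nm f) f) \<in> R \<and>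
      a (sc (1 / B.nm f) f) (sc (1 / B.nm f) f) = a f f / b f f" if "f \<in> M" "b f f > 0" for f
  proof -
    have F: "f \<in> F" using that MF by auto
    have n: "(B.nm f)\<^sup>2 = b f f" "B.nm f > 0" using B.nm_square[OF F] that by (auto simp: B.nm_def)
    have "b (sc (1 / B.nm f) f) (sc (1 / B.nm f) f) = b f f / (B.nm f)\<^sup>2"
      using F by (simp add: B.sc B.sc2 B.F_scale power2_eq_square)
    moreover have "a (sc (1 / B.nm f) f) (sc (1 / B.nm f) f) = a f f / (B.nm f)\<^sup>2"
      using F by (simp add: A.sc A.sc2 B.F_scale power2_eq_square)
    moreover have "sc (1 / B.nm f) f \<in> M" using M that by (simp add: A.subspace_scale)
    ultimately show ?thesis
      using n that by (auto simp: R_def intro!: exI[of _ "sc (1 / B.nm f) f"])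
  qed
  have wM: "w \<in> M" using w by (simp add: M_def)
  have Rne: "R \<noteq> {}" using normalise[OF wM w(3)] by auto
  have R0: "0 \<le> x" if "x \<in> R" for x using that A.nonneg MF by (auto simp: R_def)
  have bdd: "bdd_below R" using R0 by (auto simp: bdd_below_def)
  define \<sigma> where "\<sigma> = Inf R"
  have \<sigma>0: "0 \<le> \<sigma>" unfolding \<sigma>_def using Rne R0 by (intro cInf_greatest)
  have "\<sigma> \<le> a w w / b w w"
    unfolding \<sigma>_def using normalise[OF wM w(3)] bdd by (metis cInf_lower)
  also have "\<dots> \<le> \<kappa>" using w by (simp add: field_simps)
  finally have \<sigma>\<kappa>: "\<sigma> \<le> \<kappa>" .
  have qpos: "\<sigma> * b f f \<le> a f f" if "f \<in> M" for f
  proof (cases "b f f > 0")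
    case True
    have "\<sigma> \<le> a f f / b f f" unfolding \<sigma>_def using normalise[OF that True] bdd by (metis cInf_lower)
    then show ?thesis using True by (simp add: field_simps)
  next
    case False
    then have "b f f = 0" using B.nonneg MF that by (metis linorder_not_less order_antisym_conv)
    then show ?thesis using A.nonneg MF that by simp
  qed
  \<comment> \<open>By the choice of \<sigma> this form is nonnegative on M, so Cauchy-Schwarz for
    \<open>q\<close> turns \<open>q (f k) (f k)\<close> tending to 0 into
    \<open>q (f k) \<phi>\<close> tending to 0.\<close>
  define q where "q = (\<lambda>f g. a f g - \<sigma> * b f g)"
  interpret Q: psd_form sc M q
  proof unfold_locales
    show "q f g = q g f" for f g by (simp add: q_def A.sym[of f g] B.sym[of f g])
  qed (use M MF qpos in \<open>auto simp: q_def A.add B.add A.sc B.sc algebra_simps\<close>)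
  have "\<exists>f. f \<in> M \<and> b f f = 1 \<and> a f f < \<sigma> + 1 / real (Suc k)" for k
  proof -
    have "Inf R < \<sigma> + 1 / real (Suc k)" by (simp add: \<sigma>_def)
    then obtain x where "x \<in> R" "x < \<sigma> + 1 / real (Suc k)"
      using cInf_lessD[OF Rne] by blast
    then show ?thesis by (auto simp: R_def)
  qed
  then obtain f where f: "\<And>k. f k \<in> M" "\<And>k. b (f k) (f k) = 1"
    "\<And>k. a (f k) (f k) < \<sigma> + 1 / real (Suc k)" by metis
  have fF: "f k \<in> F" for k using MF f by auto
  have qf: "q (f k) (f k) \<le> 1 / real (Suc k)" for k using f(2,3)[of k] by (simp add: q_def)
  have nA: "A.nm (f k) \<le> sqrt (\<sigma> + 1)" for k
  proof -
    have "1 / real (Suc k) \<le> 1" by simp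
    then have "a (f k) (f k) \<le> \<sigma> + 1" using f(3)[of k] by linarith
    then show ?thesis by (simp add: A.nm_def)
  qed
  have nB: "B.nm (f k) = 1" for k using f by (simp add: B.nm_def)
  have inv: "(\<lambda>k. 1 / real (Suc k)) \<longlonglongrightarrow> 0" using LIMSEQ_inverse_real_of_nat by (simp add: inverse_eq_divide)
  have Qlim: "(\<lambda>k. q (f k) \<phi>) \<longlonglongrightarrow> 0" if \<phi>: "\<phi> \<in> M" for \<phi>
  proof (rule Lim_null_comparison)
    show "\<forall>\<^sub>F k in sequentially. norm (q (f k) \<phi>) \<le> sqrt (1 / real (Suc k)) * Q.nm \<phi>"
    proof (intro always_eventually allI)
      fix k
      have "\<bar>q (f k) \<phi>\<bar> \<le> Q.nm (f k) * Q.nm \<phi>" using f \<phi> by (intro Q.cauchy_schwarz)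
      also have "\<dots> \<le> sqrt (1 / real (Suc k)) * Q.nm \<phi>"
        using qf[of k] \<phi> by (intro mult_right_mono) (auto simp: Q.nm_def[of "f k"] intro: real_sqrt_le_mono)
      finally show "norm (q (f k) \<phi>) \<le> sqrt (1 / real (Suc k)) * Q.nm \<phi>" by simp
    qed
    show "(\<lambda>k. sqrt (1 / real (Suc k)) * Q.nm \<phi>) \<longlonglongrightarrow> 0"
      using tendsto_mult_left[OF tendsto_real_sqrt[OF inv], of "Q.nm \<phi>"] by (simp add: mult.commute)
  qed
  \<comment> \<open>A general \<phi> is replaced by its projection off U. That lies in M and pairs
    with \<open>f k\<close> in the same way, because U consists of weak eigenvectors and
    \<open>f k\<close> is therefore orthogonal to U for both forms.\<close>
  have weak: "(\<lambda>k. a (f k) \<phi> - \<sigma> * b (f k) \<phi>) \<longlonglongrightarrow> 0" if \<phi>: "\<phi> \<in> F" for \<phi>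
  proof -
    obtain \<psi> where \<psi>: "\<psi> \<in> F" "\<forall>u\<in>U. b \<psi> u = 0"
      "\<And>g. g \<in> F \<Longrightarrow> \<forall>u\<in>U. a g u = 0 \<Longrightarrow> a g \<psi> = a g \<phi>"
      "\<And>g. g \<in> F \<Longrightarrow> \<forall>u\<in>U. b g u = 0 \<Longrightarrow> b g \<psi> = b g \<phi>"
      using project_out[OF U(1,2) \<phi>] by blast
    have "b (f k) u = 0" "a (f k) u = 0" if "u \<in> U" for k u
      using f(1)[of k] U(3)[OF that fF] that by (auto simp: M_def)
    then have "q (f k) \<psi> = a (f k) \<phi> - \<sigma> * b (f k) \<phi>" for k
      using \<psi>(3,4)[of "f k"] fF by (simp add: q_def)
    then show ?thesis using Qlim[of \<psi>] \<psi> by (simp add: M_def)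
  qed
  obtain r where r: "strict_mono r" "\<forall>i\<in>I. convergent ((\<lambda>k. l i (f k)) \<circ> r)"
  proof -
    have "bounded (range (\<lambda>k. l i (f k)))" if "i \<in> I" for i
    proof -
      have "\<bar>l i (f k)\<bar> \<le> \<bar>C i\<bar> * (sqrt (\<sigma> + 1) + 1)" for k
      proof -
        have "\<bar>l i (f k)\<bar> \<le> C i * (A.nm (f k) + B.nm (f k))" using L(3)[OF that fF] .
        also have "\<dots> \<le> \<bar>C i\<bar> * (sqrt (\<sigma> + 1) + 1)"
          using nA[of k] nB[of k] fF[of k] by (intro mult_mono) auto
        finally show ?thesis .
      qed
      then show ?thesis by (auto simp: bounded_iff)
    qed
    then show ?thesis using convergent_subseq_finite[OF L(1), of "\<lambda>i k. l i (f k)"] that by blast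
  qed
  have "\<Lambda> > 0" using \<sigma>0 \<sigma>\<kappa> \<Lambda> by simp
  have "\<exists>K\<ge>0. \<forall>g\<in>F. sqrt \<Lambda> * B.nm g \<le> A.nm g + K * (\<Sum>i\<in>I. \<bar>l i g\<bar>)"
    by (rule gap_inequality) (use L \<open>\<Lambda> > 0\<close> in \<open>simp_all add: less_imp_le\<close>)
  then obtain K where K: "K \<ge> 0" "\<And>g. g \<in> F \<Longrightarrow> sqrt \<Lambda> * B.nm g \<le> A.nm g + K * (\<Sum>i\<in>I. \<bar>l i g\<bar>)"
    by blast
  have rle: "k \<le> r k" for k using seq_suble[OF r(1)] .
  \<comment> \<open>With A.nm g at most sqrt \<sigma> times B.nm g up to a small error, the gap
    inequality can be solved for B.nm g with this positive factor.\<close>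
  define \<delta> where "\<delta> = sqrt \<Lambda> - sqrt \<sigma>"
  have \<delta>: "\<delta> > 0" using \<Lambda> \<sigma>0 \<sigma>\<kappa> by (simp add: \<delta>_def)
  have cauchy: "\<exists>N. \<forall>i\<ge>N. \<forall>j\<ge>N. A.nm (f (r i) - f (r j)) < e \<and> B.nm (f (r i) - f (r j)) < e"
    if e: "e > 0" for e
  proof -
    \<comment> \<open>Chosen backwards: B.nm g < t makes sqrt \<sigma> * B.nm g smaller than e / 2;
      s bounds both the error in A.nm g, by e / 2, and (1 + K) * s, by less than \<delta> * min t
      e.\<close>
    define t where "t = e / (2 * (1 + sqrt \<sigma>))"
    have t: "t > 0" using e \<sigma>0 by (simp add: t_def add_pos_nonneg)
    define s where "s = min (e / 2) (\<delta> * min t e) / (2 * (1 + K))"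
    have s: "s > 0" using e t \<delta> K by (simp add: s_def add_pos_nonneg)
    have "\<exists>N. \<forall>i\<ge>N. \<forall>j\<ge>N. (\<Sum>m\<in>J. \<bar>l m (f (r i) - f (r j))\<bar>) < s" if "J \<subseteq> I" for J
    proof -
      have "finite J" using that L(1) finite_subset by auto
      define s' where "s' = s / (1 + real (card J))"
      have s': "s' > 0" using s by (simp add: s'_def add_pos_nonneg)
      have "\<exists>N. \<forall>i\<ge>N. \<forall>j\<ge>N. \<bar>l m (f (r i) - f (r j))\<bar> < s'" if "m \<in> J" for m
      proof -
        have m: "m \<in> I" using that \<open>J \<subseteq> I\<close> by auto
        have "Cauchy (\<lambda>k. l m (f (r k)))"
          using r(2) m by (auto simp: o_def convergent_Cauchy)
        then obtain N where N: "\<And>i j. i \<ge> N \<Longrightarrow> j \<ge> N \<Longrightarrow> dist (l m (f (r i))) (l m (f (r j))) < s'"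
          using s' metric_CauchyD by metis
        have "l m (f i - f j) = l m (f i) - l m (f j)" for i j
          using L(2)[OF m] fF[of i] fF[of j] unfolding linear_on_def by (metis mult_1 A.scale_one)
        with N show ?thesis by (auto simp: dist_real_def)
      qed
      then obtain N where N: "\<And>m i j. m \<in> J \<Longrightarrow> i \<ge> N m \<Longrightarrow> j \<ge> N m \<Longrightarrow> \<bar>l m (f (r i) - f (r j))\<bar> < s'"
        by metis
      have "(\<Sum>m\<in>J. \<bar>l m (f (r i) - f (r j))\<bar>) < s" if "i \<ge> Max (insert 0 (N ` J))" "j \<ge> Max (insert 0 (N ` J))" for i j
      proof -
        have "(\<Sum>m\<in>J. \<bar>l m (f (r i) - f (r j))\<bar>) \<le> (\<Sum>m\<in>J. s')"
        proof (rule sum_mono)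
          fix m assume m: "m \<in> J"
          then have "N m \<le> Max (insert 0 (N ` J))" using \<open>finite J\<close> by auto
          then show "\<bar>l m (f (r i) - f (r j))\<bar> \<le> s'" using N[OF m, of i j] that by simp
        qed
        also have "\<dots> < s" using s by (simp add: s'_def field_simps)
        finally show ?thesis .
      qed
      then show ?thesis by blast
    qed
    from this[of I] obtain N1 where N1: "\<And>i j. i \<ge> N1 \<Longrightarrow> j \<ge> N1 \<Longrightarrow> (\<Sum>m\<in>I. \<bar>l m (f (r i) - f (r j))\<bar>) < s"
      by blast
    obtain N2 where N2: "1 / real (Suc k) < (s / 2)\<^sup>2" if "k \<ge> N2" for k
    proof -
      have "(s / 2)\<^sup>2 > 0" using s by simp
      then have "\<forall>\<^sub>F k in sequentially. 1 / real (Suc k) < (s / 2)\<^sup>2" using order_tendstoD(2)[OF inv] by blast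
      then show ?thesis using that by (auto simp: eventually_sequentially)
    qed
    show ?thesis
    proof (intro exI[of _ "max N1 N2"] allI impI)
      fix i j assume ij: "max N1 N2 \<le> i" "max N1 N2 \<le> j"
      define g where "g = f (r i) - f (r j)"
      have gM: "g \<in> M" and gF: "g \<in> F"
        unfolding g_def using f fF B.F_diff by (auto intro: A.subspace_diff[OF M])
      have qg: "q g g \<le> s\<^sup>2"
      proof -
        have "q g g \<le> 2 * q (f (r i)) (f (r i)) + 2 * q (f (r j)) (f (r j))"
          unfolding g_def by (intro Q.parallelogram f)
        also have "\<dots> \<le> 2 * (s / 2)\<^sup>2 + 2 * (s / 2)\<^sup>2"
          using qf[of "r i"] qf[of "r j"] N2[of "r i"] N2[of "r j"] rle[of i] rle[of j] ij
          by (intro add_mono mult_left_mono) auto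
        also have "\<dots> \<le> s\<^sup>2" by (simp add: power2_eq_square)
        finally show ?thesis .
      qed
      have Ag: "A.nm g \<le> sqrt \<sigma> * B.nm g + s"
      proof -
        have "a g g \<le> \<sigma> * b g g + s\<^sup>2" using qg by (simp add: q_def)
        then have "A.nm g \<le> sqrt (\<sigma> * b g g + s\<^sup>2)" by (simp add: A.nm_def)
        also have "\<dots> \<le> sqrt (\<sigma> * b g g) + sqrt (s\<^sup>2)"
          using \<sigma>0 B.nonneg[OF gF] by (intro sqrt_add_le_add_sqrt) auto
        also have "\<dots> = sqrt \<sigma> * B.nm g + s" using s by (simp add: B.nm_def real_sqrt_mult)
        finally show ?thesis .
      qed
      have "sqrt \<Lambda> * B.nm g \<le> A.nm g + K * (\<Sum>m\<in>I. \<bar>l m g\<bar>)" using K gF by auto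
      also have "\<dots> \<le> sqrt \<sigma> * B.nm g + s + K * s"
        using Ag N1[of i j] ij K by (intro add_mono mult_left_mono) (auto simp: g_def)
      finally have "\<delta> * B.nm g \<le> (1 + K) * s" by (simp add: \<delta>_def algebra_simps)
      also have "(1 + K) * s = min (e / 2) (\<delta> * min t e) / 2"
      proof -
        have "(1 + K) * (m / (2 * (1 + K))) = m / 2" for m using K by (simp add: divide_simps)
        then show ?thesis by (simp only: s_def)
      qed
      also have "\<dots> < \<delta> * min t e"
      proof -
        have "0 < \<delta> * min t e" using \<delta> t e by simp
        then show ?thesis by linarith
      qed
      finally have "B.nm g < min t e" using \<delta> by simp
      then have Bg: "B.nm g < t" "B.nm g < e" by auto
      have "s \<le> e / 2"
      proof -
        have "s \<le> (e / 2) / (2 * (1 + K))" unfolding s_def using K by (intro divide_right_mono) auto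
        also have "\<dots> \<le> e / 2" using e K by (simp add: field_simps)
        finally show ?thesis .
      qed
      moreover have "sqrt \<sigma> * B.nm g < e / 2"
      proof -
        have "sqrt \<sigma> * B.nm g \<le> sqrt \<sigma> * t" using Bg \<sigma>0 by (intro mult_left_mono) auto
        also have "\<dots> < (1 + sqrt \<sigma>) * t" using t by (simp add: algebra_simps)
        also have "\<dots> = e / 2" 
        proof -
          have "0 < 1 + sqrt \<sigma>" using \<sigma>0 by (simp add: add_pos_nonneg)
          then show ?thesis by (simp only: t_def) (simp add: divide_simps)
        qed
        finally show ?thesis .
      qed
      ultimately have "A.nm g < e" using Ag by linarith
      with Bg show "A.nm (f (r i) - f (r j)) < e \<and> B.nm (f (r i) - f (r j)) < e"
        by (simp add: g_def)
    qed
  qed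
  show ?thesis
  proof (rule that[of \<sigma> "\<lambda>k. f (r k)"])
    show "(\<lambda>k. a (f (r k)) \<phi> - \<sigma> * b (f (r k)) \<phi>) \<longlonglongrightarrow> 0" if "\<phi> \<in> F" for \<phi>
      using LIMSEQ_subseq_LIMSEQ[OF weak[OF that] r(1)] by (simp add: o_def)
    show "b (f (r k)) u = 0" if "u \<in> U" for k u using f(1)[of "r k"] that by (simp add: M_def)
  qed (use \<sigma>0 \<sigma>\<kappa> fF f cauchy in auto)
qed

end

section \<open>The Gaussian weight on the line\<close>

definition gw :: "real \<Rightarrow> real" where
  "gw t = 2 / sqrt pi * exp (- t\<^sup>2)"

lemma gw_pos [simp]: "gw t > 0"
  by (simp add: gw_def)

lemma gw_nonneg [simp]: "gw t \<ge> 0" and gw_nz [simp]: "gw t \<noteq> 0"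
  using gw_pos[of t] by linarith+

lemma gw_deriv [derivative_intros]:
  "(gw has_real_derivative - 2 * t * gw t) (at t within S)"
proof -
  have "((\<lambda>t. c * exp (- t\<^sup>2)) has_real_derivative - 2 * t * (c * exp (- t\<^sup>2))) (at t within S)" for c
    by (auto intro!: derivative_eq_intros simp: power2_eq_square)
  then show ?thesis unfolding gw_def .
qed

lemma gw_continuous [continuous_intros]:
  "continuous_on S f \<Longrightarrow> continuous_on S (\<lambda>t. gw (f t))"
  unfolding gw_def by (intro continuous_intros)

lemma gw_measurable [measurable]: "gw \<in> borel_measurable borel"
  by (intro borel_measurable_continuous_onI continuous_intros)

lemma gauss_eq: "gauss = density lborel (\<lambda>t. ennreal (gw t))"
  by (simp add: gauss_def gw_def)

lemma sets_gauss [measurable_cong, simp]: "sets gauss = sets borel"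
  by (simp add: gauss_eq)

lemma integrable_gauss_iff:
  fixes f :: "real \<Rightarrow> 'b::{banach, second_countable_topology}"
  shows "f \<in> borel_measurable borel \<Longrightarrow>
    integrable gauss f \<longleftrightarrow> integrable lborel (\<lambda>t. gw t *\<^sub>R f t)"
  unfolding gauss_eq by (subst integrable_density) auto

lemma integral_gauss:
  fixes f :: "real \<Rightarrow> 'b::{banach, second_countable_topology}"
  shows "f \<in> borel_measurable borel \<Longrightarrow>
    (LINT t|gauss. f t) = (LINT t|lborel. gw t *\<^sub>R f t)"
  unfolding gauss_eq by (subst integral_density) auto

text \<open>Functions on the whole line; a function on an edge is extended by zero, so that all
  edges share one space and one inner product.\<close>

definition L2g :: "(real \<Rightarrow> complex) set" where
  "L2g = {f. f \<in> borel_measurable borel \<and> integrable gauss (\<lambda>t. (cmod (f t))\<^sup>2)}"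

text \<open>The real part of the hermitian product, since the inner product of two complex numbers
  is the real one. The imaginary part is recovered in \<open>hp\<close>.\<close>

definition ip :: "(real \<Rightarrow> complex) \<Rightarrow> (real \<Rightarrow> complex) \<Rightarrow> real" where
  "ip f g = (LINT t|gauss. f t \<bullet> g t)"

lemma L2gD [measurable_dest]: "f \<in> L2g \<Longrightarrow> f \<in> borel_measurable borel"
  by (simp add: L2g_def)

lemma L2g_square: "f \<in> L2g \<Longrightarrow> integrable gauss (\<lambda>t. (cmod (f t))\<^sup>2)"
  by (simp add: L2g_def)

lemma L2g_dominated:
  assumes "f \<in> L2g" "g \<in> borel_measurable borel" "\<And>t. cmod (g t) \<le> C * cmod (f t)"
  shows "g \<in> L2g"
proof -
  have "(cmod (g t))\<^sup>2 \<le> C\<^sup>2 * (cmod (f t))\<^sup>2" for t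
    using power_mono[OF assms(3)[of t], of 2] by (simp add: power_mult_distrib)
  then have "integrable gauss (\<lambda>t. (cmod (g t))\<^sup>2)"
    using assms(2) by (intro Bochner_Integration.integrable_bound[OF
        integrable_mult_right[OF L2g_square[OF assms(1)], of "C\<^sup>2"]]) auto
  then show ?thesis using assms(2) by (simp add: L2g_def)
qed

lemma L2g_inner_integrable:
  assumes "f \<in> L2g" "g \<in> L2g"
  shows "integrable gauss (\<lambda>t. f t \<bullet> g t)"
proof (rule Bochner_Integration.integrable_bound[OF
      Bochner_Integration.integrable_add[OF L2g_square[OF assms(1)] L2g_square[OF assms(2)]]])
  show "(\<lambda>t. f t \<bullet> g t) \<in> borel_measurable gauss" using assms[THEN L2gD] by measurable
  have "\<bar>x \<bullet> y\<bar> \<le> (cmod x)\<^sup>2 + (cmod y)\<^sup>2" for x y :: complex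
  proof -
    have "\<bar>x \<bullet> y\<bar> \<le> cmod x * cmod y" by (rule Cauchy_Schwarz_ineq2)
    also have "\<dots> \<le> (cmod x)\<^sup>2 + (cmod y)\<^sup>2"
    proof -
      have "0 \<le> cmod x * cmod y" by simp
      then show ?thesis using sum_squares_bound[of "cmod x" "cmod y"] by linarith
    qed
    finally show ?thesis .
  qed
  then show "AE t in gauss. norm (f t \<bullet> g t) \<le> norm ((cmod (f t))\<^sup>2 + (cmod (g t))\<^sup>2)"
    by (intro AE_I2) simp
qed

lemma L2g_add:
  assumes "f \<in> L2g" "g \<in> L2g"
  shows "f + g \<in> L2g"
proof -
  have m: "(\<lambda>t. f t + g t) \<in> borel_measurable borel" using assms[THEN L2gD] by measurable
  have "integrable gauss (\<lambda>t. (cmod (f t))\<^sup>2 + 2 * (f t \<bullet> g t) + (cmod (g t))\<^sup>2)"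
    using assms by (intro Bochner_Integration.integrable_add integrable_mult_right L2g_square L2g_inner_integrable)
  moreover have "(cmod (x + y))\<^sup>2 = (cmod x)\<^sup>2 + 2 * (x \<bullet> y) + (cmod y)\<^sup>2" for x y :: complex
    by (simp add: power2_norm_eq_inner inner_add inner_commute)
  ultimately show ?thesis using m by (simp add: L2g_def plus_fun_def)
qed

definition rsc :: "real \<Rightarrow> (real \<Rightarrow> complex) \<Rightarrow> (real \<Rightarrow> complex)" where
  "rsc c f = (\<lambda>t. c *\<^sub>R f t)"

lemma L2g_rsc: "f \<in> L2g \<Longrightarrow> rsc c f \<in> L2g"
  by (rule L2g_dominated[of f _ "\<bar>c\<bar>"]) (auto simp: rsc_def dest: L2gD)

lemma L2g_0: "(0 :: real \<Rightarrow> complex) \<in> L2g"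
  by (simp add: L2g_def zero_fun_def)

interpretation rsc: vector_space rsc
  by unfold_locales (auto simp: rsc_def fun_eq_iff algebra_simps)

interpretation ipg: psd_form rsc L2g ip
proof unfold_locales
  show "rsc.subspace L2g"
    unfolding rsc.subspace_def using L2g_0 L2g_add L2g_rsc by (auto simp: zero_fun_def)
  show "ip f g = ip g f" for f g by (simp add: ip_def inner_commute)
  show "ip f f \<ge> 0" for f by (simp add: ip_def)
  show "ip (f + g) h = ip f h + ip g h" if "f \<in> L2g" "g \<in> L2g" "h \<in> L2g" for f g h
    using that by (simp add: ip_def inner_add L2g_inner_integrable)
  show "ip (rsc c f) h = c * ip f h" for c f h
    by (simp add: ip_def rsc_def)
qed

lemma ip_square: "ip f f = (LINT t|gauss. (cmod (f t))\<^sup>2)"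
  by (simp add: ip_def power2_norm_eq_inner)

lemma L2g_cmult: "f \<in> L2g \<Longrightarrow> (\<lambda>t. c * f t) \<in> L2g"
  by (rule L2g_dominated[of f _ "cmod c"]) (auto simp: norm_mult dest: L2gD)

lemma L2g_cutoff: "f \<in> L2g \<Longrightarrow> A \<in> sets borel \<Longrightarrow> (\<lambda>t. indicat_real A t *\<^sub>R f t) \<in> L2g"
  by (rule L2g_dominated[of f _ 1]) (auto simp: indicator_def dest!: L2gD)

lemma ip_lborel:
  assumes "f \<in> L2g" "g \<in> L2g"
  shows "integrable lborel (\<lambda>t. gw t * (f t \<bullet> g t))" "ip f g = (LINT t|lborel. gw t * (f t \<bullet> g t))"
proof -
  have m: "(\<lambda>t. f t \<bullet> g t) \<in> borel_measurable borel" using assms[THEN L2gD] by measurable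
  show "integrable lborel (\<lambda>t. gw t * (f t \<bullet> g t))"
    using integrable_gauss_iff[OF m] L2g_inner_integrable[OF assms] by simp
  show "ip f g = (LINT t|lborel. gw t * (f t \<bullet> g t))"
    unfolding ip_def using integral_gauss[OF m] by simp
qed

lemma set_integrable_of_integrable:
  fixes f :: "real \<Rightarrow> 'b::{banach, second_countable_topology}"
  shows "integrable lborel f \<Longrightarrow> A \<in> sets borel \<Longrightarrow> set_integrable lborel A f"
  unfolding set_integrable_def by (rule integrable_mult_indicator) auto

lemma integrable_HK:
  fixes f :: "real \<Rightarrow> 'b::euclidean_space"
  assumes "integrable lborel f" "A \<in> sets borel"
  shows "f integrable_on A" "(LINT t:A|lborel. f t) = integral A f"
  using set_borel_integral_eq_integral[OF set_integrable_of_integrable[OF assms]] by auto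

lemma continuous_bounded_support_L2g:
  fixes f :: "real \<Rightarrow> complex"
  assumes "continuous_on {s..t} f"
  shows "(\<lambda>x. indicat_real {s..t} x *\<^sub>R f x) \<in> L2g"
proof -
  have m: "(\<lambda>x. indicat_real {s..t} x *\<^sub>R f x) \<in> borel_measurable borel"
    using borel_measurable_continuous_on_indicator[of "{s..t}" f] assms by simp
  have "continuous_on {s..t} (\<lambda>x. gw x * (cmod (f x))\<^sup>2)" using assms by (intro continuous_intros)
  then have "set_integrable lborel {s..t} (\<lambda>x. gw x * (cmod (f x))\<^sup>2)"
    by (intro borel_integrable_compact[of "{s..t}", folded set_integrable_def]) auto
  moreover have "gw x *\<^sub>R (cmod (indicat_real {s..t} x *\<^sub>R f x))\<^sup>2
      = indicat_real {s..t} x *\<^sub>R (gw x * (cmod (f x))\<^sup>2)" for x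
    by (auto simp: indicator_def)
  ultimately have "integrable lborel (\<lambda>x. gw x *\<^sub>R (cmod (indicat_real {s..t} x *\<^sub>R f x))\<^sup>2)"
    by (simp only: set_integrable_def)
  moreover have "(\<lambda>x. (cmod (indicat_real {s..t} x *\<^sub>R f x))\<^sup>2) \<in> borel_measurable borel"
    using m by measurable
  ultimately show ?thesis using m by (simp only: L2g_def mem_Collect_eq integrable_gauss_iff simp_thms)
qed

section \<open>The scale function, and increments of weighted Sobolev functions\<close>

lemma antiderivative_exists:
  fixes f :: "real \<Rightarrow> 'b::euclidean_space"
  assumes "continuous_on UNIV f"
  obtains F where "\<And>t. (F has_vector_derivative f t) (at t)"
proof -
  have "\<exists>F. \<forall>x::real. -\<infinity> < ereal x \<longrightarrow> ereal x < \<infinity> \<longrightarrow> (F has_vector_derivative f x) (at x)"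
    using assms by (intro einterval_antiderivative) (auto simp: continuous_on_eq_continuous_at)
  then show ?thesis using that by auto
qed

text \<open>The scale function of the operator: 1 and Phi span the solutions of - f'' / 2 + t f' =
  0. Only its differences matter, so any antiderivative will do.\<close>

definition Phi :: "real \<Rightarrow> real" where
  "Phi = (SOME P. \<forall>t. (P has_real_derivative 1 / gw t) (at t))"

lemma Phi_deriv [derivative_intros]: "(Phi has_real_derivative 1 / gw t) (at t within S)"
proof -
  have "continuous_on UNIV (\<lambda>t. 1 / gw t)" by (intro continuous_intros) auto
  then obtain P where "\<And>t. (P has_vector_derivative 1 / gw t) (at t)"
    using antiderivative_exists by blast
  then have "\<exists>P. \<forall>t. (P has_real_derivative 1 / gw t) (at t)"
    by (auto simp: has_real_derivative_iff_has_vector_derivative)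
  then have "\<forall>t. (Phi has_real_derivative 1 / gw t) (at t)"
    unfolding Phi_def by (rule someI_ex)
  then show ?thesis using has_field_derivative_at_within by blast
qed

lemma Phi_continuous [continuous_intros]:
  "continuous_on S f \<Longrightarrow> continuous_on S (\<lambda>t. Phi (f t))"
  using continuous_on_compose2[of UNIV Phi S f] Phi_deriv
  by (metis DERIV_continuous_on subset_UNIV)

lemma Phi_less: "s < t \<Longrightarrow> Phi s < Phi t"
  by (rule DERIV_pos_imp_increasing) (use Phi_deriv in \<open>force\<close>)+

lemma Phi_mono: "s \<le> t \<Longrightarrow> Phi s \<le> Phi t"
  using Phi_less by (cases "s = t") (auto simp: less_imp_le)

text \<open>Dividing by the weight cancels it in \<open>ip\<close>: paired with a derivative f',
  this function returns the increment of f from u to v in the direction z, see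
  \<open>ip_seg_H1\<close>.\<close>

definition seg :: "real \<Rightarrow> real \<Rightarrow> complex \<Rightarrow> real \<Rightarrow> complex" where
  "seg u v z = (\<lambda>x. indicat_real {u..v} x *\<^sub>R ((1 / gw x) *\<^sub>R z))"

lemma seg_L2g: "seg u v z \<in> L2g"
  unfolding seg_def by (intro continuous_bounded_support_L2g continuous_intros) auto

lemma ip_seg:
  assumes "f \<in> L2g"
  shows "((\<lambda>x. z \<bullet> f x) has_integral ip f (seg u v z)) {u..v}"
proof -
  have eq: "gw x * (f x \<bullet> seg u v z x) = indicat_real {u..v} x *\<^sub>R (z \<bullet> f x)" for x
    by (simp add: seg_def inner_commute)
  have "set_integrable lborel {u..v} (\<lambda>x. z \<bullet> f x)"
    using ip_lborel(1)[OF assms seg_L2g[of u v z]] by (simp only: eq set_integrable_def)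
  moreover have "ip f (seg u v z) = (LINT x:{u..v}|lborel. z \<bullet> f x)"
    by (simp only: ip_lborel(2)[OF assms seg_L2g[of u v z]] eq set_lebesgue_integral_def)
  ultimately show ?thesis
    using set_borel_integral_eq_integral[of "{u..v}" "\<lambda>x. z \<bullet> f x"] by (simp add: has_integral_integral)
qed

text \<open>One factor 1 / gw remains after cancelling the weight, and its integral is an increment
  of Phi.\<close>

lemma nm_seg:
  assumes "u \<le> v"
  shows "ipg.nm (seg u v z) = cmod z * sqrt (Phi v - Phi u)"
proof -
  have "((\<lambda>x. (cmod z)\<^sup>2 * (1 / gw x)) has_integral (cmod z)\<^sup>2 * (Phi v - Phi u)) {u..v}"
    by (intro has_integral_mult_right fundamental_theorem_of_calculus assms)
      (auto simp: has_real_derivative_iff_has_vector_derivative[symmetric] intro: derivative_intros)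
  moreover have "z \<bullet> seg u v z x = (cmod z)\<^sup>2 * (1 / gw x)" if "x \<in> {u..v}" for x
    using that by (simp add: seg_def power2_norm_eq_inner)
  ultimately have "((\<lambda>x. z \<bullet> seg u v z x) has_integral (cmod z)\<^sup>2 * (Phi v - Phi u)) {u..v}"
    by (subst has_integral_cong[where g = "\<lambda>x. (cmod z)\<^sup>2 * (1 / gw x)"]) auto
  then have "ip (seg u v z) (seg u v z) = (cmod z)\<^sup>2 * (Phi v - Phi u)"
    using ip_seg[OF seg_L2g] has_integral_unique by blast
  then show ?thesis by (simp add: ipg.nm_def real_sqrt_mult)
qed

text \<open>Differentiability off a finite set instead of a weak derivative: this admits hats and
  cut-off polynomials, keeps point values available, and suits the fundamental theorem of calculus
  with finitely many exceptional points.\<close>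

definition H1_on :: "real set \<Rightarrow> (real \<Rightarrow> complex) \<Rightarrow> (real \<Rightarrow> complex) \<Rightarrow> bool" where
  "H1_on I f f' \<longleftrightarrow> (\<forall>t. t \<notin> I \<longrightarrow> f t = 0 \<and> f' t = 0) \<and> continuous_on I f \<and>
     (\<exists>S. finite S \<and> (\<forall>t\<in>interior I - S. (f has_vector_derivative f' t) (at t))) \<and>
     f \<in> L2g \<and> f' \<in> L2g"

lemma H1_onD:
  assumes "H1_on I f f'"
  shows "f \<in> L2g" "f' \<in> L2g" "continuous_on I f" "t \<notin> I \<Longrightarrow> f t = 0" "t \<notin> I \<Longrightarrow> f' t = 0"
  using assms by (auto simp: H1_on_def)

lemma interior_subinterval: "{s..t} \<subseteq> I \<Longrightarrow> x \<in> {s<..<t::real} \<Longrightarrow> x \<in> interior I"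
  using interior_mono[of "{s..t}" I] by auto

lemma H1_on_product:
  assumes f: "H1_on I f f'" and st: "{s..t} \<subseteq> I" "s \<le> t"
    and p: "continuous_on {s..t} p" "\<And>x. x \<in> {s<..<t} \<Longrightarrow> (p has_vector_derivative p' x) (at x)"
  shows "((\<lambda>x. p x \<bullet> f' x + p' x \<bullet> f x) has_integral p t \<bullet> f t - p s \<bullet> f s) {s..t}"
proof -
  obtain S where S: "finite S" "\<And>x. x \<in> interior I - S \<Longrightarrow> (f has_vector_derivative f' x) (at x)"
    using f by (auto simp: H1_on_def)
  show ?thesis
  proof (rule fundamental_theorem_of_calculus_interior_strong[OF S(1) st(2)])
    show "((\<lambda>x. p x \<bullet> f x) has_vector_derivative p x \<bullet> f' x + p' x \<bullet> f x) (at x)"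
      if "x \<in> {s<..<t} - S" for x
      using bounded_bilinear.has_vector_derivative[OF bounded_bilinear_inner p(2)[of x] S(2)[of x]]
        that interior_subinterval[OF st(1)] by auto
    show "continuous_on {s..t} (\<lambda>x. p x \<bullet> f x)"
      using p(1) continuous_on_subset[OF H1_onD(3)[OF f] st(1)] by (intro continuous_intros)
  qed
qed

lemma ip_seg_H1:
  assumes f: "H1_on I f f'" and uv: "{u..v} \<subseteq> I" "u \<le> v"
  shows "ip f' (seg u v z) = z \<bullet> (f v - f u)"
proof -
  have "((\<lambda>x. z \<bullet> f' x + 0 \<bullet> f x) has_integral z \<bullet> f v - z \<bullet> f u) {u..v}"
    by (rule H1_on_product[OF f uv]) (auto intro: continuous_intros derivative_eq_intros)
  then show ?thesis
    using has_integral_unique[OF ip_seg[OF H1_onD(2)[OF f]]] by (simp add: inner_diff_right)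
qed

lemma ip_cutoff_local:
  assumes "f \<in> L2g"
  shows "((\<lambda>x. gw x * (cmod (f x))\<^sup>2) has_integral
    ip (\<lambda>x. indicat_real {u..v} x *\<^sub>R f x) (\<lambda>x. indicat_real {u..v} x *\<^sub>R f x)) {u..v}"
proof -
  have c: "(\<lambda>x. indicat_real {u..v} x *\<^sub>R f x) \<in> L2g" using assms by (intro L2g_cutoff) auto
  have eq: "gw x * ((indicat_real {u..v} x *\<^sub>R f x) \<bullet> (indicat_real {u..v} x *\<^sub>R f x))
    = indicat_real {u..v} x *\<^sub>R (gw x * (cmod (f x))\<^sup>2)" for x
    by (auto simp: power2_norm_eq_inner indicator_def)
  have "set_integrable lborel {u..v} (\<lambda>x. gw x * (cmod (f x))\<^sup>2)"
    using ip_lborel(1)[OF c c] by (simp only: eq set_integrable_def)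
  moreover have "ip (\<lambda>x. indicat_real {u..v} x *\<^sub>R f x) (\<lambda>x. indicat_real {u..v} x *\<^sub>R f x)
      = (LINT x:{u..v}|lborel. gw x * (cmod (f x))\<^sup>2)"
    by (simp only: ip_lborel(2)[OF c c] eq set_lebesgue_integral_def)
  ultimately show ?thesis
    using set_borel_integral_eq_integral[of "{u..v}" "\<lambda>x. gw x * (cmod (f x))\<^sup>2"]
    by (simp add: has_integral_integral)
qed

text \<open>Cauchy-Schwarz against \<open>seg u v z\<close> with z the increment itself. Keeping the
  energy local to {u..v} matters for Picone's inequality, where it has to tend to 0 as the segment
  shrinks.\<close>

lemma H1_increment_local:
  assumes f: "H1_on I f f'" and uv: "{u..v} \<subseteq> I" "u \<le> v"
  shows "(cmod (f v - f u))\<^sup>2 \<le> (Phi v - Phi u) * integral {u..v} (\<lambda>x. gw x * (cmod (f' x))\<^sup>2)"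
proof -
  define c where "c = (\<lambda>x. indicat_real {u..v} x *\<^sub>R f' x)"
  define z where "z = f v - f u"
  have f': "f' \<in> L2g" using H1_onD[OF f] by auto
  have c: "c \<in> L2g" unfolding c_def using f' by (intro L2g_cutoff) auto
  have cc: "ip c c = integral {u..v} (\<lambda>x. gw x * (cmod (f' x))\<^sup>2)"
    using ip_cutoff_local[OF f', of u v] by (simp add: c_def has_integral_iff)
  have "(cmod z)\<^sup>2 = ip f' (seg u v z)"
    by (simp add: ip_seg_H1[OF f uv] z_def power2_norm_eq_inner)
  also have "\<dots> = ip c (seg u v z)" by (auto simp: ip_def c_def seg_def indicator_def intro!: Bochner_Integration.integral_cong)
  also have "\<dots> \<le> ipg.nm c * (cmod z * sqrt (Phi v - Phi u))"
    using ipg.cauchy_schwarz[OF c seg_L2g, of u v z] nm_seg[OF uv(2), of z] by simp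
  finally have "cmod z * cmod z \<le> cmod z * (ipg.nm c * sqrt (Phi v - Phi u))"
    by (simp add: power2_eq_square mult_ac)
  then have "cmod z \<le> ipg.nm c * sqrt (Phi v - Phi u)"
    using c Phi_mono[OF uv(2)] by (cases "cmod z = 0") (auto simp: mult_le_cancel_left)
  then have "(cmod z)\<^sup>2 \<le> (ipg.nm c * sqrt (Phi v - Phi u))\<^sup>2" by (rule power_mono) simp
  also have "\<dots> = (Phi v - Phi u) * ip c c"
    using c Phi_mono[OF uv(2)] by (simp add: power_mult_distrib ipg.nm_square)
  finally show ?thesis by (simp add: cc z_def)
qed

lemma H1_increment:
  assumes f: "H1_on I f f'" and uv: "{u..v} \<subseteq> I" "u \<le> v"
  shows "cmod (f v - f u) \<le> ipg.nm f' * sqrt (Phi v - Phi u)"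
proof -
  have f': "f' \<in> L2g" using H1_onD[OF f] by auto
  have i: "integrable lborel (\<lambda>x. gw x * (cmod (f' x))\<^sup>2)"
    using ip_lborel(1)[OF f' f'] by (simp add: power2_norm_eq_inner)
  have "integral {u..v} (\<lambda>x. gw x * (cmod (f' x))\<^sup>2) \<le> integral UNIV (\<lambda>x. gw x * (cmod (f' x))\<^sup>2)"
    by (intro integral_subset_le integrable_HK[OF i]) auto
  also have "\<dots> = ip f' f'"
    using integrable_HK(2)[OF i, of UNIV] ip_lborel(2)[OF f' f'] by (simp add: power2_norm_eq_inner set_lebesgue_integral_def)
  finally have "(cmod (f v - f u))\<^sup>2 \<le> (Phi v - Phi u) * ip f' f'"
    using H1_increment_local[OF f uv] Phi_mono[OF uv(2)] by (meson diff_ge_0_iff_ge mult_left_mono order_trans)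
  also have "\<dots> = (ipg.nm f' * sqrt (Phi v - Phi u))\<^sup>2"
    using f' Phi_mono[OF uv(2)] by (simp add: power_mult_distrib ipg.nm_square)
  finally show ?thesis by (rule power2_le_imp_le) (use f' Phi_mono[OF uv(2)] in simp)
qed

text \<open>On {s..t} the function varies by at most \<open>ipg.nm f' * D\<close>. If its modulus at
  one point exceeds this by m > 0, it is at least m on the whole segment, so its norm is at least m
  times the norm G of the indicator.\<close>

lemma H1_pointwise_bound:
  assumes st: "s < t" "{s..t} \<subseteq> I"
  obtains C where "C \<ge> 0"
    "\<And>f f' x. H1_on I f f' \<Longrightarrow> x \<in> {s..t} \<Longrightarrow> cmod (f x) \<le> C * (ipg.nm f' + ipg.nm f)"
proof -
  define one where "one = (\<lambda>x. indicat_real {s..t} x *\<^sub>R (1::complex))"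
  have one: "one \<in> L2g" unfolding one_def by (intro continuous_bounded_support_L2g continuous_intros)
  define G where "G = ipg.nm one"
  have ip1: "((\<lambda>x. gw x) has_integral ip one one) {s..t}"
  proof -
    have eq: "gw x * (one x \<bullet> one x) = indicat_real {s..t} x *\<^sub>R gw x" for x
      by (auto simp: one_def indicator_def)
    have "set_integrable lborel {s..t} gw"
      using ip_lborel(1)[OF one one] by (simp only: eq set_integrable_def)
    then show ?thesis
      using set_borel_integral_eq_integral[of "{s..t}" gw]
      by (simp add: ip_lborel(2)[OF one one] eq set_lebesgue_integral_def[symmetric] has_integral_integral
          del: real_scaleR_def)
  qed
  have "ip one one > 0"
  proof -
    have c: "continuous_on {s..t} gw" by (intro continuous_intros)
    obtain x where x: "x \<in> {s..t}" "\<And>y. y \<in> {s..t} \<Longrightarrow> gw x \<le> gw y"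
      using continuous_attains_inf[OF compact_Icc _ c] st by auto
    have "((\<lambda>_. gw x) has_integral (t - s) * gw x) {s..t}"
      using has_integral_const_real[of "gw x" s t] st by simp
    from has_integral_le[OF this ip1] x have "(t - s) * gw x \<le> ip one one" by auto
    moreover have "0 < (t - s) * gw x" using st by simp
    ultimately show ?thesis by linarith
  qed
  then have G: "G > 0" by (simp add: G_def ipg.nm_def)
  define D where "D = sqrt (Phi t - Phi s)"
  have D: "D \<ge> 0" using st Phi_mono[of s t] by (simp add: D_def)
  show ?thesis
  proof (rule that[of "D + 1 / G"])
    show "0 \<le> D + 1 / G" using D G by simp
    fix f f' x assume f: "H1_on I f f'" and x: "x \<in> {s..t}"
    note L = H1_onD(1,2)[OF f]
    define m where "m = cmod (f x) - ipg.nm f' * D"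
    have "m \<le> ipg.nm f / G"
    proof (cases "m \<le> 0")
      case True
      then show ?thesis using L G by (meson divide_nonneg_pos ipg.nm_nonneg order_trans)
    next
      case False
      have ge: "m \<le> cmod (f y)" if y: "y \<in> {s..t}" for y
      proof -
        have "cmod (f (max x y) - f (min x y)) \<le> ipg.nm f' * sqrt (Phi (max x y) - Phi (min x y))"
        proof (rule H1_increment[OF f])
          have "{min x y..max x y} \<subseteq> {s..t}" using x y by auto
          then show "{min x y..max x y} \<subseteq> I" using st by blast
        qed auto
        also have "\<dots> \<le> ipg.nm f' * D"
          unfolding D_def using x y L
          by (intro mult_left_mono real_sqrt_le_mono diff_mono Phi_mono) auto
        finally have "cmod (f x - f y) \<le> ipg.nm f' * D"
          by (auto simp: max_def min_def norm_minus_commute split: if_splits)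
        moreover have "cmod (f x) \<le> cmod (f y) + cmod (f x - f y)" by norm
        ultimately show ?thesis unfolding m_def by linarith
      qed
      have "ip (rsc m one) (rsc m one) \<le> ip f f"
        unfolding ip_square
      proof (intro integral_mono L2g_square L2g_rsc one L)
        fix y show "(cmod (rsc m one y))\<^sup>2 \<le> (cmod (f y))\<^sup>2"
          using ge[of y] False by (auto simp: rsc_def one_def indicator_def intro!: power_mono)
      qed
      then have "ipg.nm (rsc m one) \<le> ipg.nm f" by (simp add: ipg.nm_def)
      then have "m * G \<le> ipg.nm f" using ipg.nm_scale[OF one, of m] False by (simp add: G_def)
      then show ?thesis using G by (simp add: field_simps)
    qed
    then have "cmod (f x) \<le> ipg.nm f' * D + ipg.nm f / G" by (simp add: m_def)
    also have "\<dots> \<le> (D + 1 / G) * (ipg.nm f' + ipg.nm f)"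
    proof -
      have "0 \<le> D * ipg.nm f" "0 \<le> ipg.nm f' / G" using D G L by auto
      then show ?thesis by (simp add: algebra_simps)
    qed
    finally show "cmod (f x) \<le> (D + 1 / G) * (ipg.nm f' + ipg.nm f)" .
  qed
qed

section \<open>Green's identity for solutions on segments and half-lines\<close>

definition eig_on :: "real \<Rightarrow> real set \<Rightarrow> (real \<Rightarrow> complex) \<Rightarrow> (real \<Rightarrow> complex) \<Rightarrow> bool" where
  "eig_on c I f f' \<longleftrightarrow> H1_on I f f' \<and> continuous_on I f' \<and>
     (\<forall>t\<in>interior I. (f has_vector_derivative f' t) (at t) \<and>
        (f' has_vector_derivative (2 * t) *\<^sub>R f' t - (2 * c) *\<^sub>R f t) (at t))"

text \<open>In divergence form the equation reads (gw f')' = - 2 c gw f, so the integrand is the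
  derivative of gw (f' \<bullet> g).\<close>

lemma green_segment:
  assumes f: "eig_on c I f f'" and g: "H1_on I g g'" and st: "{s..t} \<subseteq> I" "s \<le> t"
  shows "((\<lambda>x. gw x * (f' x \<bullet> g' x) - 2 * c * (gw x * (f x \<bullet> g x))) has_integral
    gw t * (f' t \<bullet> g t) - gw s * (f' s \<bullet> g s)) {s..t}"
proof -
  have f1: "continuous_on {s..t} f'" using f st continuous_on_subset unfolding eig_on_def by blast
  have d: "((\<lambda>x. gw x *\<^sub>R f' x) has_vector_derivative - ((2 * c * gw x) *\<^sub>R f x)) (at x)" if "x \<in> {s<..<t}" for x
  proof -
    have "(f' has_vector_derivative (2 * x) *\<^sub>R f' x - (2 * c) *\<^sub>R f x) (at x)"
      using f interior_subinterval[OF st(1) that] by (auto simp: eig_on_def)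
    from has_vector_derivative_scaleR[OF gw_deriv this]
    show ?thesis by (simp add: algebra_simps)
  qed
  have "((\<lambda>x. (gw x *\<^sub>R f' x) \<bullet> g' x + (- ((2 * c * gw x) *\<^sub>R f x)) \<bullet> g x) has_integral
      (gw t *\<^sub>R f' t) \<bullet> g t - (gw s *\<^sub>R f' s) \<bullet> g s) {s..t}"
    by (rule H1_on_product[OF g st]) (auto intro!: continuous_intros f1 d)
  then show ?thesis by (simp add: mult_ac)
qed

text \<open>This disposes of the boundary term at infinity in \<open>green_ray\<close> without any
  decay estimate for eigenfunctions.\<close>

lemma integrable_tendsto_at_top_imp_zero:
  fixes E :: "real \<Rightarrow> real"
  assumes E: "integrable lborel E" and l: "(E \<longlongrightarrow> l) at_top"
  shows "l = 0"
proof (rule ccontr)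
  assume nz: "l \<noteq> 0"
  then have "eventually (\<lambda>x. \<bar>l\<bar> / 2 < \<bar>E x\<bar>) at_top"
    by (intro order_tendstoD(1)[OF tendsto_rabs[OF l]]) auto
  then obtain N where N: "\<And>x. x \<ge> N \<Longrightarrow> \<bar>l\<bar> / 2 < \<bar>E x\<bar>"
    by (auto simp: eventually_at_top_linorder)
  have aE: "integrable lborel (\<lambda>x. \<bar>E x\<bar>)" using E by auto
  obtain n :: nat where n: "(LINT x|lborel. \<bar>E x\<bar>) < real n * (\<bar>l\<bar> / 2)"
    using nz reals_Archimedean3[of "\<bar>l\<bar> / 2"] by auto
  have "((\<lambda>_. \<bar>l\<bar> / 2) has_integral real n * (\<bar>l\<bar> / 2)) {N..N + real n}"
    using has_integral_const_real[of "\<bar>l\<bar> / 2" N "N + real n"] by simp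
  moreover have "((\<lambda>x. \<bar>E x\<bar>) has_integral integral {N..N + real n} (\<lambda>x. \<bar>E x\<bar>)) {N..N + real n}"
    using integrable_HK(1)[OF aE] by (simp add: has_integral_integral)
  ultimately have "real n * (\<bar>l\<bar> / 2) \<le> integral {N..N + real n} (\<lambda>x. \<bar>E x\<bar>)"
    by (rule has_integral_le) (use N in \<open>auto intro: less_imp_le\<close>)
  also have "\<dots> \<le> integral UNIV (\<lambda>x. \<bar>E x\<bar>)"
    by (intro integral_subset_le integrable_HK[OF aE]) auto
  also have "\<dots> = (LINT x|lborel. \<bar>E x\<bar>)"
    using integrable_HK(2)[OF aE, of UNIV] by (simp add: set_lebesgue_integral_def)
  finally show False using n by simp
qed

lemma integral_outside_zero:
  fixes D :: "real \<Rightarrow> real"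
  assumes "\<And>x. x \<notin> I \<Longrightarrow> D x = 0"
  shows "(LINT x|lborel. D x) = (LINT x:I|lborel. D x)"
  unfolding set_lebesgue_integral_def using assms
  by (intro Bochner_Integration.integral_cong) (auto simp: indicator_def)

lemma green_compact:
  assumes f: "eig_on c {s..t} f f'" and g: "H1_on {s..t} g g'" and st: "s \<le> t"
  shows "ip f' g' - 2 * c * ip f g = gw t * (f' t \<bullet> g t) - gw s * (f' s \<bullet> g s)"
proof -
  have f1: "H1_on {s..t} f f'" using f by (simp add: eig_on_def)
  note L = H1_onD[OF f1] H1_onD[OF g]
  define D where "D = (\<lambda>x. gw x * (f' x \<bullet> g' x) - 2 * c * (gw x * (f x \<bullet> g x)))"
  have D: "integrable lborel D" unfolding D_def
    by (intro Bochner_Integration.integrable_diff integrable_mult_right ip_lborel L)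
  have "ip f' g' - 2 * c * ip f g = (LINT x|lborel. D x)"
    unfolding D_def by (simp add: ip_lborel L)
  also have "\<dots> = integral {s..t} D"
    using integrable_HK(2)[OF D, of "{s..t}"] L by (subst integral_outside_zero[of "{s..t}"]) (auto simp: D_def)
  finally show ?thesis
    using green_segment[OF f g order.refl st] by (simp add: has_integral_iff D_def)
qed

text \<open>By Green's identity on {s..b} the boundary term at b converges as b grows. It is also
  integrable in b, being a product of two square-integrable functions, so its limit is 0.\<close>

lemma green_ray:
  assumes f: "eig_on c {s..} f f'" and g: "H1_on {s..} g g'"
  shows "ip f' g' - 2 * c * ip f g = - gw s * (f' s \<bullet> g s)"
proof -
  have f1: "H1_on {s..} f f'" using f by (simp add: eig_on_def)
  note L = H1_onD[OF f1] H1_onD[OF g]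
  define D where "D = (\<lambda>x. gw x * (f' x \<bullet> g' x) - 2 * c * (gw x * (f x \<bullet> g x)))"
  define E where "E = (\<lambda>x. gw x * (f' x \<bullet> g x))"
  have D: "integrable lborel D" unfolding D_def
    by (intro Bochner_Integration.integrable_diff integrable_mult_right ip_lborel L)
  have E: "integrable lborel E" unfolding E_def by (intro ip_lborel L)
  have eq: "ip f' g' - 2 * c * ip f g = (LINT x:{s..}|lborel. D x)"
    using L by (subst integral_outside_zero[symmetric]) (auto simp: D_def ip_lborel)
  have "((\<lambda>b. E s + (LINT x:{s..b}|lborel. D x)) \<longlongrightarrow> E s + (LINT x:{s..}|lborel. D x)) at_top"
    by (intro tendsto_intros tendsto_set_lebesgue_integral_at_top set_integrable_of_integrable D) auto
  moreover have "eventually (\<lambda>b. E s + (LINT x:{s..b}|lborel. D x) = E b) at_top"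
    using eventually_ge_at_top[of s]
  proof eventually_elim
    case (elim b)
    have "integral {s..b} D = E b - E s"
      using green_segment[OF f g _ elim] by (simp add: has_integral_iff D_def E_def)
    then show ?case using integrable_HK(2)[OF D, of "{s..b}"] by simp
  qed
  ultimately have "(E \<longlongrightarrow> E s + (LINT x:{s..}|lborel. D x)) at_top"
    by (rule Lim_transform_eventually)
  from integrable_tendsto_at_top_imp_zero[OF E this] show ?thesis
    unfolding eq by (simp add: E_def)
qed

section \<open>Picone's inequality\<close>

lemma integrable_weighted_square:
  assumes "f \<in> L2g"
  shows "integrable lborel (\<lambda>x. gw x * (cmod (f x))\<^sup>2)"
  using ip_lborel(1)[OF assms assms] by (simp add: power2_norm_eq_inner)

text \<open>Picone's identity: if \<open>h\<close> is a supersolution wherever it is positive, then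
  \<open>G = |f|\<^sup>2 (h' / h) gw\<close> satisfies \<open>G' \<le> (|f'|\<^sup>2 - 2 \<Lambda> |f|\<^sup>2) gw\<close>; the zeros of \<open>h\<close> do no harm
  because \<open>f\<close> vanishes there at the rate of a square root.\<close>

lemma picone:
  assumes f: "H1_on I f f'" and st: "{s..t} \<subseteq> I" "s < t"
    and h: "\<And>x. (h has_real_derivative h' x) (at x)" "\<And>x. (h' has_real_derivative h'' x) (at x)"
    and Z: "finite {x \<in> {s..t}. h x = 0}" "\<And>x. x \<in> {s..t} \<Longrightarrow> h x = 0 \<Longrightarrow> h' x \<noteq> 0 \<and> f x = 0"
    and super: "\<And>x. x \<in> {s..t} \<Longrightarrow> h x * (h'' x - 2 * x * h' x + 2 * \<Lambda> * h x) \<le> 0"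
    and left: "f s = 0" and right: "f t = 0 \<or> h t * h' t \<ge> 0"
  shows "2 * \<Lambda> * integral {s..t} (\<lambda>x. gw x * (cmod (f x))\<^sup>2)
    \<le> integral {s..t} (\<lambda>x. gw x * (cmod (f' x))\<^sup>2)"
proof -
  note L = H1_onD(1,2)[OF f]
  have fc: "continuous_on {s..t} f" using continuous_on_subset[OF H1_onD(3)[OF f] st(1)] .
  have hc: "isCont h x" "isCont h' x" for x using h DERIV_isCont by blast+
  obtain S where S: "finite S" "\<And>x. x \<in> interior I - S \<Longrightarrow> (f has_vector_derivative f' x) (at x)"
    using f by (auto simp: H1_on_def)
  define Z where "Z = {x \<in> {s..t}. h x = 0}"
  define G where "G = (\<lambda>x. gw x * (f x \<bullet> f x) * (h' x / h x))"
  define D where "D = (\<lambda>x. gw x * (cmod (f' x))\<^sup>2 - 2 * \<Lambda> * (gw x * (cmod (f x))\<^sup>2))"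
  define G' where "G' = (\<lambda>x. - 2 * x * gw x * (f x \<bullet> f x) * (h' x / h x) + gw x * (2 * (f x \<bullet> f' x)) * (h' x / h x)
      + gw x * (f x \<bullet> f x) * ((h'' x * h x - h' x * h' x) / (h x * h x)))"
  \<comment> \<open>At the finitely many points without a usable derivative the integrand is set to
    D itself, so that the comparison of E with D is trivial there and the integral is
    unaffected.\<close>
  define E where "E = (\<lambda>x. if x \<in> Z \<union> S then D x else G' x)"
  have i: "(\<lambda>x. gw x * (cmod (f x))\<^sup>2) integrable_on {s..t}" "(\<lambda>x. gw x * (cmod (f' x))\<^sup>2) integrable_on {s..t}"
    using L by (auto intro!: integrable_HK integrable_weighted_square)
  have Dint: "(D has_integral integral {s..t} (\<lambda>x. gw x * (cmod (f' x))\<^sup>2)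
      - 2 * \<Lambda> * integral {s..t} (\<lambda>x. gw x * (cmod (f x))\<^sup>2)) {s..t}"
    unfolding D_def by (intro has_integral_diff has_integral_mult_right integrable_integral i)
  have Gc: "continuous_on {s..t} G"
    unfolding continuous_on_def
  proof
    fix z assume z: "z \<in> {s..t}"
    show "(G \<longlongrightarrow> G z) (at z within {s..t})"
    proof (cases "h z = 0")
      case False
      have "(f \<longlongrightarrow> f z) (at z within {s..t})" using fc z by (simp add: continuous_on_def)
      moreover have "(gw \<longlongrightarrow> gw z) (at z within {s..t})"
        using z continuous_on_def[of "{s..t}" gw] gw_continuous[OF continuous_on_id] by auto
      moreover have "(h \<longlongrightarrow> h z) (at z within {s..t})" "(h' \<longlongrightarrow> h' z) (at z within {s..t})"
        using hc by (simp_all add: isCont_def tendsto_within_subset[where S=UNIV])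
      ultimately show ?thesis unfolding G_def using False by (intro tendsto_intros)
    next
      case True
      have fz: "f z = 0" "h' z \<noteq> 0" using Z(2)[OF z True] by auto
      \<comment> \<open>The energy accumulated up to x. Near a zero z of h, |f|^2 is bounded by an
        increment of Phi times one of N: the first compensates the simple zero of h, the second
        tends to 0 and carries G with it.\<close>
      define N where "N = (\<lambda>x. integral {s..x} (\<lambda>x. gw x * (cmod (f' x))\<^sup>2))"
      have Nc: "continuous_on {s..t} N" unfolding N_def by (intro indefinite_integral_continuous_1 i)
      have bound: "(cmod (f x))\<^sup>2 \<le> \<bar>Phi x - Phi z\<bar> * \<bar>N x - N z\<bar>" if x: "x \<in> {s..t}" for x
      proof -
        have comb: "integral {u..v} (\<lambda>x. gw x * (cmod (f' x))\<^sup>2) = N v - N u" if "s \<le> u" "u \<le> v" "v \<le> t" for u v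
          unfolding N_def using Henstock_Kurzweil_Integration.integral_combine[of s u v "\<lambda>x. gw x * (cmod (f' x))\<^sup>2"]
            integrable_on_subinterval[OF i(2), of s v] that by auto
        have "(cmod (f v - f u))\<^sup>2 \<le> \<bar>Phi v - Phi u\<bar> * \<bar>N v - N u\<bar>" if "s \<le> u" "u \<le> v" "v \<le> t" for u v
        proof -
          have "{u..v} \<subseteq> I" using st(1) that by auto
          from H1_increment_local[OF f this that(2)] comb[OF that]
          have "(cmod (f v - f u))\<^sup>2 \<le> (Phi v - Phi u) * (N v - N u)" by simp
          also have "\<dots> \<le> \<bar>Phi v - Phi u\<bar> * \<bar>N v - N u\<bar>" by (metis abs_ge_self abs_mult)
          finally show ?thesis .
        qed
        from this[of x z] this[of z x] x z fz show ?thesis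
          by (cases "x \<le> z") (auto simp: abs_minus_commute)
      qed
      have lim1: "((\<lambda>x. (Phi x - Phi z) / h x) \<longlongrightarrow> (1 / gw z) / h' z) (at z within {s..t})"
      proof (rule Lim_transform_eventually)
        show "((\<lambda>x. ((Phi x - Phi z) / (x - z)) / ((h x - h z) / (x - z))) \<longlongrightarrow> (1 / gw z) / h' z) (at z within {s..t})"
          using Phi_deriv[of z "{s..t}"] has_field_derivative_at_within[OF h(1)[of z], of "{s..t}"]
          unfolding has_field_derivative_iff by (rule tendsto_divide) (rule fz)
        show "\<forall>\<^sub>F x in at z within {s..t}. (Phi x - Phi z) / (x - z) / ((h x - h z) / (x - z)) = (Phi x - Phi z) / h x"
          using True by (auto simp: eventually_at_filter)
      qed
      have lim2: "((\<lambda>x. gw x * \<bar>N x - N z\<bar> * \<bar>(Phi x - Phi z) / h x\<bar> * \<bar>h' x\<bar>) \<longlongrightarrow>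
          gw z * \<bar>N z - N z\<bar> * \<bar>(1 / gw z) / h' z\<bar> * \<bar>h' z\<bar>) (at z within {s..t})"
      proof (intro tendsto_mult tendsto_rabs tendsto_diff tendsto_const lim1)
        show "(N \<longlongrightarrow> N z) (at z within {s..t})" using Nc z by (simp add: continuous_on_def)
        show "(gw \<longlongrightarrow> gw z) (at z within {s..t})"
          using z continuous_on_def[of "{s..t}" gw] gw_continuous[OF continuous_on_id] by auto
        show "(h' \<longlongrightarrow> h' z) (at z within {s..t})"
          using hc by (simp add: isCont_def tendsto_within_subset[where S=UNIV])
      qed
      have "(G \<longlongrightarrow> 0) (at z within {s..t})"
      proof (rule Lim_null_comparison)
        show "\<forall>\<^sub>F x in at z within {s..t}. norm (G x) \<le> gw x * \<bar>N x - N z\<bar> * \<bar>(Phi x - Phi z) / h x\<bar> * \<bar>h' x\<bar>"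
        proof (rule eventually_mono)
          show "\<forall>\<^sub>F x in at z within {s..t}. x \<in> {s..t}" by (simp add: eventually_at_filter)
          fix x assume x: "x \<in> {s..t}"
          have "norm (G x) = gw x * (cmod (f x))\<^sup>2 * \<bar>h' x / h x\<bar>"
            by (simp add: G_def abs_mult power2_norm_eq_inner)
          also have "\<dots> \<le> gw x * (\<bar>Phi x - Phi z\<bar> * \<bar>N x - N z\<bar>) * \<bar>h' x / h x\<bar>"
            by (intro mult_right_mono mult_left_mono bound x) auto
          also have "\<dots> = gw x * \<bar>N x - N z\<bar> * \<bar>(Phi x - Phi z) / h x\<bar> * \<bar>h' x\<bar>" by (simp add: abs_divide)
          finally show "norm (G x) \<le> \<dots>" .
        qed
      qed (use lim2 in simp)
      then show ?thesis by (simp add: G_def True)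
    qed
  qed
  have "(E has_integral G t - G s) {s..t}"
  proof (rule fundamental_theorem_of_calculus_interior_strong[OF _ less_imp_le[OF st(2)] _ Gc])
    show "finite (Z \<union> S)" using S Z by (simp add: Z_def)
    fix x assume x: "x \<in> {s<..<t} - (Z \<union> S)"
    have hx: "h x \<noteq> 0" using x by (auto simp: Z_def)
    have fd: "(f has_vector_derivative f' x) (at x)"
      using S(2)[of x] interior_subinterval[OF st(1), of x] x by auto
    have ff: "((\<lambda>x. f x \<bullet> f x) has_real_derivative 2 * (f x \<bullet> f' x)) (at x)"
      using bounded_bilinear.has_vector_derivative[OF bounded_bilinear_inner fd fd]
      by (simp add: has_real_derivative_iff_has_vector_derivative inner_commute)
    have q: "((\<lambda>x. h' x / h x) has_real_derivative (h'' x * h x - h' x * h' x) / (h x * h x)) (at x)"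
      by (rule DERIV_divide[OF h(2) h(1) hx])
    have "(G has_real_derivative G' x) (at x)"
      unfolding G_def G'_def using DERIV_mult[OF DERIV_mult[OF gw_deriv[of x UNIV] ff] q]
      by (rule DERIV_cong) (simp add: algebra_simps)
    then show "(G has_vector_derivative E x) (at x)"
      using x by (simp add: E_def has_real_derivative_iff_has_vector_derivative)
  qed
  then have "G t - G s \<le> integral {s..t} (\<lambda>x. gw x * (cmod (f' x))\<^sup>2)
      - 2 * \<Lambda> * integral {s..t} (\<lambda>x. gw x * (cmod (f x))\<^sup>2)"
  proof (rule has_integral_le[OF _ Dint])
    fix x assume x: "x \<in> {s..t}"
    show "E x \<le> D x"
    proof (cases "x \<in> Z \<union> S")
      case False
      then have hx: "h x \<noteq> 0" using x by (auto simp: Z_def)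
      define r where "r = h' x / h x"
      have "(h x * (h'' x - 2 * x * h' x + 2 * \<Lambda> * h x)) / (h x * h x) \<le> 0"
        using super[OF x] by (intro divide_nonpos_nonneg) auto
      also have "(h x * (h'' x - 2 * x * h' x + 2 * \<Lambda> * h x)) / (h x * h x) = h'' x / h x - 2 * x * r + 2 * \<Lambda>"
        using hx by (simp add: r_def field_simps)
      finally have 1: "h'' x / h x - 2 * x * r + 2 * \<Lambda> \<le> 0" .
      have 2: "(h'' x * h x - h' x * h' x) / (h x * h x) = h'' x / h x - r * r"
        using hx by (simp add: r_def field_simps)
      \<comment> \<open>Completing the square in f' - (h' / h) f, which is h times the derivative of
        f / h. What remains is the supersolution inequality divided by h^2.\<close>
      have "D x - E x = gw x * ((f' x - r *\<^sub>R f x) \<bullet> (f' x - r *\<^sub>R f x)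
          - (f x \<bullet> f x) * (h'' x / h x - 2 * x * r + 2 * \<Lambda>))"
        using False unfolding E_def D_def G'_def 2 r_def[symmetric]
        by (simp add: power2_norm_eq_inner inner_diff_left inner_diff_right inner_commute algebra_simps)
      also have "\<dots> \<ge> 0"
        using mult_nonneg_nonpos[OF inner_ge_zero 1, of "f x"] inner_ge_zero[of "f' x - r *\<^sub>R f x"]
        by (intro mult_nonneg_nonneg) (auto simp del: inner_ge_zero)
      finally show ?thesis by simp
    qed (simp add: E_def)
  qed
  moreover have "G s = 0" using left by (simp add: G_def)
  moreover have "G t \<ge> 0"
  proof (cases "f t = 0")
    case False
    then have "0 \<le> h' t / h t" using right by (auto simp: zero_le_mult_iff zero_le_divide_iff)
    then show ?thesis unfolding G_def by (intro mult_nonneg_nonneg) auto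
  qed (simp add: G_def)
  ultimately show ?thesis by linarith
qed

section \<open>Weak derivatives\<close>

lemma test_fun_deriv_zero:
  assumes \<phi>: "\<And>t. (\<phi> has_real_derivative \<phi>' t) (at t)" and K: "compact K" "\<And>t. t \<notin> K \<Longrightarrow> \<phi> t = 0"
    and t: "t \<notin> K"
  shows "\<phi>' t = 0"
proof -
  have "open (- K)" using K compact_imp_closed by auto
  have "((\<lambda>_. 0) has_real_derivative 0) (at t)" by simp
  then have "(\<phi> has_real_derivative 0) (at t)"
    by (rule DERIV_cong_ev[THEN iffD1, rotated 3])
      (use \<open>open (- K)\<close> K t in \<open>auto simp: eventually_nhds\<close>)
  then show ?thesis using \<phi> DERIV_unique by blast
qed

lemma compact_in_open_interval:
  fixes J :: "real set"
  assumes J: "open J" "is_interval J" and K: "compact K" "K \<subseteq> J" "J \<noteq> {}"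
  obtains c d where "c < d" "{c..d} \<subseteq> J" "K \<subseteq> {c<..<d}"
proof -
  obtain j where j: "j \<in> J" using K by auto
  \<comment> \<open>K may be empty; the extra point of J gives a minimum and a maximum in any
    case.\<close>
  define K' where "K' = insert j K"
  have K': "compact K'" "K' \<noteq> {}" "K' \<subseteq> J" using K j by (auto simp: K'_def)
  obtain a where a: "a \<in> K'" "\<And>x. x \<in> K' \<Longrightarrow> a \<le> x" using compact_attains_inf[OF K'(1,2)] by auto
  obtain b where b: "b \<in> K'" "\<And>x. x \<in> K' \<Longrightarrow> x \<le> b" using compact_attains_sup[OF K'(1,2)] by auto
  obtain e where e: "e > 0" "ball a e \<subseteq> J" using J(1) K'(3) a by (meson openE subsetD)
  obtain e' where e': "e' > 0" "ball b e' \<subseteq> J" using J(1) K'(3) b by (meson openE subsetD)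
  have "a - e / 2 \<in> J" "b + e' / 2 \<in> J" using e e' by (auto simp: dist_real_def subset_iff)
  then have "{a - e / 2..b + e' / 2} \<subseteq> J"
    using mem_is_interval_1_I[OF J(2)] by (meson atLeastAtMost_iff subsetI)
  moreover have "a \<le> b" using a b by auto
  then have "a - e / 2 < b + e' / 2" using e e' by linarith
  moreover have "K \<subseteq> {a - e / 2<..<b + e' / 2}"
  proof
    fix x assume "x \<in> K"
    then have "a \<le> x" "x \<le> b" using a(2) b(2) by (auto simp: K'_def)
    then show "x \<in> {a - e / 2<..<b + e' / 2}" using e e' by simp
  qed
  ultimately show ?thesis using that by blast
qed

lemma set_integral_support:
  fixes F :: "real \<Rightarrow> complex"
  assumes "continuous_on {c..d} F" "{c..d} \<subseteq> J" "\<And>x. x \<in> J \<Longrightarrow> x \<notin> {c..d} \<Longrightarrow> F x = 0"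
  shows "(LINT x:J|lborel. F x) = integral {c..d} F"
proof -
  have "(LINT x:J|lborel. F x) = (LINT x:{c..d}|lborel. F x)"
    unfolding set_lebesgue_integral_def using assms
    by (intro Bochner_Integration.integral_cong) (auto simp: indicator_def)
  also have "\<dots> = integral {c..d} F"
    using set_borel_integral_eq_integral(2)[OF borel_integrable_atLeastAtMost'[OF assms(1)]] .
  finally show ?thesis .
qed

lemma scaled_product_integral:
  fixes f g :: "real \<Rightarrow> complex"
  assumes "c \<le> d" "continuous_on {c..d} f" "continuous_on {c..d} g" "continuous_on UNIV \<phi>'"
    and "\<And>x. x \<in> {c<..<d} \<Longrightarrow> (f has_vector_derivative g x) (at x)"
    and "\<And>t. (\<phi> has_real_derivative \<phi>' t) (at t)" "\<phi> c = 0" "\<phi> d = 0"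
  shows "integral {c..d} (\<lambda>x. \<phi>' x *\<^sub>R f x) = - integral {c..d} (\<lambda>x. \<phi> x *\<^sub>R g x)"
proof -
  have p: "continuous_on {c..d} \<phi>" using assms(6) by (intro continuous_at_imp_continuous_on ballI DERIV_isCont)
  have p': "continuous_on {c..d} \<phi>'" using continuous_on_subset[OF assms(4)] by auto
  have "((\<lambda>x. \<phi> x *\<^sub>R g x + \<phi>' x *\<^sub>R f x) has_integral \<phi> d *\<^sub>R f d - \<phi> c *\<^sub>R f c) {c..d}"
    by (rule fundamental_theorem_of_calculus_interior[OF assms(1)])
      (auto intro!: continuous_intros p assms(2) has_vector_derivative_scaleR assms)
  moreover have "((\<lambda>x. \<phi> x *\<^sub>R g x + \<phi>' x *\<^sub>R f x) has_integral
      integral {c..d} (\<lambda>x. \<phi> x *\<^sub>R g x) + integral {c..d} (\<lambda>x. \<phi>' x *\<^sub>R f x)) {c..d}"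
    by (intro has_integral_add integrable_integral integrable_continuous_real continuous_intros p p' assms)
  ultimately have "\<phi> d *\<^sub>R f d - \<phi> c *\<^sub>R f c =
      integral {c..d} (\<lambda>x. \<phi> x *\<^sub>R g x) + integral {c..d} (\<lambda>x. \<phi>' x *\<^sub>R f x)"
    by (rule has_integral_unique)
  then have "integral {c..d} (\<lambda>x. \<phi> x *\<^sub>R g x) + integral {c..d} (\<lambda>x. \<phi>' x *\<^sub>R f x) = 0"
    using assms(7,8) by simp
  then show ?thesis by (simp add: add_eq_0_iff2)
qed

lemma weak_deriv_of_C1:
  fixes f g :: "real \<Rightarrow> complex"
  assumes J: "open J" "is_interval J" and c: "continuous_on J f" "continuous_on J g"
    and d: "\<And>x. x \<in> J \<Longrightarrow> (f has_vector_derivative g x) (at x)"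
  shows "weak_deriv J f g"
  unfolding weak_deriv_def
proof (intro conjI allI impI)
  have "set_integrable lborel K h" if "compact K" "K \<subseteq> J" "continuous_on J h" for h :: "real \<Rightarrow> complex" and K
    using borel_integrable_compact[OF that(1) continuous_on_subset[OF that(3,2)]] by (simp add: set_integrable_def)
  then show "loc_integrable J f" "loc_integrable J g" using c by (auto simp: loc_integrable_def)
  fix \<phi> \<phi>' assume t: "test_fun J \<phi> \<phi>'"
  then obtain K where K: "compact K" "K \<subseteq> J" "\<And>t. t \<notin> K \<Longrightarrow> \<phi> t = 0"
    and \<phi>: "\<And>t. (\<phi> has_real_derivative \<phi>' t) (at t)" "continuous_on UNIV \<phi>'"
    by (auto simp: test_fun_def)
  show "(LINT t:J|lborel. \<phi>' t *\<^sub>R f t) = - (LINT t:J|lborel. \<phi> t *\<^sub>R g t)"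
  proof (cases "J = {}")
    case False
    obtain a b where ab: "a < b" "{a..b} \<subseteq> J" "K \<subseteq> {a<..<b}"
      using compact_in_open_interval[OF J K(1,2) False] .
    have \<phi>c: "continuous_on {a..b} \<phi>" using \<phi>(1) by (intro continuous_at_imp_continuous_on ballI DERIV_isCont)
    have \<phi>'c: "continuous_on {a..b} \<phi>'" using continuous_on_subset[OF \<phi>(2)] by auto
    have fc: "continuous_on {a..b} f" and gc: "continuous_on {a..b} g"
      using c ab continuous_on_subset by blast+
    have z: "\<phi> x = 0" "\<phi>' x = 0" if "x \<notin> {a<..<b}" for x
      using K(3) test_fun_deriv_zero[OF \<phi>(1) K(1,3)] ab(3) that by blast+
    have "(LINT t:J|lborel. \<phi>' t *\<^sub>R f t) = integral {a..b} (\<lambda>t. \<phi>' t *\<^sub>R f t)"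
      by (rule set_integral_support) (use z ab in \<open>auto intro!: continuous_intros \<phi>'c fc\<close>)
    also have "\<dots> = - integral {a..b} (\<lambda>t. \<phi> t *\<^sub>R g t)"
      using ab z by (intro scaled_product_integral \<phi> fc gc d) auto
    also have "integral {a..b} (\<lambda>t. \<phi> t *\<^sub>R g t) = (LINT t:J|lborel. \<phi> t *\<^sub>R g t)"
      by (rule set_integral_support[symmetric]) (use z ab in \<open>auto intro!: continuous_intros \<phi>c gc\<close>)
    finally show ?thesis .
  qed (simp add: set_lebesgue_integral_def)
qed

text \<open>A mollifier whose mass does not depend on p. The difference of two tents therefore has
  mean zero, and its primitive is a C1 function of compact support, as \<open>test_fun\<close>
  demands.\<close>

definition tent :: "real \<Rightarrow> real \<Rightarrow> real \<Rightarrow> real" where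
  "tent h p u = max 0 (h - \<bar>u - p\<bar>)"

lemma tent_continuous [continuous_intros]: "continuous_on S f \<Longrightarrow> continuous_on S (\<lambda>u. tent h p (f u))"
  unfolding tent_def by (intro continuous_intros)

lemma tent_zero: "h \<le> \<bar>u - p\<bar> \<Longrightarrow> tent h p u = 0"
  by (simp add: tent_def)

lemma tent_integral:
  assumes "{p - h..p + h} \<subseteq> {c..d}" "h > 0"
  shows "integral {c..d} (tent h p) = (LINT x|lborel. tent h 0 x)"
proof -
  have "integral {c..d} (tent h p) = (LINT x:{c..d}|lborel. tent h p x)"
    by (intro set_borel_integral_eq_integral(2)[symmetric] borel_integrable_atLeastAtMost' continuous_intros)
  also have "\<dots> = (LINT x|lborel. tent h p x)"
    unfolding set_lebesgue_integral_def
  proof (intro Bochner_Integration.integral_cong refl)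
    fix x show "indicat_real {c..d} x *\<^sub>R tent h p x = tent h p x"
    proof (cases "x \<in> {c..d}")
      case False
      have "p - h \<in> {c..d}" "p + h \<in> {c..d}" using assms by auto
      with False have "h \<le> \<bar>x - p\<bar>" by (auto simp: abs_if)
      then show ?thesis by (simp add: tent_zero)
    qed simp
  qed
  also have "\<dots> = (LINT x|lborel. tent h 0 x)"
    using lborel_integral_real_affine[of 1 "tent h p" p] by (simp add: tent_def)
  finally show ?thesis .
qed

lemma tent_average:
  fixes F :: "real \<Rightarrow> complex"
  assumes F: "continuous_on {c..d} F" and p: "{p - h..p + h} \<subseteq> {c..d}" "h > 0"
    and close: "\<And>u. \<bar>u - p\<bar> < h \<Longrightarrow> cmod (F u - F p) \<le> e"
  shows "cmod (integral {c..d} (\<lambda>u. tent h p u *\<^sub>R F u) - (LINT x|lborel. tent h 0 x) *\<^sub>R F p)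
    \<le> e * (LINT x|lborel. tent h 0 x)"
proof -
  have i: "(\<lambda>u. tent h p u *\<^sub>R F u) integrable_on {c..d}" "(\<lambda>u. tent h p u *\<^sub>R F p) integrable_on {c..d}"
    "(\<lambda>u. e * tent h p u) integrable_on {c..d}" "tent h p integrable_on {c..d}"
    by (intro integrable_continuous_real continuous_intros F)+
  have "(LINT x|lborel. tent h 0 x) *\<^sub>R F p = integral {c..d} (\<lambda>u. tent h p u *\<^sub>R F p)"
    using has_integral_scaleR_left[OF integrable_integral[OF i(4)], of "F p"]
    by (simp add: tent_integral[OF p] integral_unique)
  then have "integral {c..d} (\<lambda>u. tent h p u *\<^sub>R F u) - (LINT x|lborel. tent h 0 x) *\<^sub>R F p
      = integral {c..d} (\<lambda>u. tent h p u *\<^sub>R F u - tent h p u *\<^sub>R F p)"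
    by (simp add: Henstock_Kurzweil_Integration.integral_diff[OF i(1,2)])
  also have "cmod \<dots> \<le> integral {c..d} (\<lambda>u. e * tent h p u)"
  proof (rule integral_norm_bound_integral)
    show "(\<lambda>u. tent h p u *\<^sub>R F u - tent h p u *\<^sub>R F p) integrable_on {c..d}"
      by (intro Henstock_Kurzweil_Integration.integrable_diff i)
    fix u assume "u \<in> {c..d}"
    show "cmod (tent h p u *\<^sub>R F u - tent h p u *\<^sub>R F p) \<le> e * tent h p u"
    proof (cases "\<bar>u - p\<bar> < h")
      case True
      have "cmod (tent h p u *\<^sub>R F u - tent h p u *\<^sub>R F p) = tent h p u * cmod (F u - F p)"
        by (simp add: scaleR_diff_right[symmetric] tent_def)
      also have "\<dots> \<le> tent h p u * e" by (intro mult_left_mono close True) (simp add: tent_def)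
      finally show ?thesis by (simp add: mult.commute)
    qed (simp add: tent_zero)
  qed (rule i)
  also have "\<dots> = e * (LINT x|lborel. tent h 0 x)" by (simp add: tent_integral[OF p])
  finally show ?thesis .
qed

text \<open>The lemma of du Bois-Reymond. After subtracting a primitive of g, the remainder F is
  orthogonal to differences of tents, so its tent averages at p and q agree; narrow tents then give
  F p = F q.\<close>

lemma weak_deriv_continuous_imp:
  fixes f g :: "real \<Rightarrow> complex"
  assumes J: "open J" "is_interval J" and c: "continuous_on J f" "continuous_on J g"
    and w: "\<And>\<phi> \<phi>'. test_fun J \<phi> \<phi>' \<Longrightarrow>
      (LINT t:J|lborel. \<phi>' t *\<^sub>R f t) = - (LINT t:J|lborel. \<phi> t *\<^sub>R g t)"
    and x: "x \<in> J"
  shows "(f has_vector_derivative g x) (at x)"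
proof -
  obtain a b where ab: "a < b" "{a..b} \<subseteq> J" "{x} \<subseteq> {a<..<b}"
    using compact_in_open_interval[OF J, of "{x}"] x by auto
  have fc: "continuous_on {a..b} f" and gc: "continuous_on {a..b} g"
    using c ab continuous_on_subset by blast+
  define G where "G = (\<lambda>u. integral {a..u} g)"
  have Gw: "(G has_vector_derivative g u) (at u within {a..b})" if "u \<in> {a..b}" for u
    unfolding G_def by (rule integral_has_vector_derivative[OF gc that])
  have Gc: "continuous_on {a..b} G"
    unfolding continuous_on_eq_continuous_within using Gw has_vector_derivative_continuous by blast
  have Gd: "(G has_vector_derivative g u) (at u)" if "u \<in> {a<..<b}" for u
    using Gw[of u] that by (simp add: at_within_Icc_at)
  define F where "F = (\<lambda>u. f u - G u)"
  have Fc: "continuous_on {a..b} F" unfolding F_def by (intro continuous_intros fc Gc)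
  have eqI: "integral {a..b} (\<lambda>u. tent h p u *\<^sub>R F u) = integral {a..b} (\<lambda>u. tent h q u *\<^sub>R F u)"
    if h: "h > 0" "{p - h..p + h} \<subseteq> {a..b}" "{q - h..q + h} \<subseteq> {a..b}" for h p q
  proof -
    define \<psi> where "\<psi> = (\<lambda>u. tent h p u - tent h q u)"
    have \<psi>c: "continuous_on S \<psi>" for S unfolding \<psi>_def by (intro continuous_intros)
    obtain P where P: "\<And>t. (P has_vector_derivative \<psi> t) (at t)" using antiderivative_exists[OF \<psi>c] by blast
    define \<phi> where "\<phi> = (\<lambda>t. P t - P a)"
    have \<phi>: "(\<phi> has_real_derivative \<psi> t) (at t)" for t
      using DERIV_diff[of P "\<psi> t" t UNIV "\<lambda>_. P a" 0] P
      by (simp add: \<phi>_def has_real_derivative_iff_has_vector_derivative)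
    have \<psi>0: "\<psi> u = 0" if "u \<notin> {a<..<b}" for u
    proof -
      have "p - h \<in> {a..b}" "p + h \<in> {a..b}" "q - h \<in> {a..b}" "q + h \<in> {a..b}" using h by auto
      then have "h \<le> \<bar>u - p\<bar>" "h \<le> \<bar>u - q\<bar>" using that by auto
      then show ?thesis by (simp add: \<psi>_def tent_zero)
    qed
    have incr: "integral {u..v} \<psi> = \<phi> v - \<phi> u" if "u \<le> v" for u v
      using fundamental_theorem_of_calculus[OF that, of \<phi> \<psi>] \<phi>
      by (simp add: has_real_derivative_iff_has_vector_derivative has_vector_derivative_at_within integral_unique)
    have "integral {a..b} \<psi> = 0"
      unfolding \<psi>_def using h
      by (subst Henstock_Kurzweil_Integration.integral_diff)
        (auto intro!: integrable_continuous_real continuous_intros simp: tent_integral)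
    then have \<phi>b: "\<phi> b = 0" using incr[of a b] ab by (simp add: \<phi>_def)
    have \<phi>a: "\<phi> a = 0" by (simp add: \<phi>_def)
    have \<phi>0: "\<phi> u = 0" if "u \<notin> {a..b}" for u
    proof (cases "u < a")
      case True
      have "integral {u..a} \<psi> = integral {u..a} (\<lambda>_. 0)"
        by (intro Henstock_Kurzweil_Integration.integral_cong \<psi>0) auto
      then show ?thesis using incr[of u a] True \<phi>a by simp
    next
      case False
      then have "b \<le> u" using that by auto
      have "integral {b..u} \<psi> = integral {b..u} (\<lambda>_. 0)"
        by (intro Henstock_Kurzweil_Integration.integral_cong \<psi>0) auto
      then show ?thesis using incr[OF \<open>b \<le> u\<close>] \<phi>b by simp
    qed
    have \<phi>c: "continuous_on {a..b} \<phi>" using \<phi> by (intro continuous_at_imp_continuous_on ballI DERIV_isCont)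
    have tf: "test_fun J \<phi> \<psi>"
      unfolding test_fun_def using \<phi> \<psi>c \<phi>0 ab by (auto intro!: exI[of _ "{a..b}"])
    have "integral {a..b} (\<lambda>t. \<psi> t *\<^sub>R f t) = (LINT t:J|lborel. \<psi> t *\<^sub>R f t)"
      by (rule set_integral_support[symmetric]) (use \<psi>0 ab in \<open>auto intro!: continuous_intros \<psi>c fc\<close>)
    also have "\<dots> = - (LINT t:J|lborel. \<phi> t *\<^sub>R g t)" by (rule w[OF tf])
    also have "(LINT t:J|lborel. \<phi> t *\<^sub>R g t) = integral {a..b} (\<lambda>t. \<phi> t *\<^sub>R g t)"
      by (rule set_integral_support) (use \<phi>0 ab in \<open>auto intro!: continuous_intros \<phi>c gc\<close>)
    also have "- integral {a..b} (\<lambda>t. \<phi> t *\<^sub>R g t) = integral {a..b} (\<lambda>t. \<psi> t *\<^sub>R G t)"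
      using ab by (intro scaled_product_integral[symmetric] \<phi> \<phi>a \<phi>b Gc gc Gd \<psi>c) auto
    finally have "integral {a..b} (\<lambda>t. \<psi> t *\<^sub>R F t) = 0"
      unfolding F_def scaleR_diff_right
      by (subst Henstock_Kurzweil_Integration.integral_diff)
        (auto intro!: integrable_continuous_real continuous_intros \<psi>c fc Gc)
    moreover have "integral {a..b} (\<lambda>t. \<psi> t *\<^sub>R F t) =
        integral {a..b} (\<lambda>u. tent h p u *\<^sub>R F u) - integral {a..b} (\<lambda>u. tent h q u *\<^sub>R F u)"
      unfolding \<psi>_def scaleR_diff_left
      by (intro Henstock_Kurzweil_Integration.integral_diff integrable_continuous_real continuous_intros Fc)
    ultimately show ?thesis by simp
  qed
  have const: "F p = F q" if p: "p \<in> {a<..<b}" and q: "q \<in> {a<..<b}" for p q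
  proof (rule ccontr)
    assume ne: "F p \<noteq> F q"
    \<comment> \<open>A third: both averages lie within e of the respective values, so the distance
      3 e would be at most 2 e.\<close>
    define e where "e = cmod (F p - F q) / 3"
    have e: "e > 0" using ne by (simp add: e_def)
    have near: "\<exists>\<delta>>0. {r - \<delta>..r + \<delta>} \<subseteq> {a..b} \<and> (\<forall>u. \<bar>u - r\<bar> < \<delta> \<longrightarrow> cmod (F u - F r) \<le> e)"
      if r: "r \<in> {a<..<b}" for r
    proof -
      have "isCont F r" using continuous_on_interior[OF Fc, of r] r by simp
      then obtain \<delta> where \<delta>: "\<delta> > 0" "\<And>u. dist u r < \<delta> \<Longrightarrow> dist (F u) (F r) < e"
        using e unfolding continuous_at_eps_delta by blast
      show ?thesis
        using \<delta> r by (intro exI[of _ "min \<delta> (min (r - a) (b - r))"])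
          (auto simp: dist_norm min_def intro: less_imp_le)
    qed
    obtain h1 where h1: "h1 > 0" "{p - h1..p + h1} \<subseteq> {a..b}" "\<And>u. \<bar>u - p\<bar> < h1 \<Longrightarrow> cmod (F u - F p) \<le> e"
      using near[OF p] by blast
    obtain h2 where h2: "h2 > 0" "{q - h2..q + h2} \<subseteq> {a..b}" "\<And>u. \<bar>u - q\<bar> < h2 \<Longrightarrow> cmod (F u - F q) \<le> e"
      using near[OF q] by blast
    define h where "h = min h1 h2"
    have h: "h > 0" "h \<le> h1" "h \<le> h2" using h1 h2 by (auto simp: h_def)
    have sp: "{p - h..p + h} \<subseteq> {a..b}" and sq: "{q - h..q + h} \<subseteq> {a..b}"
      using h1(2) h2(2) h by (auto simp: subset_iff)
    define m where "m = (LINT x|lborel. tent h 0 x)"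
    have m: "m > 0"
    proof -
      have eq: "m = integral {p - h..p + h} (tent h p)" unfolding m_def using h by (intro tent_integral[symmetric]) auto
      have "m \<ge> 0" unfolding m_def by (intro Bochner_Integration.integral_nonneg) (simp add: tent_def)
      moreover have "m \<noteq> 0"
      proof
        assume "m = 0"
        have nn: "0 \<le> tent h p u" for u by (simp add: tent_def)
        have "(integral {p - h..p + h} (tent h p) = 0) = (\<forall>u\<in>{p - h..p + h}. tent h p u = 0)"
          by (rule integral_eq_0_iff) (use h nn tent_continuous[OF continuous_on_id] in auto)
        with \<open>m = 0\<close> eq have "\<forall>u\<in>{p - h..p + h}. tent h p u = 0" by simp
        then have "tent h p p = 0" using h by auto
        then show False using h by (simp add: tent_def)
      qed
      ultimately show ?thesis by simp
    qed
    define I where "I = integral {a..b} (\<lambda>u. tent h p u *\<^sub>R F u)"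
    have 1: "cmod (I - m *\<^sub>R F p) \<le> e * m"
      unfolding I_def m_def by (rule tent_average[OF Fc sp h(1)]) (use h1(3) h in auto)
    have 2: "cmod (I - m *\<^sub>R F q) \<le> e * m"
      unfolding I_def m_def eqI[OF h(1) sp sq] by (rule tent_average[OF Fc sq h(1)]) (use h2(3) h in auto)
    have "m * cmod (F p - F q) = cmod ((I - m *\<^sub>R F q) - (I - m *\<^sub>R F p))"
      using m by (simp add: scaleR_diff_right[symmetric])
    also have "\<dots> \<le> e * m + e * m" using norm_triangle_ineq4 1 2 by (meson add_mono order_trans)
    finally have "m * cmod (F p - F q) \<le> m * (2 * e)" by (simp add: algebra_simps)
    then have "cmod (F p - F q) \<le> 2 * e" using m by simp
    then show False using e by (simp add: e_def)
  qed
  have x': "x \<in> {a<..<b}" using ab by auto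
  have "((\<lambda>u. G u + F x) has_vector_derivative g x) (at x)"
    using Gd[OF x'] by (auto intro!: derivative_eq_intros)
  then show ?thesis
  proof (rule has_vector_derivative_transform_within_open)
    show "G u + F x = f u" if "u \<in> {a<..<b}" for u
      using const[OF x' that] by (simp add: F_def)
  qed (use x' in auto)
qed

text \<open>For an eigenfunction, f'' is known only almost everywhere, but there it equals a
  continuous expression in f and f'. This upgrades f' to a classically differentiable
  function.\<close>

lemma weak_deriv_AE_continuous:
  fixes f g k :: "real \<Rightarrow> complex"
  assumes J: "open J" "is_interval J" and c: "continuous_on J f" "continuous_on J k"
    and w: "weak_deriv J f g" and ae: "AE t in lborel. t \<in> J \<longrightarrow> g t = k t"
    and x: "x \<in> J"
  shows "(f has_vector_derivative k x) (at x)"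
proof (rule weak_deriv_continuous_imp[OF J c _ x])
  fix \<phi> \<phi>' assume t: "test_fun J \<phi> \<phi>'"
  then obtain K where K: "compact K" "K \<subseteq> J" "\<And>t. t \<notin> K \<Longrightarrow> \<phi> t = 0"
    and \<phi>: "\<And>t. (\<phi> has_real_derivative \<phi>' t) (at t)"
    by (auto simp: test_fun_def)
  have \<phi>c: "continuous_on UNIV \<phi>" using \<phi> by (intro continuous_at_imp_continuous_on ballI DERIV_isCont)
  then have [measurable]: "\<phi> \<in> borel_measurable borel" by (rule borel_measurable_continuous_onI)
  have gK: "set_integrable lborel K g" using w K by (auto simp: weak_deriv_def loc_integrable_def)
  have kK: "set_integrable lborel K k"
    using borel_integrable_compact[OF K(1) continuous_on_subset[OF c(2) K(2)]] by (simp add: set_integrable_def)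
  have eq: "indicat_real J t *\<^sub>R (\<phi> t *\<^sub>R h t) = \<phi> t *\<^sub>R (indicat_real K t *\<^sub>R h t)" for h :: "real \<Rightarrow> complex" and t
    using K by (cases "t \<in> K") (auto simp: indicator_def)
  have m: "(\<lambda>t. indicat_real K t *\<^sub>R g t) \<in> borel_measurable lborel" "(\<lambda>t. indicat_real K t *\<^sub>R k t) \<in> borel_measurable lborel"
    using gK kK by (auto simp: set_integrable_def)
  have "(LINT t:J|lborel. \<phi> t *\<^sub>R g t) = (LINT t:J|lborel. \<phi> t *\<^sub>R k t)"
    unfolding set_lebesgue_integral_def eq
  proof (rule integral_cong_AE)
    show "AE t in lborel. \<phi> t *\<^sub>R (indicat_real K t *\<^sub>R g t) = \<phi> t *\<^sub>R (indicat_real K t *\<^sub>R k t)"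
      using ae by eventually_elim (use K in \<open>auto simp: indicator_def\<close>)
  qed (use m in measurable)
  then show "(LINT t:J|lborel. \<phi>' t *\<^sub>R f t) = - (LINT t:J|lborel. \<phi> t *\<^sub>R k t)"
    using w t by (simp add: weak_deriv_def)
qed

section \<open>Square integrability of derivatives on half-lines\<close>

lemma bounded_segments_integrable:
  fixes F :: "real \<Rightarrow> real"
  assumes c: "continuous_on {s..} F" and nn: "\<And>x. x \<ge> s \<Longrightarrow> 0 \<le> F x"
    and b: "\<And>n::nat. integral {s..s + real n} F \<le> C"
  shows "set_integrable lborel {s..} F"
proof -
  define f where "f = (\<lambda>n x. indicat_real {s..s + real n} x *\<^sub>R F x)"
  have c': "continuous_on {s..s + real n} F" for n using continuous_on_subset[OF c] by auto
  have i: "integrable lborel (f n)" for n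
    using borel_integrable_atLeastAtMost'[OF c', of n] by (simp add: f_def set_integrable_def)
  have eq: "(LINT x|lborel. f n x) = integral {s..s + real n} F" for n
    using set_borel_integral_eq_integral(2)[OF borel_integrable_atLeastAtMost'[OF c', of n]]
    by (simp add: f_def set_lebesgue_integral_def)
  have m: "mono (\<lambda>n. f n x)" for x
    using nn by (auto simp: mono_def f_def indicator_def)
  have inc: "incseq (\<lambda>n. LINT x|lborel. f n x)"
    using m by (auto simp: incseq_def mono_def intro!: integral_mono i)
  have bnd: "\<forall>n. (LINT x|lborel. f n x) \<le> C" using b eq by simp
  obtain L where L: "(\<lambda>n. LINT x|lborel. f n x) \<longlonglongrightarrow> L"
    using incseq_convergent[OF inc bnd] by blast
  have "integrable lborel (\<lambda>x. indicat_real {s..} x *\<^sub>R F x)"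
  proof (rule integrable_monotone_convergence[OF i _ _ L])
    show "AE x in lborel. (\<lambda>n. f n x) \<longlonglongrightarrow> indicat_real {s..} x *\<^sub>R F x"
    proof (intro AE_I2 tendsto_eventually)
      fix x
      obtain N :: nat where "x - s \<le> real N" using real_arch_simple by blast
      then show "\<forall>\<^sub>F n in sequentially. f n x = indicat_real {s..} x *\<^sub>R F x"
        by (auto simp: eventually_sequentially f_def indicator_def intro!: exI[of _ N])
    qed
  qed (use m borel_measurable_continuous_on_indicator[OF _ c] in auto)
  then show ?thesis by (simp add: set_integrable_def)
qed

lemma L2g_rayI:
  fixes g :: "real \<Rightarrow> complex"
  assumes c: "continuous_on {s..} g" and b: "\<And>n::nat. integral {s..s + real n} (\<lambda>x. gw x * (cmod (g x))\<^sup>2) \<le> C"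
  shows "(\<lambda>t. indicat_real {s..} t *\<^sub>R g t) \<in> L2g"
proof -
  have m: "(\<lambda>t. indicat_real {s..} t *\<^sub>R g t) \<in> borel_measurable borel"
    by (intro borel_measurable_continuous_on_indicator c) auto
  have "set_integrable lborel {s..} (\<lambda>x. gw x * (cmod (g x))\<^sup>2)"
    by (rule bounded_segments_integrable[OF _ _ b]) (auto intro!: continuous_intros c)
  moreover have "indicat_real {s..} x *\<^sub>R (gw x * (cmod (g x))\<^sup>2) = gw x *\<^sub>R (cmod (indicat_real {s..} x *\<^sub>R g x))\<^sup>2" for x
    by (simp add: indicator_def)
  ultimately have "integrable lborel (\<lambda>x. gw x *\<^sub>R (cmod (indicat_real {s..} x *\<^sub>R g x))\<^sup>2)"
    by (simp only: set_integrable_def)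
  moreover have "(\<lambda>x. (cmod (indicat_real {s..} x *\<^sub>R g x))\<^sup>2) \<in> borel_measurable borel" using m by measurable
  ultimately show ?thesis using m by (simp only: L2g_def mem_Collect_eq integrable_gauss_iff simp_thms)
qed

text \<open>Caccioppoli's inequality: the equation is tested with g times a squared cutoff, and the
  cross term is absorbed into half of the energy, leaving only the norm of g. It is used for limits
  of minimising sequences and, one derivative higher, for f''.\<close>

lemma caccioppoli:
  fixes g g1 :: "real \<Rightarrow> complex"
  assumes c: "continuous_on {s..} g" "continuous_on {s..} g1"
    and d: "\<And>t. t > s \<Longrightarrow> (g has_vector_derivative g1 t) (at t)"
      "\<And>t. t > s \<Longrightarrow> (g1 has_vector_derivative (2 * t) *\<^sub>R g1 t - (2 * \<kappa>) *\<^sub>R g t) (at t)"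
    and L2: "(\<lambda>t. indicat_real {s..} t *\<^sub>R g t) \<in> L2g"
  shows "(\<lambda>t. indicat_real {s..} t *\<^sub>R g1 t) \<in> L2g"
proof -
  define V where "V = (\<lambda>t. gw t * (cmod (g t))\<^sup>2)"
  define V1 where "V1 = (\<lambda>t. gw t * (cmod (g1 t))\<^sup>2)"
  define B where "B = (LINT x:{s..}|lborel. V x)"
  have Vi: "set_integrable lborel {s..} V"
  proof -
    have "gw x * (cmod (indicat_real {s..} x *\<^sub>R g x))\<^sup>2 = indicat_real {s..} x *\<^sub>R V x" for x
      by (simp add: V_def indicator_def)
    moreover have "integrable lborel (\<lambda>x. gw x * (cmod (indicat_real {s..} x *\<^sub>R g x))\<^sup>2)"
      using ip_lborel(1)[OF L2 L2] by (simp only: power2_norm_eq_inner)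
    ultimately show ?thesis by (simp only: set_integrable_def)
  qed
  have VB: "integral {s..R} V \<le> B" for R
  proof -
    have "integral {s..R} V \<le> integral {s..} V"
      using set_borel_integral_eq_integral(1)[OF Vi]
        set_borel_integral_eq_integral(1)[OF set_integrable_subset[OF Vi, of "{s..R}"]]
      by (intro integral_subset_le) (auto simp: V_def)
    then show ?thesis using set_borel_integral_eq_integral(2)[OF Vi] by (simp add: B_def)
  qed
  \<comment> \<open>Doubled constants, because the absorption leaves only half of the energy on the
    left.\<close>
  define C where "C = 2 * \<bar>gw s * (g s \<bullet> g1 s)\<bar> + (4 + 4 * \<bar>\<kappa>\<bar>) * B"
  show ?thesis
  proof (rule L2g_rayI[OF c(2), where C = C])
    fix n :: nat
    define R where "R = s + real n"
    have R: "s \<le> R" by (simp add: R_def)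
    \<comment> \<open>Equal to 1 up to R and falling linearly to 0 at R + 1: the boundary term at R
      + 1 vanishes and the slope stays bounded independently of n.\<close>
    define \<eta> where "\<eta> = (\<lambda>t. min 1 (R + 1 - t))"
    define \<eta>' where "\<eta>' = (\<lambda>t::real. if t \<le> R then 0 else - 1 :: real)"
    have cR: "continuous_on {s..R + 1} g" "continuous_on {s..R + 1} g1"
      using continuous_on_subset[OF c(1)] continuous_on_subset[OF c(2)] by auto
    have \<eta>c: "continuous_on A \<eta>" for A unfolding \<eta>_def by (intro continuous_intros)
    define U where "U = (\<lambda>t. (\<eta> t)\<^sup>2 * (gw t * (g t \<bullet> g1 t)))"
    define U' where "U' = (\<lambda>t. 2 * \<eta> t * \<eta>' t * (gw t * (g t \<bullet> g1 t)) + (\<eta> t)\<^sup>2 * (V1 t - 2 * \<kappa> * V t))"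
    have "(U' has_integral U (R + 1) - U s) {s..R + 1}"
    proof (rule fundamental_theorem_of_calculus_interior_strong[of "{R}"])
      show "continuous_on {s..R + 1} U" unfolding U_def by (intro continuous_intros \<eta>c cR)
      fix t assume t: "t \<in> {s<..<R + 1} - {R}"
      have e: "(\<eta> has_real_derivative \<eta>' t) (at t)"
      proof (cases "t < R")
        case True
        have "(\<eta> has_real_derivative 0) (at t)"
          by (rule has_field_derivative_transform_within_open[of "\<lambda>_. 1" _ _ "{..<R}"])
            (use True in \<open>auto simp: \<eta>_def\<close>)
        then show ?thesis using True by (simp add: \<eta>'_def)
      next
        case False
        have "((\<lambda>t. R + 1 - t) has_real_derivative - 1) (at t)" by (auto intro!: derivative_eq_intros)
        then have "(\<eta> has_real_derivative - 1) (at t)"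
          by (rule has_field_derivative_transform_within_open[of _ _ _ "{R<..}"])
            (use False t in \<open>auto simp: \<eta>_def\<close>)
        then show ?thesis using False t by (simp add: \<eta>'_def)
      qed
      have p: "((\<lambda>t. g t \<bullet> g1 t) has_real_derivative g t \<bullet> ((2 * t) *\<^sub>R g1 t - (2 * \<kappa>) *\<^sub>R g t) + g1 t \<bullet> g1 t) (at t)"
        using bounded_bilinear.has_vector_derivative[OF bounded_bilinear_inner d(1)[of t] d(2)[of t]] t
        by (simp add: has_real_derivative_iff_has_vector_derivative)
      have e2: "((\<lambda>t. (\<eta> t)\<^sup>2) has_real_derivative 2 * \<eta> t * \<eta>' t) (at t)"
        using DERIV_power[OF e, of 2] by (simp add: mult_ac)
      have "(U has_real_derivative U' t) (at t)"
        unfolding U_def U'_def using DERIV_mult[OF e2 DERIV_mult[OF gw_deriv[of t UNIV] p]]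
        by (rule DERIV_cong)
          (simp add: V_def V1_def power2_norm_eq_inner inner_diff_right algebra_simps)
      then show "(U has_vector_derivative U' t) (at t)"
        by (simp add: has_real_derivative_iff_has_vector_derivative)
    qed (use R in auto)
    then have U': "(U' has_integral - (gw s * (g s \<bullet> g1 s))) {s..R + 1}"
      using R by (simp add: U_def \<eta>_def)
    have iV: "V integrable_on {s..R + 1}" "(\<lambda>t. (\<eta> t)\<^sup>2 * V1 t) integrable_on {s..R + 1}"
      "V1 integrable_on {s..R}"
      unfolding V_def V1_def using cR continuous_on_subset[OF cR(2), of "{s..R}"]
      by (auto intro!: integrable_continuous_real continuous_intros \<eta>c)
    have "((\<lambda>t. 1 / 2 * ((\<eta> t)\<^sup>2 * V1 t) - (2 + 2 * \<bar>\<kappa>\<bar>) * V t) has_integral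
        1 / 2 * integral {s..R + 1} (\<lambda>t. (\<eta> t)\<^sup>2 * V1 t) - (2 + 2 * \<bar>\<kappa>\<bar>) * integral {s..R + 1} V) {s..R + 1}"
      by (intro has_integral_diff has_integral_mult_right integrable_integral iV)
    then have "1 / 2 * integral {s..R + 1} (\<lambda>t. (\<eta> t)\<^sup>2 * V1 t) - (2 + 2 * \<bar>\<kappa>\<bar>) * integral {s..R + 1} V
      \<le> - (gw s * (g s \<bullet> g1 s))"
    proof (rule has_integral_le[OF _ U'])
      fix t assume t: "t \<in> {s..R + 1}"
      have \<eta>: "0 \<le> \<eta> t" "\<eta> t \<le> 1" "\<bar>\<eta>' t\<bar> \<le> 1" using t by (auto simp: \<eta>_def \<eta>'_def)
      have "\<bar>2 * \<eta> t * \<eta>' t * (g t \<bullet> g1 t)\<bar> = 2 * \<eta> t * \<bar>\<eta>' t\<bar> * \<bar>g t \<bullet> g1 t\<bar>"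
        using \<eta> by (simp add: abs_mult)
      also have "\<dots> \<le> 2 * \<eta> t * 1 * (cmod (g t) * cmod (g1 t))"
        using \<eta> by (intro mult_mono Cauchy_Schwarz_ineq2) auto
      also have "\<dots> \<le> 1 / 2 * ((\<eta> t)\<^sup>2 * (cmod (g1 t))\<^sup>2) + 2 * (cmod (g t))\<^sup>2"
        using zero_le_power2[of "\<eta> t * cmod (g1 t) - 2 * cmod (g t)"]
        by (simp add: power2_eq_square algebra_simps)
      finally have 1: "- (1 / 2 * ((\<eta> t)\<^sup>2 * (cmod (g1 t))\<^sup>2) + 2 * (cmod (g t))\<^sup>2) \<le> 2 * \<eta> t * \<eta>' t * (g t \<bullet> g1 t)"
        by linarith
      have 2: "(\<eta> t)\<^sup>2 * (2 * \<kappa> * (cmod (g t))\<^sup>2) \<le> 2 * \<bar>\<kappa>\<bar> * (cmod (g t))\<^sup>2"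
      proof -
        have "(\<eta> t)\<^sup>2 * (2 * \<kappa> * (cmod (g t))\<^sup>2) \<le> (\<eta> t)\<^sup>2 * (2 * \<bar>\<kappa>\<bar> * (cmod (g t))\<^sup>2)"
          by (intro mult_left_mono mult_right_mono) auto
        also have "\<dots> \<le> 1 * (2 * \<bar>\<kappa>\<bar> * (cmod (g t))\<^sup>2)"
          using \<eta> by (intro mult_right_mono) (auto simp: power_le_one)
        finally show ?thesis by simp
      qed
      have "1 / 2 * ((\<eta> t)\<^sup>2 * (cmod (g1 t))\<^sup>2) - (2 + 2 * \<bar>\<kappa>\<bar>) * (cmod (g t))\<^sup>2 \<le>
          2 * \<eta> t * \<eta>' t * (g t \<bullet> g1 t) + (\<eta> t)\<^sup>2 * ((cmod (g1 t))\<^sup>2 - 2 * \<kappa> * (cmod (g t))\<^sup>2)"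
        using 1 2 by (simp add: algebra_simps)
      then have "gw t * (1 / 2 * ((\<eta> t)\<^sup>2 * (cmod (g1 t))\<^sup>2) - (2 + 2 * \<bar>\<kappa>\<bar>) * (cmod (g t))\<^sup>2) \<le>
          gw t * (2 * \<eta> t * \<eta>' t * (g t \<bullet> g1 t) + (\<eta> t)\<^sup>2 * ((cmod (g1 t))\<^sup>2 - 2 * \<kappa> * (cmod (g t))\<^sup>2))"
        by (rule mult_left_mono) simp
      then show "1 / 2 * ((\<eta> t)\<^sup>2 * V1 t) - (2 + 2 * \<bar>\<kappa>\<bar>) * V t \<le> U' t"
        unfolding V_def V1_def U'_def by (simp add: algebra_simps)
    qed
    then have 3: "integral {s..R + 1} (\<lambda>t. (\<eta> t)\<^sup>2 * V1 t) \<le>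
        2 * \<bar>gw s * (g s \<bullet> g1 s)\<bar> + (4 + 4 * \<bar>\<kappa>\<bar>) * integral {s..R + 1} V"
      by (simp add: algebra_simps) 
    have "integral {s..R} V1 = integral {s..R} (\<lambda>t. (\<eta> t)\<^sup>2 * V1 t)"
      by (intro Henstock_Kurzweil_Integration.integral_cong) (auto simp: \<eta>_def)
    also have "\<dots> \<le> integral {s..R + 1} (\<lambda>t. (\<eta> t)\<^sup>2 * V1 t)"
      using integrable_on_subinterval[OF iV(2), of s R] iV(2)
      by (intro integral_subset_le) (auto simp: V1_def)
    also have "\<dots> \<le> C"
      using 3 mult_left_mono[OF VB[of "R + 1"], of "4 + 4 * \<bar>\<kappa>\<bar>"] by (simp add: C_def)
    finally show "integral {s..s + real n} (\<lambda>x. gw x * (cmod (g1 x))\<^sup>2) \<le> C"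
      by (simp add: V1_def R_def)
  qed
qed

section \<open>Hermite polynomials\<close>

text \<open>The physicists' Hermite polynomials. The recursion is Rodrigues' formula in one step:
  the derivative of exp (- x^2) H_n is - exp (- x^2) H_(n+1).\<close>

primrec hermite :: "nat \<Rightarrow> real poly" where
  "hermite 0 = 1"
| "hermite (Suc n) = [:0, 2:] * hermite n - pderiv (hermite n)"

lemma pderiv_linear: "pderiv [:0, 2::real:] = [:2:]"
  by (simp add: pderiv_pCons)

lemma pderiv_hermite_Suc: "pderiv (hermite (Suc n)) = smult (2 * real (Suc n)) (hermite n)"
proof (induction n)
  case 0
  show ?case by (simp add: pderiv_pCons)
next
  case (Suc n)
  have "pderiv (hermite (Suc (Suc n))) =
      [:0, 2:] * pderiv (hermite (Suc n)) + [:2:] * hermite (Suc n) - pderiv (pderiv (hermite (Suc n)))"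
    by (simp only: hermite.simps(2)[of "Suc n"] pderiv_diff pderiv_mult pderiv_linear)
      (simp add: algebra_simps)
  also have "\<dots> = smult (2 * real (Suc n)) ([:0, 2:] * hermite n - pderiv (hermite n)) + smult 2 (hermite (Suc n))"
    unfolding Suc.IH by (simp add: pderiv_smult smult_diff_right algebra_simps)
  also have "\<dots> = smult (2 * real (Suc (Suc n))) (hermite (Suc n))"
    unfolding hermite.simps(2)[symmetric] by (simp add: smult_add_left[symmetric] algebra_simps)
  finally show ?case .
qed

text \<open>The derivative of H_(n+1) is computed twice, from the recursion and from
  \<open>pderiv_hermite_Suc\<close>; equating the results is Hermite's equation.\<close>

lemma hermite_ode:
  "poly (pderiv (pderiv (hermite n))) x - 2 * x * poly (pderiv (hermite n)) x + 2 * real n * poly (hermite n) x = 0"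
proof -
  have "pderiv (hermite (Suc n)) =
      [:0, 2:] * pderiv (hermite n) + [:2:] * hermite n - pderiv (pderiv (hermite n))"
    by (simp only: hermite.simps(2) pderiv_diff pderiv_mult pderiv_linear) (simp add: algebra_simps)
  then have "smult (2 * real (Suc n)) (hermite n) =
      [:0, 2:] * pderiv (hermite n) + [:2:] * hermite n - pderiv (pderiv (hermite n))"
    by (simp only: pderiv_hermite_Suc)
  from arg_cong[OF this, of "\<lambda>p. poly p x"] show ?thesis by (simp add: algebra_simps)
qed

lemma hermite_degree_lead: "degree (hermite n) = n \<and> lead_coeff (hermite n) > 0"
proof (induction n)
  case (Suc n)
  have "hermite n \<noteq> 0" using Suc by auto
  have 1: "degree ([:0, 2:] * hermite n) = Suc n"
    using Suc \<open>hermite n \<noteq> 0\<close> by (subst degree_mult_eq) auto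
  have 2: "degree (pderiv (hermite n)) < Suc n"
    using Suc by (simp add: degree_pderiv)
  have "degree (hermite (Suc n)) = Suc n"
    using 1 2 degree_add_eq_left[of "- pderiv (hermite n)" "[:0, 2:] * hermite n"] by simp
  moreover have "coeff (hermite (Suc n)) (Suc n) = 2 * coeff (hermite n) n"
    using coeff_eq_0[OF 2] by simp
  moreover have "coeff (hermite n) n > 0" using Suc by metis
  ultimately show ?case by simp
qed simp

lemma hermite_nz [simp]: "hermite n \<noteq> 0"
  using hermite_degree_lead[of n] by auto

lemma hermite_parity: "poly (hermite n) (- x) = (- 1) ^ n * poly (hermite n) x
    \<and> poly (pderiv (hermite n)) (- x) = - ((- 1) ^ n * poly (pderiv (hermite n)) x)"
proof (induction n)
  case (Suc n)
  have "poly (hermite (Suc n)) (- x) = (- 1) ^ Suc n * poly (hermite (Suc n)) x"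
    using Suc by (simp add: algebra_simps)
  then show ?case using Suc unfolding pderiv_hermite_Suc by simp
qed simp

lemma hermite_odd_zero: "poly (hermite (2 * k + 1)) 0 = 0"
  using hermite_parity[of "2 * k + 1" 0] by simp

text \<open>At a double zero of H_(n+1) its derivative, a multiple of H_n, vanishes; by the
  recursion H_n' vanishes as well, so H_n would have a double zero too.\<close>

lemma hermite_simple_roots: "poly (hermite n) z \<noteq> 0 \<or> poly (pderiv (hermite n)) z \<noteq> 0"
proof (induction n)
  case (Suc n)
  show ?case
  proof (rule ccontr)
    assume "\<not> ?thesis"
    then have "poly (hermite (Suc n)) z = 0" "poly (hermite n) z = 0"
      unfolding pderiv_hermite_Suc by auto
    with Suc show False by simp
  qed
qed simp

declare hermite.simps(2) [simp del]

section \<open>Counting positive zeros of Hermite polynomials\<close>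

lemma rolle_real:
  fixes g :: "real \<Rightarrow> real"
  assumes g: "\<And>x. (g has_real_derivative g' x) (at x)" and "a < b" "g a = g b"
  shows "\<exists>x>a. x < b \<and> g' x = 0"
proof -
  have "continuous_on {a..b} g" using DERIV_isCont[OF g] by (simp add: continuous_at_imp_continuous_on)
  then obtain z where "a < z" "z < b" "(g has_real_derivative 0) (at z)"
    using Rolle[of a b g] assms real_differentiable_def by blast
  then show ?thesis using DERIV_unique[OF g] by blast
qed

text \<open>Rolle's theorem with infinity as the second zero: half of a nonzero value g s is taken
  on both sides of s, because g starts at 0 and tends to 0.\<close>

lemma rolle_at_top:
  fixes g :: "real \<Rightarrow> real"
  assumes g: "\<And>x. (g has_real_derivative g' x) (at x)" and z: "g z = 0" and lim: "(g \<longlongrightarrow> 0) at_top"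
  shows "\<exists>x>z. g' x = 0"
proof (cases "\<forall>x>z. g x = 0")
  case True
  then show ?thesis using rolle_real[OF g, of z "z + 1"] z by auto
next
  case False
  then obtain s where s: "s > z" "g s \<noteq> 0" by auto
  have cont: "isCont g x" for x using g DERIV_isCont by blast
  define c where "c = g s / 2"
  have "eventually (\<lambda>x. \<bar>g x\<bar> < \<bar>c\<bar>) at_top"
    using order_tendstoD(2)[OF tendsto_rabs[OF lim], of "\<bar>c\<bar>"] s by (simp add: c_def)
  then have "eventually (\<lambda>x. s < x \<and> \<bar>g x\<bar> < \<bar>c\<bar>) at_top"
    by (intro eventually_conj eventually_gt_at_top)
  then obtain r where r: "r > s" "\<bar>g r\<bar> < \<bar>c\<bar>"
    using eventually_happens'[OF trivial_limit_at_top_linorder] by blast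
  have ex: "\<exists>x\<in>{u..v}. g x = c" if "u \<le> v" "(g u \<le> c \<and> c \<le> g v) \<or> (g v \<le> c \<and> c \<le> g u)" for u v
    using that IVT[of g u c v] IVT2[of g v c u] cont by (auto simp: Bex_def)
  obtain p where p: "p \<in> {z..s}" "g p = c"
    using ex[of z s] s z by (cases "c \<ge> 0") (auto simp: c_def)
  obtain q where q: "q \<in> {s..r}" "g q = c"
  proof -
    have "(g s \<le> c \<and> c \<le> g r) \<or> (g r \<le> c \<and> c \<le> g s)"
      using r(2) unfolding c_def by linarith
    then show ?thesis using ex[of s r] r that by auto
  qed
  have "p \<noteq> s" "q \<noteq> s" using p q s by (auto simp: c_def)
  then have "p < q" using p q by auto
  then show ?thesis using rolle_real[OF g, of p q] p q by force
qed

text \<open>One zero of g' between consecutive zeros of g and one beyond the last: infinity counts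
  as a further zero, so the number is preserved. The new zeros lie strictly beyond a even if a
  itself was a zero of g.\<close>

lemma rolle_zeros:
  fixes g :: "real \<Rightarrow> real"
  assumes g: "\<And>x. (g has_real_derivative g' x) (at x)" and lim: "(g \<longlongrightarrow> 0) at_top"
    and A: "finite A" "\<And>x. x \<in> A \<Longrightarrow> g x = 0" "\<And>x. x \<in> A \<Longrightarrow> a \<le> x"
  shows "\<exists>B. finite B \<and> card B = card A \<and> B \<subseteq> {a<..} \<and> (\<forall>x\<in>B. g' x = 0)"
  using A
proof (induction A arbitrary: a rule: finite_linorder_min_induct)
  case empty
  then show ?case by (intro exI[of _ "{}"]) auto
next
  case (insert b A)
  show ?case
  proof (cases "A = {}")
    case True
    obtain x where "x > b" "g' x = 0" using rolle_at_top[OF g _ lim, of b] insert by auto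
    then show ?thesis using True insert.prems(2)[of b] by (intro exI[of _ "{x}"]) auto
  next
    case False
    define m where "m = Min A"
    have m: "m \<in> A" "\<And>x. x \<in> A \<Longrightarrow> m \<le> x" using False insert by (auto simp: m_def)
    obtain B where B: "finite B" "card B = card A" "B \<subseteq> {m<..}" "\<forall>x\<in>B. g' x = 0"
      using insert.IH[of m] insert.prems m by auto
    have bm: "b < m" using insert m by auto
    then obtain x where x: "b < x" "x < m" "g' x = 0"
      using rolle_real[OF g, of b m] insert.prems(1)[of b] insert.prems(1)[of m] m by auto
    have "b \<notin> A" using insert by auto
    then show ?thesis using B x insert.prems(2)[of b] insert.hyps
      by (intro exI[of _ "insert x B"]) (auto simp: card_insert_if subset_iff)
  qed
qed

lemma poly_exp_tendsto_0: "((\<lambda>x::real. poly p x * exp (- x)) \<longlongrightarrow> 0) at_top"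
proof -
  have "((\<lambda>x. \<Sum>i\<le>degree p. coeff p i * (x ^ i / exp x)) \<longlongrightarrow> (\<Sum>i\<le>degree p. coeff p i * 0)) at_top"
    by (intro tendsto_sum tendsto_mult tendsto_const tendsto_power_div_exp_0)
  then show ?thesis by (simp add: poly_altdef exp_minus sum_distrib_right divide_inverse mult.assoc)
qed

lemma poly_gaussian_tendsto_0: "((\<lambda>x::real. exp (- x\<^sup>2) * poly p x) \<longlongrightarrow> 0) at_top"
proof (rule Lim_null_comparison)
  show "\<forall>\<^sub>F x::real in at_top. norm (exp (- x\<^sup>2) * poly p x) \<le> \<bar>poly p x * exp (- x)\<bar>"
    using eventually_ge_at_top[of 1]
  proof eventually_elim
    case (elim x)
    then have "x * 1 \<le> x * x" by (intro mult_left_mono) auto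
    then have "exp (- x\<^sup>2) \<le> exp (- x)" by (simp add: power2_eq_square)
    then have "exp (- x\<^sup>2) * \<bar>poly p x\<bar> \<le> exp (- x) * \<bar>poly p x\<bar>" by (intro mult_right_mono) auto
    then show ?case by (simp add: abs_mult mult.commute)
  qed
  show "((\<lambda>x. \<bar>poly p x * exp (- x)\<bar>) \<longlongrightarrow> 0) at_top"
    using tendsto_rabs_zero[OF poly_exp_tendsto_0] .
qed

text \<open>The index is k, the degree 2 k + 1; the set has exactly k elements.\<close>

definition pos_roots :: "nat \<Rightarrow> real set" where
  "pos_roots k = {t. 0 < t \<and> poly (hermite (2 * k + 1)) t = 0}"

lemma finite_pos_roots [simp]: "finite (pos_roots k)"
  by (rule finite_subset[OF _ poly_roots_finite[OF hermite_nz[of "2 * k + 1"]]]) (auto simp: pos_roots_def)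

text \<open>Rodrigues' formula makes the zeros of H_(n+1) critical points of exp (- x^2) H_n, which
  vanishes at infinity. The count thus never drops, and it grows by one whenever n is odd, since 0
  is then an additional zero to start from.\<close>

lemma hermite_positive_zeros: "\<exists>A. finite A \<and> card A = n div 2 \<and> A \<subseteq> {0<..} \<and> (\<forall>x\<in>A. poly (hermite n) x = 0)"
proof (induction n)
  case 0
  show ?case by (intro exI[of _ "{}"]) auto
next
  case (Suc n)
  then obtain A where A: "finite A" "card A = n div 2" "A \<subseteq> {0<..}" "\<forall>x\<in>A. poly (hermite n) x = 0" by auto
  define g where "g = (\<lambda>x. exp (- x\<^sup>2) * poly (hermite n) x)"
  define g' where "g' = (\<lambda>x. - (exp (- x\<^sup>2) * poly (hermite (Suc n)) x))"
  have g: "(g has_real_derivative g' x) (at x)" for x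
    unfolding g_def g'_def by (auto intro!: derivative_eq_intros simp: hermite.simps(2) algebra_simps power2_eq_square)
  have lim: "(g \<longlongrightarrow> 0) at_top" unfolding g_def by (rule poly_gaussian_tendsto_0)
  define A' where "A' = (if odd n then insert 0 A else A)"
  have A': "finite A'" "card A' = Suc n div 2" "\<And>x. x \<in> A' \<Longrightarrow> g x = 0" "\<And>x. x \<in> A' \<Longrightarrow> 0 \<le> x"
  proof -
    have "0 \<notin> A" using A by auto
    then show "card A' = Suc n div 2" using A by (auto simp: A'_def elim!: oddE)
    show "g x = 0" if "x \<in> A'" for x
      using that A hermite_odd_zero by (auto simp: A'_def g_def elim!: oddE split: if_splits)
    show "0 \<le> x" if "x \<in> A'" for x using that A by (auto simp: A'_def subset_iff less_imp_le split: if_splits)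
  qed (use A in \<open>simp add: A'_def\<close>)
  obtain B where "finite B" "card B = card A'" "B \<subseteq> {0<..}" "\<forall>x\<in>B. g' x = 0"
    using rolle_zeros[OF g lim A'(1,3,4)] by blast
  then show ?case using A' by (intro exI[of _ B]) (auto simp: g'_def)
qed

text \<open>The upper bound comes from symmetry: the positive zeros, their negatives and 0 are
  distinct zeros of a polynomial of degree 2 k + 1.\<close>

lemma card_pos_roots: "card (pos_roots k) = k"
proof (rule antisym)
  define H where "H = hermite (2 * k + 1)"
  have H: "H \<noteq> 0" "degree H = 2 * k + 1" "poly H 0 = 0" "\<And>x. poly H (- x) = - poly H x"
    using hermite_degree_lead[of "2 * k + 1"] hermite_odd_zero[of k] hermite_parity[of "2 * k + 1"]
    by (simp_all add: H_def)
  have R: "pos_roots k = {t. 0 < t \<and> poly H t = 0}" by (simp only: pos_roots_def H_def)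
  have "\<exists>A. finite A \<and> card A = k \<and> A \<subseteq> {0<..} \<and> (\<forall>x\<in>A. poly H x = 0)"
    using hermite_positive_zeros[of "2 * k + 1"] by (simp add: H_def)
  then obtain A where A: "finite A" "card A = k" "A \<subseteq> {0<..}" "\<forall>x\<in>A. poly H x = 0" by auto
  have "A \<subseteq> pos_roots k" using A unfolding R by auto
  then show "k \<le> card (pos_roots k)" using card_mono[OF finite_pos_roots, of A k] A by simp
  define N where "N = uminus ` pos_roots k"
  have "card N = card (pos_roots k)" unfolding N_def by (rule card_image) (simp add: inj_on_def)
  moreover have PN: "x > 0 \<and> poly H x = 0" if "x \<in> pos_roots k" for x using that unfolding R by simp
  moreover have "x < 0 \<and> poly H x = 0" if "x \<in> N" for x
    using that PN H(4) by (fastforce simp: N_def)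
  moreover have "finite N" by (simp add: N_def)
  ultimately have N: "finite N" "card N = card (pos_roots k)" "N \<inter> insert 0 (pos_roots k) = {}"
    "0 \<notin> pos_roots k" "N \<union> insert 0 (pos_roots k) \<subseteq> {x. poly H x = 0}"
    using H(3) by force+
  have "card (N \<union> insert 0 (pos_roots k)) \<le> card {x. poly H x = 0}"
    by (intro card_mono poly_roots_finite H N)
  also have "\<dots> \<le> 2 * k + 1" using card_poly_roots_bound[OF H(1)] H by simp
  also have "card (N \<union> insert 0 (pos_roots k)) = 2 * card (pos_roots k) + 1"
  proof -
    have "card (N \<union> insert 0 (pos_roots k)) = card N + card (insert 0 (pos_roots k))"
      by (rule card_Un_disjoint) (use N in auto)
    then show ?thesis using N by simp
  qed
  finally show "card (pos_roots k) \<le> k" by simp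
qed

text \<open>Provides the sign condition of Picone's inequality at a far right end, where the test
  function need not vanish.\<close>

lemma hermite_eventually_increasing:
  "\<exists>N. \<forall>t\<ge>N. 0 < poly (hermite n) t \<and> 0 \<le> poly (pderiv (hermite n)) t"
proof -
  have pos: "\<exists>N. \<forall>t\<ge>N. 0 < poly (hermite n) t" for n
    using poly_pinfty_gt_lc[of "hermite n"] hermite_degree_lead[of n] by (meson less_le_trans)
  show ?thesis
  proof (cases n)
    case 0
    then show ?thesis by simp
  next
    case (Suc m)
    obtain N M where N: "\<forall>t\<ge>N. 0 < poly (hermite n) t" and M: "\<forall>t\<ge>M. 0 < poly (hermite m) t"
      using pos by meson
    have "0 < poly (hermite n) t \<and> 0 \<le> poly (pderiv (hermite n)) t" if "t \<ge> max N M" for t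
    proof -
      have "poly (pderiv (hermite n)) t = 2 * real (Suc m) * poly (hermite m) t"
        unfolding Suc pderiv_hermite_Suc by simp
      then show ?thesis using N M that by (simp add: less_imp_le)
    qed
    then show ?thesis by (intro exI[of _ "max N M"]) auto
  qed
qed

section \<open>Forms and eigenfunctions on the tree\<close>

lemma H1_on_add:
  assumes "H1_on I f f'" "H1_on I g g'"
  shows "H1_on I (f + g) (f' + g')"
proof -
  obtain S where S: "finite S" "\<And>x. x \<in> interior I - S \<Longrightarrow> (f has_vector_derivative f' x) (at x)"
    using assms by (auto simp: H1_on_def)
  obtain R where R: "finite R" "\<And>x. x \<in> interior I - R \<Longrightarrow> (g has_vector_derivative g' x) (at x)"
    using assms by (auto simp: H1_on_def)
  have "\<forall>x\<in>interior I - (S \<union> R). ((\<lambda>t. f t + g t) has_vector_derivative f' x + g' x) (at x)"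
    using S R by (auto intro!: has_vector_derivative_add)
  then have "\<exists>S. finite S \<and> (\<forall>x\<in>interior I - S. ((\<lambda>t. f t + g t) has_vector_derivative f' x + g' x) (at x))"
    using S R by (intro exI[of _ "S \<union> R"]) auto
  then show ?thesis
    using assms L2g_add[of f g] L2g_add[of f' g']
    by (auto simp: H1_on_def plus_fun_def intro!: continuous_intros)
qed

lemma H1_on_cmult:
  assumes "H1_on I f f'"
  shows "H1_on I (\<lambda>t. c * f t) (\<lambda>t. c * f' t)"
proof -
  obtain S where S: "finite S" "\<And>x. x \<in> interior I - S \<Longrightarrow> (f has_vector_derivative f' x) (at x)"
    using assms by (auto simp: H1_on_def)
  have "\<forall>x\<in>interior I - S. ((\<lambda>t. c * f t) has_vector_derivative c * f' x) (at x)"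
    using S by (auto intro!: has_vector_derivative_mult_right)
  then show ?thesis
    using assms S by (auto simp: H1_on_def intro!: continuous_intros L2g_cmult)
qed

lemma H1_on_0: "H1_on I (\<lambda>_. 0) (\<lambda>_. 0)"
  using L2g_0 by (auto simp: H1_on_def zero_fun_def intro!: exI[of _ "{}"])

text \<open>A function travels with its derivative: \<open>H1_on\<close> leaves the derivative
  undetermined at exceptional points, and the pair spares choosing one each time the energy is
  formed.\<close>

type_synonym 'x tpair = "('x \<Rightarrow> real \<Rightarrow> complex) \<times> ('x \<Rightarrow> real \<Rightarrow> complex)"

definition csc :: "complex \<Rightarrow> 'x tpair \<Rightarrow> 'x tpair" where
  "csc c u = (fscale c (fst u), fscale c (snd u))"

text \<open>Real multiples only, which is what the real bilinear forms respect.\<close>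

definition psc :: "real \<Rightarrow> 'x tpair \<Rightarrow> 'x tpair" where
  "psc r u = csc (complex_of_real r) u"

interpretation psc: vector_space psc
  by unfold_locales
    (auto simp: psc_def csc_def fscale_def plus_prod_def plus_fun_def algebra_simps)

text \<open>X is the set of Dirichlet vertices. The root alone and the empty set give the two
  realisations, so both are treated by one argument.\<close>

definition form_dom :: "('v, 'e, 'r) ray_tree \<Rightarrow> 'v set \<Rightarrow> ('e + 'r) tpair set" where
  "form_dom T X = {u. (\<forall>x. x \<notin> edges T \<longrightarrow> fst u x = (\<lambda>_. 0) \<and> snd u x = (\<lambda>_. 0)) \<and>
     (\<forall>x\<in>edges T. H1_on (edge_span T x) (fst u x) (snd u x)) \<and>
     (\<forall>v\<in>verts (core T). \<forall>x\<in>incident T v. \<forall>y\<in>incident T v. fst u x (rad T v) = fst u y (rad T v)) \<and>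
     (\<forall>v\<in>X. \<forall>x\<in>incident T v. fst u x (rad T v) = 0)}"

definition fa :: "('v, 'e, 'r) ray_tree \<Rightarrow> ('e + 'r) tpair \<Rightarrow> ('e + 'r) tpair \<Rightarrow> real" where
  "fa T u w = (\<Sum>x\<in>edges T. ip (snd u x) (snd w x)) / 2"

definition ba :: "('v, 'e, 'r) ray_tree \<Rightarrow> ('e + 'r) tpair \<Rightarrow> ('e + 'r) tpair \<Rightarrow> real" where
  "ba T u w = (\<Sum>x\<in>edges T. ip (fst u x) (fst w x))"

definition eigp :: "('v, 'e, 'r) ray_tree \<Rightarrow> 'v set \<Rightarrow> real \<Rightarrow> ('e + 'r) tpair set" where
  "eigp T X c = {u \<in> form_dom T X. (\<forall>x\<in>edges T. eig_on c (edge_span T x) (fst u x) (snd u x)) \<and>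
     (\<forall>v\<in>verts (core T) - X. (\<Sum>x\<in>incident T v. normal_deriv T (snd u) v x) = 0)}"

definition OU :: "('v, 'e, 'r) ray_tree \<Rightarrow> 'v set \<Rightarrow> ('e + 'r \<Rightarrow> real \<Rightarrow> complex) \<Rightarrow>
   ('e + 'r \<Rightarrow> real \<Rightarrow> complex) \<Rightarrow> bool" where
  "OU T X f g \<longleftrightarrow> (\<exists>f' f''. H2 T f f' f'' \<and>
     (\<forall>v\<in>X. \<forall>x\<in>incident T v. f x (rad T v) = 0) \<and>
     (\<forall>v\<in>verts (core T) - X. std_cond T f f' v) \<and> OU_action T f' f'' g)"

lemma OU_D_eq: "OU_D T = OU T {root T}"
  by (intro ext) (simp add: OU_D_def OU_def vertex_cond_D_def conj_assoc)

lemma OU_N_eq: "OU_N T = OU T {}"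
  by (intro ext) (simp add: OU_N_def OU_def vertex_cond_N_def conj_assoc)

locale ou_tree =
  fixes T :: "('v, 'e, 'r) ray_tree" and X :: "'v set"
  assumes T: "is_ray_tree T" and X: "X \<subseteq> verts (core T)"
begin

sublocale G: fin_digraph "core T"
  using T by (simp add: is_ray_tree_def)

abbreviation "E \<equiv> edges T"
abbreviation "I \<equiv> edge_span T"
abbreviation "F \<equiv> form_dom T X"

lemma finite_rays: "finite (rays T)" and root_in: "root T \<in> verts (core T)"
  and unique_walk: "v \<in> verts (core T) \<Longrightarrow> \<exists>!p. G.awalk (root T) p v"
  and len_pos: "e \<in> arcs (core T) \<Longrightarrow> len T e > 0"
  using T by (auto simp: is_ray_tree_def)

lemma foot_in: "r \<in> rays T \<Longrightarrow> foot T r \<in> verts (core T)"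
  using T by (auto simp: is_ray_tree_def leaves_def)

lemma finite_E [simp]: "finite E"
  by (simp add: edges_def finite_rays)

text \<open>The distance is an infimum over walks; here there is only one.\<close>

lemma rad_walk:
  assumes "G.awalk (root T) p v"
  shows "rad T v = G.awalk_cost (len T) p"
proof -
  have "v \<in> verts (core T)" using assms by auto
  then have "{p. G.awalk (root T) p v} = {p}" using unique_walk assms by blast
  then show ?thesis by (simp add: rad_def G.\<mu>_def)
qed

lemma rad_nonneg: "v \<in> verts (core T) \<Longrightarrow> rad T v \<ge> 0"
proof -
  assume "v \<in> verts (core T)"
  then obtain p where p: "G.awalk (root T) p v" using unique_walk by blast
  show ?thesis
    unfolding rad_walk[OF p]
    by (rule G.pos_cost_pos_awalk_cost[OF p]) (simp add: len_pos less_imp_le)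
qed

lemma rad_head:
  assumes "e \<in> arcs (core T)"
  shows "rad T (head (core T) e) = rad T (tail (core T) e) + len T e"
proof -
  obtain p where p: "G.awalk (root T) p (tail (core T) e)"
    using unique_walk[of "tail (core T) e"] assms by auto
  have "G.awalk (root T) (p @ [e]) (head (core T) e)"
    using G.awalk_appendI[OF p G.arc_implies_awalk[OF assms]] .
  from rad_walk[OF this] rad_walk[OF p] show ?thesis by simp
qed

lemma rad_less: "e \<in> arcs (core T) \<Longrightarrow> rad T (tail (core T) e) < rad T (head (core T) e)"
  using rad_head len_pos by simp

lemma tail_ne_head: "e \<in> arcs (core T) \<Longrightarrow> tail (core T) e \<noteq> head (core T) e"
  using rad_less by force

lemma rad_in_span: "x \<in> incident T v \<Longrightarrow> rad T v \<in> I x"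
  using rad_less by (cases x) (auto simp: incident_def edges_def less_imp_le)

lemma finite_incident [simp]: "finite (incident T v)"
  by (simp add: incident_def)

lemma incident_E: "x \<in> incident T v \<Longrightarrow> x \<in> E"
  by (simp add: incident_def)

lemma E_cases:
  assumes "x \<in> E"
  obtains (arc) e where "x = Inl e" "e \<in> arcs (core T)" | (ray) r where "x = Inr r" "r \<in> rays T"
  using assms by (auto simp: edges_def)

definition lo :: "'e + 'r \<Rightarrow> real" where
  "lo x = (case x of Inl e \<Rightarrow> rad T (tail (core T) e) | Inr r \<Rightarrow> rad T (foot T r))"

lemma span_props:
  assumes "x \<in> E"
  shows "closed (I x)" "is_interval (I x)" "interior (I x) \<noteq> {}" "closure (interior (I x)) = I x"
    "lo x \<in> I x" "\<And>t. t \<in> I x \<Longrightarrow> lo x \<le> t" "0 \<le> lo x"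
proof -
  have "closed (I x) \<and> is_interval (I x) \<and> interior (I x) \<noteq> {} \<and> closure (interior (I x)) = I x
      \<and> lo x \<in> I x \<and> (\<forall>t\<in>I x. lo x \<le> t) \<and> 0 \<le> lo x"
    using assms
  proof (cases rule: E_cases)
    case (arc e)
    then show ?thesis using rad_less[OF arc(2)] rad_nonneg[of "tail (core T) e"]
      by (simp add: lo_def is_interval_cc)
  next
    case (ray r)
    then show ?thesis using rad_nonneg[OF foot_in[OF ray(2)]]
      by (simp add: lo_def is_interval_ci)
  qed
  then show "closed (I x)" "is_interval (I x)" "interior (I x) \<noteq> {}" "closure (interior (I x)) = I x"
    "lo x \<in> I x" "\<And>t. t \<in> I x \<Longrightarrow> lo x \<le> t" "0 \<le> lo x" by auto
qed

lemma form_domD: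
  assumes "u \<in> F"
  shows "x \<notin> E \<Longrightarrow> fst u x = (\<lambda>_. 0)" "x \<notin> E \<Longrightarrow> snd u x = (\<lambda>_. 0)"
    "x \<in> E \<Longrightarrow> H1_on (I x) (fst u x) (snd u x)"
    "v \<in> verts (core T) \<Longrightarrow> x \<in> incident T v \<Longrightarrow> y \<in> incident T v \<Longrightarrow> fst u x (rad T v) = fst u y (rad T v)"
    "v \<in> X \<Longrightarrow> x \<in> incident T v \<Longrightarrow> fst u x (rad T v) = 0"
  using assms unfolding form_dom_def by blast+

lemma form_dom_L2:
  assumes "u \<in> F"
  shows "fst u x \<in> L2g" "snd u x \<in> L2g"
proof -
  have "fst u x \<in> L2g \<and> snd u x \<in> L2g"
  proof (cases "x \<in> E")
    case True
    then show ?thesis using H1_onD(1,2)[OF form_domD(3)[OF assms]] by blast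
  next
    case False
    then show ?thesis using form_domD(1,2)[OF assms False] L2g_0 by (simp add: zero_fun_def)
  qed
  then show "fst u x \<in> L2g" "snd u x \<in> L2g" by auto
qed

lemma form_domI:
  assumes "\<And>x. x \<notin> E \<Longrightarrow> fst u x = (\<lambda>_. 0) \<and> snd u x = (\<lambda>_. 0)"
    "\<And>x. x \<in> E \<Longrightarrow> H1_on (I x) (fst u x) (snd u x)"
    "\<And>v x y. v \<in> verts (core T) \<Longrightarrow> x \<in> incident T v \<Longrightarrow> y \<in> incident T v \<Longrightarrow> fst u x (rad T v) = fst u y (rad T v)"
    "\<And>v x. v \<in> X \<Longrightarrow> x \<in> incident T v \<Longrightarrow> fst u x (rad T v) = 0"
  shows "u \<in> F"
  using assms unfolding form_dom_def by blast

lemma form_dom_add: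
  assumes u: "u \<in> F" and w: "w \<in> F"
  shows "u + w \<in> F"
proof (rule form_domI)
  have p: "fst (u + w) x = fst u x + fst w x" "snd (u + w) x = snd u x + snd w x" for x
    by (simp_all add: plus_fun_def)
  show "fst (u + w) x = (\<lambda>_. 0) \<and> snd (u + w) x = (\<lambda>_. 0)" if "x \<notin> E" for x
    unfolding p form_domD(1,2)[OF u that] form_domD(1,2)[OF w that] by (simp add: plus_fun_def)
  show "H1_on (I x) (fst (u + w) x) (snd (u + w) x)" if "x \<in> E" for x
    unfolding p by (rule H1_on_add[OF form_domD(3)[OF u that] form_domD(3)[OF w that]])
  show "fst (u + w) x (rad T v) = fst (u + w) y (rad T v)"
    if "v \<in> verts (core T)" "x \<in> incident T v" "y \<in> incident T v" for v x y
    unfolding p plus_fun_def form_domD(4)[OF u that] form_domD(4)[OF w that] ..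
  show "fst (u + w) x (rad T v) = 0" if "v \<in> X" "x \<in> incident T v" for v x
    unfolding p plus_fun_def form_domD(5)[OF u that] form_domD(5)[OF w that] by simp
qed

lemma csc_apply [simp]: "fst (csc c u) x t = c * fst u x t" "snd (csc c u) x t = c * snd u x t"
  by (simp_all add: csc_def fscale_def)

lemma form_dom_csc:
  assumes u: "u \<in> F"
  shows "csc c u \<in> F"
proof (rule form_domI)
  show "fst (csc c u) x = (\<lambda>_. 0) \<and> snd (csc c u) x = (\<lambda>_. 0)" if "x \<notin> E" for x
    using form_domD(1,2)[OF u that] by (simp add: fun_eq_iff)
  show "H1_on (I x) (fst (csc c u) x) (snd (csc c u) x)" if "x \<in> E" for x
    using H1_on_cmult[OF form_domD(3)[OF u that], of c] by (simp add: csc_def fscale_def)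
  show "fst (csc c u) x (rad T v) = fst (csc c u) y (rad T v)"
    if "v \<in> verts (core T)" "x \<in> incident T v" "y \<in> incident T v" for v x y
    using form_domD(4)[OF u that] by simp
  show "fst (csc c u) x (rad T v) = 0" if "v \<in> X" "x \<in> incident T v" for v x
    using form_domD(5)[OF u that] by simp
qed

lemma form_dom_0: "0 \<in> F"
  by (rule form_domI) (simp_all add: zero_prod_def zero_fun_def H1_on_0)

lemma subspace_F: "psc.subspace F"
  unfolding psc.subspace_def psc_def by (intro conjI ballI allI form_dom_0 form_dom_add form_dom_csc)

lemma psc_apply: "fst (psc r u) x = rsc r (fst u x)" "snd (psc r u) x = rsc r (snd u x)"
  by (auto simp: psc_def csc_def fscale_def rsc_def scaleR_conv_of_real)

sublocale form_pair psc F "fa T" "ba T"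
proof unfold_locales
  show "fa T u w = fa T w u" "ba T u w = ba T w u" for u w
    by (simp_all add: fa_def ba_def ipg.sym)
  show "0 \<le> fa T u u" "0 \<le> ba T u u" if "u \<in> F" for u
    using that by (auto simp: fa_def ba_def intro!: sum_nonneg ipg.nonneg form_dom_L2)
  have p: "fst (u + w) x = fst u x + fst w x" "snd (u + w) x = snd u x + snd w x" for u w :: "('e + 'r) tpair" and x
    by (simp_all add: plus_fun_def)
  show "fa T (u + w) z = fa T u z + fa T w z" "ba T (u + w) z = ba T u z + ba T w z"
    if "u \<in> F" "w \<in> F" "z \<in> F" for u w z
    unfolding fa_def ba_def p
    using that by (simp_all only: ipg.add form_dom_L2 sum.distrib add_divide_distrib)
  show "fa T (psc c u) w = c * fa T u w" "ba T (psc c u) w = c * ba T u w" if "u \<in> F" "w \<in> F" for c u w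
    unfolding fa_def ba_def psc_apply
    using that by (simp_all only: ipg.sc form_dom_L2 sum_distrib_left[symmetric] times_divide_eq_right)
qed (rule subspace_F)

text \<open>Boundary terms are regrouped from edges to vertices. An arc contributes at its two
  distinct ends, a half-line only at its foot.\<close>

lemma boundary_sum:
  fixes g :: "'e + 'r \<Rightarrow> real \<Rightarrow> real"
  shows "(\<Sum>x\<in>E. case x of Inl e \<Rightarrow> g x (rad T (head (core T) e)) - g x (rad T (tail (core T) e))
      | Inr r \<Rightarrow> - g x (rad T (foot T r)))
    = - (\<Sum>v\<in>verts (core T). \<Sum>x\<in>incident T v. if starts_at T x v then g x (rad T v) else - g x (rad T v))"
    (is "_ = - ?R")
proof -
  let ?h = "\<lambda>x v. if starts_at T x v then g x (rad T v) else - g x (rad T v)"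
  have "?R = (\<Sum>x\<in>E. \<Sum>v\<in>{v \<in> verts (core T). starts_at T x v \<or> ends_at T x v}. ?h x v)"
    unfolding incident_def by (rule sum.swap_restrict) simp_all
  also have "\<dots> = (\<Sum>x\<in>E. - (case x of Inl e \<Rightarrow> g x (rad T (head (core T) e)) - g x (rad T (tail (core T) e))
      | Inr r \<Rightarrow> - g x (rad T (foot T r))))"
  proof (rule sum.cong[OF refl])
    fix x assume "x \<in> E"
    then show "(\<Sum>v\<in>{v \<in> verts (core T). starts_at T x v \<or> ends_at T x v}. ?h x v) =
      - (case x of Inl e \<Rightarrow> g x (rad T (head (core T) e)) - g x (rad T (tail (core T) e))
      | Inr r \<Rightarrow> - g x (rad T (foot T r)))"
    proof (cases rule: E_cases)
      case (arc e)
      then have "{v \<in> verts (core T). starts_at T x v \<or> ends_at T x v} = {tail (core T) e, head (core T) e}"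
        by auto
      then show ?thesis using arc tail_ne_head[of e] by simp
    next
      case (ray r)
      then have "{v \<in> verts (core T). starts_at T x v \<or> ends_at T x v} = {foot T r}"
        using foot_in by auto
      then show ?thesis using ray by simp
    qed
  qed
  finally show ?thesis by (simp add: sum_negf)
qed

lemma eigp_F: "u \<in> eigp T X c \<Longrightarrow> u \<in> F"
  by (simp add: eigp_def)

text \<open>By continuity w has one value at v, read off on an arbitrary incident edge; it factors
  out and leaves the sum of the normal derivatives. At vertices of X this value is 0.\<close>

lemma vertex_terms:
  assumes w: "w \<in> F"
  shows "(\<Sum>x\<in>E. case x of
        Inl e \<Rightarrow> gw (rad T (head (core T) e)) * (p x (rad T (head (core T) e)) \<bullet> fst w x (rad T (head (core T) e)))
          - gw (rad T (tail (core T) e)) * (p x (rad T (tail (core T) e)) \<bullet> fst w x (rad T (tail (core T) e)))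
      | Inr r \<Rightarrow> - (gw (rad T (foot T r)) * (p x (rad T (foot T r)) \<bullet> fst w x (rad T (foot T r)))))
    = - (\<Sum>v\<in>verts (core T) - X. gw (rad T v) *
        ((\<Sum>x\<in>incident T v. normal_deriv T p v x) \<bullet> fst w (SOME x. x \<in> incident T v) (rad T v)))"
proof -
  have v: "(\<Sum>x\<in>incident T v. if starts_at T x v then gw (rad T v) * (p x (rad T v) \<bullet> fst w x (rad T v))
        else - (gw (rad T v) * (p x (rad T v) \<bullet> fst w x (rad T v))))
      = gw (rad T v) * ((\<Sum>x\<in>incident T v. normal_deriv T p v x) \<bullet> fst w (SOME x. x \<in> incident T v) (rad T v))"
    if "v \<in> verts (core T)" for v
  proof -
    have "fst w x (rad T v) = fst w (SOME x. x \<in> incident T v) (rad T v)" if x: "x \<in> incident T v" for x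
      using form_domD(4)[OF w \<open>v \<in> verts (core T)\<close> x] someI[of "\<lambda>x. x \<in> incident T v", OF x] by blast
    then show ?thesis
      by (simp add: inner_sum_left sum_distrib_left normal_deriv_def if_distrib cong: if_cong)
        (intro sum.cong, auto)
  qed
  have z: "gw (rad T v) * ((\<Sum>x\<in>incident T v. normal_deriv T p v x) \<bullet> fst w (SOME x. x \<in> incident T v) (rad T v)) = 0"
    if "v \<in> X" for v
  proof (cases "incident T v = {}")
    case False
    then have "(SOME x. x \<in> incident T v) \<in> incident T v" by (simp add: some_in_eq)
    then show ?thesis using form_domD(5)[OF w that] by simp
  qed simp
  have "(\<Sum>v\<in>verts (core T). gw (rad T v) *
        ((\<Sum>x\<in>incident T v. normal_deriv T p v x) \<bullet> fst w (SOME x. x \<in> incident T v) (rad T v)))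
      = (\<Sum>v\<in>verts (core T) - X. gw (rad T v) *
        ((\<Sum>x\<in>incident T v. normal_deriv T p v x) \<bullet> fst w (SOME x. x \<in> incident T v) (rad T v)))"
    by (rule sum.mono_neutral_right) (use z in auto)
  then show ?thesis
    unfolding boundary_sum[of "\<lambda>x t. gw t * (p x t \<bullet> fst w x t)"]
    using sum.cong[OF refl v, of "verts (core T)"] by simp
qed

lemma green_tree_general:
  assumes u: "\<And>x. x \<in> E \<Longrightarrow> eig_on c (I x) (fst u x) (snd u x)" and w: "w \<in> F"
  shows "2 * (fa T u w - c * ba T u w) = - (\<Sum>v\<in>verts (core T) - X. gw (rad T v) *
    ((\<Sum>x\<in>incident T v. normal_deriv T (snd u) v x) \<bullet> fst w (SOME x. x \<in> incident T v) (rad T v)))"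
proof -
  have eq: "ip (snd u x) (snd w x) - 2 * c * ip (fst u x) (fst w x) = (case x of
        Inl e \<Rightarrow> gw (rad T (head (core T) e)) * (snd u x (rad T (head (core T) e)) \<bullet> fst w x (rad T (head (core T) e)))
          - gw (rad T (tail (core T) e)) * (snd u x (rad T (tail (core T) e)) \<bullet> fst w x (rad T (tail (core T) e)))
      | Inr r \<Rightarrow> - (gw (rad T (foot T r)) * (snd u x (rad T (foot T r)) \<bullet> fst w x (rad T (foot T r)))))"
    if x: "x \<in> E" for x
    using x
  proof (cases rule: E_cases)
    case (arc e)
    have "eig_on c {rad T (tail (core T) e)..rad T (head (core T) e)} (fst u x) (snd u x)"
      "H1_on {rad T (tail (core T) e)..rad T (head (core T) e)} (fst w x) (snd w x)"
      using u[OF x] form_domD(3)[OF w x] arc by auto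
    from green_compact[OF this less_imp_le[OF rad_less[OF arc(2)]]] show ?thesis by (simp add: arc)
  next
    case (ray r)
    have "eig_on c {rad T (foot T r)..} (fst u x) (snd u x)"
      "H1_on {rad T (foot T r)..} (fst w x) (snd w x)"
      using u[OF x] form_domD(3)[OF w x] ray by auto
    from green_ray[OF this] show ?thesis by (simp add: ray)
  qed
  have "2 * fa T u w - 2 * c * ba T u w = (\<Sum>x\<in>E. ip (snd u x) (snd w x) - 2 * c * ip (fst u x) (fst w x))"
  proof -
    have "2 * fa T u w = (\<Sum>x\<in>E. ip (snd u x) (snd w x))" by (simp add: fa_def)
    moreover have "2 * c * ba T u w = (\<Sum>x\<in>E. 2 * c * ip (fst u x) (fst w x))"
      unfolding ba_def by (rule sum_distrib_left)
    ultimately show ?thesis by (simp only: sum_subtractf)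
  qed
  also have "\<dots> = (\<Sum>x\<in>E. case x of
        Inl e \<Rightarrow> gw (rad T (head (core T) e)) * (snd u x (rad T (head (core T) e)) \<bullet> fst w x (rad T (head (core T) e)))
          - gw (rad T (tail (core T) e)) * (snd u x (rad T (tail (core T) e)) \<bullet> fst w x (rad T (tail (core T) e)))
      | Inr r \<Rightarrow> - (gw (rad T (foot T r)) * (snd u x (rad T (foot T r)) \<bullet> fst w x (rad T (foot T r)))))"
    using eq by (rule sum.cong[OF refl])
  finally show ?thesis unfolding vertex_terms[OF w] by (simp add: algebra_simps)
qed

lemma green_tree:
  assumes u: "u \<in> eigp T X c" and w: "w \<in> F"
  shows "fa T u w = c * ba T u w"
proof -
  have "2 * (fa T u w - c * ba T u w) = 0"
    by (subst green_tree_general[OF _ w]) (use u in \<open>auto simp: eigp_def\<close>)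
  then show ?thesis by simp
qed

lemma eigp_orthogonal:
  assumes "u \<in> eigp T X c" "w \<in> eigp T X d" "c \<noteq> d"
  shows "ba T u w = 0"
proof -
  have "c * ba T u w = d * ba T u w"
    using green_tree[OF assms(1) eigp_F[OF assms(2)]] green_tree[OF assms(2) eigp_F[OF assms(1)]]
    by (metis A.sym B.sym)
  then show ?thesis using assms(3) by simp
qed

end

section \<open>Green functions on segments\<close>

lemma L2g_of_L2_gauss:
  assumes "L2_gauss I f" "\<And>t. t \<notin> I \<Longrightarrow> g t = 0" "\<And>t. t \<in> I \<Longrightarrow> g t = f t"
  shows "g \<in> L2g"
proof -
  have g: "g = (\<lambda>t. indicat_real I t *\<^sub>R f t)" using assms(2,3) by (auto simp: indicator_def)
  have "(\<lambda>t. (cmod (g t))\<^sup>2) = (\<lambda>t. indicat_real I t *\<^sub>R (cmod (f t))\<^sup>2)"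
    unfolding g by (auto simp: indicator_def)
  then show ?thesis
    using assms(1) unfolding L2_gauss_def L2g_def set_borel_measurable_def set_integrable_def g by simp
qed

lemma L2_gauss_of_L2g:
  assumes g: "g \<in> L2g" and I: "I \<in> sets borel" "\<And>t. t \<in> I \<Longrightarrow> g t = f t"
  shows "L2_gauss I f"
proof -
  have "(\<lambda>t. indicat_real I t *\<^sub>R g t) \<in> L2g" by (rule L2g_cutoff[OF g I(1)])
  moreover have "(\<lambda>t. indicat_real I t *\<^sub>R g t) = (\<lambda>t. indicat_real I t *\<^sub>R f t)"
  proof (rule ext)
    fix t show "indicat_real I t *\<^sub>R g t = indicat_real I t *\<^sub>R f t"
      using I(2)[of t] by (cases "t \<in> I") auto
  qed
  moreover have "(\<lambda>t. (cmod (indicat_real I t *\<^sub>R f t))\<^sup>2) = (\<lambda>t. indicat_real I t *\<^sub>R (cmod (f t))\<^sup>2)"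
    by (auto simp: indicator_def)
  ultimately show ?thesis
    by (simp add: L2_gauss_def set_borel_measurable_def set_integrable_def L2g_def del: real_scaleR_def)
qed

text \<open>Differentiating f'' = 2 t f' - 2 c f shows that f' solves the same equation with c - 1
  in place of c, so on a half-line \<open>caccioppoli\<close> applies to f'.\<close>

lemma eig_on_second_L2g:
  assumes e: "eig_on c J f f'" and J: "J = {s..t} \<or> J = {s..}"
  shows "(\<lambda>x. indicat_real J x *\<^sub>R ((2 * x) *\<^sub>R f' x - (2 * c) *\<^sub>R f x)) \<in> L2g"
proof -
  have H: "H1_on J f f'" and f'c: "continuous_on J f'" using e by (auto simp: eig_on_def)
  note fc = H1_onD(3)[OF H]
  have kc: "continuous_on J (\<lambda>x. (2 * x) *\<^sub>R f' x - (2 * c) *\<^sub>R f x)"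
    by (intro continuous_intros fc f'c)
  show ?thesis
  proof (cases "J = {s..t}")
    case True
    then show ?thesis using continuous_bounded_support_L2g[of s t] kc by simp
  next
    case False
    then have J: "J = {s..}" using J by simp
    have int: "x \<in> interior J" if "x > s" for x using that by (simp add: J)
    have d: "(f' has_vector_derivative (2 * x) *\<^sub>R f' x - (2 * c) *\<^sub>R f x) (at x)"
      "(f has_vector_derivative f' x) (at x)" if "x > s" for x
      using e int[OF that] by (auto simp: eig_on_def)
    have "(\<lambda>x. indicat_real {s..} x *\<^sub>R ((2 * x) *\<^sub>R f' x - (2 * c) *\<^sub>R f x)) \<in> L2g"
    proof (rule caccioppoli[where \<kappa> = "c - 1"])
      show "continuous_on {s..} f'" "continuous_on {s..} (\<lambda>x. (2 * x) *\<^sub>R f' x - (2 * c) *\<^sub>R f x)"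
        using f'c kc J by auto
      show "(\<lambda>t. indicat_real {s..} t *\<^sub>R f' t) \<in> L2g"
        using H1_onD(2)[OF H] by (intro L2g_cutoff) auto
      fix x assume x: "s < x"
      show "(f' has_vector_derivative (2 * x) *\<^sub>R f' x - (2 * c) *\<^sub>R f x) (at x)" by (rule d[OF x])
      have "((\<lambda>x. (2 * x) *\<^sub>R f' x) has_vector_derivative (2 * x) *\<^sub>R ((2 * x) *\<^sub>R f' x - (2 * c) *\<^sub>R f x) + 2 *\<^sub>R f' x) (at x)"
        by (rule has_vector_derivative_scaleR[OF _ d(1)[OF x]]) (auto intro!: derivative_eq_intros)
      moreover have "((\<lambda>x. (2 * c) *\<^sub>R f x) has_vector_derivative (2 * c) *\<^sub>R f' x + 0 *\<^sub>R f x) (at x)"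
        by (rule has_vector_derivative_scaleR[OF _ d(2)[OF x]]) auto
      ultimately show "((\<lambda>x. (2 * x) *\<^sub>R f' x - (2 * c) *\<^sub>R f x) has_vector_derivative
          (2 * x) *\<^sub>R ((2 * x) *\<^sub>R f' x - (2 * c) *\<^sub>R f x) - (2 * (c - 1)) *\<^sub>R f' x) (at x)"
        by (rule has_vector_derivative_diff[THEN has_vector_derivative_eq_rhs])
          (simp add: algebra_simps scaleR_2)
    qed
    then show ?thesis by (simp add: J)
  qed
qed

lemma H1_on_zero_of_norm_zero:
  assumes f: "H1_on I f f'" and z: "ip f f = 0" and st: "{s..t} \<subseteq> I" "s < t" and x: "x \<in> {s..t}"
  shows "f x = 0"
proof -
  note L = H1_onD(1)[OF f]
  define V where "V = (\<lambda>x. gw x * (cmod (f x))\<^sup>2)"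
  have c: "continuous_on {s..t} V"
    unfolding V_def using continuous_on_subset[OF H1_onD(3)[OF f] st(1)] by (intro continuous_intros)
  have Vi: "integrable lborel V" unfolding V_def by (rule integrable_weighted_square[OF L])
  have "integral {s..t} V \<le> integral UNIV V"
    by (intro integral_subset_le integrable_HK[OF Vi]) (auto simp: V_def)
  also have "\<dots> = ip f f"
    using integrable_HK(2)[OF Vi, of UNIV] ip_lborel(2)[OF L L]
    by (simp add: V_def power2_norm_eq_inner set_lebesgue_integral_def)
  finally have "integral {s..t} V \<le> 0" using z by simp
  moreover have "0 \<le> integral {s..t} V"
    by (intro Henstock_Kurzweil_Integration.integral_nonneg integrable_HK[OF Vi]) (auto simp: V_def)
  ultimately have "integral {s..t} V = 0" by simp
  moreover have "(integral {s..t} V = 0) = (\<forall>x\<in>{s..t}. V x = 0)"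
    by (rule integral_eq_0_iff) (use c st in \<open>auto simp: V_def\<close>)
  ultimately have "V x = 0" using x by blast
  then show ?thesis by (simp add: V_def)
qed

text \<open>Completeness when the pointwise limit is already known: Fatou's lemma in the second
  index of the Cauchy condition.\<close>

lemma L2g_limit:
  fixes h :: "nat \<Rightarrow> real \<Rightarrow> complex"
  assumes h: "\<And>k. h k \<in> L2g" and lim: "\<And>t. (\<lambda>k. h k t) \<longlonglongrightarrow> g t"
    and cauchy: "\<And>e. e > 0 \<Longrightarrow> \<exists>N. \<forall>i\<ge>N. \<forall>j\<ge>N. ipg.nm (h i - h j) < e"
  shows "g \<in> L2g" "(\<lambda>k. ipg.nm (h k - g)) \<longlonglongrightarrow> 0"
proof -
  have [measurable]: "h k \<in> borel_measurable borel" for k using h L2gD by blast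
  have gm [measurable]: "g \<in> borel_measurable borel"
    by (rule borel_measurable_LIMSEQ_metric[of h]) (use lim in auto)
  have fatou: "h i - g \<in> L2g \<and> ip (h i - g) (h i - g) \<le> e\<^sup>2"
    if e: "e > 0" and N: "\<forall>i\<ge>N. \<forall>j\<ge>N. ipg.nm (h i - h j) < e" and i: "i \<ge> N" for e N i
  proof -
    define u where "u = (\<lambda>j t. ennreal ((cmod (h i t - h (j + N) t))\<^sup>2))"
    have sq: "integrable gauss (\<lambda>t. (cmod (h i t - h (j + N) t))\<^sup>2)" for j
      using L2g_square[OF ipg.F_diff[OF h[of i] h[of "j + N"]]] by (simp add: fun_diff_def)
    have "(\<integral>\<^sup>+t. u j t \<partial>gauss) \<le> ennreal (e\<^sup>2)" for j
    proof -
      have "(\<integral>\<^sup>+t. u j t \<partial>gauss) = ennreal (LINT t|gauss. (cmod (h i t - h (j + N) t))\<^sup>2)"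
        unfolding u_def by (rule nn_integral_eq_integral[OF sq]) simp
      also have "(LINT t|gauss. (cmod (h i t - h (j + N) t))\<^sup>2) = ip (h i - h (j + N)) (h i - h (j + N))"
        by (simp add: ip_square fun_diff_def)
      also have "\<dots> = (ipg.nm (h i - h (j + N)))\<^sup>2"
        by (rule ipg.nm_square[symmetric]) (intro ipg.F_diff h)
      also have "ennreal \<dots> \<le> ennreal (e\<^sup>2)"
      proof (rule ennreal_leI, rule power_mono)
        show "ipg.nm (h i - h (j + N)) \<le> e" using N i by (simp add: less_imp_le)
      qed (intro ipg.nm_nonneg ipg.F_diff h)
      finally show ?thesis .
    qed
    then have "liminf (\<lambda>j. \<integral>\<^sup>+t. u j t \<partial>gauss) \<le> liminf (\<lambda>j::nat. ennreal (e\<^sup>2))"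
      by (intro Liminf_mono always_eventually allI)
    then have "liminf (\<lambda>j. \<integral>\<^sup>+t. u j t \<partial>gauss) \<le> ennreal (e\<^sup>2)"
      by (simp add: Liminf_const)
    moreover have "(\<integral>\<^sup>+t. liminf (\<lambda>j. u j t) \<partial>gauss) \<le> liminf (\<lambda>j. \<integral>\<^sup>+t. u j t \<partial>gauss)"
      by (rule nn_integral_liminf) (simp add: u_def)
    moreover have "liminf (\<lambda>j. u j t) = ennreal ((cmod (h i t - g t))\<^sup>2)" for t
    proof (rule lim_imp_Liminf)
      have "(\<lambda>j. h (j + N) t) \<longlonglongrightarrow> g t" using lim by (rule LIMSEQ_ignore_initial_segment)
      then show "(\<lambda>j. u j t) \<longlonglongrightarrow> ennreal ((cmod (h i t - g t))\<^sup>2)"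
        unfolding u_def by (intro tendsto_intros)
    qed simp
    ultimately have le: "(\<integral>\<^sup>+t. ennreal ((cmod (h i t - g t))\<^sup>2) \<partial>gauss) \<le> ennreal (e\<^sup>2)"
      by simp
    have int: "integrable gauss (\<lambda>t. (cmod (h i t - g t))\<^sup>2)"
    proof (rule integrableI_bounded)
      have "(\<integral>\<^sup>+t. ennreal (norm ((cmod (h i t - g t))\<^sup>2)) \<partial>gauss) \<le> ennreal (e\<^sup>2)" using le by simp
      also have "\<dots> < \<infinity>" by simp
      finally show "(\<integral>\<^sup>+t. ennreal (norm ((cmod (h i t - g t))\<^sup>2)) \<partial>gauss) < \<infinity>" .
    qed measurable
    have "h i - g \<in> L2g" using int by (simp add: L2g_def fun_diff_def)
    moreover have "ip (h i - g) (h i - g) \<le> e\<^sup>2"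
      using le nn_integral_eq_integral[OF int] by (simp add: ip_square fun_diff_def)
    ultimately show ?thesis by blast
  qed
  obtain N where "\<forall>i\<ge>N. \<forall>j\<ge>N. ipg.nm (h i - h j) < 1" using cauchy[of 1] by auto
  from fatou[OF _ this, of N] have "h N - g \<in> L2g" by simp
  from ipg.F_diff[OF h[of N] this] show gL: "g \<in> L2g" by simp
  show "(\<lambda>k. ipg.nm (h k - g)) \<longlonglongrightarrow> 0"
  proof (rule LIMSEQ_I)
    fix r :: real assume r: "0 < r"
    then obtain N where N: "\<forall>i\<ge>N. \<forall>j\<ge>N. ipg.nm (h i - h j) < r / 2" using cauchy[of "r / 2"] by auto
    have "norm (ipg.nm (h k - g) - 0) < r" if "k \<ge> N" for k
    proof -
      have "ip (h k - g) (h k - g) \<le> (r / 2)\<^sup>2" using fatou[OF _ N that] r by simp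
      then have "ipg.nm (h k - g) \<le> r / 2" unfolding ipg.nm_def using r by (intro real_le_lsqrt) auto
      moreover have "0 \<le> ipg.nm (h k - g)" by (intro ipg.nm_nonneg ipg.F_diff h gL)
      ultimately show ?thesis using r by simp
    qed
    then show "\<exists>no. \<forall>n\<ge>no. norm (ipg.nm (h n - g) - 0) < r" by blast
  qed
qed

text \<open>The Dirichlet Green function of the form on \<open>{s..b}\<close> is
  \<open>(\<Phi> (min y \<tau>) - \<Phi> s) (\<Phi> b - \<Phi> (max y \<tau>)) / (\<Phi> b - \<Phi> s)\<close>, where \<open>\<Phi>' = 1 / gw\<close>.\<close>

lemma green_representation_C2:
  fixes g :: "real \<Rightarrow> complex"
  assumes sb: "s < b" and gc: "continuous_on {s..b} g"
    and rep: "\<And>\<tau>. \<tau> \<in> {s..b} \<Longrightarrow> (Phi b - Phi s) *\<^sub>R g \<tau> =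
      (Phi b - Phi \<tau>) *\<^sub>R g s + (Phi \<tau> - Phi s) *\<^sub>R g b
      + (2 * \<sigma>) *\<^sub>R ((Phi b - Phi \<tau>) *\<^sub>R integral {s..\<tau>} (\<lambda>y. (gw y * (Phi y - Phi s)) *\<^sub>R g y)
                 + (Phi \<tau> - Phi s) *\<^sub>R integral {\<tau>..b} (\<lambda>y. (gw y * (Phi b - Phi y)) *\<^sub>R g y))"
  obtains d where
    "\<And>\<tau>. \<tau> \<in> {s..b} \<Longrightarrow> (g has_vector_derivative d \<tau>) (at \<tau> within {s..b})"
    "\<And>\<tau>. \<tau> \<in> {s..b} \<Longrightarrow> (d has_vector_derivative (2 * \<tau>) *\<^sub>R d \<tau> - (2 * \<sigma>) *\<^sub>R g \<tau>) (at \<tau> within {s..b})"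
proof -
  define D where "D = Phi b - Phi s"
  have D: "D > 0" using Phi_less[OF sb] by (simp add: D_def)
  define k1 where "k1 = (\<lambda>y. (gw y * (Phi y - Phi s)) *\<^sub>R g y)"
  define k2 where "k2 = (\<lambda>y. (gw y * (Phi b - Phi y)) *\<^sub>R g y)"
  have kc: "continuous_on {s..b} k1" "continuous_on {s..b} k2"
    unfolding k1_def k2_def by (intro continuous_intros gc)+
  define A where "A = (\<lambda>\<tau>. integral {s..\<tau>} k1)"
  define B where "B = (\<lambda>\<tau>. integral {s..b} k2 - integral {s..\<tau>} k2)"
  have Bq: "integral {\<tau>..b} k2 = B \<tau>" if "\<tau> \<in> {s..b}" for \<tau>
    using Henstock_Kurzweil_Integration.integral_combine[of s \<tau> b k2] that integrable_continuous_real[OF kc(2)]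
    by (simp add: B_def algebra_simps)
  have Ad: "(A has_vector_derivative k1 \<tau>) (at \<tau> within {s..b})" if "\<tau> \<in> {s..b}" for \<tau>
    unfolding A_def by (rule integral_has_vector_derivative[OF kc(1) that])
  have Bd: "(B has_vector_derivative - k2 \<tau>) (at \<tau> within {s..b})" if "\<tau> \<in> {s..b}" for \<tau>
    unfolding B_def
    using has_vector_derivative_diff[OF has_vector_derivative_const integral_has_vector_derivative[OF kc(2) that]]
    by simp
  \<comment> \<open>c is the flux gw g', obtained by differentiating the representation formally;
    its derivative will be - 2 \<sigma> gw g.\<close>
  define c where "c = (\<lambda>\<tau>. (1 / D) *\<^sub>R (g b - g s + (2 * \<sigma>) *\<^sub>R (B \<tau> - A \<tau>)))"
  define d where "d = (\<lambda>\<tau>. (1 / gw \<tau>) *\<^sub>R c \<tau>)"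
  define G where "G = (\<lambda>\<tau>. (1 / D) *\<^sub>R ((Phi b - Phi \<tau>) *\<^sub>R g s + (Phi \<tau> - Phi s) *\<^sub>R g b
      + (2 * \<sigma>) *\<^sub>R ((Phi b - Phi \<tau>) *\<^sub>R A \<tau> + (Phi \<tau> - Phi s) *\<^sub>R B \<tau>)))"
  have gG: "g \<tau> = G \<tau>" if "\<tau> \<in> {s..b}" for \<tau>
  proof -
    have "D *\<^sub>R g \<tau> = D *\<^sub>R G \<tau>"
      using rep[OF that] D Bq[OF that] by (simp add: G_def A_def k1_def k2_def D_def)
    then show ?thesis using D by simp
  qed
  have cd: "(c has_vector_derivative - ((2 * \<sigma> * gw \<tau>) *\<^sub>R g \<tau>)) (at \<tau> within {s..b})" if \<tau>: "\<tau> \<in> {s..b}" for \<tau>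
  proof -
    have "(c has_vector_derivative (1 / D) *\<^sub>R ((2 * \<sigma>) *\<^sub>R (- k2 \<tau> - k1 \<tau>))) (at \<tau> within {s..b})"
      unfolding c_def using Ad[OF \<tau>] Bd[OF \<tau>] by (auto intro!: derivative_eq_intros)
    moreover have "(1 / D) *\<^sub>R ((2 * \<sigma>) *\<^sub>R (- k2 \<tau> - k1 \<tau>)) = - ((2 * \<sigma> * gw \<tau>) *\<^sub>R g \<tau>)"
    proof -
      have "k2 \<tau> + k1 \<tau> = (D * gw \<tau>) *\<^sub>R g \<tau>"
      proof -
        have "k2 \<tau> + k1 \<tau> = (gw \<tau> * (Phi b - Phi \<tau>) + gw \<tau> * (Phi \<tau> - Phi s)) *\<^sub>R g \<tau>"
          by (simp only: k1_def k2_def scaleR_add_left)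
        also have "gw \<tau> * (Phi b - Phi \<tau>) + gw \<tau> * (Phi \<tau> - Phi s) = D * gw \<tau>"
          by (simp add: D_def algebra_simps)
        finally show ?thesis .
      qed
      then have "- k2 \<tau> - k1 \<tau> = - ((D * gw \<tau>) *\<^sub>R g \<tau>)" by (metis minus_add_distrib diff_conv_add_uminus)
      then show ?thesis using D by (simp add: mult_ac)
    qed
    ultimately show ?thesis by simp
  qed
  have Pd: "((\<lambda>\<tau>. Phi b - Phi \<tau>) has_real_derivative - (1 / gw \<tau>)) (at \<tau> within {s..b})"
    "((\<lambda>\<tau>. Phi \<tau> - Phi s) has_real_derivative 1 / gw \<tau>) (at \<tau> within {s..b})" for \<tau>
    by (auto intro!: derivative_eq_intros)
  have gd: "(g has_vector_derivative d \<tau>) (at \<tau> within {s..b})" if \<tau>: "\<tau> \<in> {s..b}" for \<tau>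
  proof -
    have 1: "((\<lambda>\<tau>. (Phi b - Phi \<tau>) *\<^sub>R A \<tau>) has_vector_derivative
        (Phi b - Phi \<tau>) *\<^sub>R k1 \<tau> + (- (1 / gw \<tau>)) *\<^sub>R A \<tau>) (at \<tau> within {s..b})"
      by (rule has_vector_derivative_scaleR[OF Pd(1) Ad[OF \<tau>]])
    have 2: "((\<lambda>\<tau>. (Phi \<tau> - Phi s) *\<^sub>R B \<tau>) has_vector_derivative
        (Phi \<tau> - Phi s) *\<^sub>R (- k2 \<tau>) + (1 / gw \<tau>) *\<^sub>R B \<tau>) (at \<tau> within {s..b})"
      by (rule has_vector_derivative_scaleR[OF Pd(2) Bd[OF \<tau>]])
    have 3: "((\<lambda>\<tau>. (Phi b - Phi \<tau>) *\<^sub>R g s) has_vector_derivative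
        (Phi b - Phi \<tau>) *\<^sub>R 0 + (- (1 / gw \<tau>)) *\<^sub>R g s) (at \<tau> within {s..b})"
      by (rule has_vector_derivative_scaleR[OF Pd(1) has_vector_derivative_const])
    have 4: "((\<lambda>\<tau>. (Phi \<tau> - Phi s) *\<^sub>R g b) has_vector_derivative
        (Phi \<tau> - Phi s) *\<^sub>R 0 + (1 / gw \<tau>) *\<^sub>R g b) (at \<tau> within {s..b})"
      by (rule has_vector_derivative_scaleR[OF Pd(2) has_vector_derivative_const])
    \<comment> \<open>The contributions from differentiating the limits of the two integrals
      cancel.\<close>
    have kk: "(Phi b - Phi \<tau>) *\<^sub>R k1 \<tau> = (Phi \<tau> - Phi s) *\<^sub>R k2 \<tau>"
      by (simp add: k1_def k2_def mult_ac)
    have "(G has_vector_derivative (1 / D) *\<^sub>R ((Phi b - Phi \<tau>) *\<^sub>R 0 + (- (1 / gw \<tau>)) *\<^sub>R g s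
        + ((Phi \<tau> - Phi s) *\<^sub>R 0 + (1 / gw \<tau>) *\<^sub>R g b)
        + (2 * \<sigma>) *\<^sub>R ((Phi b - Phi \<tau>) *\<^sub>R k1 \<tau> + (- (1 / gw \<tau>)) *\<^sub>R A \<tau>
          + ((Phi \<tau> - Phi s) *\<^sub>R (- k2 \<tau>) + (1 / gw \<tau>) *\<^sub>R B \<tau>)))) (at \<tau> within {s..b})"
      unfolding G_def
      by (intro bounded_linear.has_vector_derivative[OF bounded_linear_scaleR_right] has_vector_derivative_add 1 2 3 4)
    then have "(G has_vector_derivative d \<tau>) (at \<tau> within {s..b})"
      by (rule has_vector_derivative_eq_rhs) (subst kk, simp add: d_def c_def algebra_simps)
    then show ?thesis
      by (rule has_vector_derivative_transform[OF \<tau>, rotated]) (use gG in auto)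
  qed
  have dd: "(d has_vector_derivative (2 * \<tau>) *\<^sub>R d \<tau> - (2 * \<sigma>) *\<^sub>R g \<tau>) (at \<tau> within {s..b})" if \<tau>: "\<tau> \<in> {s..b}" for \<tau>
  proof -
    have "((\<lambda>\<tau>. 1 / gw \<tau>) has_real_derivative 2 * \<tau> * (1 / gw \<tau>)) (at \<tau> within {s..b})"
      by (auto intro!: derivative_eq_intros simp: field_simps)
    from has_vector_derivative_scaleR[OF this cd[OF \<tau>]]
    show ?thesis unfolding d_def by (rule has_vector_derivative_eq_rhs) (simp add: field_simps)
  qed
  show ?thesis using that[of d] gd dd by blast
qed

section \<open>The operator graph and eigenpairs\<close>

lemma ramp_deriv:
  assumes "s < b" "y \<noteq> s" "y \<noteq> b"
  shows "((\<lambda>y. Phi (max s (min y b))) has_real_derivative indicat_real {s..b} y / gw y) (at y)"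
proof -
  consider "y < s" | "s < y" "y < b" | "b < y" using assms by linarith
  then show ?thesis
  proof cases
    case 1
    have "((\<lambda>y. Phi (max s (min y b))) has_real_derivative 0) (at y)"
      by (rule has_field_derivative_transform_within_open[of "\<lambda>_. Phi s" _ _ "{..<s}"])
        (use 1 assms in auto)
    then show ?thesis using 1 by simp
  next
    case 2
    have "((\<lambda>y. Phi (max s (min y b))) has_real_derivative 1 / gw y) (at y)"
      by (rule has_field_derivative_transform_within_open[OF Phi_deriv, of "{s<..<b}"])
        (use 2 in auto)
    then show ?thesis using 2 by simp
  next
    case 3
    have "((\<lambda>y. Phi (max s (min y b))) has_real_derivative 0) (at y)"
      by (rule has_field_derivative_transform_within_open[of "\<lambda>_. Phi b" _ _ "{b<..}"])
        (use 3 assms in auto)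
    then show ?thesis using 3 by simp
  qed
qed

text \<open>The Green function with pole \<tau>, times Phi b - Phi s and the vector z. The nested
  min and max freeze each factor outside its own half, so one formula vanishes off {s..b}.\<close>

definition hat :: "real \<Rightarrow> real \<Rightarrow> real \<Rightarrow> complex \<Rightarrow> real \<Rightarrow> complex" where
  "hat s \<tau> b z y = ((Phi (max s (min y \<tau>)) - Phi s) * (Phi b - Phi (max \<tau> (min y b)))) *\<^sub>R z"

definition hat' :: "real \<Rightarrow> real \<Rightarrow> real \<Rightarrow> complex \<Rightarrow> real \<Rightarrow> complex" where
  "hat' s \<tau> b z = seg s \<tau> ((Phi b - Phi \<tau>) *\<^sub>R z) - seg \<tau> b ((Phi \<tau> - Phi s) *\<^sub>R z)"

lemma H1_on_bump:
  assumes "{s..b} \<subseteq> J" "continuous_on J h" "\<And>y. y \<notin> {s..b} \<Longrightarrow> h y = 0"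
    and "h' \<in> L2g" "\<And>y. y \<notin> J \<Longrightarrow> h' y = 0"
    and "finite S" "\<And>y. y \<in> interior J - S \<Longrightarrow> (h has_vector_derivative h' y) (at y)"
  shows "H1_on J h h'"
proof -
  have "h = (\<lambda>y. indicat_real {s..b} y *\<^sub>R h y)"
    using assms(3) by (auto simp: indicator_def fun_eq_iff)
  moreover have "(\<lambda>y. indicat_real {s..b} y *\<^sub>R h y) \<in> L2g"
    by (intro continuous_bounded_support_L2g continuous_on_subset[OF assms(2,1)])
  ultimately have "h \<in> L2g" by simp
  then show ?thesis using assms unfolding H1_on_def by blast
qed

lemma hat_zero: "s < \<tau> \<Longrightarrow> \<tau> < b \<Longrightarrow> y \<le> s \<or> b \<le> y \<Longrightarrow> hat s \<tau> b z y = 0"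
  by (auto simp: hat_def min_def max_def)

lemma hat_H1:
  assumes st: "s < \<tau>" "\<tau> < b" and J: "{s..b} \<subseteq> J"
  shows "H1_on J (hat s \<tau> b z) (hat' s \<tau> b z)"
proof (rule H1_on_bump[OF J, where S = "{s, \<tau>, b}"])
  show "continuous_on J (hat s \<tau> b z)" unfolding hat_def by (intro continuous_intros)
  show "hat s \<tau> b z y = 0" if "y \<notin> {s..b}" for y
    by (rule hat_zero[OF st]) (use that in auto)
  show "hat' s \<tau> b z \<in> L2g" unfolding hat'_def by (intro ipg.F_diff seg_L2g)
  show "hat' s \<tau> b z y = 0" if "y \<notin> J" for y
  proof -
    have "y \<notin> {s..b}" using J that by blast
    moreover have "{s..\<tau>} \<subseteq> {s..b}" "{\<tau>..b} \<subseteq> {s..b}"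
      using st by (simp_all only: atLeastatMost_subset_iff) linarith+
    ultimately have "y \<notin> {s..\<tau>}" "y \<notin> {\<tau>..b}" by blast+
    then show ?thesis by (simp add: hat'_def seg_def fun_diff_def)
  qed
  fix y assume y: "y \<in> interior J - {s, \<tau>, b}"
  have "((\<lambda>y. (Phi (max s (min y \<tau>)) - Phi s) * (Phi b - Phi (max \<tau> (min y b)))) has_real_derivative
      (indicat_real {s..\<tau>} y / gw y - 0) * (Phi b - Phi (max \<tau> (min y b)))
      + (0 - indicat_real {\<tau>..b} y / gw y) * (Phi (max s (min y \<tau>)) - Phi s)) (at y)"
    by (intro DERIV_mult DERIV_diff DERIV_const ramp_deriv) (use st y in auto)
  from has_vector_derivative_scaleR[OF this has_vector_derivative_const[of z]]
  have d: "(hat s \<tau> b z has_vector_derivative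
      ((indicat_real {s..\<tau>} y / gw y - 0) * (Phi b - Phi (max \<tau> (min y b)))
      + (0 - indicat_real {\<tau>..b} y / gw y) * (Phi (max s (min y \<tau>)) - Phi s)) *\<^sub>R z) (at y)"
    by (simp add: hat_def[abs_def])
  have eq: "((indicat_real {s..\<tau>} y / gw y - 0) * (Phi b - Phi (max \<tau> (min y b)))
      + (0 - indicat_real {\<tau>..b} y / gw y) * (Phi (max s (min y \<tau>)) - Phi s)) *\<^sub>R z = hat' s \<tau> b z y"
  proof -
    consider "y < s" | "s < y" "y < \<tau>" | "\<tau> < y" "y < b" | "b < y" using y st by force
    then show ?thesis
      by cases (use st in \<open>auto simp: hat'_def seg_def fun_diff_def indicator_def\<close>)
  qed
  show "(hat s \<tau> b z has_vector_derivative hat' s \<tau> b z y) (at y)" using d unfolding eq .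
qed simp

lemma up_H1:
  assumes sb: "s < b"
  shows "H1_on {s..b} (\<lambda>y. if y \<in> {s..b} then (Phi y - Phi s) *\<^sub>R z else 0) (seg s b z)"
proof (rule H1_on_bump[OF order.refl, where S = "{}"])
  show "seg s b z \<in> L2g" by (rule seg_L2g)
  have "continuous_on {s..b} (\<lambda>y. (Phi y - Phi s) *\<^sub>R z)" by (intro continuous_intros)
  then show "continuous_on {s..b} (\<lambda>y. if y \<in> {s..b} then (Phi y - Phi s) *\<^sub>R z else 0)"
    by (rule continuous_on_eq) auto
  fix y assume y: "y \<in> interior {s..b} - {}"
  have "((\<lambda>y. Phi y - Phi s) has_real_derivative 1 / gw y - 0) (at y)"
    by (intro DERIV_diff DERIV_const Phi_deriv)
  from has_vector_derivative_scaleR[OF this has_vector_derivative_const[of z]]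
  have "((\<lambda>y. (Phi y - Phi s) *\<^sub>R z) has_vector_derivative seg s b z y) (at y)"
    using y by (simp add: seg_def)
  then show "((\<lambda>y. if y \<in> {s..b} then (Phi y - Phi s) *\<^sub>R z else 0) has_vector_derivative seg s b z y) (at y)"
    by (rule has_vector_derivative_transform_within_open[of _ _ _ "{s<..<b}"]) (use y in auto)
qed (auto simp: seg_def)

text \<open>On a half-line the function is continued by 0 beyond b, whence the exceptional point
  b.\<close>

lemma down_H1:
  assumes sb: "s < b" and J: "J = {s..b} \<or> J = {s..}"
  shows "H1_on J (\<lambda>y. if y \<in> {s..b} then (Phi b - Phi y) *\<^sub>R z else 0) (seg s b (- z))"
proof (rule H1_on_bump[where S = "{b}"])
  show "seg s b (- z) \<in> L2g" by (rule seg_L2g)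
  have "continuous_on J (\<lambda>y. (Phi b - Phi (min y b)) *\<^sub>R z)" by (intro continuous_intros)
  then show "continuous_on J (\<lambda>y. if y \<in> {s..b} then (Phi b - Phi y) *\<^sub>R z else 0)"
    by (rule continuous_on_eq) (use J in auto)
  fix y assume y: "y \<in> interior J - {b}"
  then have ys: "s < y" using J by auto
  show "((\<lambda>y. if y \<in> {s..b} then (Phi b - Phi y) *\<^sub>R z else 0) has_vector_derivative seg s b (- z) y) (at y)"
  proof (cases "y < b")
    case True
    have "((\<lambda>y. Phi b - Phi y) has_real_derivative 0 - 1 / gw y) (at y)"
      by (intro DERIV_diff DERIV_const Phi_deriv)
    from has_vector_derivative_scaleR[OF this has_vector_derivative_const[of z]]
    have "((\<lambda>y. (Phi b - Phi y) *\<^sub>R z) has_vector_derivative seg s b (- z) y) (at y)"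
      using ys True by (simp add: seg_def)
    then show ?thesis
      by (rule has_vector_derivative_transform_within_open[of _ _ _ "{s<..<b}"]) (use ys True in auto)
  next
    case False
    then have yb: "b < y" using y by auto
    have "((\<lambda>_. 0) has_vector_derivative seg s b (- z) y) (at y)"
      using yb by (simp add: seg_def)
    then show ?thesis
      by (rule has_vector_derivative_transform_within_open[of _ _ _ "{b<..}"]) (use yb in auto)
  qed
qed (use J in \<open>auto simp: seg_def\<close>)

lemma ip_hat:
  assumes st: "s < \<tau>" "\<tau> < b" and g: "g \<in> L2g" "continuous_on {s..b} g"
  shows "ip g (hat s \<tau> b z) = z \<bullet>
    ((Phi b - Phi \<tau>) *\<^sub>R integral {s..\<tau>} (\<lambda>y. (gw y * (Phi y - Phi s)) *\<^sub>R g y)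
      + (Phi \<tau> - Phi s) *\<^sub>R integral {\<tau>..b} (\<lambda>y. (gw y * (Phi b - Phi y)) *\<^sub>R g y))"
proof -
  have h: "hat s \<tau> b z \<in> L2g" using H1_onD(1)[OF hat_H1[OF st order.refl]] .
  define D where "D = (\<lambda>y. gw y * (g y \<bullet> hat s \<tau> b z y))"
  have D: "integrable lborel D" unfolding D_def by (rule ip_lborel(1)[OF g(1) h])
  have lin: "integral {u..v} (\<lambda>y. k * (z \<bullet> f y)) = k * (z \<bullet> integral {u..v} f)"
    if "continuous_on {u..v} f" for u v k and f :: "real \<Rightarrow> complex"
  proof -
    have "((\<lambda>y. z \<bullet> f y) has_integral z \<bullet> integral {u..v} f) {u..v}"
      using has_integral_linear[OF integrable_integral[OF integrable_continuous_real[OF that]]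
          bounded_linear_inner_right[of z]] unfolding o_def .
    then show ?thesis by (intro integral_unique has_integral_mult_right)
  qed
  have gc: "continuous_on {s..\<tau>} g" "continuous_on {\<tau>..b} g"
    using continuous_on_subset[OF g(2)] st by auto
  have "ip g (hat s \<tau> b z) = (LINT y|lborel. D y)" unfolding D_def by (rule ip_lborel(2)[OF g(1) h])
  also have "\<dots> = (LINT y:{s..b}|lborel. D y)"
    by (rule integral_outside_zero) (use hat_zero[OF st] in \<open>auto simp: D_def\<close>)
  also have "\<dots> = integral {s..b} D" by (rule integrable_HK(2)[OF D]) simp
  also have "\<dots> = integral {s..\<tau>} D + integral {\<tau>..b} D"
    by (rule Henstock_Kurzweil_Integration.integral_combine[symmetric])
      (use st integrable_HK(1)[OF D] in auto)
  also have "integral {s..\<tau>} D = integral {s..\<tau>} (\<lambda>y. (Phi b - Phi \<tau>) * (z \<bullet> ((gw y * (Phi y - Phi s)) *\<^sub>R g y)))"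
    by (rule Henstock_Kurzweil_Integration.integral_cong)
      (use st in \<open>auto simp: D_def hat_def inner_commute\<close>)
  also have "\<dots> = (Phi b - Phi \<tau>) * (z \<bullet> integral {s..\<tau>} (\<lambda>y. (gw y * (Phi y - Phi s)) *\<^sub>R g y))"
    by (rule lin) (intro continuous_intros gc)
  also have "integral {\<tau>..b} D = integral {\<tau>..b} (\<lambda>y. (Phi \<tau> - Phi s) * (z \<bullet> ((gw y * (Phi b - Phi y)) *\<^sub>R g y)))"
    by (rule Henstock_Kurzweil_Integration.integral_cong)
      (use st in \<open>auto simp: D_def hat_def inner_commute\<close>)
  also have "\<dots> = (Phi \<tau> - Phi s) * (z \<bullet> integral {\<tau>..b} (\<lambda>y. (gw y * (Phi b - Phi y)) *\<^sub>R g y))"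
    by (rule lin) (intro continuous_intros gc)
  finally show ?thesis by (simp add: inner_add_right)
qed

lemma ip_zero [simp]: "ip f (\<lambda>_. 0) = 0" "ip (\<lambda>_. 0) f = 0"
  by (simp_all add: ip_def)

context ou_tree
begin

lemma span_form:
  assumes "x \<in> E"
  shows "(\<exists>b>lo x. I x = {lo x..b}) \<or> I x = {lo x..}"
  using assms by (cases rule: E_cases) (use rad_less in \<open>auto simp: lo_def\<close>)

text \<open>The last alternative makes {lo x..b} a neighbourhood of t relative to the edge, so
  derivatives on the segment are derivatives on the edge.\<close>

lemma segment:
  assumes "x \<in> E" "t \<in> I x"
  obtains b where "lo x < b" "{lo x..b} \<subseteq> I x" "t \<in> {lo x..b}" "t < b \<or> I x = {lo x..b}"
proof (cases "I x = {lo x..}")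
  case True
  then show ?thesis using that[of "t + 1"] assms(2) by auto
next
  case False
  then obtain b where "lo x < b" "I x = {lo x..b}" using span_form[OF assms(1)] by auto
  then show ?thesis using that[of b] assms(2) by auto
qed

lemma interior_span:
  assumes "x \<in> E"
  shows "open (interior (I x))" "is_interval (interior (I x))"
  using span_props(2)[OF assms] by (auto simp: is_interval_convex_1 convex_interior)

lemma borel_span: "x \<in> E \<Longrightarrow> I x \<in> sets borel"
  using span_props(1) by (intro borel_closed)

lemma rad_incident:
  assumes "x \<in> incident T v" "{lo x..b} \<subseteq> I x" "lo x < b"
  shows "rad T v = lo x \<or> b \<le> rad T v"
proof -
  have "x \<in> E" using assms by (simp add: incident_def)
  then show ?thesis
  proof (cases rule: E_cases)
    case (arc e)
    then show ?thesis using assms by (auto simp: incident_def lo_def)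
  next
    case (ray r)
    then show ?thesis using assms by (auto simp: incident_def lo_def)
  qed
qed

text \<open>Regularity of eigenfunctions: the eigenvalue equation expresses f'' almost everywhere by
  a continuous function, so the weak derivatives are classical inside the edges.\<close>

lemma OU_imp_eigp:
  assumes "OU T X f (fscale (complex_of_real c) f)"
  shows "\<exists>f'. (f, f') \<in> eigp T X c"
proof -
  obtain f' f'' where H: "H2 T f f' f''" and D: "\<And>v x. v \<in> X \<Longrightarrow> x \<in> incident T v \<Longrightarrow> f x (rad T v) = 0"
    and S: "\<And>v. v \<in> verts (core T) - X \<Longrightarrow> std_cond T f f' v"
    and O: "OU_action T f' f'' (fscale (complex_of_real c) f)"
    using assms unfolding OU_def by blast
  \<comment> \<open>\<open>H2\<close> leaves f' arbitrary off the edges, whereas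
    \<open>H1_on\<close> wants it to be 0 there.\<close>
  define p where "p = (\<lambda>x t. if x \<in> E \<and> t \<in> I x then f' x t else 0)"
  have eig: "eig_on c (I x) (f x) (p x)" if x: "x \<in> E" for x
  proof -
    have h: "continuous_on (I x) (f x)" "continuous_on (I x) (f' x)"
      "L2_gauss (I x) (f x)" "L2_gauss (I x) (f' x)"
      "weak_deriv (interior (I x)) (f x) (f' x)" "weak_deriv (interior (I x)) (f' x) (f'' x)"
      and f0: "\<And>t. t \<notin> I x \<Longrightarrow> f x t = 0"
      using H x unfolding H2_def by blast+
    have hc: "continuous_on (interior (I x)) (f x)" "continuous_on (interior (I x)) (f' x)"
      using h(1,2) continuous_on_subset interior_subset by blast+
    have fd: "(f x has_vector_derivative f' x t) (at t)" if "t \<in> interior (I x)" for t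
      by (rule weak_deriv_AE_continuous[OF interior_span[OF x] hc h(5) _ that]) simp
    have k: "continuous_on (interior (I x)) (\<lambda>t. (2 * t) *\<^sub>R f' x t - (2 * c) *\<^sub>R f x t)"
      by (intro continuous_intros hc)
    have "AE t in lborel. t \<in> I x \<longrightarrow> fscale (complex_of_real c) f x t = - (1 / 2) * f'' x t + complex_of_real t * f' x t"
      using O x unfolding OU_action_def by blast
    then have ae: "AE t in lborel. t \<in> interior (I x) \<longrightarrow> f'' x t = (2 * t) *\<^sub>R f' x t - (2 * c) *\<^sub>R f x t"
    proof eventually_elim
      case (elim t)
      show ?case
      proof
        assume "t \<in> interior (I x)"
        then have "t \<in> I x" using interior_subset by blast
        with elim have "complex_of_real c * f x t = - (1 / 2) * f'' x t + complex_of_real t * f' x t"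
          by (simp add: fscale_def)
        then have "2 * (complex_of_real c * f x t) = - f'' x t + 2 * (complex_of_real t * f' x t)"
          by (simp add: field_simps)
        then show "f'' x t = (2 * t) *\<^sub>R f' x t - (2 * c) *\<^sub>R f x t"
          by (simp add: scaleR_conv_of_real algebra_simps)
      qed
    qed
    have f'd: "(f' x has_vector_derivative (2 * t) *\<^sub>R f' x t - (2 * c) *\<^sub>R f x t) (at t)"
      if "t \<in> interior (I x)" for t
      by (rule weak_deriv_AE_continuous[OF interior_span[OF x] hc(2) k h(6) ae that])
    have pt: "p x t = f' x t" if "t \<in> I x" for t using x that by (simp add: p_def)
    have pti: "p x t = f' x t" if "t \<in> interior (I x)" for t
      using pt interior_subset that by blast
    have pc: "continuous_on (I x) (p x)"
      using h(2) by (rule continuous_on_eq) (simp add: pt)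
    have pd: "(p x has_vector_derivative (2 * t) *\<^sub>R p x t - (2 * c) *\<^sub>R f x t) (at t)"
      if t: "t \<in> interior (I x)" for t
      unfolding pti[OF t] using f'd[OF t]
      by (rule has_vector_derivative_transform_within_open[OF _ interior_span(1)[OF x] t]) (simp add: pti)
    have L: "f x \<in> L2g" "p x \<in> L2g"
      using L2g_of_L2_gauss[OF h(3), of "f x"] L2g_of_L2_gauss[OF h(4), of "p x"] f0 pt
      by (auto simp: p_def)
    show ?thesis
      unfolding eig_on_def H1_on_def
    proof (intro conjI allI impI ballI)
      show "\<exists>S. finite S \<and> (\<forall>t\<in>interior (I x) - S. (f x has_vector_derivative p x t) (at t))"
        using fd by (intro exI[of _ "{}"]) (simp add: pti)
      fix t
      show "f x t = 0" "p x t = 0" if "t \<notin> I x" using f0 that by (simp_all add: p_def)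
      show "(f x has_vector_derivative p x t) (at t)"
        "(p x has_vector_derivative (2 * t) *\<^sub>R p x t - (2 * c) *\<^sub>R f x t) (at t)"
        if "t \<in> interior (I x)" using fd[OF that] pd[OF that] by (simp_all add: pti[OF that])
    qed (fact h(1) pc L)+
  qed
  have "(f, p) \<in> F"
  proof (rule form_domI)
    show "fst (f, p) x = (\<lambda>_. 0) \<and> snd (f, p) x = (\<lambda>_. 0)" if "x \<notin> E" for x
      using H that by (auto simp: H2_def p_def)
    show "H1_on (I x) (fst (f, p) x) (snd (f, p) x)" if "x \<in> E" for x
      using eig[OF that] by (simp add: eig_on_def)
    show "fst (f, p) x (rad T v) = fst (f, p) y (rad T v)"
      if "v \<in> verts (core T)" "x \<in> incident T v" "y \<in> incident T v" for v x y
    proof (cases "v \<in> X")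
      case True
      then show ?thesis using D[OF True] that by simp
    next
      case False
      then have "std_cond T f f' v" using S that by blast
      then show ?thesis using that unfolding std_cond_def fst_conv by blast
    qed
    show "fst (f, p) x (rad T v) = 0" if "v \<in> X" "x \<in> incident T v" for v x
      using D that by simp
  qed
  moreover have "(\<Sum>x\<in>incident T v. normal_deriv T p v x) = 0" if "v \<in> verts (core T) - X" for v
  proof -
    have "(\<Sum>x\<in>incident T v. normal_deriv T p v x) = (\<Sum>x\<in>incident T v. normal_deriv T f' v x)"
      by (rule sum.cong) (auto simp: normal_deriv_def p_def rad_in_span incident_E)
    then show ?thesis using S[OF that] by (simp add: std_cond_def)
  qed
  ultimately have "(f, p) \<in> eigp T X c" using eig by (simp add: eigp_def)
  then show ?thesis by blast
qed

text \<open>f'' is defined by the equation; its square integrability on half-lines is the content of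
  \<open>eig_on_second_L2g\<close>.\<close>

lemma eigp_imp_OU:
  assumes u: "u \<in> eigp T X c"
  shows "OU T X (fst u) (fscale (complex_of_real c) (fst u))"
proof -
  have uF: "u \<in> F" using u by (rule eigp_F)
  define f'' where "f'' = (\<lambda>x t. (2 * t) *\<^sub>R snd u x t - (2 * c) *\<^sub>R fst u x t)"
  have "H2 T (fst u) (snd u) f''"
    unfolding H2_def
  proof (intro conjI allI impI ballI)
    show "fst u x t = 0" if "x \<notin> E \<or> t \<notin> I x" for x t
      using form_domD(1,3)[OF uF, of x] H1_onD(4) that by (cases "x \<in> E") auto
    fix x assume x: "x \<in> E"
    have e: "eig_on c (I x) (fst u x) (snd u x)" using u x by (simp add: eigp_def)
    then have H: "H1_on (I x) (fst u x) (snd u x)" and sc: "continuous_on (I x) (snd u x)"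
      and d: "\<And>t. t \<in> interior (I x) \<Longrightarrow> (fst u x has_vector_derivative snd u x t) (at t)"
        "\<And>t. t \<in> interior (I x) \<Longrightarrow> (snd u x has_vector_derivative f'' x t) (at t)"
      by (auto simp: eig_on_def f''_def)
    note h = H1_onD[OF H]
    show "continuous_on (I x) (fst u x)" "continuous_on (I x) (snd u x)" by (fact h(3), fact sc)
    show "L2_gauss (I x) (fst u x)" "L2_gauss (I x) (snd u x)"
      using L2_gauss_of_L2g[OF h(1) borel_span[OF x]] L2_gauss_of_L2g[OF h(2) borel_span[OF x]] by auto
    have "(\<lambda>t. indicat_real (I x) t *\<^sub>R f'' x t) \<in> L2g"
      unfolding f''_def using eig_on_second_L2g[OF e] span_form[OF x] by blast
    then show "L2_gauss (I x) (f'' x)" by (rule L2_gauss_of_L2g) (use borel_span[OF x] in auto)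
    have c: "continuous_on (interior (I x)) (fst u x)" "continuous_on (interior (I x)) (snd u x)"
      using h(3) sc continuous_on_subset interior_subset by blast+
    have c2: "continuous_on (interior (I x)) (f'' x)" unfolding f''_def by (intro continuous_intros c)
    show "weak_deriv (interior (I x)) (fst u x) (snd u x)"
      by (rule weak_deriv_of_C1[OF interior_span[OF x] c d(1)])
    show "weak_deriv (interior (I x)) (snd u x) (f'' x)"
      by (rule weak_deriv_of_C1[OF interior_span[OF x] c(2) c2 d(2)])
  qed
  moreover have "std_cond T (fst u) (snd u) v" if "v \<in> verts (core T) - X" for v
    unfolding std_cond_def
  proof (intro conjI ballI)
    show "fst u x (rad T v) = fst u y (rad T v)" if "x \<in> incident T v" "y \<in> incident T v" for x y
      using form_domD(4)[OF uF _ that] \<open>v \<in> verts (core T) - X\<close> by blast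
    show "(\<Sum>x\<in>incident T v. normal_deriv T (snd u) v x) = 0"
      using u that unfolding eigp_def by blast
  qed
  moreover have "OU_action T (snd u) f'' (fscale (complex_of_real c) (fst u))"
    unfolding OU_action_def
  proof (intro ballI AE_I2 impI)
    fix x t
    show "fscale (complex_of_real c) (fst u) x t = - (1 / 2) * f'' x t + complex_of_real t * snd u x t"
      by (simp add: fscale_def f''_def scaleR_conv_of_real field_simps)
  qed
  ultimately show ?thesis unfolding OU_def using form_domD(5)[OF uF] by blast
qed

section \<open>Point values and null functions of the two forms\<close>

lemma ip_le_forms:
  assumes u: "u \<in> F" and x: "x \<in> E"
  shows "ip (fst u x) (fst u x) \<le> ba T u u" "ip (snd u x) (snd u x) \<le> 2 * fa T u u"
proof -
  have "ip (fst u x) (fst u x) \<le> (\<Sum>x\<in>E. ip (fst u x) (fst u x))"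
    by (rule member_le_sum[OF x]) (auto intro: ipg.nonneg form_dom_L2[OF u])
  then show "ip (fst u x) (fst u x) \<le> ba T u u" by (simp add: ba_def)
  have "ip (snd u x) (snd u x) \<le> (\<Sum>x\<in>E. ip (snd u x) (snd u x))"
    by (rule member_le_sum[OF x]) (auto intro: ipg.nonneg form_dom_L2[OF u])
  then show "ip (snd u x) (snd u x) \<le> 2 * fa T u u" by (simp add: fa_def)
qed

lemma nm_le_forms:
  assumes u: "u \<in> F" and x: "x \<in> E"
  shows "ipg.nm (fst u x) \<le> B.nm u" "ipg.nm (snd u x) \<le> 2 * A.nm u"
proof -
  show "ipg.nm (fst u x) \<le> B.nm u"
    unfolding ipg.nm_def B.nm_def by (intro real_sqrt_le_mono ip_le_forms assms)
  have "ipg.nm (snd u x) \<le> sqrt (4 * fa T u u)"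
    unfolding ipg.nm_def using ip_le_forms(2)[OF assms] A.nonneg[OF u] by (intro real_sqrt_le_mono) linarith
  then show "ipg.nm (snd u x) \<le> 2 * A.nm u" by (simp add: A.nm_def real_sqrt_mult)
qed

text \<open>Evaluation is continuous for the form norms, locally uniformly on an edge. Hence point
  values are admissible functionals in \<open>minimizing_sequence\<close>, and its Cauchy sequences
  converge uniformly on segments.\<close>

lemma point_bound:
  assumes x: "x \<in> E" and b: "{lo x..b} \<subseteq> I x" "lo x < b"
  obtains C where "C \<ge> 0"
    "\<And>u t. u \<in> F \<Longrightarrow> t \<in> {lo x..b} \<Longrightarrow> cmod (fst u x t) \<le> C * (A.nm u + B.nm u)"
proof -
  obtain C where C: "C \<ge> 0" "\<And>f f' y. H1_on (I x) f f' \<Longrightarrow> y \<in> {lo x..b} \<Longrightarrow> cmod (f y) \<le> C * (ipg.nm f' + ipg.nm f)"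
    using H1_pointwise_bound[OF b(2,1)] by blast
  show ?thesis
  proof (rule that[of "2 * C"])
    fix u t assume u: "u \<in> F" and t: "t \<in> {lo x..b}"
    have "cmod (fst u x t) \<le> C * (ipg.nm (snd u x) + ipg.nm (fst u x))"
      by (rule C(2)[OF form_domD(3)[OF u x] t])
    also have "\<dots> \<le> C * (2 * A.nm u + 2 * B.nm u)"
    proof (intro mult_left_mono C)
      show "ipg.nm (snd u x) + ipg.nm (fst u x) \<le> 2 * A.nm u + 2 * B.nm u"
        using nm_le_forms[OF u x] B.nm_nonneg[OF u] by linarith
    qed
    finally show "cmod (fst u x t) \<le> 2 * C * (A.nm u + B.nm u)" by (simp add: algebra_simps)
  qed (use C in simp)
qed

lemma ba_zero_imp:
  assumes u: "u \<in> F" and z: "ba T u u = 0"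
  shows "fst u x t = 0"
proof (cases "x \<in> E \<and> t \<in> I x")
  case True
  then obtain b where b: "lo x < b" "{lo x..b} \<subseteq> I x" "t \<in> {lo x..b}" using segment by metis
  have "ip (fst u x) (fst u x) = 0"
    using ip_le_forms(1)[OF u] True z ipg.nonneg[OF form_dom_L2(1)[OF u]] by (metis order_antisym_conv)
  from H1_on_zero_of_norm_zero[OF form_domD(3)[OF u] this b(2,1,3)] True show ?thesis by simp
next
  case False
  then show ?thesis using form_domD(1,3)[OF u, of x] H1_onD(4) by (cases "x \<in> E") auto
qed

lemma fa_zero_imp_const:
  assumes u: "u \<in> F" and z: "fa T u u = 0" and x: "x \<in> E" and t: "t \<in> I x"
  shows "fst u x t = fst u x (lo x)"
proof -
  have "ip (snd u x) (snd u x) = 0"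
    using ip_le_forms(2)[OF u x] z ipg.nonneg[OF form_dom_L2(2)[OF u], of x] by simp
  then have "ipg.nm (snd u x) = 0" by (simp add: ipg.nm_def)
  moreover have "{lo x..t} \<subseteq> I x" using segment[OF x t] by (metis atLeastatMost_subset_iff atLeastAtMost_iff order.trans order.refl)
  ultimately show ?thesis
    using H1_increment[OF form_domD(3)[OF u x], of "lo x" t] span_props(6)[OF x t] by simp
qed

text \<open>Without energy, u is constant on every edge; the value 0 at the root is carried by
  continuity along the walk to each vertex.\<close>

lemma kernel_zero:
  assumes u: "u \<in> F" and z: "fa T u u = 0"
    and r: "\<And>x. x \<in> incident T (root T) \<Longrightarrow> fst u x (rad T (root T)) = 0"
  shows "fst u x t = 0"
proof -
  have walk: "G.awalk (root T) p v \<Longrightarrow> x \<in> incident T v \<Longrightarrow> fst u x (rad T v) = 0" for p v x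
  proof (induction p arbitrary: v x rule: rev_induct)
    case Nil
    then have "v = root T" by (simp add: G.awalk_Nil_iff)
    then show ?case using r Nil by simp
  next
    case (snoc e p)
    have e: "e \<in> arcs (core T)" "G.awalk (root T) p (tail (core T) e)" "v = head (core T) e"
      using snoc.prems(1) by (auto simp: G.awalk_Cons_iff G.awalk_Nil_iff)
    have inc: "Inl e \<in> incident T (tail (core T) e)" "Inl e \<in> incident T v"
      using e by (auto simp: incident_def edges_def)
    have xE: "Inl e \<in> E" using inc by (simp add: incident_def)
    have "fst u (Inl e) (rad T v) = fst u (Inl e) (lo (Inl e))"
      by (rule fa_zero_imp_const[OF u z xE rad_in_span[OF inc(2)]])
    also have "\<dots> = 0" using snoc.IH[OF e(2) inc(1)] by (simp add: lo_def)
    finally have "fst u (Inl e) (rad T v) = 0" .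
    moreover have "v \<in> verts (core T)" using e by simp
    ultimately show ?case using form_domD(4)[OF u _ snoc.prems(2) inc(2)] by simp
  qed
  show ?thesis
  proof (cases "x \<in> E \<and> t \<in> I x")
    case True
    then obtain v where v: "v \<in> verts (core T)" "x \<in> incident T v" "lo x = rad T v"
    proof -
      have xE: "x \<in> E" using True by simp
      then show ?thesis
      proof (cases rule: E_cases)
        case (arc e)
        then show ?thesis using that[of "tail (core T) e"] xE by (auto simp: incident_def lo_def)
      next
        case (ray q)
        then show ?thesis using that[of "foot T q"] xE foot_in by (auto simp: incident_def lo_def)
      qed
    qed
    obtain p where "G.awalk (root T) p v" using unique_walk[OF v(1)] by blast
    then show ?thesis using walk v fa_zero_imp_const[OF u z] True by metis
  next
    case False
    then show ?thesis using form_domD(1,3)[OF u, of x] H1_onD(4) by (cases "x \<in> E") auto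
  qed
qed

end

section \<open>Limits of minimising sequences\<close>

lemma inner_zero_imp: "(\<And>z. z \<bullet> V = 0) \<Longrightarrow> V = (0::complex)"
  using inner_eq_zero_iff by blast

context ou_tree
begin

text \<open>The far end of the segment on which vertex hats live; on a half-line it is simply one
  unit from the foot.\<close>

definition hi :: "'e + 'r \<Rightarrow> real" where
  "hi x = (case x of Inl e \<Rightarrow> rad T (head (core T) e) | Inr r \<Rightarrow> rad T (foot T r) + 1)"

lemma lo_less_hi: "x \<in> E \<Longrightarrow> lo x < hi x" and hi_span: "x \<in> E \<Longrightarrow> {lo x..hi x} \<subseteq> I x"
  by (auto simp: lo_def hi_def rad_less elim!: E_cases)

definition single :: "'e + 'r \<Rightarrow> (real \<Rightarrow> complex) \<Rightarrow> (real \<Rightarrow> complex) \<Rightarrow> ('e + 'r) tpair" where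
  "single x h h' = ((\<lambda>y. if y = x then h else (\<lambda>_. 0)), (\<lambda>y. if y = x then h' else (\<lambda>_. 0)))"

lemma single_forms:
  assumes "x \<in> E"
  shows "fa T u (single x h h') = ip (snd u x) h' / 2" "ba T u (single x h h') = ip (fst u x) h"
proof -
  have "(\<Sum>y\<in>E. ip (g y) (if y = x then k else (\<lambda>_. 0))) = ip (g x) k" for g and k :: "real \<Rightarrow> complex"
  proof -
    have "(\<Sum>y\<in>E. ip (g y) (if y = x then k else (\<lambda>_. 0))) = (\<Sum>y\<in>E. if y = x then ip (g y) k else 0)"
      by (rule sum.cong) auto
    also have "\<dots> = ip (g x) k" using assms by simp
    finally show ?thesis .
  qed
  then show "fa T u (single x h h') = ip (snd u x) h' / 2" "ba T u (single x h h') = ip (fst u x) h"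
    by (simp_all add: fa_def ba_def single_def)
qed

lemma single_in_F:
  assumes x: "x \<in> E" and h: "H1_on (I x) h h'" and v: "\<And>v. x \<in> incident T v \<Longrightarrow> h (rad T v) = 0"
  shows "single x h h' \<in> F"
proof (rule form_domI)
  have s: "fst (single x h h') y = (if y = x then h else (\<lambda>_. 0))"
    "snd (single x h h') y = (if y = x then h' else (\<lambda>_. 0))" for y
    by (simp_all add: single_def)
  show "fst (single x h h') y = (\<lambda>_. 0) \<and> snd (single x h h') y = (\<lambda>_. 0)" if "y \<notin> E" for y
    using x that by (auto simp: s)
  show "H1_on (I y) (fst (single x h h') y) (snd (single x h h') y)" if "y \<in> E" for y
    using h H1_on_0 by (simp add: s)
  have z: "fst (single x h h') y (rad T w) = 0" if "y \<in> incident T w" for w y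
    using v that by (auto simp: s)
  show "fst (single x h h') y (rad T w) = fst (single x h h') y' (rad T w)"
    if "w \<in> verts (core T)" "y \<in> incident T w" "y' \<in> incident T w" for w y y'
    using z that by simp
  show "fst (single x h h') y (rad T w) = 0" if "w \<in> X" "y \<in> incident T w" for w y
    using z that by simp
qed

text \<open>Equal to z at v and, on each incident edge, affine in Phi down to 0 at the other end of
  {lo x..hi x}. By \<open>seg\<close>, the energy against it involves only increments.\<close>

definition vertex_hat :: "'v \<Rightarrow> complex \<Rightarrow> ('e + 'r) tpair" where
  "vertex_hat v z =
    ((\<lambda>x t. if x \<in> incident T v \<and> t \<in> {lo x..hi x} then
        (if starts_at T x v then Phi (hi x) - Phi t else Phi t - Phi (lo x)) *\<^sub>R ((1 / (Phi (hi x) - Phi (lo x))) *\<^sub>R z) else 0),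
     (\<lambda>x. if x \<in> incident T v then
        seg (lo x) (hi x) (if starts_at T x v then - ((1 / (Phi (hi x) - Phi (lo x))) *\<^sub>R z) else (1 / (Phi (hi x) - Phi (lo x))) *\<^sub>R z)
        else (\<lambda>_. 0)))"

lemma incident_end:
  assumes "x \<in> incident T v"
  shows "starts_at T x v \<and> rad T v = lo x \<or> \<not> starts_at T x v \<and> rad T v = hi x \<and> I x = {lo x..hi x}"
proof -
  have "x \<in> E" using assms by (simp add: incident_def)
  then show ?thesis
    by (cases rule: E_cases) (use assms in \<open>auto simp: incident_def lo_def hi_def\<close>)
qed

lemma incident_other:
  assumes "x \<in> incident T v" "x \<in> incident T v'" "v \<noteq> v'"
  shows "starts_at T x v \<longleftrightarrow> \<not> starts_at T x v'"
proof -
  have "x \<in> E" using assms by (simp add: incident_def)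
  then show ?thesis
    by (cases rule: E_cases) (use assms in \<open>auto simp: incident_def\<close>)
qed

lemma vertex_hat_value:
  assumes x: "x \<in> incident T v'"
  shows "fst (vertex_hat v z) x (rad T v') = (if v' = v then z else 0)"
proof -
  have xE: "x \<in> E" using x by (simp add: incident_def)
  have D: "Phi (hi x) - Phi (lo x) \<noteq> 0" using Phi_less[OF lo_less_hi[OF xE]] by simp
  show ?thesis
  proof (cases "x \<in> incident T v")
    case False
    then have "v' \<noteq> v" using x by auto
    then show ?thesis using False by (simp add: vertex_hat_def)
  next
    case True
    have "rad T v' \<in> {lo x..hi x}" using incident_end[OF x] lo_less_hi[OF xE] by auto
    then show ?thesis
    proof (cases "v' = v")
      case True
      then show ?thesis using x incident_end[OF x] lo_less_hi[OF xE] D by (auto simp: vertex_hat_def)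
    next
      case False
      then show ?thesis
        using True incident_other[OF True x] incident_end[OF x] lo_less_hi[OF xE] by (auto simp: vertex_hat_def)
    qed
  qed
qed

lemma vertex_hat_in_F:
  assumes v: "v \<in> verts (core T)" "v \<notin> X"
  shows "vertex_hat v z \<in> F"
proof (rule form_domI)
  show "fst (vertex_hat v z) x = (\<lambda>_. 0) \<and> snd (vertex_hat v z) x = (\<lambda>_. 0)" if "x \<notin> E" for x
  proof -
    have "x \<notin> incident T v" using that by (auto simp: incident_def)
    then show ?thesis by (simp add: vertex_hat_def)
  qed
  show "H1_on (I x) (fst (vertex_hat v z) x) (snd (vertex_hat v z) x)" if x: "x \<in> E" for x
  proof (cases "x \<in> incident T v")
    case False
    then show ?thesis using H1_on_0 by (simp add: vertex_hat_def)
  next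
    case True
    define y where "y = (1 / (Phi (hi x) - Phi (lo x))) *\<^sub>R z"
    show ?thesis
    proof (cases "starts_at T x v")
      case S: True
      have "I x = {lo x..hi x} \<or> I x = {lo x..}"
        using x by (cases rule: E_cases) (auto simp: lo_def hi_def)
      from down_H1[OF lo_less_hi[OF x] this, of y]
      show ?thesis using True S by (simp add: vertex_hat_def y_def cong: if_cong)
    next
      case S: False
      then have "I x = {lo x..hi x}" using incident_end[OF True] by auto
      with up_H1[OF lo_less_hi[OF x], of y]
      show ?thesis using True S by (simp add: vertex_hat_def y_def cong: if_cong)
    qed
  qed
  show "fst (vertex_hat v z) x (rad T w) = fst (vertex_hat v z) y (rad T w)"
    if "w \<in> verts (core T)" "x \<in> incident T w" "y \<in> incident T w" for w x y
    using that by (simp add: vertex_hat_value)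
  show "fst (vertex_hat v z) x (rad T w) = 0" if "w \<in> X" "x \<in> incident T w" for w x
    using that v by (auto simp: vertex_hat_value)
qed

text \<open>Against hats the energy of \<open>f k\<close> is a combination of its point values, so
  the asymptotic equation passes to the pointwise limit without any knowledge about limits of the
  derivatives. Hats inside the edges yield the differential equation, vertex hats the Kirchhoff
  condition.\<close>

lemma form_limit:
  fixes f :: "nat \<Rightarrow> ('e + 'r) tpair"
  assumes f: "\<And>k. f k \<in> F"
    and weak: "\<And>w. w \<in> F \<Longrightarrow> (\<lambda>k. fa T (f k) w - \<sigma> * ba T (f k) w) \<longlonglongrightarrow> 0"
    and cauchy: "\<And>e. e > 0 \<Longrightarrow> \<exists>N. \<forall>i\<ge>N. \<forall>j\<ge>N. A.nm (f i - f j) < e \<and> B.nm (f i - f j) < e"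
  obtains u where "u \<in> eigp T X \<sigma>"
    "\<And>w. w \<in> F \<Longrightarrow> (\<lambda>k. ba T (f k) w) \<longlonglongrightarrow> ba T u w"
    "(\<lambda>k. ba T (f k) (f k)) \<longlonglongrightarrow> ba T u u"
proof -
  have fd: "fst (u - w) x t = fst u x t - fst w x t" for u w :: "('e + 'r) tpair" and x t
    by (simp add: fun_diff_def)
  have fdx: "fst (u - w) x = fst u x - fst w x" for u w :: "('e + 'r) tpair" and x
    by (simp add: fun_diff_def)
  have uC: "uniformly_Cauchy_on {lo x..b} (\<lambda>k. fst (f k) x)" if x: "x \<in> E" and b: "lo x < b" "{lo x..b} \<subseteq> I x" for x b
    unfolding uniformly_Cauchy_on_def
  proof (intro allI impI)
    fix e :: real assume e: "e > 0"
    obtain C where C: "C \<ge> 0" "\<And>u t. u \<in> F \<Longrightarrow> t \<in> {lo x..b} \<Longrightarrow> cmod (fst u x t) \<le> C * (A.nm u + B.nm u)"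
      using point_bound[OF x b(2,1)] by blast
    define d where "d = e / (2 * C + 1)"
    have d: "d > 0" using e C by (simp add: d_def)
    obtain N where N: "\<forall>i\<ge>N. \<forall>j\<ge>N. A.nm (f i - f j) < d \<and> B.nm (f i - f j) < d" using cauchy[OF d] by blast
    show "\<exists>M. \<forall>t\<in>{lo x..b}. \<forall>m\<ge>M. \<forall>n\<ge>M. dist (fst (f m) x t) (fst (f n) x t) < e"
    proof (intro exI ballI allI impI)
      fix t m n assume t: "t \<in> {lo x..b}" and mn: "N \<le> m" "N \<le> n"
      have "dist (fst (f m) x t) (fst (f n) x t) = cmod (fst (f m - f n) x t)"
        by (simp add: dist_norm fd)
      also have "\<dots> \<le> C * (A.nm (f m - f n) + B.nm (f m - f n))"
        by (rule C(2)[OF B.F_diff[OF f f] t])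
      also have "\<dots> \<le> C * (d + d)"
        using N mn C by (intro mult_left_mono add_mono) (auto intro: less_imp_le)
      also have "\<dots> < (2 * C + 1) * d" using d by (simp add: algebra_simps)
      also have "\<dots> = e" using C by (simp add: d_def)
      finally show "dist (fst (f m) x t) (fst (f n) x t) < e" .
    qed
  qed
  define g where "g = (\<lambda>x t. if x \<in> E \<and> t \<in> I x then lim (\<lambda>k. fst (f k) x t) else 0)"
  have f0: "fst (f k) x t = 0" if "\<not> (x \<in> E \<and> t \<in> I x)" for k x t
    using form_domD(1,3)[OF f, of x k] H1_onD(4) that by (cases "x \<in> E") auto
  have ulim: "uniform_limit {lo x..b} (\<lambda>k. fst (f k) x) (g x) sequentially"
    if x: "x \<in> E" and b: "lo x < b" "{lo x..b} \<subseteq> I x" for x b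
  proof -
    have "uniform_limit {lo x..b} (\<lambda>k. fst (f k) x) (\<lambda>t. lim (\<lambda>k. fst (f k) x t)) sequentially"
      using Cauchy_uniformly_convergent[OF uC[OF x b]] by (simp add: uniformly_convergent_uniform_limit_iff)
    then show ?thesis
      by (rule uniform_limit_cong[THEN iffD1, rotated 2]) (use x b in \<open>auto simp: g_def subset_iff\<close>)
  qed
  have glim: "(\<lambda>k. fst (f k) x t) \<longlonglongrightarrow> g x t" for x t
  proof (cases "x \<in> E \<and> t \<in> I x")
    case True
    then obtain b where "lo x < b" "{lo x..b} \<subseteq> I x" "t \<in> {lo x..b}" using segment by metis
    then show ?thesis using tendsto_uniform_limitI[OF ulim] True by blast
  next
    case False
    have "g x t = 0" unfolding g_def using False by (rule if_not_P)
    then show ?thesis using f0[OF False] by simp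
  qed
  have gc: "continuous_on {lo x..b} (g x)" if x: "x \<in> E" and b: "lo x < b" "{lo x..b} \<subseteq> I x" for x b
  proof (rule uniform_limit_theorem[OF _ ulim[OF x b]])
    show "\<forall>\<^sub>F k in sequentially. continuous_on {lo x..b} (fst (f k) x)"
      using continuous_on_subset[OF H1_onD(3)[OF form_domD(3)[OF f x]] b(2)] by simp
  qed simp
  have gL: "g x \<in> L2g" and gn: "(\<lambda>k. ipg.nm (fst (f k) x - g x)) \<longlonglongrightarrow> 0" for x
  proof -
    have c: "\<exists>N. \<forall>i\<ge>N. \<forall>j\<ge>N. ipg.nm (fst (f i) x - fst (f j) x) < e" if e: "e > 0" for e
    proof (cases "x \<in> E")
      case True
      obtain N where N: "\<forall>i\<ge>N. \<forall>j\<ge>N. A.nm (f i - f j) < e \<and> B.nm (f i - f j) < e" using cauchy[OF e] by blast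
      have "ipg.nm (fst (f i) x - fst (f j) x) \<le> B.nm (f i - f j)" for i j
        using nm_le_forms(1)[OF B.F_diff[OF f f] True] by (simp only: fdx)
      then show ?thesis using N le_less_trans by blast
    next
      case False
      then have "fst (f i) x = (\<lambda>_. 0)" for i using form_domD(1)[OF f] by blast
      then show ?thesis using e by (auto simp: ipg.nm_def ip_def fun_diff_def)
    qed
    show "g x \<in> L2g" "(\<lambda>k. ipg.nm (fst (f k) x - g x)) \<longlonglongrightarrow> 0"
      using L2g_limit[of "\<lambda>k. fst (f k) x" "g x", OF form_dom_L2(1)[OF f] glim c] by auto
  qed
  have iplim: "(\<lambda>k. ip (fst (f k) x) h) \<longlonglongrightarrow> ip (g x) h" if h: "h \<in> L2g" for x h
  proof -
    have "(\<lambda>k. ip (fst (f k) x - g x) h) \<longlonglongrightarrow> 0"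
    proof (rule Lim_null_comparison)
      show "\<forall>\<^sub>F k in sequentially. norm (ip (fst (f k) x - g x) h) \<le> ipg.nm (fst (f k) x - g x) * ipg.nm h"
        using ipg.cauchy_schwarz[OF ipg.F_diff[OF form_dom_L2(1)[OF f] gL] h] by simp
      show "(\<lambda>k. ipg.nm (fst (f k) x - g x) * ipg.nm h) \<longlonglongrightarrow> 0"
        using tendsto_mult_left_zero[OF gn] .
    qed
    then have "(\<lambda>k. ip (fst (f k) x) h - ip (g x) h) \<longlonglongrightarrow> 0"
      by (simp only: ipg.diff[OF form_dom_L2(1)[OF f] gL h])
    then show ?thesis by (rule LIM_zero_cancel)
  qed
  \<comment> \<open>Strong convergence enters through |f_k|^2 = 2 <f_k, g> - |g|^2 + |f_k -
    g|^2.\<close>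
  have iplim2: "(\<lambda>k. ip (fst (f k) x) (fst (f k) x)) \<longlonglongrightarrow> ip (g x) (g x)" for x
  proof -
    have L: "fst (f k) x \<in> L2g" for k by (rule form_dom_L2(1)[OF f])
    have "(\<lambda>k. ip (fst (f k) x) (g x) + ip (fst (f k) x) (g x) - ip (g x) (g x)
        + (ipg.nm (fst (f k) x - g x))\<^sup>2) \<longlonglongrightarrow> ip (g x) (g x) + ip (g x) (g x) - ip (g x) (g x) + 0\<^sup>2"
      by (intro tendsto_intros iplim gL gn)
    moreover have "ip (fst (f k) x) (g x) + ip (fst (f k) x) (g x) - ip (g x) (g x)
        + (ipg.nm (fst (f k) x - g x))\<^sup>2 = ip (fst (f k) x) (fst (f k) x)" for k
      using ipg.nm_square[OF ipg.F_diff[OF L gL]]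
      by (simp add: ipg.diff ipg.diff2 ipg.F_diff L gL ipg.sym[of "g x" "fst (f k) x"])
    ultimately show ?thesis by simp
  qed
  have balim: "(\<lambda>k. ba T (f k) w) \<longlonglongrightarrow> ba T (g, h) w" if "w \<in> F" for w h
    unfolding ba_def fst_conv by (intro tendsto_sum iplim form_dom_L2(1)[OF that])
  have balim2: "(\<lambda>k. ba T (f k) (f k)) \<longlonglongrightarrow> ba T (g, h) (g, h)" for h
    unfolding ba_def fst_conv by (intro tendsto_sum iplim2)
  have rep: "(Phi b - Phi s) *\<^sub>R g x \<tau> =
      (Phi b - Phi \<tau>) *\<^sub>R g x s + (Phi \<tau> - Phi s) *\<^sub>R g x b
      + (2 * \<sigma>) *\<^sub>R ((Phi b - Phi \<tau>) *\<^sub>R integral {s..\<tau>} (\<lambda>y. (gw y * (Phi y - Phi s)) *\<^sub>R g x y)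
                 + (Phi \<tau> - Phi s) *\<^sub>R integral {\<tau>..b} (\<lambda>y. (gw y * (Phi b - Phi y)) *\<^sub>R g x y))"
    if x: "x \<in> E" and s: "s = lo x" and b: "s < b" "{s..b} \<subseteq> I x" and \<tau>: "\<tau> \<in> {s..b}" for x s b \<tau>
  proof (cases "\<tau> = s \<or> \<tau> = b")
    case True
    then show ?thesis by (auto simp: scaleR_diff_left)
  next
    case False
    then have st: "s < \<tau>" "\<tau> < b" using \<tau> by auto
    define W where "W = (Phi b - Phi \<tau>) *\<^sub>R integral {s..\<tau>} (\<lambda>y. (gw y * (Phi y - Phi s)) *\<^sub>R g x y)
                 + (Phi \<tau> - Phi s) *\<^sub>R integral {\<tau>..b} (\<lambda>y. (gw y * (Phi b - Phi y)) *\<^sub>R g x y)"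
    \<comment> \<open>The defect of the representation formula, shown to be orthogonal to every
      z.\<close>
    define V where "V = (Phi b - Phi \<tau>) *\<^sub>R (g x \<tau> - g x s) - (Phi \<tau> - Phi s) *\<^sub>R (g x b - g x \<tau>) - (2 * \<sigma>) *\<^sub>R W"
    have "z \<bullet> V = 0" for z
    proof -
      define w where "w = single x (hat s \<tau> b z) (hat' s \<tau> b z)"
      have hH: "H1_on (I x) (hat s \<tau> b z) (hat' s \<tau> b z)" by (rule hat_H1[OF st b(2)])
      have wF: "w \<in> F" unfolding w_def
      proof (rule single_in_F[OF x hH])
        fix v assume "x \<in> incident T v"
        then have "rad T v = lo x \<or> b \<le> rad T v" using rad_incident b s by simp
        then show "hat s \<tau> b z (rad T v) = 0" using hat_zero[OF st] s by auto
      qed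
      have sub: "{s..\<tau>} \<subseteq> I x" "{\<tau>..b} \<subseteq> I x" using b(2) st by (auto simp: subset_iff)
      have fk: "fa T (f k) w - \<sigma> * ba T (f k) w =
          (((Phi b - Phi \<tau>) *\<^sub>R z) \<bullet> (fst (f k) x \<tau> - fst (f k) x s)
            - ((Phi \<tau> - Phi s) *\<^sub>R z) \<bullet> (fst (f k) x b - fst (f k) x \<tau>)) / 2 - \<sigma> * ip (fst (f k) x) (hat s \<tau> b z)" for k
        unfolding w_def single_forms[OF x] hat'_def
        using ip_seg_H1[OF form_domD(3)[OF f x] sub(1)] ip_seg_H1[OF form_domD(3)[OF f x] sub(2)] st
        by (simp add: ipg.diff2[OF seg_L2g seg_L2g form_dom_L2(2)[OF f]])
      have "(\<lambda>k. fa T (f k) w - \<sigma> * ba T (f k) w) \<longlonglongrightarrow>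
          (((Phi b - Phi \<tau>) *\<^sub>R z) \<bullet> (g x \<tau> - g x s)
            - ((Phi \<tau> - Phi s) *\<^sub>R z) \<bullet> (g x b - g x \<tau>)) / 2 - \<sigma> * ip (g x) (hat s \<tau> b z)"
        unfolding fk by (intro tendsto_intros glim iplim H1_onD(1)[OF hH]) simp
      have gcs: "continuous_on {s..b} (g x)" using gc[OF x, of b] b s by simp
      from LIMSEQ_unique[OF \<open>(\<lambda>k. fa T (f k) w - \<sigma> * ba T (f k) w) \<longlonglongrightarrow> _\<close> weak[OF wF]]
      have "(((Phi b - Phi \<tau>) *\<^sub>R z) \<bullet> (g x \<tau> - g x s)
            - ((Phi \<tau> - Phi s) *\<^sub>R z) \<bullet> (g x b - g x \<tau>)) / 2 - \<sigma> * (z \<bullet> W) = 0"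
        using ip_hat[OF st gL gcs] by (simp only: W_def)
      then show ?thesis unfolding V_def inner_diff_right inner_scaleR_right inner_scaleR_left
        by (simp add: field_simps)
    qed
    then have "V = 0" by (rule inner_zero_imp)
    then show ?thesis unfolding V_def W_def[symmetric] by (simp add: algebra_simps)
  qed
  \<comment> \<open>Defined intrinsically, because the segment that supplies the derivative below
    depends on the point t.\<close>
  define g' where "g' = (\<lambda>x t. if x \<in> E \<and> t \<in> I x then vector_derivative (g x) (at t within I x) else 0)"
  have C2: "(g x has_vector_derivative g' x t) (at t within I x)"
    "(g' x has_vector_derivative (2 * t) *\<^sub>R g' x t - (2 * \<sigma>) *\<^sub>R g x t) (at t within I x)"
    if x: "x \<in> E" and t: "t \<in> I x" for x t
  proof -
    obtain b where b: "lo x < b" "{lo x..b} \<subseteq> I x" "t \<in> {lo x..b}" "t < b \<or> I x = {lo x..b}"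
      using segment[OF x t] .
    obtain d where d: "\<And>\<tau>. \<tau> \<in> {lo x..b} \<Longrightarrow> (g x has_vector_derivative d \<tau>) (at \<tau> within {lo x..b})"
      "\<And>\<tau>. \<tau> \<in> {lo x..b} \<Longrightarrow> (d has_vector_derivative (2 * \<tau>) *\<^sub>R d \<tau> - (2 * \<sigma>) *\<^sub>R g x \<tau>) (at \<tau> within {lo x..b})"
      using green_representation_C2[OF b(1) gc[OF x b(1,2)] rep[OF x refl b(1,2)]] by blast
    \<comment> \<open>An open set on which limits within the edge and within the segment agree; at a
      right end shared by both nothing has to be removed.\<close>
    define U where "U = (if I x = {lo x..b} then UNIV else {..<b})"
    have U: "open U" "t \<in> U" using b(4) by (auto simp: U_def)
    have IO: "y \<in> {lo x..b} \<and> at y within I x = at y within {lo x..b}" if y: "y \<in> I x" "y \<in> U" for y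
    proof (cases "I x = {lo x..b}")
      case True
      then show ?thesis using y by simp
    next
      case False
      then have yb: "y < b" "lo x \<le> y" using y span_props(6)[OF x] by (auto simp: U_def)
      have "at y within I x = at y within {lo x..b}"
      proof (rule at_within_nhd[of y "{..<b}"])
        show "I x \<inter> {..<b} - {y} = {lo x..b} \<inter> {..<b} - {y}"
          using b(2) span_props(6)[OF x] by force
      qed (use yb in auto)
      then show ?thesis using yb by simp
    qed
    have gd: "g' x y = d y \<and> (g x has_vector_derivative d y) (at y within I x)" if y: "y \<in> I x" "y \<in> U" for y
    proof -
      have 1: "(g x has_vector_derivative d y) (at y within {lo x..b})" using d(1) IO[OF y] by blast
      have "vector_derivative (g x) (at y within {lo x..b}) = d y"
        using vector_derivative_within_closed_interval[OF b(1) _ 1] IO[OF y] by auto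
      then show ?thesis using 1 IO[OF y] x y by (simp add: g'_def)
    qed
    show "(g x has_vector_derivative g' x t) (at t within I x)" using gd[OF t U(2)] by simp
    obtain e where e: "e > 0" "ball t e \<subseteq> U" using U openE by blast
    have "(d has_vector_derivative (2 * t) *\<^sub>R d t - (2 * \<sigma>) *\<^sub>R g x t) (at t within I x)"
      using d(2)[OF b(3)] IO[OF t U(2)] by simp
    then have "(g' x has_vector_derivative (2 * t) *\<^sub>R d t - (2 * \<sigma>) *\<^sub>R g x t) (at t within I x)"
    proof (rule has_vector_derivative_transform_within[OF _ e(1) t])
      fix y assume "y \<in> I x" "dist y t < e"
      then show "d y = g' x y" using gd e(2) by (auto simp: dist_commute subset_iff)
    qed
    then show "(g' x has_vector_derivative (2 * t) *\<^sub>R g' x t - (2 * \<sigma>) *\<^sub>R g x t) (at t within I x)"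
      using gd[OF t U(2)] by simp
  qed
  have contI: "continuous_on (I x) (g x)" "continuous_on (I x) (g' x)" if x: "x \<in> E" for x
    unfolding continuous_on_eq_continuous_within
    using C2[OF x] has_vector_derivative_continuous by blast+
  have C2i: "(g x has_vector_derivative g' x t) (at t)"
    "(g' x has_vector_derivative (2 * t) *\<^sub>R g' x t - (2 * \<sigma>) *\<^sub>R g x t) (at t)"
    if x: "x \<in> E" and t: "t \<in> interior (I x)" for x t
    using C2[OF x, of t] at_within_interior[OF t] interior_subset[of "I x"] t by auto
  have g'L: "g' x \<in> L2g" if x: "x \<in> E" for x
  proof -
    have eq: "(\<lambda>t. indicat_real (I x) t *\<^sub>R g' x t) = g' x" "(\<lambda>t. indicat_real (I x) t *\<^sub>R g x t) = g x"
      by (auto simp: g'_def g_def indicator_def fun_eq_iff)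
    show ?thesis
    proof (cases "I x = {lo x..}")
      case True
      have "t \<in> interior (I x)" if "lo x < t" for t using that by (simp add: True)
      note int = this
      \<comment> \<open>Only g is known to be a limit in the weighted L2 space; the bound on its
        derivative is recovered from the equation.\<close>
      have "(\<lambda>t. indicat_real {lo x..} t *\<^sub>R g' x t) \<in> L2g"
      proof (rule caccioppoli[where g = "g x" and \<kappa> = \<sigma>])
        show "continuous_on {lo x..} (g x)" "continuous_on {lo x..} (g' x)"
          using contI[OF x] unfolding True by blast+
        show "(\<lambda>t. indicat_real {lo x..} t *\<^sub>R g x t) \<in> L2g"
          using gL[of x] unfolding True[symmetric] eq(2) .
      qed (use C2i[OF x int] in blast)+
      then show ?thesis unfolding True[symmetric] eq(1) .
    next
      case False
      then obtain b where "I x = {lo x..b}" using span_form[OF x] by auto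
      then show ?thesis using continuous_bounded_support_L2g[of "lo x" b "g' x"] contI(2)[OF x] eq(1) by simp
    qed
  qed
  have eig: "eig_on \<sigma> (I x) (g x) (g' x)" if x: "x \<in> E" for x
    unfolding eig_on_def H1_on_def
  proof (intro conjI allI impI ballI)
    fix t
    show "g x t = 0" "g' x t = 0" if "t \<notin> I x" using that by (simp_all add: g_def g'_def)
    show "\<exists>S. finite S \<and> (\<forall>t\<in>interior (I x) - S. (g x has_vector_derivative g' x t) (at t))"
      using C2i(1)[OF x] by (intro exI[of _ "{}"]) simp
  qed (fact contI[OF x] gL g'L[OF x] C2i[OF x])+
  define u where "u = (g, g')"
  have uF: "u \<in> F"
  proof (rule form_domI)
    show "fst u x = (\<lambda>_. 0) \<and> snd u x = (\<lambda>_. 0)" if "x \<notin> E" for x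
      using that by (simp add: u_def g_def g'_def)
    show "H1_on (I x) (fst u x) (snd u x)" if "x \<in> E" for x
      using eig[OF that] by (simp add: eig_on_def u_def)
    show "fst u x (rad T v) = fst u y (rad T v)"
      if "v \<in> verts (core T)" "x \<in> incident T v" "y \<in> incident T v" for v x y
    proof -
      have "(\<lambda>k. fst (f k) x (rad T v)) = (\<lambda>k. fst (f k) y (rad T v))"
        using form_domD(4)[OF f that] by (intro ext)
      from LIMSEQ_unique[OF glim[of x "rad T v", unfolded this] glim[of y "rad T v"]]
      show ?thesis by (simp add: u_def)
    qed
    show "fst u x (rad T v) = 0" if "v \<in> X" "x \<in> incident T v" for v x
    proof -
      have "(\<lambda>k. fst (f k) x (rad T v)) = (\<lambda>k. 0)"
        using form_domD(5)[OF f that] by (intro ext)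
      from LIMSEQ_unique[OF glim[of x "rad T v", unfolded this] tendsto_const]
      show ?thesis by (simp add: u_def)
    qed
  qed
  have kirch: "(\<Sum>x\<in>incident T v. normal_deriv T g' v x) = 0" if v: "v \<in> verts (core T) - X" for v
  proof (cases "incident T v = {}")
    case False
    \<comment> \<open>The test vector at v is the Kirchhoff defect itself, so Green's identity
      yields gw times |K|^2 = 0.\<close>
    define K where "K = (\<Sum>x\<in>incident T v. normal_deriv T g' v x)"
    define w where "w = vertex_hat v K"
    have wF: "w \<in> F" unfolding w_def using v by (intro vertex_hat_in_F) auto
    define z where "z = (\<lambda>x. if starts_at T x v then - ((1 / (Phi (hi x) - Phi (lo x))) *\<^sub>R K) else (1 / (Phi (hi x) - Phi (lo x))) *\<^sub>R K)"
    have fav: "fa T y w = (\<Sum>x\<in>E. if x \<in> incident T v then z x \<bullet> (fst y x (hi x) - fst y x (lo x)) else 0) / 2"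
      if y: "y \<in> F" for y
    proof -
      have "ip (snd y x) (snd w x) = (if x \<in> incident T v then z x \<bullet> (fst y x (hi x) - fst y x (lo x)) else 0)"
        if x: "x \<in> E" for x
        using ip_seg_H1[OF form_domD(3)[OF y x] hi_span[OF x] less_imp_le[OF lo_less_hi[OF x]], of "z x"]
        by (simp add: w_def vertex_hat_def z_def)
      then show ?thesis by (simp add: fa_def)
    qed
    have "(\<lambda>k. fa T (f k) w) \<longlonglongrightarrow> fa T u w"
      unfolding fav[OF f] fav[OF uF]
    proof (intro tendsto_divide tendsto_sum tendsto_const)
      fix x
      show "(\<lambda>k. if x \<in> incident T v then z x \<bullet> (fst (f k) x (hi x) - fst (f k) x (lo x)) else 0)
          \<longlonglongrightarrow> (if x \<in> incident T v then z x \<bullet> (fst u x (hi x) - fst u x (lo x)) else 0)"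
        by (auto intro!: tendsto_intros glim simp: u_def)
    qed simp
    then have "(\<lambda>k. fa T (f k) w - \<sigma> * ba T (f k) w) \<longlonglongrightarrow> fa T u w - \<sigma> * ba T u w"
      unfolding u_def by (intro tendsto_intros balim[OF wF])
    from LIMSEQ_unique[OF this weak[OF wF]] have q0: "fa T u w - \<sigma> * ba T u w = 0" .
    have "(\<Sum>v'\<in>verts (core T) - X. gw (rad T v') *
      ((\<Sum>x\<in>incident T v'. normal_deriv T (snd u) v' x) \<bullet> fst w (SOME x. x \<in> incident T v') (rad T v'))) = 0"
      using green_tree_general[OF _ wF, of \<sigma> u] eig q0 by (simp add: u_def)
    also have "(\<Sum>v'\<in>verts (core T) - X. gw (rad T v') *
      ((\<Sum>x\<in>incident T v'. normal_deriv T (snd u) v' x) \<bullet> fst w (SOME x. x \<in> incident T v') (rad T v')))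
      = (\<Sum>v'\<in>verts (core T) - X. if v' = v then gw (rad T v) * (K \<bullet> K) else 0)"
    proof (rule sum.cong[OF refl])
      fix v' assume "v' \<in> verts (core T) - X"
      show "gw (rad T v') * ((\<Sum>x\<in>incident T v'. normal_deriv T (snd u) v' x) \<bullet> fst w (SOME x. x \<in> incident T v') (rad T v'))
        = (if v' = v then gw (rad T v) * (K \<bullet> K) else 0)"
      proof (cases "incident T v' = {}")
        case True
        then show ?thesis using False by auto
      next
        case ne: False
        then have "(SOME x. x \<in> incident T v') \<in> incident T v'" by (simp add: some_in_eq)
        from vertex_hat_value[OF this, of v K] show ?thesis by (simp add: w_def K_def u_def)
      qed
    qed
    also have "\<dots> = gw (rad T v) * (K \<bullet> K)" using v by simp
    finally show ?thesis by (simp add: K_def[symmetric])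
  qed simp
  have "u \<in> eigp T X \<sigma>" using uF eig kirch by (simp add: eigp_def u_def)
  then show ?thesis using that[of u] balim balim2 by (simp add: u_def)
qed

end

section \<open>Bounds for the enumerated eigenvalues\<close>

context psd_form
begin

lemma sum_mem: "(\<And>i. i \<in> S \<Longrightarrow> f i \<in> F) \<Longrightarrow> sum f S \<in> F"
  by (rule subspace_sum[OF F])

lemma zero_left: "h \<in> F \<Longrightarrow> b 0 h = 0"
  using sc[OF F_0, of h 0] by simp

lemma sum_left:
  assumes "\<And>i. i \<in> S \<Longrightarrow> f i \<in> F" "h \<in> F"
  shows "b (sum f S) h = (\<Sum>i\<in>S. b (f i) h)"
  using assms(1)
proof (induction S rule: infinite_finite_induct)
  case (insert i S)
  then show ?case using sum_mem[of S f] assms(2) by (simp add: add)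
qed (simp_all add: zero_left assms(2))

lemma sum_right:
  assumes "\<And>i. i \<in> S \<Longrightarrow> f i \<in> F" "h \<in> F"
  shows "b h (sum f S) = (\<Sum>i\<in>S. b h (f i))"
  using sum_left[OF assms] by (simp add: sym[of h])

lemma sum_orthogonal:
  assumes S: "finite S" and f: "\<And>i. i \<in> S \<Longrightarrow> f i \<in> F"
    and o: "\<And>i j. i \<in> S \<Longrightarrow> j \<in> S \<Longrightarrow> i \<noteq> j \<Longrightarrow> b (f i) (f j) = 0"
  shows "b (sum f S) (sum f S) = (\<Sum>i\<in>S. b (f i) (f i))"
proof -
  have "b (sum f S) (sum f S) = (\<Sum>i\<in>S. b (f i) (sum f S))"
    by (rule sum_left[OF f sum_mem[OF f]])
  also have "\<dots> = (\<Sum>i\<in>S. b (f i) (f i))"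
  proof (rule sum.cong[OF refl])
    fix i assume i: "i \<in> S"
    have "b (f i) (sum f S) = (\<Sum>j\<in>S. b (f i) (f j))" by (rule sum_right[OF f f[OF i]])
    also have "\<dots> = (\<Sum>j\<in>S. if j = i then b (f i) (f i) else 0)"
      by (rule sum.cong[OF refl]) (use o i in auto)
    also have "\<dots> = b (f i) (f i)" using S i by simp
    finally show "b (f i) (sum f S) = b (f i) (f i)" .
  qed
  finally show ?thesis .
qed

end

lemma eig_on_cmult:
  assumes "eig_on c J f f'"
  shows "eig_on c J (\<lambda>t. \<gamma> * f t) (\<lambda>t. \<gamma> * f' t)"
  unfolding eig_on_def
proof (intro conjI ballI)
  show "H1_on J (\<lambda>t. \<gamma> * f t) (\<lambda>t. \<gamma> * f' t)" using assms by (auto simp: eig_on_def intro: H1_on_cmult)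
  show "continuous_on J (\<lambda>t. \<gamma> * f' t)" using assms by (auto simp: eig_on_def intro!: continuous_intros)
  fix t assume "t \<in> interior J"
  then have d: "(f has_vector_derivative f' t) (at t)"
    "(f' has_vector_derivative (2 * t) *\<^sub>R f' t - (2 * c) *\<^sub>R f t) (at t)"
    using assms by (auto simp: eig_on_def)
  show "((\<lambda>t. \<gamma> * f t) has_vector_derivative \<gamma> * f' t) (at t)"
    by (rule has_vector_derivative_mult_right[OF d(1)])
  have "((\<lambda>t. \<gamma> * f' t) has_vector_derivative \<gamma> * ((2 * t) *\<^sub>R f' t - (2 * c) *\<^sub>R f t)) (at t)"
    by (rule has_vector_derivative_mult_right[OF d(2)])
  then show "((\<lambda>t. \<gamma> * f' t) has_vector_derivative (2 * t) *\<^sub>R (\<gamma> * f' t) - (2 * c) *\<^sub>R (\<gamma> * f t)) (at t)"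
    by (simp add: right_diff_distrib)
qed

lemma eig_on_add:
  assumes "eig_on c J f f'" "eig_on c J g g'"
  shows "eig_on c J (f + g) (f' + g')"
  unfolding eig_on_def
proof (intro conjI ballI)
  show "H1_on J (f + g) (f' + g')" using assms by (auto simp: eig_on_def intro: H1_on_add)
  show "continuous_on J (f' + g')" using assms by (auto simp: eig_on_def plus_fun_def intro!: continuous_intros)
  fix t assume "t \<in> interior J"
  then have d: "(f has_vector_derivative f' t) (at t)"
    "(f' has_vector_derivative (2 * t) *\<^sub>R f' t - (2 * c) *\<^sub>R f t) (at t)"
    "(g has_vector_derivative g' t) (at t)"
    "(g' has_vector_derivative (2 * t) *\<^sub>R g' t - (2 * c) *\<^sub>R g t) (at t)"
    using assms by (auto simp: eig_on_def)
  show "(f + g has_vector_derivative (f' + g') t) (at t)"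
    using has_vector_derivative_add[OF d(1,3)] by (simp add: plus_fun_def)
  show "(f' + g' has_vector_derivative (2 * t) *\<^sub>R (f' + g') t - (2 * c) *\<^sub>R (f + g) t) (at t)"
    using has_vector_derivative_add[OF d(2,4)] by (simp add: plus_fun_def algebra_simps)
qed

lemma sum_fun2_apply: "(\<Sum>i\<in>S. g i) x t = (\<Sum>i\<in>S. g i x t)"
  for g :: "'i \<Rightarrow> 'x \<Rightarrow> real \<Rightarrow> complex"
  by (induction S rule: infinite_finite_induct) (simp_all add: plus_fun_def zero_fun_def)

context ou_tree
begin

lemma eigp_csc:
  assumes u: "u \<in> eigp T X c"
  shows "csc \<gamma> u \<in> eigp T X c"
  unfolding eigp_def mem_Collect_eq
proof (intro conjI ballI)
  show "csc \<gamma> u \<in> F" by (rule form_dom_csc[OF eigp_F[OF u]])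
  show "eig_on c (I x) (fst (csc \<gamma> u) x) (snd (csc \<gamma> u) x)" if "x \<in> E" for x
    using eig_on_cmult[of c "I x" "fst u x" "snd u x" \<gamma>] u that by (simp add: eigp_def csc_def fscale_def)
  show "(\<Sum>x\<in>incident T v. normal_deriv T (snd (csc \<gamma> u)) v x) = 0" if "v \<in> verts (core T) - X" for v
  proof -
    have "(\<Sum>x\<in>incident T v. normal_deriv T (snd (csc \<gamma> u)) v x) = \<gamma> * (\<Sum>x\<in>incident T v. normal_deriv T (snd u) v x)"
      unfolding sum_distrib_left by (rule sum.cong) (auto simp: normal_deriv_def)
    then show ?thesis using u that by (simp add: eigp_def)
  qed
qed

lemma eigp_add:
  assumes u: "u \<in> eigp T X c" and w: "w \<in> eigp T X c"
  shows "u + w \<in> eigp T X c"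
  unfolding eigp_def mem_Collect_eq
proof (intro conjI ballI)
  have p: "fst (u + w) x = fst u x + fst w x" "snd (u + w) x = snd u x + snd w x" for x
    by (simp_all add: plus_fun_def)
  show "u + w \<in> F" by (rule form_dom_add[OF eigp_F[OF u] eigp_F[OF w]])
  show "eig_on c (I x) (fst (u + w) x) (snd (u + w) x)" if "x \<in> E" for x
    unfolding p using u w that by (intro eig_on_add) (auto simp: eigp_def)
  show "(\<Sum>x\<in>incident T v. normal_deriv T (snd (u + w)) v x) = 0" if "v \<in> verts (core T) - X" for v
  proof -
    have "(\<Sum>x\<in>incident T v. normal_deriv T (snd (u + w)) v x)
        = (\<Sum>x\<in>incident T v. normal_deriv T (snd u) v x) + (\<Sum>x\<in>incident T v. normal_deriv T (snd w) v x)"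
      unfolding sum.distrib[symmetric] by (rule sum.cong) (auto simp: normal_deriv_def p plus_fun_def)
    then show ?thesis using u w that by (simp add: eigp_def)
  qed
qed

lemma eigp_0: "0 \<in> eigp T X c"
proof -
  have "eig_on c J (\<lambda>_. 0) (\<lambda>_. 0)" for J by (simp add: eig_on_def H1_on_0)
  moreover have "normal_deriv T (snd (0 :: ('e + 'r) tpair)) v x = 0" for v x
    by (simp add: normal_deriv_def zero_prod_def zero_fun_def cong: if_cong)
  ultimately show ?thesis
    using form_dom_0 by (simp add: eigp_def zero_fun_def)
qed

lemma eigp_sum: "(\<And>i. i \<in> S \<Longrightarrow> f i \<in> eigp T X c) \<Longrightarrow> sum f S \<in> eigp T X c"
  by (induction S rule: infinite_finite_induct) (auto simp: eigp_0 eigp_add)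

lemma ba_cong: "fst u = fst u' \<Longrightarrow> ba T u w = ba T u' w" "fst u = fst u' \<Longrightarrow> ba T w u = ba T w u'"
  by (simp_all add: ba_def)

text \<open>The forms are real-linear only; this reduces a complex multiple to real multiples of u
  and \<open>csc \<i> u\<close>.\<close>

lemma csc_split: "csc \<gamma> u = psc (Re \<gamma>) u + psc (Im \<gamma>) (csc \<i> u)"
proof (rule prod_eqI)
  have *: "\<gamma> * z = complex_of_real (Re \<gamma>) * z + complex_of_real (Im \<gamma>) * (\<i> * z)" for z
    by (subst complex_eq[of \<gamma>]) (simp add: algebra_simps)
  show "fst (csc \<gamma> u) = fst (psc (Re \<gamma>) u + psc (Im \<gamma>) (csc \<i> u))"
    by (intro ext) (simp add: psc_def plus_fun_def * [symmetric])
  show "snd (csc \<gamma> u) = snd (psc (Re \<gamma>) u + psc (Im \<gamma>) (csc \<i> u))"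
    by (intro ext) (simp add: psc_def plus_fun_def * [symmetric])
qed

lemma ba_imag:
  shows "ba T (csc \<i> u) w = - ba T u (csc \<i> w)" "ba T (csc \<i> u) (csc \<i> w) = ba T u w"
proof -
  have "(\<i> * a) \<bullet> b = - (a \<bullet> (\<i> * b))" "(\<i> * a) \<bullet> (\<i> * b) = a \<bullet> b" for a b :: complex
    by (simp_all add: inner_complex_def)
  then show "ba T (csc \<i> u) w = - ba T u (csc \<i> w)" "ba T (csc \<i> u) (csc \<i> w) = ba T u w"
    by (simp_all add: ba_def ip_def sum_negf)
qed

text \<open>The hermitian product, complex-linear in the first argument: multiplying w by \<i> moves
  the imaginary part into the real form.\<close>

definition hp :: "('e + 'r) tpair \<Rightarrow> ('e + 'r) tpair \<Rightarrow> complex" where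
  "hp u w = Complex (ba T u w) (ba T u (csc \<i> w))"

lemma hp_csc:
  assumes "u \<in> F" "w \<in> F"
  shows "hp (csc \<gamma> u) w = \<gamma> * hp u w"
proof -
  have i: "csc \<i> u \<in> F" "csc \<i> w \<in> F" using assms by (auto intro: form_dom_csc)
  have "ba T (csc \<gamma> u) w = Re \<gamma> * ba T u w - Im \<gamma> * ba T u (csc \<i> w)"
    using assms i by (subst csc_split) (simp add: B.add B.sc B.F_scale ba_imag)
  moreover have "ba T (csc \<gamma> u) (csc \<i> w) = Re \<gamma> * ba T u (csc \<i> w) + Im \<gamma> * ba T u w"
    using assms i by (subst csc_split) (simp add: B.add B.sc B.F_scale ba_imag(2))
  ultimately show ?thesis by (simp add: hp_def complex_eq_iff)
qed

lemma hp_sum: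
  assumes "\<And>i. i \<in> S \<Longrightarrow> f i \<in> F" "w \<in> F"
  shows "hp (sum f S) w = (\<Sum>i\<in>S. hp (f i) w)"
  using B.sum_left[of S f, OF assms] B.sum_left[of S f, OF assms(1) form_dom_csc[OF assms(2)]]
  by (simp add: hp_def complex_eq_iff)

text \<open>Bases of the eigenspaces at real c, each function lifted to a pair with a chosen
  derivative. Distinct functions of one basis are independent but need not be orthogonal.\<close>

lemma eigen_basis:
  assumes "enumerates_eigenvalues (OU T X) lam"
  obtains B p where "\<And>c. finite (B c)" "\<And>c. card (B c) = card {n \<in> {1..}. lam n = c}"
    "\<And>c. finite {n \<in> {1..}. lam n = c}"
    "\<And>c. tfun.independent (B c)" "\<And>c. tfun.span (B c) = eigenspace (OU T X) (complex_of_real c)"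
    "\<And>c f. f \<in> B c \<Longrightarrow> (f, p c f) \<in> eigp T X c"
proof -
  have en: "finite {n \<in> {1..}. lam n = c}" "has_dim (eigenspace (OU T X) (complex_of_real c)) (card {n \<in> {1..}. lam n = c})"
    for c :: real
  proof -
    have "finite {n \<in> {1..}. complex_of_real (lam n) = complex_of_real c} \<and>
      has_dim (eigenspace (OU T X) (complex_of_real c)) (card {n \<in> {1..}. complex_of_real (lam n) = complex_of_real c})"
      using assms unfolding enumerates_eigenvalues_def by blast
    then show "finite {n \<in> {1..}. lam n = c}" "has_dim (eigenspace (OU T X) (complex_of_real c)) (card {n \<in> {1..}. lam n = c})"
      by simp_all
  qed
  then have "\<exists>B. finite B \<and> card B = card {n \<in> {1..}. lam n = c} \<and> tfun.independent B
      \<and> tfun.span B = eigenspace (OU T X) (complex_of_real c)" for c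
    unfolding has_dim_def by blast
  then obtain B where B: "\<And>c. finite (B c)" "\<And>c. card (B c) = card {n \<in> {1..}. lam n = c}"
    "\<And>c. tfun.independent (B c)" "\<And>c. tfun.span (B c) = eigenspace (OU T X) (complex_of_real c)" by metis
  have ex: "\<exists>f'. (f, f') \<in> eigp T X c" if "f \<in> B c" for c f
  proof (rule OU_imp_eigp)
    show "OU T X f (fscale (complex_of_real c) f)"
      using tfun.span_base[OF that] B(4)[of c] by (simp add: eigenspace_def)
  qed
  have p: "(f, SOME f'. (f, f') \<in> eigp T X c) \<in> eigp T X c" if "f \<in> B c" for c f
    using ex[OF that] by (rule someI_ex)
  show ?thesis
  proof (rule that[of B "\<lambda>c f. SOME f'. (f, f') \<in> eigp T X c"])
    fix c
    show "finite (B c)" by (rule B(1))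
    show "card (B c) = card {n \<in> {1..}. lam n = c}" by (rule B(2))
    show "finite {n \<in> {1..}. lam n = c}" by (rule en(1))
    show "tfun.independent (B c)" by (rule B(3))
    show "tfun.span (B c) = eigenspace (OU T X) (complex_of_real c)" by (rule B(4))
    show "(f, SOME f'. (f, f') \<in> eigp T X c) \<in> eigp T X c" if "f \<in> B c" for f
      by (rule p[OF that])
  qed
qed

lemma fst_csc_sum:
  "fst (\<Sum>f\<in>S. csc (\<gamma> f) (f, p f)) = (\<Sum>f\<in>S. fscale (\<gamma> f) f)"
  by (simp add: fst_sum csc_def)

text \<open>Dimension count: more than \<open>card N\<close> eigenfunctions below \<open>\<Lambda>\<close> have a nontrivial combination
  vanishing at all points of \<open>N\<close>.\<close>

lemma eigenvalue_lower_bound: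
  assumes en: "enumerates_eigenvalues (OU T X) lam" and N: "finite N"
    and gap: "\<And>u. u \<in> F \<Longrightarrow> (\<And>x t. (x, t) \<in> N \<Longrightarrow> fst u x t = 0) \<Longrightarrow> \<Lambda> * ba T u u \<le> fa T u u"
  shows "\<Lambda> \<le> lam (card N + 1)"
proof (rule ccontr)
  assume neg: "\<not> \<Lambda> \<le> lam (card N + 1)"
  define \<kappa> where "\<kappa> = lam (card N + 1)"
  have \<kappa>: "\<kappa> < \<Lambda>" using neg by (simp add: \<kappa>_def)
  have mono: "lam i \<le> lam j" if "1 \<le> i" "i \<le> j" for i j
    using en that by (auto simp: enumerates_eigenvalues_def mono_on_def)
  obtain B p where B: "\<And>c. finite (B c)" "\<And>c. card (B c) = card {n \<in> {1..}. lam n = c}"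
    "\<And>c. finite {n \<in> {1..}. lam n = c}"
    "\<And>c. tfun.independent (B c)" "\<And>c. tfun.span (B c) = eigenspace (OU T X) (complex_of_real c)"
    "\<And>c f. f \<in> B c \<Longrightarrow> (f, p c f) \<in> eigp T X c"
    by (rule eigen_basis[OF en]) (rule that, assumption+)
  \<comment> \<open>A set, so each eigenvalue occurs once; multiplicities reappear through
    \<open>B c\<close>.\<close>
  define C where "C = lam ` {1..card N + 1}"
  have C: "finite C" by (simp add: C_def)
  have C\<kappa>: "c \<le> \<kappa>" if "c \<in> C" for c
  proof -
    obtain j where j: "1 \<le> j" "j \<le> card N + 1" "c = lam j" using \<open>c \<in> C\<close> by (auto simp: C_def)
    then show ?thesis using mono[OF j(1,2)] by (simp add: \<kappa>_def)
  qed
  define U where "U = Sigma C B"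
  have U: "finite U" unfolding U_def using C B(1) by (intro finite_SigmaI)
  \<comment> \<open>U contains whole eigenspace bases, also the part of the last eigenvalue beyond
    the index \<open>card N + 1\<close>; it may only be larger than needed.\<close>
  have "card N < card U"
  proof -
    have "card N + 1 = card {1..card N + 1}" by simp
    also have "{1..card N + 1} = (\<Union>c\<in>C. {n \<in> {1..card N + 1}. lam n = c})" by (auto simp: C_def)
    also have "card \<dots> \<le> (\<Sum>c\<in>C. card {n \<in> {1..card N + 1}. lam n = c})" by (rule card_UN_le[OF C])
    also have "\<dots> \<le> (\<Sum>c\<in>C. card (B c))"
      unfolding B(2) by (intro sum_mono card_mono B(3)) auto
    also have "\<dots> = card U" unfolding U_def using C B(1) by simp
    finally show ?thesis by simp
  qed
  from homogeneous_system_nontrivial[OF N U this, of "\<lambda>i j. snd j (fst i) (snd i)"]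
  obtain \<gamma> where \<gamma>: "\<exists>j\<in>U. \<gamma> j \<noteq> 0" "\<forall>i\<in>N. (\<Sum>j\<in>U. snd j (fst i) (snd i) * \<gamma> j) = 0"
    by blast
  \<comment> \<open>Grouping by eigenvalue: orthogonality is available between different
    eigenvalues, not within one basis.\<close>
  define w where "w = (\<lambda>c. \<Sum>f\<in>B c. csc (\<gamma> (c, f)) (f, p c f))"
  have w: "w c \<in> eigp T X c" for c unfolding w_def by (intro eigp_sum eigp_csc B(6))
  have wF: "w c \<in> F" for c using eigp_F[OF w] .
  define u where "u = sum w C"
  have uF: "u \<in> F" unfolding u_def by (intro B.sum_mem wF)
  have "fst u x t = 0" if "(x, t) \<in> N" for x t
  proof -
    have "fst u x t = (\<Sum>c\<in>C. \<Sum>f\<in>B c. \<gamma> (c, f) * f x t)"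
      by (simp add: u_def w_def fst_sum sum_fun2_apply)
    also have "\<dots> = (\<Sum>(c, f)\<in>U. \<gamma> (c, f) * f x t)"
      unfolding U_def using C B(1) by (intro sum.Sigma) blast+
    also have "\<dots> = (\<Sum>j\<in>U. snd j x t * \<gamma> j)"
      by (rule sum.cong) auto
    also have "\<dots> = 0" using bspec[OF \<gamma>(2) that] by simp
    finally show ?thesis .
  qed
  then have le: "\<Lambda> * ba T u u \<le> fa T u u" by (rule gap[OF uF])
  have ob: "ba T (w c) (w d) = 0" if "c \<noteq> d" for c d by (rule eigp_orthogonal[OF w w that])
  have oa: "fa T (w c) (w d) = 0" if "c \<noteq> d" for c d
    using green_tree[OF w wF, of c d] ob[OF that] by simp
  have bu: "ba T u u = (\<Sum>c\<in>C. ba T (w c) (w c))"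
    unfolding u_def by (rule B.sum_orthogonal[OF C wF ob])
  have "fa T u u = (\<Sum>c\<in>C. fa T (w c) (w c))"
    unfolding u_def by (rule A.sum_orthogonal[OF C wF oa])
  also have "\<dots> = (\<Sum>c\<in>C. c * ba T (w c) (w c))" using green_tree[OF w wF] by simp
  also have "\<dots> \<le> (\<Sum>c\<in>C. \<kappa> * ba T (w c) (w c))"
    by (intro sum_mono mult_right_mono C\<kappa> B.nonneg wF)
  also have "\<dots> = \<kappa> * ba T u u" by (simp add: bu sum_distrib_left)
  finally have "\<Lambda> * ba T u u \<le> \<kappa> * ba T u u" using le by simp
  then have "ba T u u \<le> 0" using \<kappa> by (simp add: mult_le_cancel_right)
  \<comment> \<open>Since \<kappa> < \<Lambda>, the combination has norm 0. By orthogonality each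
    group vanishes, against the independence of its basis.\<close>
  then have "(\<Sum>c\<in>C. ba T (w c) (w c)) = 0"
    using bu B.nonneg[OF uF] by simp
  have "\<forall>c\<in>C. ba T (w c) (w c) = 0"
    by (rule iffD1[OF sum_nonneg_eq_0_iff[OF C]]) (rule B.nonneg[OF wF], fact)
  then have w0: "ba T (w c) (w c) = 0" if "c \<in> C" for c using that by blast
  obtain c f where cf: "c \<in> C" "f \<in> B c" "\<gamma> (c, f) \<noteq> 0" using \<gamma>(1) by (auto simp: U_def)
  have "fst (w c) = 0" by (intro ext) (simp add: ba_zero_imp[OF wF w0[OF cf(1)]] zero_fun_def)
  then have "(\<Sum>f\<in>B c. fscale (\<gamma> (c, f)) f) = 0" by (simp add: w_def fst_csc_sum)
  then have "\<gamma> (c, f) = 0"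
    using tfun.independentD[OF B(4)[of c] B(1) order.refl, of "\<lambda>f. \<gamma> (c, f)"] cf(2) by blast
  then show False using cf by simp
qed

text \<open>If fewer than \<open>card J\<close> eigenvalues were \<open>\<le> \<kappa>\<close>, some trial function would be orthogonal to all
  their eigenfunctions, and minimising the Rayleigh quotient there would produce one more.\<close>

lemma eigenvalue_upper_bound:
  assumes en: "enumerates_eigenvalues (OU T X) lam"
    and N: "finite N" "\<And>x t. (x, t) \<in> N \<Longrightarrow> x \<in> E \<and> t \<in> I x"
    and gap: "\<And>u. u \<in> F \<Longrightarrow> (\<And>x t. (x, t) \<in> N \<Longrightarrow> fst u x t = 0) \<Longrightarrow> \<Lambda> * ba T u u \<le> fa T u u"
    and \<kappa>: "\<kappa> < \<Lambda>"
    and J: "finite J" "J \<noteq> {}" "\<And>j. j \<in> J \<Longrightarrow> w j \<in> F"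
    and trial: "\<And>\<gamma>. \<exists>j\<in>J. \<gamma> j \<noteq> 0 \<Longrightarrow>
      ba T (\<Sum>j\<in>J. csc (\<gamma> j) (w j)) (\<Sum>j\<in>J. csc (\<gamma> j) (w j)) > 0 \<and>
      fa T (\<Sum>j\<in>J. csc (\<gamma> j) (w j)) (\<Sum>j\<in>J. csc (\<gamma> j) (w j))
        \<le> \<kappa> * ba T (\<Sum>j\<in>J. csc (\<gamma> j) (w j)) (\<Sum>j\<in>J. csc (\<gamma> j) (w j))"
  shows "lam (card J) \<le> \<kappa>"
proof (rule ccontr)
  assume neg: "\<not> lam (card J) \<le> \<kappa>"
  have mono: "lam i \<le> lam j" if "1 \<le> i" "i \<le> j" for i j
    using en that by (auto simp: enumerates_eigenvalues_def mono_on_def)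
  define n where "n = card J"
  have n: "n \<ge> 1" using J by (simp add: n_def Suc_le_eq card_gt_0_iff)
  have small: "m < n" if "1 \<le> m" "lam m \<le> \<kappa>" for m
    using mono[of n m] n that neg unfolding n_def by linarith
  obtain B p where B: "\<And>c. finite (B c)" "\<And>c. card (B c) = card {n \<in> {1..}. lam n = c}"
    "\<And>c. finite {n \<in> {1..}. lam n = c}"
    "\<And>c. tfun.independent (B c)" "\<And>c. tfun.span (B c) = eigenspace (OU T X) (complex_of_real c)"
    "\<And>c f. f \<in> B c \<Longrightarrow> (f, p c f) \<in> eigp T X c"
    by (rule eigen_basis[OF en]) (rule that, assumption+)
  \<comment> \<open>By the assumption to be refuted, every eigenvalue up to \<kappa> has all its
    indices below n; hence the union of their bases has fewer than n elements.\<close>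
  define C where "C = lam ` {m \<in> {1..<n}. lam m \<le> \<kappa>}"
  have C: "finite C" by (simp add: C_def)
  define U where "U = Sigma C B"
  have U: "finite U" unfolding U_def using C B(1) by (intro finite_SigmaI)
  define e where "e = (\<lambda>(c, f). (f, p c f))"
  have eU: "e j \<in> eigp T X (fst j)" if "j \<in> U" for j
    using that B(6) by (auto simp: U_def e_def)
  have eF: "e j \<in> F" if "j \<in> U" for j using eigp_F[OF eU[OF that]] .
  have "card U < n"
  proof -
    have "card U = (\<Sum>c\<in>C. card (B c))" unfolding U_def using C B(1) by simp
    also have "\<dots> = (\<Sum>c\<in>C. card {m \<in> {1..}. lam m = c})" by (simp add: B(2))
    also have "\<dots> = card (\<Union>c\<in>C. {m \<in> {1..}. lam m = c})"
      by (rule card_UN_disjoint[symmetric]) (use C B(3) in auto)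
    also have "\<dots> \<le> card {1..<n}"
      by (rule card_mono) (use small in \<open>auto simp: C_def\<close>)
    also have "\<dots> < n" using n by simp
    finally show ?thesis .
  qed
  then have "card U < card J" by (simp add: n_def)
  from homogeneous_system_nontrivial[OF U J(1) this, of "\<lambda>i j. hp (w j) (e i)"]
  obtain \<gamma> where \<gamma>: "\<exists>j\<in>J. \<gamma> j \<noteq> 0" "\<forall>i\<in>U. (\<Sum>j\<in>J. hp (w j) (e i) * \<gamma> j) = 0"
    by blast
  define w0 where "w0 = (\<Sum>j\<in>J. csc (\<gamma> j) (w j))"
  have w0F: "w0 \<in> F" unfolding w0_def by (intro B.sum_mem form_dom_csc J(3))
  have w0: "ba T w0 w0 > 0" "fa T w0 w0 \<le> \<kappa> * ba T w0 w0" using trial[OF \<gamma>(1)] by (simp_all add: w0_def)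
  have hp0: "hp w0 (e i) = 0" if "i \<in> U" for i
  proof -
    have "hp w0 (e i) = (\<Sum>j\<in>J. hp (csc (\<gamma> j) (w j)) (e i))"
      unfolding w0_def by (rule hp_sum) (auto intro: form_dom_csc J(3) eF that)
    also have "\<dots> = (\<Sum>j\<in>J. hp (w j) (e i) * \<gamma> j)"
      by (rule sum.cong) (auto simp: hp_csc J(3) eF that)
    finally show ?thesis using \<gamma>(2) that by simp
  qed
  \<comment> \<open>Orthogonality in the minimisation is real, so the multiples by \<i> are added to
    exclude the complex span of the eigenfunctions.\<close>
  define V where "V = e ` U \<union> (\<lambda>i. csc \<i> (e i)) ` U"
  have V: "finite V" "V \<subseteq> F"
    unfolding V_def using U eF form_dom_csc[OF eF] by (simp, blast)
  have "\<exists>c. v \<in> eigp T X c" if "v \<in> V" for v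
    using that eU eigp_csc[OF eU] unfolding V_def by blast
  then obtain \<mu> where \<mu>: "\<And>v. v \<in> V \<Longrightarrow> v \<in> eigp T X (\<mu> v)" by metis
  have Vgreen: "fa T f v = \<mu> v * ba T f v" if "v \<in> V" "f \<in> F" for v f
    using green_tree[OF \<mu>[OF that(1)] that(2)] A.sym[of f v] B.sym[of f v] by metis
  have "ba T w0 (e i) = 0 \<and> ba T w0 (csc \<i> (e i)) = 0" if "i \<in> U" for i
    using hp0[OF that] unfolding hp_def complex_eq_iff by simp
  then have w0V: "ba T w0 v = 0" if "v \<in> V" for v
    using that unfolding V_def by blast
  \<comment> \<open>Evaluations as real functionals: z = 1 gives the real part of a point value, z =
    \<i> the imaginary part.\<close>
  define L where "L = (\<lambda>((x, t), z) (u :: ('e + 'r) tpair). (z::complex) \<bullet> fst u x t)"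
  have Ln: "linear_on (L i)" if "i \<in> N \<times> {1, \<i>}" for i
    unfolding linear_on_def
  proof (intro ballI allI)
    fix f g :: "('e + 'r) tpair" and c :: real
    have d: "fst (f - psc c g) x t = fst f x t - c *\<^sub>R fst g x t" for x t
      unfolding scaleR_conv_of_real by (simp only: fst_diff minus_apply psc_def csc_apply)
    obtain x t z where i: "i = ((x, t), z)" by (metis surj_pair)
    show "L i (f - psc c g) = L i f - c * L i g"
      unfolding i L_def by (simp only: prod.case d inner_diff_right inner_scaleR_right)
  qed
  have "\<exists>K. \<forall>u\<in>F. \<bar>L i u\<bar> \<le> K * (A.nm u + B.nm u)" if iN: "i \<in> N \<times> {1, \<i>}" for i
  proof -
    obtain x t z where i: "i = ((x, t), z)" "(x, t) \<in> N" using iN by (metis SigmaE surj_pair)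
    have x: "x \<in> E" "t \<in> I x" using N(2) i by auto
    obtain b where b: "lo x < b" "{lo x..b} \<subseteq> I x" "t \<in> {lo x..b}" using segment[OF x] by metis
    obtain K where K: "K \<ge> 0" "\<And>u t. u \<in> F \<Longrightarrow> t \<in> {lo x..b} \<Longrightarrow> cmod (fst u x t) \<le> K * (A.nm u + B.nm u)"
      using point_bound[OF x(1) b(2,1)] by blast
    have "\<bar>L i u\<bar> \<le> (cmod z * K) * (A.nm u + B.nm u)" if "u \<in> F" for u
    proof -
      have "\<bar>L i u\<bar> \<le> cmod z * cmod (fst u x t)" 
        unfolding L_def i prod.case by (rule Cauchy_Schwarz_ineq2)
      also have "\<dots> \<le> cmod z * (K * (A.nm u + B.nm u))" by (intro mult_left_mono K(2) that b) simp
      finally show ?thesis by (simp add: mult.assoc)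
    qed
    then show ?thesis by blast
  qed
  then obtain K where K: "\<And>i u. i \<in> N \<times> {1, \<i>} \<Longrightarrow> u \<in> F \<Longrightarrow> \<bar>L i u\<bar> \<le> K i * (A.nm u + B.nm u)" by metis
  have Lgap: "\<Lambda> * ba T u u \<le> fa T u u" if u: "u \<in> F" and z: "\<And>i. i \<in> N \<times> {1, \<i>} \<Longrightarrow> L i u = 0" for u
  proof (rule gap[OF u])
    fix x t assume xt: "(x, t) \<in> N"
    show "fst u x t = 0"
      using z[of "((x, t), 1)"] z[of "((x, t), \<i>)"] xt by (simp add: L_def inner_complex_def complex_eq_iff)
  qed
  have finI: "finite (N \<times> {1, \<i>})" using N by simp
  have "\<exists>\<sigma> f. 0 \<le> \<sigma> \<and> \<sigma> \<le> \<kappa> \<and> (\<forall>k::nat. f k \<in> F \<and> ba T (f k) (f k) = 1) \<and>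
    (\<forall>k. \<forall>v\<in>V. ba T (f k) v = 0) \<and>
    (\<forall>\<phi>\<in>F. (\<lambda>k. fa T (f k) \<phi> - \<sigma> * ba T (f k) \<phi>) \<longlonglongrightarrow> 0) \<and>
    (\<forall>d>0. \<exists>N. \<forall>i\<ge>N. \<forall>j\<ge>N. A.nm (f i - f j) < d \<and> B.nm (f i - f j) < d)" (is ?ex)
  proof (rule minimizing_sequence[of V \<mu> w0 \<kappa> "N \<times> {1, \<i>}" L K \<Lambda>,
        OF V Vgreen w0F w0V w0 finI Ln K Lgap \<kappa>])
    fix \<sigma> f
    assume "0 \<le> \<sigma>" "\<sigma> \<le> \<kappa>" "\<And>k::nat. f k \<in> F" "\<And>k. ba T (f k) (f k) = 1"
      "\<And>k u. u \<in> V \<Longrightarrow> ba T (f k) u = 0"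
      "\<And>\<phi>. \<phi> \<in> F \<Longrightarrow> (\<lambda>k. fa T (f k) \<phi> - \<sigma> * ba T (f k) \<phi>) \<longlonglongrightarrow> 0"
      "\<And>e. e > 0 \<Longrightarrow> \<exists>N. \<forall>i\<ge>N. \<forall>j\<ge>N. A.nm (f i - f j) < e \<and> B.nm (f i - f j) < e"
    then show ?ex by (intro exI[of _ \<sigma>] exI[of _ f] conjI allI ballI impI)
  qed
  then obtain \<sigma> f where \<sigma>: "0 \<le> \<sigma>" "\<sigma> \<le> \<kappa>" and f': "\<forall>k::nat. f k \<in> F \<and> ba T (f k) (f k) = 1"
    "\<forall>k. \<forall>v\<in>V. ba T (f k) v = 0"
    "\<forall>\<phi>\<in>F. (\<lambda>k. fa T (f k) \<phi> - \<sigma> * ba T (f k) \<phi>) \<longlonglongrightarrow> 0"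
    "\<forall>d>0. \<exists>N. \<forall>i\<ge>N. \<forall>j\<ge>N. A.nm (f i - f j) < d \<and> B.nm (f i - f j) < d"
    by (elim exE conjE)
  have f: "f k \<in> F" "ba T (f k) (f k) = 1" "u \<in> V \<Longrightarrow> ba T (f k) u = 0"
    "\<phi> \<in> F \<Longrightarrow> (\<lambda>k. fa T (f k) \<phi> - \<sigma> * ba T (f k) \<phi>) \<longlonglongrightarrow> 0"
    "d > 0 \<Longrightarrow> \<exists>N. \<forall>i\<ge>N. \<forall>j\<ge>N. A.nm (f i - f j) < d \<and> B.nm (f i - f j) < d" for k u \<phi> d
    using f' by simp_all
  have "\<exists>u. u \<in> eigp T X \<sigma> \<and> (\<forall>w\<in>F. (\<lambda>k. ba T (f k) w) \<longlonglongrightarrow> ba T u w) \<and>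
      (\<lambda>k. ba T (f k) (f k)) \<longlonglongrightarrow> ba T u u" (is ?ex)
  proof (rule form_limit[of f \<sigma>, OF f(1,4,5)])
    fix u assume "u \<in> eigp T X \<sigma>" "\<And>w. w \<in> F \<Longrightarrow> (\<lambda>k. ba T (f k) w) \<longlonglongrightarrow> ba T u w"
      "(\<lambda>k. ba T (f k) (f k)) \<longlonglongrightarrow> ba T u u"
    then show ?ex by (intro exI[of _ u] conjI ballI)
  qed
  then obtain u where u: "u \<in> eigp T X \<sigma>" "\<forall>w\<in>F. (\<lambda>k. ba T (f k) w) \<longlonglongrightarrow> ba T u w"
    "(\<lambda>k. ba T (f k) (f k)) \<longlonglongrightarrow> ba T u u" by (elim exE conjE)
  have uF: "u \<in> F" using eigp_F[OF u(1)] .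
  have u1: "ba T u u = 1"
    using LIMSEQ_unique[OF u(3)[unfolded f(2)] tendsto_const] .
  have uV: "ba T u v = 0" if "v \<in> V" for v
  proof -
    have "(\<lambda>k. ba T (f k) v) \<longlonglongrightarrow> ba T u v" using u(2) V(2) that by blast
    then have "(\<lambda>k. 0) \<longlonglongrightarrow> ba T u v" by (simp only: f(3)[OF that])
    then show ?thesis using LIMSEQ_unique[OF tendsto_const] by fastforce
  qed
  have "fst u \<in> tfun.span (B \<sigma>)"
    unfolding B(5) eigenspace_def using eigp_imp_OU[OF u(1)] by simp
  then obtain \<delta> where \<delta>: "fst u = (\<Sum>g\<in>B \<sigma>. fscale (\<delta> g) g)"
    unfolding tfun.span_finite[OF B(1)] by auto
  \<comment> \<open>y has the same function component as u, possibly with another derivative at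
    exceptional places; \<open>ba\<close> does not see the difference.\<close>
  define y where "y = (\<Sum>g\<in>B \<sigma>. csc (\<delta> g) (g, p \<sigma> g))"
  have "fst y = fst u" by (simp add: y_def fst_csc_sum \<delta>)
  have gF: "(g, p \<sigma> g) \<in> F" if "g \<in> B \<sigma>" for g using eigp_F[OF B(6)[OF that]] .
  have "B \<sigma> \<noteq> {}"
  proof
    assume "B \<sigma> = {}"
    then have "fst u = 0" using \<delta> by simp
    then have "ba T u u = 0" by (simp add: ba_def zero_fun_def)
    then show False using u1 by simp
  qed
  then have "card (B \<sigma>) \<noteq> 0" using B(1) by simp
  then have "{m \<in> {1..}. lam m = \<sigma>} \<noteq> {}" unfolding B(2) by (metis card.empty)
  then obtain m where m: "1 \<le> m" "lam m = \<sigma>" by auto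
  \<comment> \<open>As \<sigma> is at most \<kappa>, its eigenspace was among those projected out: u
    lies in the span of V and is orthogonal to V, although \<open>ba T u u = 1\<close>.\<close>
  then have "\<sigma> \<in> C" using small[of m] \<sigma> by (auto simp: C_def)
  then have inV: "(g, p \<sigma> g) \<in> V" "csc \<i> (g, p \<sigma> g) \<in> V" if "g \<in> B \<sigma>" for g
    using that by (force simp: V_def U_def e_def)+
  have "ba T u u = ba T u y" by (rule ba_cong(2)) (simp add: \<open>fst y = fst u\<close>)
  also have "\<dots> = (\<Sum>g\<in>B \<sigma>. ba T u (csc (\<delta> g) (g, p \<sigma> g)))"
    unfolding y_def by (rule B.sum_right) (auto intro: form_dom_csc gF uF)
  also have "\<dots> = 0"
  proof (rule sum.neutral, rule ballI)
    fix g assume g: "g \<in> B \<sigma>"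
    show "ba T u (csc (\<delta> g) (g, p \<sigma> g)) = 0"
      using uF gF[OF g] form_dom_csc[OF gF[OF g]] uV[OF inV(1)[OF g]] uV[OF inV(2)[OF g]]
      by (subst csc_split) (simp add: B.add2 B.sc2 B.F_scale)
  qed
  finally show False using u1 by simp
qed

end

section \<open>Nodal comparison on edges\<close>

lemma ip_segment:
  assumes f: "f \<in> L2g" and z: "\<And>x. x \<notin> {s..t} \<Longrightarrow> f x = 0"
  shows "integral {s..t} (\<lambda>x. gw x * (cmod (f x))\<^sup>2) = ip f f"
proof -
  note i = integrable_weighted_square[OF f]
  have "ip f f = (LINT x|lborel. gw x * (cmod (f x))\<^sup>2)"
    using ip_lborel(2)[OF f f] by (simp add: power2_norm_eq_inner)
  also have "\<dots> = (LINT x:{s..t}|lborel. gw x * (cmod (f x))\<^sup>2)"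
    by (rule integral_outside_zero) (simp add: z)
  also have "\<dots> = integral {s..t} (\<lambda>x. gw x * (cmod (f x))\<^sup>2)" by (rule integrable_HK(2)[OF i]) simp
  finally show ?thesis by simp
qed

lemma ip_ray_limit:
  assumes f: "f \<in> L2g" and z: "\<And>x. x \<notin> {s..} \<Longrightarrow> f x = 0"
  shows "((\<lambda>b. integral {s..b} (\<lambda>x. gw x * (cmod (f x))\<^sup>2)) \<longlongrightarrow> ip f f) at_top"
proof -
  note i = integrable_weighted_square[OF f]
  have "ip f f = (LINT x|lborel. gw x * (cmod (f x))\<^sup>2)"
    using ip_lborel(2)[OF f f] by (simp add: power2_norm_eq_inner)
  also have "\<dots> = (LINT x:{s..}|lborel. gw x * (cmod (f x))\<^sup>2)"
    by (rule integral_outside_zero) (simp add: z)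
  finally have eq: "ip f f = (LINT x:{s..}|lborel. gw x * (cmod (f x))\<^sup>2)" .
  have "(LINT x:{s..b}|lborel. gw x * (cmod (f x))\<^sup>2) = integral {s..b} (\<lambda>x. gw x * (cmod (f x))\<^sup>2)" for b
    by (rule integrable_HK(2)[OF i]) simp
  moreover have "((\<lambda>b. LINT x:{s..b}|lborel. gw x * (cmod (f x))\<^sup>2) \<longlongrightarrow>
      (LINT x:{s..}|lborel. gw x * (cmod (f x))\<^sup>2)) at_top"
    by (rule tendsto_set_lebesgue_integral_at_top) (auto intro: set_integrable_of_integrable i)
  ultimately show ?thesis unfolding eq by simp
qed

text \<open>Picone's inequality with H itself on {s..t}, then t to infinity. Far out H is positive
  and nondecreasing, which supplies the sign at the free end; at s the function vanishes whether or
  not s is a zero of H.\<close>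

lemma ray_gap:
  assumes f: "H1_on {s..} f f'" and s: "0 \<le> s" "f s = 0"
    and z: "\<And>z. z \<in> pos_roots k \<Longrightarrow> s < z \<Longrightarrow> f z = 0"
  shows "2 * real (2 * k + 1) * ip f f \<le> ip f' f'"
proof -
  define H where "H = hermite (2 * k + 1)"
  note L = H1_onD(1,2)[OF f]
  obtain N where N: "\<And>t. t \<ge> N \<Longrightarrow> 0 < poly H t \<and> 0 \<le> poly (pderiv H) t"
    using hermite_eventually_increasing[of "2 * k + 1"] unfolding H_def by blast
  have seg: "2 * real (2 * k + 1) * integral {s..t} (\<lambda>x. gw x * (cmod (f x))\<^sup>2)
      \<le> integral {s..t} (\<lambda>x. gw x * (cmod (f' x))\<^sup>2)" if t: "t \<ge> max N (s + 1)" for t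
  proof (rule picone[OF f, where h = "poly H" and h' = "poly (pderiv H)" and h'' = "poly (pderiv (pderiv H))"])
    show "finite {x \<in> {s..t}. poly H x = 0}"
      by (rule finite_subset[OF _ poly_roots_finite[OF hermite_nz[of "2 * k + 1"]]]) (auto simp: H_def)
    fix x
    show "(poly H has_real_derivative poly (pderiv H) x) (at x)"
      "(poly (pderiv H) has_real_derivative poly (pderiv (pderiv H)) x) (at x)" by (rule poly_DERIV)+
    show "poly H x * (poly (pderiv (pderiv H)) x - 2 * x * poly (pderiv H) x + 2 * real (2 * k + 1) * poly H x) \<le> 0"
      using hermite_ode[of "2 * k + 1" x] by (simp only: H_def)
    assume x: "x \<in> {s..t}" "poly H x = 0"
    have "f x = 0"
    proof (cases "x = s")
      case False
      then have "x \<in> pos_roots k" using x s by (simp add: pos_roots_def H_def)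
      then show ?thesis using z x False by simp
    qed (simp add: s)
    moreover have "poly (pderiv H) x \<noteq> 0" using hermite_simple_roots[of "2 * k + 1" x] x by (simp only: H_def) blast
    ultimately show "poly (pderiv H) x \<noteq> 0 \<and> f x = 0" by simp
  next
    have "0 < poly H t \<and> 0 \<le> poly (pderiv H) t" using N t by simp
    then show "f t = 0 \<or> 0 \<le> poly H t * poly (pderiv H) t" by simp
  qed (use t s in auto)
  show ?thesis
  proof (rule tendsto_le[OF trivial_limit_at_top_linorder])
    show "((\<lambda>b. integral {s..b} (\<lambda>x. gw x * (cmod (f' x))\<^sup>2)) \<longlongrightarrow> ip f' f') at_top"
      by (rule ip_ray_limit[OF L(2)]) (rule H1_onD(5)[OF f])
    show "((\<lambda>b. 2 * real (2 * k + 1) * integral {s..b} (\<lambda>x. gw x * (cmod (f x))\<^sup>2))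
        \<longlongrightarrow> 2 * real (2 * k + 1) * ip f f) at_top"
      by (intro tendsto_mult_left ip_ray_limit[OF L(1)]) (rule H1_onD(4)[OF f])
    show "\<forall>\<^sub>F t in at_top. 2 * real (2 * k + 1) * integral {s..t} (\<lambda>x. gw x * (cmod (f x))\<^sup>2)
      \<le> integral {s..t} (\<lambda>x. gw x * (cmod (f' x))\<^sup>2)"
      using eventually_ge_at_top[of "max N (s + 1)"] by eventually_elim (rule seg)
  qed
qed

text \<open>\<open>exp (x\<^sup>2 / 2) * sin (\<omega> * x + \<theta>)\<close> is a supersolution on each of its nodal intervals when
  \<open>\<omega>\<^sup>2 = 2 * \<Lambda> + 1\<close>.\<close>

lemma sine_gap:
  assumes f: "H1_on {s..t} f f'" and st: "s < t" and \<Lambda>: "0 \<le> \<Lambda>"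
    and ends: "f s = 0" "f t = 0"
    and z: "\<And>x. x \<in> {s..t} \<Longrightarrow> sin (sqrt (2 * \<Lambda> + 1) * x + \<theta>) = 0 \<Longrightarrow> f x = 0"
    and fin: "finite {x \<in> {s..t}. sin (sqrt (2 * \<Lambda> + 1) * x + \<theta>) = 0}"
  shows "2 * \<Lambda> * ip f f \<le> ip f' f'"
proof -
  define \<omega> where "\<omega> = sqrt (2 * \<Lambda> + 1)"
  have \<omega>: "\<omega> > 0" "\<omega> * \<omega> = 2 * \<Lambda> + 1" using \<Lambda> by (simp_all add: \<omega>_def)
  define h where "h = (\<lambda>x. exp (x\<^sup>2 / 2) * sin (\<omega> * x + \<theta>))"
  define h' where "h' = (\<lambda>x. exp (x\<^sup>2 / 2) * (x * sin (\<omega> * x + \<theta>) + \<omega> * cos (\<omega> * x + \<theta>)))"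
  define h'' where "h'' = (\<lambda>x. exp (x\<^sup>2 / 2) * ((1 + x * x - \<omega> * \<omega>) * sin (\<omega> * x + \<theta>) + 2 * x * \<omega> * cos (\<omega> * x + \<theta>)))"
  have e: "((\<lambda>x. exp (x\<^sup>2 / 2)) has_real_derivative x * exp (x\<^sup>2 / 2)) (at x)" for x
    by (auto intro!: derivative_eq_intros)
  have "2 * \<Lambda> * integral {s..t} (\<lambda>x. gw x * (cmod (f x))\<^sup>2) \<le> integral {s..t} (\<lambda>x. gw x * (cmod (f' x))\<^sup>2)"
  proof (rule picone[OF f order.refl st, of h h' h''])
    show "finite {x \<in> {s..t}. h x = 0}" using fin by (simp add: h_def \<omega>_def)
    fix x
    have s: "((\<lambda>x. sin (\<omega> * x + \<theta>)) has_real_derivative \<omega> * cos (\<omega> * x + \<theta>)) (at x)"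
      "((\<lambda>x. cos (\<omega> * x + \<theta>)) has_real_derivative - (\<omega> * sin (\<omega> * x + \<theta>))) (at x)"
      by (auto intro!: derivative_eq_intros)
    show "(h has_real_derivative h' x) (at x)"
      unfolding h_def h'_def using DERIV_mult[OF e s(1)] by (rule DERIV_cong) (simp add: algebra_simps)
    have "((\<lambda>x. x * sin (\<omega> * x + \<theta>) + \<omega> * cos (\<omega> * x + \<theta>)) has_real_derivative
        1 * sin (\<omega> * x + \<theta>) + \<omega> * cos (\<omega> * x + \<theta>) * x + \<omega> * (- (\<omega> * sin (\<omega> * x + \<theta>)))) (at x)"
      by (intro DERIV_add DERIV_mult s DERIV_ident DERIV_cmult)
    from DERIV_mult[OF e this]
    show "(h' has_real_derivative h'' x) (at x)"
      unfolding h'_def h''_def by (rule DERIV_cong) (simp add: algebra_simps)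
    \<comment> \<open>With \<omega> * \<omega> = 2 * \<Lambda> + 1 the constant terms cancel and
      only - x^2 survives as a factor.\<close>
    have "h x * (h'' x - 2 * x * h' x + 2 * \<Lambda> * h x)
        = - (x * exp (x\<^sup>2 / 2) * sin (\<omega> * x + \<theta>))\<^sup>2"
    proof -
      have "h'' x - 2 * x * h' x + 2 * \<Lambda> * h x
        = exp (x\<^sup>2 / 2) * sin (\<omega> * x + \<theta>) * (1 - x * x - \<omega> * \<omega> + 2 * \<Lambda>)"
        unfolding h_def h'_def h''_def by (simp add: algebra_simps)
      also have "\<dots> = exp (x\<^sup>2 / 2) * sin (\<omega> * x + \<theta>) * (- (x * x))" using \<omega> by simp
      finally show ?thesis by (simp add: h_def power2_eq_square mult_ac)
    qed
    then show "h x * (h'' x - 2 * x * h' x + 2 * \<Lambda> * h x) \<le> 0" by simp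
    assume x: "x \<in> {s..t}" "h x = 0"
    then have s0: "sin (\<omega> * x + \<theta>) = 0" by (simp add: h_def)
    then have "cos (\<omega> * x + \<theta>) \<noteq> 0" using sin_cos_squared_add[of "\<omega> * x + \<theta>"] by auto
    then have "h' x \<noteq> 0" using s0 \<omega> by (simp add: h'_def)
    then show "h' x \<noteq> 0 \<and> f x = 0" using z[OF x(1)] s0 by (simp add: \<omega>_def)
  qed (use ends in auto)
  then show ?thesis
    using ip_segment[OF H1_onD(1)[OF f] H1_onD(4)[OF f]] ip_segment[OF H1_onD(2)[OF f] H1_onD(5)[OF f]] by simp
qed

section \<open>Spacing of zeros and their number in bounded intervals\<close>

lemma card_separated:
  fixes A :: "real set"
  assumes A: "A \<subseteq> {a..b}" and \<delta>: "\<delta> > 0" and sep: "\<And>x y. x \<in> A \<Longrightarrow> y \<in> A \<Longrightarrow> x < y \<Longrightarrow> \<delta> \<le> y - x"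
    and ab: "a \<le> b"
  shows "finite A" "real (card A) \<le> (b - a) / \<delta> + 1"
proof -
  define g where "g = (\<lambda>x. \<lfloor>(x - a) / \<delta>\<rfloor>)"
  have less: "g x < g y" if "x \<in> A" "y \<in> A" "x < y" for x y
  proof -
    have "(x - a) / \<delta> + 1 = (x - a + \<delta>) / \<delta>" using \<delta> by (simp add: add_divide_distrib)
    also have "\<dots> \<le> (y - a) / \<delta>" using sep[OF that] \<delta> by (intro divide_right_mono) auto
    finally have "(x - a) / \<delta> + 1 \<le> (y - a) / \<delta>" .
    then have "\<lfloor>(x - a) / \<delta> + 1\<rfloor> \<le> \<lfloor>(y - a) / \<delta>\<rfloor>" by (rule floor_mono)
    then show ?thesis by (simp add: g_def)
  qed
  have inj: "inj_on g A"
  proof (rule inj_onI)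
    fix x y assume "x \<in> A" "y \<in> A" "g x = g y"
    then show "x = y" using less[of x y] less[of y x] by (cases x y rule: linorder_cases) auto
  qed
  have sub: "g ` A \<subseteq> {0..\<lfloor>(b - a) / \<delta>\<rfloor>}"
  proof (rule image_subsetI)
    fix x assume "x \<in> A"
    then have x: "a \<le> x" "x \<le> b" using A by auto
    then have "(x - a) / \<delta> \<le> (b - a) / \<delta>" using \<delta> by (intro divide_right_mono) auto
    moreover have "0 \<le> (x - a) / \<delta>" using x \<delta> by simp
    ultimately show "g x \<in> {0..\<lfloor>(b - a) / \<delta>\<rfloor>}" unfolding g_def by (simp add: floor_mono)
  qed
  show "finite A" using inj_on_finite[OF inj sub] by simp
  have "card A \<le> card {0..\<lfloor>(b - a) / \<delta>\<rfloor>}" using card_inj_on_le[OF inj sub] by simp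
  also have "\<dots> = nat (\<lfloor>(b - a) / \<delta>\<rfloor> + 1)" by simp
  finally have "real (card A) \<le> real (nat (\<lfloor>(b - a) / \<delta>\<rfloor> + 1))" by simp
  also have "\<dots> = of_int (\<lfloor>(b - a) / \<delta>\<rfloor> + 1)"
    using ab \<delta> by (intro of_nat_nat) (simp add: add_nonneg_nonneg)
  also have "\<dots> \<le> (b - a) / \<delta> + 1" by simp
  finally show "real (card A) \<le> (b - a) / \<delta> + 1" .
qed

lemma sine_zeros:
  fixes \<omega> :: real
  assumes \<omega>: "\<omega> > 0" and st: "s \<le> t"
  shows "finite {x \<in> {s..t}. sin (\<omega> * x) = 0}"
    "real (card {x \<in> {s..t}. sin (\<omega> * x) = 0}) \<le> (t - s) / (pi / \<omega>) + 1"
proof -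
  have sep: "pi / \<omega> \<le> y - x" if xy: "sin (\<omega> * x) = 0" "sin (\<omega> * y) = 0" "x < y" for x y
  proof -
    obtain i j :: int where ij: "\<omega> * x = of_int i * pi" "\<omega> * y = of_int j * pi"
      using xy(1,2) unfolding sin_zero_iff_int2 by blast
    have "\<omega> * x < \<omega> * y" using xy(3) \<omega> by simp
    then have "i < j" unfolding ij by simp
    then have "1 \<le> real_of_int (j - i)" by linarith
    then have "pi \<le> real_of_int (j - i) * pi" using mult_right_mono[of 1 "real_of_int (j - i)" pi] by simp
    also have "\<dots> = \<omega> * (y - x)" using ij by (simp add: algebra_simps)
    finally show ?thesis using \<omega> by (simp add: field_simps)
  qed
  have "pi / \<omega> > 0" using \<omega> by simp
  have sub: "{x \<in> {s..t}. sin (\<omega> * x) = 0} \<subseteq> {s..t}" by blast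
  have sep': "pi / \<omega> \<le> y - x" if "x \<in> {x \<in> {s..t}. sin (\<omega> * x) = 0}"
    "y \<in> {x \<in> {s..t}. sin (\<omega> * x) = 0}" "x < y" for x y using sep that by blast
  show "finite {x \<in> {s..t}. sin (\<omega> * x) = 0}"
    by (rule card_separated(1)[OF sub \<open>pi / \<omega> > 0\<close> sep' st])
  show "real (card {x \<in> {s..t}. sin (\<omega> * x) = 0}) \<le> (t - s) / (pi / \<omega>) + 1"
    by (rule card_separated(2)[OF sub \<open>pi / \<omega> > 0\<close> sep' st])
qed

section \<open>Hermite polynomials cut off to intervals\<close>

definition cut :: "real set \<Rightarrow> real poly \<Rightarrow> real \<Rightarrow> complex" where
  "cut P p t = (if t \<in> P then complex_of_real (poly p t) else 0)"

text \<open>The Gaussian is split into three factors: one exp (- x) makes the square of the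
  polynomial bounded, another is kept for integrability, and the rest, exp (2 x - x^2), is at most
  exp 1.\<close>

lemma poly_ray_L2g:
  assumes s: "0 \<le> s"
  shows "cut {s..} p \<in> L2g"
proof -
  define q where "q = p * p"
  have lim: "((\<lambda>x. poly q x * exp (- x)) \<longlongrightarrow> 0) at_top" by (rule poly_exp_tendsto_0)
  then have "eventually (\<lambda>x. \<bar>poly q x * exp (- x)\<bar> < 1) at_top"
    using order_tendstoD(2)[OF tendsto_rabs_zero[OF lim], of 1] by simp
  then obtain N where N: "\<And>x. x \<ge> N \<Longrightarrow> \<bar>poly q x * exp (- x)\<bar> < 1" by (auto simp: eventually_at_top_linorder)
  have "continuous_on {0..max 0 N} (\<lambda>x. poly q x * exp (- x))" by (intro continuous_intros)
  then obtain M0 where M0: "\<And>x. x \<in> {0..max 0 N} \<Longrightarrow> poly q x * exp (- x) \<le> M0"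
    using continuous_attains_sup[of "{0..max 0 N}" "\<lambda>x. poly q x * exp (- x)"] by fastforce
  define M where "M = max M0 1"
  have M: "poly q x * exp (- x) \<le> M" if "0 \<le> x" for x
  proof (cases "x \<le> N")
    case True
    then show ?thesis using M0[of x] that by (simp add: M_def)
  next
    case False
    then show ?thesis using N[of x] by (simp add: M_def)
  qed
  have M1: "M \<ge> 1" by (simp add: M_def)
  define c where "c = 2 / sqrt pi * M * exp 1"
  have c: "c \<ge> 0" using M1 by (simp add: c_def)
  have bound: "gw x * (poly p x)\<^sup>2 \<le> c * exp (- x)" if x: "0 \<le> x" for x
  proof -
    have e: "exp (- x\<^sup>2) = exp (- x) * exp (- x) * exp (- x\<^sup>2 + 2 * x)" by (simp add: exp_add[symmetric])
    have "exp (- x\<^sup>2 + 2 * x) \<le> exp 1"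
      using zero_le_power2[of "x - 1"] by (simp add: power2_eq_square algebra_simps)
    then have "poly q x * exp (- x) * (exp (- x) * exp (- x\<^sup>2 + 2 * x)) \<le> M * (exp (- x) * exp 1)"
      using M[OF x] M1 by (intro mult_mono) (auto simp: q_def)
    then have "2 / sqrt pi * (poly q x * exp (- x) * (exp (- x) * exp (- x\<^sup>2 + 2 * x))) \<le> 2 / sqrt pi * (M * (exp (- x) * exp 1))"
      by (rule mult_left_mono) simp
    moreover have "gw x * (poly p x)\<^sup>2 = 2 / sqrt pi * (poly q x * exp (- x) * (exp (- x) * exp (- x\<^sup>2 + 2 * x)))"
      unfolding gw_def e by (simp add: q_def power2_eq_square mult_ac)
    ultimately show ?thesis by (simp add: c_def mult_ac)
  qed
  have "(\<lambda>t. indicat_real {s..} t *\<^sub>R complex_of_real (poly p t)) \<in> L2g"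
  proof (rule L2g_rayI[where C = c])
    show "continuous_on {s..} (\<lambda>t. complex_of_real (poly p t))" by (intro continuous_intros)
    fix n :: nat
    have "((\<lambda>x. exp (- x)) has_integral - exp (- (s + real n)) - - exp (- s)) {s..s + real n}"
      by (rule fundamental_theorem_of_calculus)
        (auto simp: has_real_derivative_iff_has_vector_derivative[symmetric] intro!: derivative_eq_intros)
    then have I: "((\<lambda>x. c * exp (- x)) has_integral c * (exp (- s) - exp (- (s + real n)))) {s..s + real n}"
      using has_integral_mult_right[of "\<lambda>x. exp (- x)" _ _ c] by simp
    have "integral {s..s + real n} (\<lambda>x. gw x * (cmod (complex_of_real (poly p x)))\<^sup>2)
        \<le> c * (exp (- s) - exp (- (s + real n)))"
    proof (rule has_integral_le[OF integrable_integral I])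
      show "(\<lambda>x. gw x * (cmod (complex_of_real (poly p x)))\<^sup>2) integrable_on {s..s + real n}"
        by (intro integrable_continuous_real continuous_intros)
      show "gw x * (cmod (complex_of_real (poly p x)))\<^sup>2 \<le> c * exp (- x)" if "x \<in> {s..s + real n}" for x
        using bound[of x] that s by simp
    qed
    also have "\<dots> \<le> c * 1"
    proof (rule mult_left_mono[OF _ c])
      have "exp (- s) \<le> 1" using s by simp
      then show "exp (- s) - exp (- (s + real n)) \<le> 1" using exp_gt_zero[of "- (s + real n)"] by linarith
    qed
    finally show "integral {s..s + real n} (\<lambda>x. gw x * (cmod (complex_of_real (poly p x)))\<^sup>2) \<le> c" by simp
  qed
  moreover have "cut {s..} p = (\<lambda>t. indicat_real {s..} t *\<^sub>R complex_of_real (poly p t))"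
    by (auto simp: cut_def fun_eq_iff)
  ultimately show ?thesis by simp
qed

lemma cut_L2g:
  assumes "P = {z..b} \<or> P = {z..}" "0 \<le> z"
  shows "cut P p \<in> L2g"
proof (cases "P = {z..}")
  case True
  then show ?thesis using poly_ray_L2g[OF assms(2)] by simp
next
  case False
  have "(\<lambda>t. indicat_real {z..b} t *\<^sub>R complex_of_real (poly p t)) \<in> L2g"
    by (intro continuous_bounded_support_L2g continuous_intros)
  moreover have "cut P p = (\<lambda>t. indicat_real {z..b} t *\<^sub>R complex_of_real (poly p t))"
    using assms(1) False by (auto simp: cut_def fun_eq_iff)
  ultimately show ?thesis by simp
qed

lemma cut_deriv:
  assumes t: "t \<in> interior P"
  shows "(cut P p has_vector_derivative cut P (pderiv p) t) (at t)"
proof -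
  have "((\<lambda>t. complex_of_real (poly p t)) has_vector_derivative complex_of_real (poly (pderiv p) t)) (at t)"
    using has_vector_derivative_of_real[of "poly p" "poly (pderiv p) t" "at t"] poly_DERIV[of p t]
    by (simp add: has_real_derivative_iff_has_vector_derivative)
  moreover have "t \<in> P" using t interior_subset by blast
  ultimately have "((\<lambda>t. complex_of_real (poly p t)) has_vector_derivative cut P (pderiv p) t) (at t)"
    by (simp add: cut_def)
  then show ?thesis
    by (rule has_vector_derivative_transform_within_open[OF _ open_interior t])
      (use interior_subset[of P] in \<open>auto simp: cut_def\<close>)
qed

lemma cut_continuous: "continuous_on P (cut P p)"
proof -
  have "continuous_on P (\<lambda>t. complex_of_real (poly p t))" by (intro continuous_intros)
  then show ?thesis by (rule continuous_on_eq) (simp add: cut_def)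
qed

lemma hermite_eig_on:
  assumes P: "P = {z..b} \<or> P = {z..}" "0 \<le> z"
  shows "eig_on (real n) P (cut P (hermite n)) (cut P (pderiv (hermite n)))"
  unfolding eig_on_def H1_on_def
proof (intro conjI ballI allI impI)
  show "\<exists>S. finite S \<and> (\<forall>t\<in>interior P - S. (cut P (hermite n) has_vector_derivative cut P (pderiv (hermite n)) t) (at t))"
    using cut_deriv by (intro exI[of _ "{}"]) simp
  fix t
  show "cut P (hermite n) t = 0" "cut P (pderiv (hermite n)) t = 0" if "t \<notin> P"
    using that by (simp_all add: cut_def)
  assume t: "t \<in> interior P"
  show "(cut P (hermite n) has_vector_derivative cut P (pderiv (hermite n)) t) (at t)" by (rule cut_deriv[OF t])
  have "poly (pderiv (pderiv (hermite n))) t = 2 * t * poly (pderiv (hermite n)) t - 2 * real n * poly (hermite n) t"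
    using hermite_ode[of n t] by linarith
  then have "cut P (pderiv (pderiv (hermite n))) t = (2 * t) *\<^sub>R cut P (pderiv (hermite n)) t - (2 * real n) *\<^sub>R cut P (hermite n) t"
    by (simp add: cut_def scaleR_conv_of_real)
  then show "(cut P (pderiv (hermite n)) has_vector_derivative
      (2 * t) *\<^sub>R cut P (pderiv (hermite n)) t - (2 * real n) *\<^sub>R cut P (hermite n) t) (at t)"
    using cut_deriv[OF t, of "pderiv (hermite n)"] by simp
qed (rule cut_continuous cut_L2g[OF P])+

lemma hermite_nonzero_in_interval:
  assumes "s < t"
  shows "\<exists>x\<in>{s..t}. poly (hermite n) x \<noteq> 0"
proof (rule ccontr)
  assume "\<not> ?thesis"
  then have "{s..t} \<subseteq> {x. poly (hermite n) x = 0}" by auto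
  then have "finite {s..t}" using poly_roots_finite[OF hermite_nz] finite_subset by blast
  then show False using assms infinite_Icc by blast
qed

lemma cut_norm_pos:
  assumes P: "P = {z..b} \<or> P = {z..}" "0 \<le> z" "z < b"
  shows "0 < ip (cut P (hermite n)) (cut P (hermite n))"
proof -
  have H: "H1_on P (cut P (hermite n)) (cut P (pderiv (hermite n)))"
    using hermite_eig_on[OF P(1,2)] by (simp add: eig_on_def)
  have sub: "{z..b} \<subseteq> P" using P by auto
  have "ip (cut P (hermite n)) (cut P (hermite n)) \<noteq> 0"
  proof
    assume "ip (cut P (hermite n)) (cut P (hermite n)) = 0"
    then have "cut P (hermite n) x = 0" if "x \<in> {z..b}" for x
      using H1_on_zero_of_norm_zero[OF H _ sub P(3) that] by blast
    then have "poly (hermite n) x = 0" if "x \<in> {z..b}" for x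
      using that sub by (force simp: cut_def)
    then show False using hermite_nonzero_in_interval[OF P(3)] by blast
  qed
  then show ?thesis using ipg.nonneg[OF cut_L2g[OF P(1,2)]] by (simp add: order_less_le)
qed

text \<open>Green's identity of the function with itself; the boundary terms vanish at the zeros of
  H_n.\<close>

lemma cut_energy:
  assumes P: "(P = {z..b} \<and> poly (hermite n) b = 0) \<or> P = {z..}" "0 \<le> z" "z < b" and z: "poly (hermite n) z = 0"
  shows "ip (cut P (pderiv (hermite n))) (cut P (pderiv (hermite n))) = 2 * real n * ip (cut P (hermite n)) (cut P (hermite n))"
proof -
  have P': "P = {z..b} \<or> P = {z..}" using P by auto
  have e: "eig_on (real n) P (cut P (hermite n)) (cut P (pderiv (hermite n)))" by (rule hermite_eig_on[OF P' P(2)])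
  then have H: "H1_on P (cut P (hermite n)) (cut P (pderiv (hermite n)))" by (simp add: eig_on_def)
  have c0: "cut P (hermite n) z = 0" using z by (simp add: cut_def)
  show ?thesis
  proof (cases "P = {z..}")
    case True
    show ?thesis using green_ray[of "real n" z, folded True, OF e H] c0 by simp
  next
    case False
    then have PP: "P = {z..b}" "poly (hermite n) b = 0" using P by auto
    have "cut P (hermite n) b = 0" using PP(2) by (simp add: cut_def)
    then show ?thesis using green_compact[of "real n" z b, folded PP(1), OF e H less_imp_le[OF P(3)]] c0 by simp
  qed
qed

text \<open>Sturm comparison through the forms. On an interval shorter than pi / \<omega> a shifted
  sine has no zero, so \<open>sine_gap\<close> with \<Lambda> = n + 1 applies to H_n cut off to it;
  but there its energy is only n times its norm. Taking n + 1 rather than n makes the contradiction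
  strict.\<close>

lemma hermite_zero_gap:
  assumes z: "0 \<le> z" "z < b" "poly (hermite n) z = 0" "poly (hermite n) b = 0"
  shows "pi / sqrt (2 * real (n + 1) + 1) \<le> b - z"
proof (rule ccontr)
  assume neg: "\<not> ?thesis"
  define \<omega> where "\<omega> = sqrt (2 * real (n + 1) + 1)"
  have \<omega>: "\<omega> > 0" by (simp add: \<omega>_def)
  have len: "\<omega> * (b - z) < pi" using neg \<omega> unfolding \<omega>_def[symmetric] by (simp add: field_simps)
  \<comment> \<open>Half of the spare phase: on {z..b} the argument of the sine runs from \<epsilon>
    to pi - \<epsilon>.\<close>
  define \<epsilon> where "\<epsilon> = (pi - \<omega> * (b - z)) / 2"
  define P where "P = {z..b}"
  define f where "f = cut P (hermite n)"
  have H: "H1_on {z..b} f (cut P (pderiv (hermite n)))"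
    using hermite_eig_on[of P z b n] z(1) by (simp add: eig_on_def f_def P_def)
  have pos: "sin (\<omega> * x + (\<epsilon> - \<omega> * z)) > 0" if x: "x \<in> {z..b}" for x
  proof (rule sin_gt_zero)
    have "\<omega> * z \<le> \<omega> * x" "\<omega> * x \<le> \<omega> * b" using x \<omega> by simp_all
    then show "0 < \<omega> * x + (\<epsilon> - \<omega> * z)" "\<omega> * x + (\<epsilon> - \<omega> * z) < pi"
      using len by (simp_all add: \<epsilon>_def field_simps)
  qed
  have "2 * real (n + 1) * ip f f \<le> ip (cut P (pderiv (hermite n))) (cut P (pderiv (hermite n)))"
  proof (rule sine_gap[OF H z(2)])
    show "f z = 0" "f b = 0" using z by (simp_all add: f_def cut_def)
    have none: "\<not> (x \<in> {z..b} \<and> sin (sqrt (2 * real (n + 1) + 1) * x + (\<epsilon> - \<omega> * z)) = 0)" for x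
      using pos[of x] unfolding \<omega>_def by auto
    show "f x = 0" if "x \<in> {z..b}" "sin (sqrt (2 * real (n + 1) + 1) * x + (\<epsilon> - \<omega> * z)) = 0" for x
      using none that by blast
    have "{x \<in> {z..b}. sin (sqrt (2 * real (n + 1) + 1) * x + (\<epsilon> - \<omega> * z)) = 0} = {}" using none by blast
    then show "finite {x \<in> {z..b}. sin (sqrt (2 * real (n + 1) + 1) * x + (\<epsilon> - \<omega> * z)) = 0}" by (simp only: finite.emptyI)
  qed simp
  also have "\<dots> = 2 * real n * ip f f"
    unfolding f_def using cut_energy[of P z b n] z by (simp add: P_def)
  finally have "ip f f \<le> 0" by (simp add: algebra_simps)
  moreover have "0 < ip f f" unfolding f_def using cut_norm_pos[of P z b n] z by (simp add: P_def)
  ultimately show False by simp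
qed

text \<open>The radicand 4 k + 5 is 2 (n + 1) + 1 for the degree n = 2 k + 1.\<close>

lemma card_small_roots:
  assumes a: "0 \<le> a"
  shows "real (card {z \<in> pos_roots k. z \<le> a}) \<le> a * sqrt (4 * real k + 5) / pi + 1"
proof -
  have s: "sqrt (2 * real (2 * k + 1 + 1) + 1) = sqrt (4 * real k + 5)" by simp
  have "real (card {z \<in> pos_roots k. z \<le> a}) \<le> (a - 0) / (pi / sqrt (4 * real k + 5)) + 1"
  proof (rule card_separated(2)[OF _ _ _ a])
    show "{z \<in> pos_roots k. z \<le> a} \<subseteq> {0..a}" by (auto simp: pos_roots_def)
    show "0 < pi / sqrt (4 * real k + 5)" by (simp add: add_nonneg_pos)
    show "pi / sqrt (4 * real k + 5) \<le> y - x"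
      if "x \<in> {z \<in> pos_roots k. z \<le> a}" "y \<in> {z \<in> pos_roots k. z \<le> a}" "x < y" for x y
      using hermite_zero_gap[of x y "2 * k + 1"] that unfolding s by (auto simp: pos_roots_def)
  qed
  then show ?thesis by simp
qed

text \<open>The nodal interval that starts at z, unbounded when z is the last zero.\<close>

definition piece :: "nat \<Rightarrow> real \<Rightarrow> real set" where
  "piece k z = (if {\<zeta> \<in> pos_roots k. z < \<zeta>} = {} then {z..} else {z..Min {\<zeta> \<in> pos_roots k. z < \<zeta>}})"

lemma piece_cases:
  obtains b where "z < b" "(piece k z = {z..b} \<and> b \<in> pos_roots k) \<or> piece k z = {z..}"
proof (cases "{\<zeta> \<in> pos_roots k. z < \<zeta>} = {}")
  case True
  then show ?thesis using that[of "z + 1"] by (simp add: piece_def)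
next
  case False
  have "Min {\<zeta> \<in> pos_roots k. z < \<zeta>} \<in> {\<zeta> \<in> pos_roots k. z < \<zeta>}" by (rule Min_in) (use False in auto)
  then show ?thesis using that[of "Min {\<zeta> \<in> pos_roots k. z < \<zeta>}"] False by (auto simp: piece_def)
qed

lemma piece_le:
  assumes "z' \<in> pos_roots k" "z < z'" "t \<in> piece k z"
  shows "t \<le> z'"
proof -
  have "Min {\<zeta> \<in> pos_roots k. z < \<zeta>} \<le> z'" using assms by (intro Min_le) auto
  moreover have "{\<zeta> \<in> pos_roots k. z < \<zeta>} \<noteq> {}" using assms by auto
  ultimately show ?thesis using assms by (auto simp: piece_def split: if_splits)
qed

lemma piece_overlap:
  assumes "z \<in> pos_roots k" "z' \<in> pos_roots k" "z \<noteq> z'" "t \<in> piece k z" "t \<in> piece k z'"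
  shows "t = max z z'"
proof -
  have lo: "z \<le> t" if "t \<in> piece k z" for z using that by (auto simp: piece_def split: if_splits)
  show ?thesis
    using assms lo[OF assms(4)] lo[OF assms(5)] piece_le[of z' k z t] piece_le[of z k z' t]
    by (cases "z < z'") auto
qed

text \<open>Neighbouring nodal intervals share an endpoint, where the derivatives do not vanish; a
  single point does not contribute to the integral.\<close>

lemma ip_almost_disjoint:
  assumes f: "f \<in> L2g" and g: "g \<in> L2g" and d: "\<And>t. t \<noteq> p \<Longrightarrow> f t \<bullet> g t = 0"
  shows "ip f g = 0"
proof -
  have "AE t in lborel. gw t * (f t \<bullet> g t) = 0"
    using AE_lborel_singleton[of p] by eventually_elim (simp add: d)
  then have "(LINT t|lborel. gw t * (f t \<bullet> g t)) = 0" by (rule integral_eq_zero_AE)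
  then show ?thesis using ip_lborel(2)[OF f g] by simp
qed

lemma cut_piece_H1:
  assumes z: "z \<in> pos_roots k" and sz: "s \<le> z"
  defines "P \<equiv> piece k z" and "H \<equiv> hermite (2 * k + 1)"
  shows "H1_on {s..} (cut P H) (cut P (pderiv H))"
proof -
  have z0: "0 \<le> z" "poly H z = 0" using z by (auto simp: pos_roots_def H_def)
  obtain b where b: "z < b" "(P = {z..b} \<and> b \<in> pos_roots k) \<or> P = {z..}"
    unfolding P_def by (rule piece_cases)
  have P: "P = {z..b} \<or> P = {z..}" using b by auto
  have PJ: "P \<subseteq> {s..}" using P sz by auto
  show ?thesis
    unfolding H1_on_def
  proof (intro conjI allI impI)
    fix t assume "t \<notin> {s..}"
    then have "t \<notin> P" using PJ by blast
    then show "cut P H t = 0" "cut P (pderiv H) t = 0" by (simp_all add: cut_def)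
  next
    show "continuous_on {s..} (cut P H)"
    proof (cases "P = {z..}")
      case True
      \<comment> \<open>Clamping the argument to the nodal interval reproduces the extension by 0,
        because H vanishes at its ends.\<close>
      have "continuous_on {s..} (\<lambda>t. complex_of_real (poly H (max z t)))" by (intro continuous_intros)
      then show ?thesis by (rule continuous_on_eq) (use z0 True in \<open>auto simp: cut_def max_def\<close>)
    next
      case False
      then have PP: "P = {z..b}" "poly H b = 0" using b by (auto simp: pos_roots_def H_def)
      have "continuous_on {s..} (\<lambda>t. complex_of_real (poly H (max z (min t b))))" by (intro continuous_intros)
      then show ?thesis by (rule continuous_on_eq) (use z0 PP b in \<open>auto simp: cut_def max_def min_def\<close>)
    qed
  next
    have "(cut P H has_vector_derivative cut P (pderiv H) t) (at t)" if t: "t \<in> interior {s..} - {z, b}" for t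
    proof (cases "t \<in> interior P")
      case True
      then show ?thesis by (rule cut_deriv)
    next
      case False
      have "t \<notin> P" using False t P by auto
      then have "t \<in> - P" "open (- P)" using P by auto
      have "((\<lambda>_. 0) has_vector_derivative cut P (pderiv H) t) (at t)"
        using \<open>t \<notin> P\<close> by (simp add: cut_def)
      then show ?thesis
        by (rule has_vector_derivative_transform_within_open[OF _ \<open>open (- P)\<close> \<open>t \<in> - P\<close>]) (simp add: cut_def)
    qed
    then show "\<exists>S. finite S \<and> (\<forall>t\<in>interior {s..} - S. (cut P H has_vector_derivative cut P (pderiv H) t) (at t))"
      by (intro exI[of _ "{z, b}"]) blast
    show "cut P H \<in> L2g" "cut P (pderiv H) \<in> L2g" by (rule cut_L2g[OF P z0(1)])+
  qed
qed

section \<open>Counting nodes and nodal intervals\<close>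

lemma ip_cmult2: "ip (\<lambda>t. \<gamma> * f t) (\<lambda>t. \<gamma> * g t) = (cmod \<gamma>)\<^sup>2 * ip f g"
proof -
  have "(\<gamma> * a) \<bullet> (\<gamma> * b) = (cmod \<gamma>)\<^sup>2 * (a \<bullet> b)" for a b
    unfolding cmod_power2 inner_complex_def by (simp add: power2_eq_square algebra_simps)
  then show ?thesis by (simp add: ip_def)
qed

context ou_tree
begin

text \<open>Both ends of every edge are included, so vanishing at the nodes decouples the edges. The
  frequency sqrt (4 k + 3) is that of \<open>sine_gap\<close> for \<Lambda> = 2 k + 1.\<close>

definition nodes :: "nat \<Rightarrow> (('e + 'r) \<times> real) set" where
  "nodes k = (\<Union>r\<in>rays T. Pair (Inr r) ` insert (rad T (foot T r)) {z \<in> pos_roots k. rad T (foot T r) < z})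
    \<union> (\<Union>e\<in>arcs (core T). Pair (Inl e) ` ({rad T (tail (core T) e), rad T (head (core T) e)} \<union>
        {x \<in> {rad T (tail (core T) e)..rad T (head (core T) e)}. sin (sqrt (4 * real k + 3) * x) = 0}))"

lemma nodes_foot: "r \<in> rays T \<Longrightarrow> (Inr r, rad T (foot T r)) \<in> nodes k"
  unfolding nodes_def by (rule UnI1, rule UN_I, assumption, rule imageI, rule insertI1)

lemma nodes_ray:
  "r \<in> rays T \<Longrightarrow> z \<in> pos_roots k \<Longrightarrow> rad T (foot T r) < z \<Longrightarrow> (Inr r, z) \<in> nodes k"
  unfolding nodes_def by (rule UnI1, rule UN_I, assumption, rule imageI, rule insertI2) simp

lemma nodes_arc:
  assumes "e \<in> arcs (core T)"
    and "t \<in> {rad T (tail (core T) e), rad T (head (core T) e)} \<or>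
      t \<in> {rad T (tail (core T) e)..rad T (head (core T) e)} \<and> sin (sqrt (4 * real k + 3) * t) = 0"
  shows "(Inl e, t) \<in> nodes k"
  unfolding nodes_def by (rule UnI2, rule UN_I[OF assms(1)], rule imageI) (use assms(2) in simp)

lemma sqrt_pos: "sqrt (4 * real k + 3) > 0"
  by (simp add: add_nonneg_pos)

lemma finite_arc_zeros:
  "e \<in> arcs (core T) \<Longrightarrow>
    finite {x \<in> {rad T (tail (core T) e)..rad T (head (core T) e)}. sin (sqrt (4 * real k + 3) * x) = 0}"
  by (rule sine_zeros(1)[OF sqrt_pos less_imp_le[OF rad_less]])

lemma finite_nodes: "finite (nodes k)"
  unfolding nodes_def using finite_rays finite_arc_zeros by auto

lemma nodes_in: "(x, t) \<in> nodes k \<Longrightarrow> x \<in> E \<and> t \<in> I x"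
  using rad_less by (fastforce simp: nodes_def edges_def less_imp_le)

text \<open>A half-line carries at most k zeros and its foot. On an arc, the 3 stands for the two
  ends and the rounding in the number of sine zeros.\<close>

lemma card_nodes:
  "real (card (nodes k)) \<le> real (m_inf T) * (real k + 1)
    + (\<Sum>e\<in>arcs (core T). len T e * sqrt (4 * real k + 3) / pi + 3)"
proof -
  let ?R = "\<lambda>r. insert (rad T (foot T r)) {z \<in> pos_roots k. rad T (foot T r) < z}"
  let ?Z = "\<lambda>e. {x \<in> {rad T (tail (core T) e)..rad T (head (core T) e)}. sin (sqrt (4 * real k + 3) * x) = 0}"
  let ?A = "\<lambda>e. {rad T (tail (core T) e), rad T (head (core T) e)} \<union> ?Z e"
  have r: "real (card (Pair (Inr r :: 'e + 'r) ` ?R r)) \<le> real k + 1" for r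
  proof -
    have "card (Pair (Inr r :: 'e + 'r) ` ?R r) \<le> card (?R r)" by (rule card_image_le) simp
    also have "\<dots> \<le> Suc (card {z \<in> pos_roots k. rad T (foot T r) < z})" by (rule card_insert_le_m1[THEN order.trans]) (auto simp: card_insert_if)
    also have "\<dots> \<le> Suc (card (pos_roots k))" by (intro Suc_leI le_imp_less_Suc card_mono) auto
    finally show ?thesis by (simp add: card_pos_roots)
  qed
  have a: "real (card (Pair (Inl e :: 'e + 'r) ` ?A e)) \<le> len T e * sqrt (4 * real k + 3) / pi + 3"
    if e: "e \<in> arcs (core T)" for e
  proof -
    have "card (Pair (Inl e :: 'e + 'r) ` ?A e) \<le> card (?A e)"
      by (rule card_image_le) (use finite_arc_zeros[OF e] in simp)
    also have "\<dots> \<le> card {rad T (tail (core T) e), rad T (head (core T) e)} + card (?Z e)" by (rule card_Un_le)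
    also have "\<dots> \<le> 2 + card (?Z e)" by (intro add_right_mono) (simp add: card_insert_if)
    finally have "real (card (Pair (Inl e :: 'e + 'r) ` ?A e)) \<le> 2 + real (card (?Z e))" by simp
    also have "\<dots> \<le> 2 + ((rad T (head (core T) e) - rad T (tail (core T) e)) / (pi / sqrt (4 * real k + 3)) + 1)"
      by (intro add_left_mono sine_zeros(2) sqrt_pos less_imp_le rad_less e)
    finally show ?thesis using rad_head[OF e] by simp
  qed
  have "card (nodes k) \<le> card (\<Union>r\<in>rays T. Pair (Inr r :: 'e + 'r) ` ?R r) + card (\<Union>e\<in>arcs (core T). Pair (Inl e :: 'e + 'r) ` ?A e)"
    unfolding nodes_def by (rule card_Un_le)
  also have "\<dots> \<le> (\<Sum>r\<in>rays T. card (Pair (Inr r :: 'e + 'r) ` ?R r)) + (\<Sum>e\<in>arcs (core T). card (Pair (Inl e :: 'e + 'r) ` ?A e))"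
    by (intro add_mono card_UN_le finite_rays) simp
  finally have "real (card (nodes k)) \<le> real ((\<Sum>r\<in>rays T. card (Pair (Inr r :: 'e + 'r) ` ?R r))
      + (\<Sum>e\<in>arcs (core T). card (Pair (Inl e :: 'e + 'r) ` ?A e)))"
    by (rule of_nat_mono)
  also have "\<dots> = (\<Sum>r\<in>rays T. real (card (Pair (Inr r :: 'e + 'r) ` ?R r)))
      + (\<Sum>e\<in>arcs (core T). real (card (Pair (Inl e :: 'e + 'r) ` ?A e)))"
    by (simp only: of_nat_add of_nat_sum)
  also have "\<dots> \<le> (\<Sum>r\<in>rays T. real k + 1) + (\<Sum>e\<in>arcs (core T). len T e * sqrt (4 * real k + 3) / pi + 3)"
    by (intro add_mono sum_mono r a)
  finally show ?thesis by (simp add: m_inf_def)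
qed

lemma nodes_gap:
  assumes u: "u \<in> F" and z: "\<And>x t. (x, t) \<in> nodes k \<Longrightarrow> fst u x t = 0"
  shows "real (2 * k + 1) * ba T u u \<le> fa T u u"
proof -
  have "2 * real (2 * k + 1) * ip (fst u x) (fst u x) \<le> ip (snd u x) (snd u x)" if x: "x \<in> E" for x
    using x
  proof (cases rule: E_cases)
    case (ray r)
    have H: "H1_on {rad T (foot T r)..} (fst u x) (snd u x)" using form_domD(3)[OF u x] ray by simp
    show ?thesis
    proof (rule ray_gap[OF H rad_nonneg[OF foot_in[OF ray(2)]]])
      show "fst u x (rad T (foot T r)) = 0"
        unfolding ray(1) by (rule z[OF nodes_foot[OF ray(2)]])
      show "fst u x y = 0" if "y \<in> pos_roots k" "rad T (foot T r) < y" for y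
        unfolding ray(1) by (rule z[OF nodes_ray[OF ray(2) that]])
    qed
  next
    case (arc e)
    have H: "H1_on {rad T (tail (core T) e)..rad T (head (core T) e)} (fst u x) (snd u x)"
      using form_domD(3)[OF u x] arc by simp
    have s: "sqrt (2 * real (2 * k + 1) + 1) = sqrt (4 * real k + 3)" by simp
    show ?thesis
    proof (rule sine_gap[OF H rad_less[OF arc(2)], where \<theta> = 0])
      show "fst u x (rad T (tail (core T) e)) = 0" "fst u x (rad T (head (core T) e)) = 0"
        unfolding arc(1) by (rule z[OF nodes_arc[OF arc(2)]], simp)+
      show "fst u x y = 0" if "y \<in> {rad T (tail (core T) e)..rad T (head (core T) e)}"
        "sin (sqrt (2 * real (2 * k + 1) + 1) * y + 0) = 0" for y
        unfolding arc(1)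
        by (rule z[OF nodes_arc[OF arc(2)]]) (use that in \<open>simp only: s add_0_right, simp\<close>)
      show "finite {y \<in> {rad T (tail (core T) e)..rad T (head (core T) e)}.
          sin (sqrt (2 * real (2 * k + 1) + 1) * y + 0) = 0}"
        unfolding s using finite_arc_zeros[OF arc(2), of k] by simp
    qed (rule of_nat_0_le_iff)
  qed
  then have "(\<Sum>x\<in>E. 2 * real (2 * k + 1) * ip (fst u x) (fst u x)) \<le> (\<Sum>x\<in>E. ip (snd u x) (snd u x))"
    by (rule sum_mono)
  then have "2 * real (2 * k + 1) * (\<Sum>x\<in>E. ip (fst u x) (fst u x)) \<le> (\<Sum>x\<in>E. ip (snd u x) (snd u x))"
    unfolding sum_distrib_left .
  moreover have "c * a \<le> b / 2" if "2 * c * a \<le> b" for a b c :: real using that by simp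
  ultimately show ?thesis unfolding fa_def ba_def by blast
qed

definition trials :: "nat \<Rightarrow> ('r \<times> real) set" where
  "trials k = Sigma (rays T) (\<lambda>r. {z \<in> pos_roots k. rad T (foot T r) < z})"

definition trial_fun :: "nat \<Rightarrow> 'r \<times> real \<Rightarrow> ('e + 'r) tpair" where
  "trial_fun k j = single (Inr (fst j)) (cut (piece k (snd j)) (hermite (2 * k + 1)))
     (cut (piece k (snd j)) (pderiv (hermite (2 * k + 1))))"

lemma trialsD:
  assumes "j \<in> trials k"
  shows "fst j \<in> rays T" "snd j \<in> pos_roots k" "rad T (foot T (fst j)) < snd j" "Inr (fst j) \<in> E"
proof -
  show r: "fst j \<in> rays T" "snd j \<in> pos_roots k" "rad T (foot T (fst j)) < snd j"
    using assms unfolding trials_def by (cases j, simp)+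
  show "Inr (fst j) \<in> E" unfolding edges_def by (rule InrI[OF r(1)])
qed

lemma finite_trials: "finite (trials k)"
  unfolding trials_def using finite_rays by auto

lemma card_trials:
  "real (m_inf T) * (real k - 1) - (\<Sum>r\<in>rays T. rad T (foot T r)) * (sqrt (4 * real k + 5) / pi)
    \<le> real (card (trials k))"
proof -
  have r: "real k - 1 - rad T (foot T r) * (sqrt (4 * real k + 5) / pi)
      \<le> real (card {z \<in> pos_roots k. rad T (foot T r) < z})" if "r \<in> rays T" for r
  proof -
    let ?a = "rad T (foot T r)"
    have "k = card (pos_roots k)" by (simp add: card_pos_roots)
    also have "pos_roots k = {z \<in> pos_roots k. z \<le> ?a} \<union> {z \<in> pos_roots k. ?a < z}" by auto
    also have "card \<dots> = card {z \<in> pos_roots k. z \<le> ?a} + card {z \<in> pos_roots k. ?a < z}"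
      by (rule card_Un_disjoint) auto
    finally have "real k = real (card {z \<in> pos_roots k. z \<le> ?a}) + real (card {z \<in> pos_roots k. ?a < z})"
      by (metis of_nat_add)
    then show ?thesis using card_small_roots[OF rad_nonneg[OF foot_in[OF that]], of k] by simp
  qed
  have "(\<Sum>r\<in>rays T. real k - 1 - rad T (foot T r) * (sqrt (4 * real k + 5) / pi))
      \<le> (\<Sum>r\<in>rays T. real (card {z \<in> pos_roots k. rad T (foot T r) < z}))"
    by (rule sum_mono) (rule r)
  also have "\<dots> = real (card (trials k))" by (simp add: trials_def finite_rays)
  finally show ?thesis
    unfolding sum_subtractf[of "\<lambda>_. real k - 1"] sum_distrib_right[symmetric] sum_constant m_inf_def[symmetric] .
qed

lemma trial_fun_in:
  assumes j: "j \<in> trials k"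
  shows "trial_fun k j \<in> F"
proof -
  note jz = trialsD[OF j]
  have "H1_on (I (Inr (fst j))) (cut (piece k (snd j)) (hermite (2 * k + 1)))
      (cut (piece k (snd j)) (pderiv (hermite (2 * k + 1))))"
    using cut_piece_H1[OF jz(2) less_imp_le[OF jz(3)]] by simp
  moreover have "cut (piece k (snd j)) (hermite (2 * k + 1)) (rad T v) = 0"
    if "Inr (fst j) \<in> incident T v" for v
  proof -
    have "rad T v < snd j" using that jz(3) by (simp add: incident_def)
    then have "rad T v \<notin> piece k (snd j)" by (auto simp: piece_def)
    then show ?thesis by (simp add: cut_def)
  qed
  ultimately show ?thesis unfolding trial_fun_def by (rule single_in_F[OF jz(4)])
qed

text \<open>The supports overlap in single points at most, so the summands are orthogonal for both
  forms, and each has energy exactly 2 k + 1 times its norm. The combination inherits this equality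
  whatever the complex coefficients are.\<close>

lemma trial_combination:
  assumes \<gamma>: "\<exists>j\<in>trials k. \<gamma> j \<noteq> 0"
  defines "u \<equiv> (\<Sum>j\<in>trials k. csc (\<gamma> j) (trial_fun k j))"
  shows "0 < ba T u u \<and> fa T u u \<le> real (2 * k + 1) * ba T u u"
proof -
  define H where "H = hermite (2 * k + 1)"
  define c where "c = (\<lambda>j :: 'r \<times> real. cut (piece k (snd j)) H)"
  define c' where "c' = (\<lambda>j :: 'r \<times> real. cut (piece k (snd j)) (pderiv H))"
  define w where "w = (\<lambda>j. csc (\<gamma> j) (trial_fun k j))"
  have ws: "w j = single (Inr (fst j)) (\<lambda>t. \<gamma> j * c j t) (\<lambda>t. \<gamma> j * c' j t)" for j
    unfolding w_def trial_fun_def c_def c'_def H_def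
    by (rule prod_eqI; intro ext) (simp_all add: single_def)
  have wF: "w j \<in> F" if "j \<in> trials k" for j
    unfolding w_def by (rule form_dom_csc[OF trial_fun_in[OF that]])
  note x = trialsD(4) and root = trialsD(2)
  have L: "c j \<in> L2g" "c' j \<in> L2g" if "j \<in> trials k" for j
    unfolding c_def c'_def H_def by (rule H1_onD(1,2)[OF cut_piece_H1[OF root[OF that] order.refl]])+
  have forms: "ba T u' (w j) = ip (fst u' (Inr (fst j))) (\<lambda>t. \<gamma> j * c j t)"
    "fa T u' (w j) = ip (snd u' (Inr (fst j))) (\<lambda>t. \<gamma> j * c' j t) / 2" if "j \<in> trials k" for u' j
    unfolding ws by (rule single_forms[OF x[OF that]])+
  have fs: "fst (w i) (Inr r) = (if r = fst i then (\<lambda>t. \<gamma> i * c i t) else (\<lambda>_. 0))"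
    "snd (w i) (Inr r) = (if r = fst i then (\<lambda>t. \<gamma> i * c' i t) else (\<lambda>_. 0))" for i r
    unfolding ws single_def fst_conv snd_conv sum.inject by (rule refl)+
  have orth: "ba T (w i) (w j) = 0 \<and> fa T (w i) (w j) = 0"
    if ij: "i \<in> trials k" "j \<in> trials k" "i \<noteq> j" for i j
  proof (cases "fst i = fst j")
    case False
    then have "fst (w i) (Inr (fst j)) = (\<lambda>_. 0)" "snd (w i) (Inr (fst j)) = (\<lambda>_. 0)"
      by (simp_all only: fs if_not_P not_sym[OF False] if_False)
    then show ?thesis unfolding forms[OF ij(2)] by (simp only: ip_zero div_0)
  next
    case True
    then have ne: "snd i \<noteq> snd j" using ij(3) by (metis prod_eqI)
    have d: "(\<gamma> i * cut (piece k (snd i)) p t) \<bullet> (\<gamma> j * cut (piece k (snd j)) p t) = 0"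
      if t: "t \<noteq> max (snd i) (snd j)" for t p
    proof -
      have "t \<notin> piece k (snd i) \<or> t \<notin> piece k (snd j)"
        using piece_overlap[OF root[OF ij(1)] root[OF ij(2)] ne] t by blast
      then have "cut (piece k (snd i)) p t = 0 \<or> cut (piece k (snd j)) p t = 0"
        unfolding cut_def by presburger
      then show ?thesis
      proof
        assume "cut (piece k (snd i)) p t = 0"
        then show ?thesis by (simp only: mult_zero_right inner_zero_left)
      next
        assume "cut (piece k (snd j)) p t = 0"
        then show ?thesis by (simp only: mult_zero_right inner_zero_right)
      qed
    qed
    have "ip (\<lambda>t. \<gamma> i * c i t) (\<lambda>t. \<gamma> j * c j t) = 0"
      by (rule ip_almost_disjoint[OF L2g_cmult[OF L(1)[OF ij(1)]] L2g_cmult[OF L(1)[OF ij(2)]]])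
        (unfold c_def, erule d)
    moreover have "ip (\<lambda>t. \<gamma> i * c' i t) (\<lambda>t. \<gamma> j * c' j t) = 0"
      by (rule ip_almost_disjoint[OF L2g_cmult[OF L(2)[OF ij(1)]] L2g_cmult[OF L(2)[OF ij(2)]]])
        (unfold c'_def, erule d)
    ultimately show ?thesis unfolding forms[OF ij(2)] fs True[symmetric] by (simp only: refl if_True div_0)
  qed
  have half: "a * (2 * b * c) / 2 = b * (a * c)" for a b c :: real by simp
  have diag: "ba T (w j) (w j) = (cmod (\<gamma> j))\<^sup>2 * ip (c j) (c j)"
    "fa T (w j) (w j) = real (2 * k + 1) * ba T (w j) (w j)" "0 < ip (c j) (c j)" if j: "j \<in> trials k" for j
  proof -
    obtain b where b: "snd j < b" "(piece k (snd j) = {snd j..b} \<and> b \<in> pos_roots k) \<or> piece k (snd j) = {snd j..}"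
      by (rule piece_cases)
    have z: "0 \<le> snd j" "poly (hermite (2 * k + 1)) (snd j) = 0" using root[OF j] by (simp_all add: pos_roots_def)
    have en: "ip (c' j) (c' j) = 2 * real (2 * k + 1) * ip (c j) (c j)"
      unfolding c_def c'_def H_def
      by (rule cut_energy[where z = "snd j" and b = b]) (use b z in \<open>auto simp: pos_roots_def\<close>)
    show "0 < ip (c j) (c j)"
      unfolding c_def H_def by (rule cut_norm_pos[where z = "snd j" and b = b]) (use b z in auto)
    show 1: "ba T (w j) (w j) = (cmod (\<gamma> j))\<^sup>2 * ip (c j) (c j)"
      unfolding forms[OF j] fs by (simp only: refl if_True ip_cmult2)
    have "fa T (w j) (w j) = (cmod (\<gamma> j))\<^sup>2 * ip (c' j) (c' j) / 2"
      unfolding forms[OF j] fs by (simp only: refl if_True ip_cmult2)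
    then show "fa T (w j) (w j) = real (2 * k + 1) * ba T (w j) (w j)"
      unfolding 1 en half .
  qed
  have u: "u = sum w (trials k)" by (simp add: u_def w_def)
  have bu: "ba T u u = (\<Sum>j\<in>trials k. ba T (w j) (w j))"
    unfolding u by (rule B.sum_orthogonal[OF finite_trials wF]) (use orth in blast)+
  have "fa T u u = (\<Sum>j\<in>trials k. fa T (w j) (w j))"
    unfolding u by (rule A.sum_orthogonal[OF finite_trials wF]) (use orth in blast)+
  also have "\<dots> = (\<Sum>j\<in>trials k. real (2 * k + 1) * ba T (w j) (w j))"
    by (rule sum.cong[OF refl]) (rule diag(2))
  also have "\<dots> = real (2 * k + 1) * ba T u u" unfolding bu by (rule sum_distrib_left[symmetric])
  finally have fu: "fa T u u = real (2 * k + 1) * ba T u u" .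
  obtain j where j: "j \<in> trials k" "\<gamma> j \<noteq> 0" using \<gamma> by blast
  have "0 < (cmod (\<gamma> j))\<^sup>2" by (rule zero_less_power) (simp add: j(2))
  then have "0 < ba T (w j) (w j)" unfolding diag(1)[OF j(1)] by (rule mult_pos_pos[OF _ diag(3)[OF j(1)]])
  also have "\<dots> \<le> ba T u u"
    unfolding bu by (rule member_le_sum[OF j(1) _ finite_trials]) (rule B.nonneg, rule wF, erule DiffD1)
  finally have "0 < ba T u u" .
  then show ?thesis using eq_refl[OF fu] by (rule conjI)
qed

lemma lam_lower:
  assumes "enumerates_eigenvalues (OU T X) lam"
  shows "real (2 * k + 1) \<le> lam (card (nodes k) + 1)"
  by (rule eigenvalue_lower_bound[OF assms finite_nodes nodes_gap])

text \<open>The gap is taken from \<open>nodes (k + 1)\<close>: the minimisation needs a level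
  strictly above 2 k + 1, and 2 k + 3 is the next one.\<close>

lemma lam_upper:
  assumes "enumerates_eigenvalues (OU T X) lam" and "card (trials k) > 0"
  shows "lam (card (trials k)) \<le> real (2 * k + 1)"
proof (rule eigenvalue_upper_bound[OF assms(1) finite_nodes[of "k + 1"], where w = "trial_fun k"])
  show "x \<in> E \<and> t \<in> I x" if "(x, t) \<in> nodes (k + 1)" for x t by (rule nodes_in[OF that])
  show "real (2 * (k + 1) + 1) * ba T u u \<le> fa T u u"
    if "u \<in> F" "\<And>x t. (x, t) \<in> nodes (k + 1) \<Longrightarrow> fst u x t = 0" for u
    by (rule nodes_gap[OF that])
  show "trials k \<noteq> {}" using assms(2) by auto
  show "real (2 * k + 1) < real (2 * (k + 1) + 1)" by simp
  show "finite (trials k)" by (rule finite_trials)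
  show "trial_fun k j \<in> F" if "j \<in> trials k" for j by (rule trial_fun_in[OF that])
  fix \<gamma> :: "'r \<times> real \<Rightarrow> complex"
  let ?u = "\<Sum>j\<in>trials k. csc (\<gamma> j) (trial_fun k j)"
  assume "\<exists>j\<in>trials k. \<gamma> j \<noteq> 0"
  then show "0 < ba T ?u ?u \<and> fa T ?u ?u \<le> real (2 * k + 1) * ba T ?u ?u" by (rule trial_combination)
qed

end

section \<open>Asymptotics\<close>

lemma eventually_le_of_ratio:
  fixes g :: "nat \<Rightarrow> real"
  assumes "(\<lambda>k. g k / real k) \<longlonglongrightarrow> m" "m < c"
  shows "\<exists>N. \<forall>k\<ge>N. g k \<le> c * real k"
proof -
  have "\<forall>\<^sub>F k in sequentially. g k / real k < c" by (rule order_tendstoD(2)[OF assms])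
  then have "\<forall>\<^sub>F k in sequentially. g k \<le> c * real k"
    using eventually_gt_at_top[of 0] by eventually_elim (simp add: field_simps)
  then show ?thesis by (simp add: eventually_sequentially)
qed

text \<open>Inverting the counting functions: \<open>A k\<close> and \<open>B k\<close> bound the number of eigenvalues below
  \<open>2 * k + 1\<close> from above and from below.\<close>

lemma ratio_of_counts:
  fixes lam :: "nat \<Rightarrow> real" and A B :: "nat \<Rightarrow> nat"
  assumes m: "0 < m" and mono: "mono_on {1..} lam"
    and A: "\<And>k. 1 \<le> A k" "\<And>k. real (2 * k + 1) \<le> lam (A k)" "(\<lambda>k. g k / real k) \<longlonglongrightarrow> m" "\<And>k. real (A k) \<le> g k"
    and B: "\<And>k. 0 < B k \<Longrightarrow> lam (B k) \<le> real (2 * k + 1)" "(\<lambda>k. h k / real k) \<longlonglongrightarrow> m" "\<And>k. h k \<le> real (B k)"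
  shows "(\<lambda>n. lam n / real n) \<longlonglongrightarrow> 2 / m"
proof -
  have lower: "\<forall>\<^sub>F n in sequentially. 2 / c - 1 / real n \<le> lam n / real n" if c: "m < c" for c
  proof -
    have c0: "0 < c" using c m by simp
    obtain N where N: "\<And>k. N \<le> k \<Longrightarrow> g k \<le> c * real k" using eventually_le_of_ratio[OF A(3) c] by blast
    have "\<forall>\<^sub>F n in sequentially. max 1 (nat \<lceil>c * (real N + 1)\<rceil>) \<le> n" by (rule eventually_ge_at_top)
    then show ?thesis
    proof eventually_elim
      case (elim n)
      then have n: "1 \<le> n" "c * (real N + 1) \<le> real n" by linarith+
      \<comment> \<open>The largest k with c * k at most n: then A k is at most n, and 2 k + 1
        exceeds 2 n / c - 1. The lower bound on n ensures that k is at least N.\<close>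
      define k where "k = nat \<lfloor>real n / c\<rfloor>"
      have q: "real N + 1 \<le> real n / c" using n(2) c0 by (simp add: field_simps)
      have "real k = of_int \<lfloor>real n / c\<rfloor>" using q by (simp add: k_def)
      then have k: "real k \<le> real n / c" "real n / c - 1 < real k" by linarith+
      have "N \<le> k" using k q by linarith
      then have "real (A k) \<le> c * real k" using A(4)[of k] N[of k] by linarith
      also have "\<dots> \<le> c * (real n / c)" by (rule mult_left_mono[OF k(1) less_imp_le[OF c0]])
      also have "\<dots> = real n" using c0 by simp
      finally have "A k \<le> n" by simp
      then have "lam (A k) \<le> lam n" using A(1)[of k] n by (intro mono_onD[OF mono]) auto
      then have "2 * (real n / c) - 1 \<le> lam n" using A(2)[of k] k by simp
      then have "(2 * (real n / c) - 1) / real n \<le> lam n / real n" by (rule divide_right_mono) simp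
      then show ?case using n c0 by (simp add: diff_divide_distrib)
    qed
  qed
  have upper: "\<forall>\<^sub>F n in sequentially. lam n / real n \<le> 2 / c + 3 / real n" if c: "c < m" "0 < c" for c
  proof -
    have "(\<lambda>k. - h k / real k) \<longlonglongrightarrow> - m" using tendsto_minus[OF B(2)] by simp
    then obtain N where N: "\<And>k. N \<le> k \<Longrightarrow> - h k \<le> - c * real k"
      using eventually_le_of_ratio[of "\<lambda>k. - h k" "- m" "- c"] c by auto
    have "\<forall>\<^sub>F n in sequentially. max 1 (nat \<lceil>c * (real N + 1)\<rceil>) \<le> n" by (rule eventually_ge_at_top)
    then show ?thesis
    proof eventually_elim
      case (elim n)
      then have n: "1 \<le> n" "c * (real N + 1) \<le> real n" by linarith+
      \<comment> \<open>Rounded up, so that n is at most c * k and hence at most B k; the 3 is 1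
        plus twice the rounding error.\<close>
      define k where "k = nat \<lceil>real n / c\<rceil>"
      have q: "real N + 1 \<le> real n / c" using n(2) c by (simp add: field_simps)
      have "real k = of_int \<lceil>real n / c\<rceil>" using q by (simp add: k_def)
      then have k: "real n / c \<le> real k" "real k < real n / c + 1" by linarith+
      have "N \<le> k" using k q by linarith
      have "real n = c * (real n / c)" using c by simp
      also have "\<dots> \<le> c * real k" by (rule mult_left_mono[OF k(1) less_imp_le[OF c(2)]])
      also have "\<dots> \<le> real (B k)" using B(3)[of k] N[OF \<open>N \<le> k\<close>] by linarith
      finally have nB: "n \<le> B k" by simp
      then have "lam n \<le> lam (B k)" using n by (intro mono_onD[OF mono]) auto
      then have "lam n \<le> 2 * (real n / c) + 3" using B(1)[of k] nB n k by simp
      then have "lam n / real n \<le> (2 * (real n / c) + 3) / real n" by (rule divide_right_mono) simp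
      then show ?case using n c by (simp add: add_divide_distrib)
    qed
  qed
  show ?thesis
  proof (rule order_tendstoI)
    fix a assume a: "a < 2 / m"
    have "((\<lambda>c. 2 / c) \<longlongrightarrow> 2 / m) (at_right m)" by (intro tendsto_intros) (use m in simp)
    then have "\<forall>\<^sub>F c in at_right m. a < 2 / c" using a by (rule order_tendstoD(1))
    then have "\<forall>\<^sub>F c in at_right m. a < 2 / c \<and> m < c"
      using eventually_at_right_less[of m] by eventually_elim simp
    then obtain c where c: "a < 2 / c" "m < c" using eventually_happens'[OF trivial_limit_at_right_real] by blast
    have "(\<lambda>n. 2 / c - 1 / real n) \<longlonglongrightarrow> 2 / c - 0" by (intro tendsto_diff tendsto_const lim_1_over_n)
    then have "\<forall>\<^sub>F n in sequentially. a < 2 / c - 1 / real n" using order_tendstoD(1) c(1) by simp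
    with lower[OF c(2)] show "\<forall>\<^sub>F n in sequentially. a < lam n / real n" by eventually_elim simp
  next
    fix a assume a: "2 / m < a"
    have "((\<lambda>c. 2 / c) \<longlongrightarrow> 2 / m) (at_left m)" by (intro tendsto_intros) (use m in simp)
    then have "\<forall>\<^sub>F c in at_left m. 2 / c < a" using a by (rule order_tendstoD(2))
    moreover have "\<forall>\<^sub>F c in at_left m. c \<in> {0<..<m}" by (rule eventually_at_leftI[OF _ m]) simp
    ultimately have "\<forall>\<^sub>F c in at_left m. 2 / c < a \<and> c < m \<and> 0 < c" by eventually_elim simp
    then obtain c where c: "2 / c < a" "c < m" "0 < c" using eventually_happens'[OF trivial_limit_at_left_real] by blast
    have "(\<lambda>n. 3 * (1 / real n)) \<longlonglongrightarrow> 3 * 0" by (intro tendsto_mult tendsto_const lim_1_over_n)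
    then have "(\<lambda>n. 2 / c + 3 / real n) \<longlonglongrightarrow> 2 / c + 0" by (intro tendsto_add tendsto_const) simp
    then have "\<forall>\<^sub>F n in sequentially. 2 / c + 3 / real n < a" using order_tendstoD(2) c(1) by simp
    with upper[OF c(2,3)] show "\<forall>\<^sub>F n in sequentially. lam n / real n < a" by eventually_elim simp
  qed
qed

context ou_tree
begin

lemma m_inf_pos: "0 < m_inf T"
proof -
  have "foot T ` rays T \<noteq> {}" using T by (simp add: is_ray_tree_def)
  then show ?thesis using finite_rays by (simp add: m_inf_def card_gt_0_iff)
qed

lemma eigenvalue_ratio:
  assumes en: "enumerates_eigenvalues (OU T X) lam"
  shows "(\<lambda>n. lam n / real n) \<longlonglongrightarrow> 2 / real (m_inf T)"
proof -
  define M L R where "M = real (m_inf T)"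
    and "L = (\<Sum>e\<in>arcs (core T). len T e)" and "R = (\<Sum>r\<in>rays T. rad T (foot T r))"
  \<comment> \<open>Three per arc from \<open>card_nodes\<close>, and one for the shift in
    \<open>card (nodes k) + 1\<close>.\<close>
  define c where "c = 3 * real (card (arcs (core T))) + 1"
  define g where "g = (\<lambda>k. M * (real k + 1) + L * sqrt (4 * real k + 3) / pi + c)"
  define h where "h = (\<lambda>k. M * (real k - 1) - R * (sqrt (4 * real k + 5) / pi))"
  have lim: "(\<lambda>k. (real k + 1) / real k) \<longlonglongrightarrow> 1" "(\<lambda>k. (real k - 1) / real k) \<longlonglongrightarrow> 1"
    "(\<lambda>k. sqrt (4 * real k + 3) / real k) \<longlonglongrightarrow> 0" "(\<lambda>k. sqrt (4 * real k + 5) / real k) \<longlonglongrightarrow> 0"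
    by real_asymp+
  have "(\<lambda>k. M * ((real k + 1) / real k) + (L / pi) * (sqrt (4 * real k + 3) / real k) + c * (1 / real k))
      \<longlonglongrightarrow> M * 1 + (L / pi) * 0 + c * 0"
    by (intro tendsto_add tendsto_mult tendsto_const lim lim_1_over_n)
  moreover have "M * (a / b) + (L / pi) * (d / b) + c * (1 / b) = (M * a + L * d / pi + c) / b" for a b d
    by (simp add: add_divide_distrib)
  ultimately have g: "(\<lambda>k. g k / real k) \<longlonglongrightarrow> M" by (simp only: g_def mult_1_right mult_zero_right add_0_right)
  have "(\<lambda>k. M * ((real k - 1) / real k) - (R / pi) * (sqrt (4 * real k + 5) / real k)) \<longlonglongrightarrow> M * 1 - (R / pi) * 0"
    by (intro tendsto_diff tendsto_mult tendsto_const lim)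
  moreover have "M * (a / b) - (R / pi) * (d / b) = (M * a - R * (d / pi)) / b" for a b d
    by (simp add: diff_divide_distrib)
  ultimately have h: "(\<lambda>k. h k / real k) \<longlonglongrightarrow> M" by (simp only: h_def mult_1_right mult_zero_right diff_0_right)
  have M: "0 < M" using m_inf_pos by (simp add: M_def)
  have mono: "mono_on {1..} lam" using en unfolding enumerates_eigenvalues_def by blast
  have "(\<Sum>e\<in>arcs (core T). len T e * sqrt (4 * real k + 3) / pi + 3)
      = L * sqrt (4 * real k + 3) / pi + 3 * real (card (arcs (core T)))" for k
    by (simp add: L_def sum.distrib sum_distrib_right sum_divide_distrib)
  then have A: "real (card (nodes k) + 1) \<le> g k" for k
    using card_nodes[of k] by (simp add: g_def c_def M_def)
  show ?thesis
    unfolding M_def[symmetric]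
  proof (rule ratio_of_counts[OF M mono _ _ g A _ h])
    show "1 \<le> card (nodes k) + 1" for k by simp
    show "real (2 * k + 1) \<le> lam (card (nodes k) + 1)" for k by (rule lam_lower[OF en])
    show "lam (card (trials k)) \<le> real (2 * k + 1)" if "0 < card (trials k)" for k
      by (rule lam_upper[OF en that])
    show "h k \<le> real (card (trials k))" for k
      using card_trials[of k] by (simp only: h_def M_def R_def)
  qed
qed

lemma eigenvalue_asymptotics:
  assumes en: "enumerates_eigenvalues (OU T X) lam"
  shows "filterlim lam at_top sequentially"
    "lam \<sim>[sequentially] (\<lambda>n. 2 * real n / real (m_inf T))"
    "lam \<in> O[sequentially](\<lambda>n. real n)"
proof -
  define M where "M = real (m_inf T)"
  have M: "0 < M" using m_inf_pos by (simp add: M_def)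
  have r: "(\<lambda>n. lam n / real n) \<longlonglongrightarrow> 2 / M" using eigenvalue_ratio[OF en] by (simp add: M_def)
  have "filterlim (\<lambda>n. lam n / real n * real n) at_top sequentially"
    by (rule filterlim_tendsto_pos_mult_at_top[OF r _ filterlim_real_sequentially]) (use M in simp)
  then show "filterlim lam at_top sequentially"
    by (rule filterlim_mono_eventually[OF _ order.refl order.refl])
      (use eventually_gt_at_top[of 0] in \<open>eventually_elim, simp\<close>)
  have "(\<lambda>n. lam n / real n * (M / 2)) \<longlonglongrightarrow> 2 / M * (M / 2)" by (intro tendsto_mult r tendsto_const)
  moreover have "lam n / real n * (M / 2) = lam n / (2 * real n / M)" for n by (simp add: field_simps)
  ultimately have "(\<lambda>n. lam n / (2 * real n / M)) \<longlonglongrightarrow> 2 / M * (M / 2)" by (simp only:)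
  also have "2 / M * (M / 2) = 1" using M by simp
  finally have "(\<lambda>n. lam n / (2 * real n / M)) \<longlonglongrightarrow> 1" .
  then show "lam \<sim>[sequentially] (\<lambda>n. 2 * real n / real (m_inf T))"
    unfolding M_def by (rule asymp_equivI')
  show "lam \<in> O[sequentially](\<lambda>n. real n)"
    by (rule bigoI_tendsto[OF r]) (use eventually_gt_at_top[of 0] in \<open>eventually_elim, simp\<close>)
qed

section \<open>The bottom of the spectrum\<close>

lemma eigenfunction_exists:
  assumes en: "enumerates_eigenvalues (OU T X) lam" and n: "1 \<le> n"
  obtains u where "u \<in> eigp T X (lam n)" "fst u \<noteq> 0"
proof -
  obtain B p where B: "\<And>c. finite (B c)" "\<And>c. card (B c) = card {n \<in> {1..}. lam n = c}"
    "\<And>c. finite {n \<in> {1..}. lam n = c}" "\<And>c. tfun.independent (B c)"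
    "\<And>c. tfun.span (B c) = eigenspace (OU T X) (complex_of_real c)" "\<And>c f. f \<in> B c \<Longrightarrow> (f, p c f) \<in> eigp T X c"
    using eigen_basis[OF en] by blast
  have "n \<in> {k \<in> {1..}. lam k = lam n}" using n by simp
  then have "card {k \<in> {1..}. lam k = lam n} \<noteq> 0" using B(3)[of "lam n"] card_0_eq by blast
  then have "B (lam n) \<noteq> {}" unfolding B(2)[symmetric] by (metis card.empty)
  then obtain f where f: "f \<in> B (lam n)" by blast
  have "f \<noteq> 0" using tfun.dependent_zero[of "B (lam n)"] B(4)[of "lam n"] f by metis
  then show ?thesis using that[OF B(6)[OF f]] by simp
qed

lemma ba_pos: "u \<in> F \<Longrightarrow> fst u \<noteq> 0 \<Longrightarrow> 0 < ba T u u"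
  using B.nonneg[of u] ba_zero_imp[of u] by (fastforce simp: fun_eq_iff zero_fun_def order_less_le)

lemma eigenvalue_nonneg:
  assumes en: "enumerates_eigenvalues (OU T X) lam" and n: "1 \<le> n"
  shows "0 \<le> lam n"
proof -
  obtain u where u: "u \<in> eigp T X (lam n)" "fst u \<noteq> 0" by (rule eigenfunction_exists[OF assms])
  have uF: "u \<in> F" by (rule eigp_F[OF u(1)])
  have "0 \<le> lam n * ba T u u" using A.nonneg[OF uF] green_tree[OF u(1) uF] by simp
  then show ?thesis using ba_pos[OF uF u(2)] by (simp add: zero_le_mult_iff)
qed

text \<open>An eigenfunction for 0 has no energy, and the Dirichlet condition at the root leaves
  only 0 by \<open>kernel_zero\<close>.\<close>

lemma eigenvalue_pos:
  assumes en: "enumerates_eigenvalues (OU T X) lam" and n: "1 \<le> n" and r: "root T \<in> X"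
  shows "0 < lam n"
proof (rule ccontr)
  assume "\<not> 0 < lam n"
  then have z: "lam n = 0" using eigenvalue_nonneg[OF en n] by simp
  obtain u where u: "u \<in> eigp T X (lam n)" "fst u \<noteq> 0" by (rule eigenfunction_exists[OF en n])
  have uF: "u \<in> F" by (rule eigp_F[OF u(1)])
  have "fa T u u = 0" using green_tree[OF u(1) uF] z by simp
  then have "fst u x t = 0" for x t by (rule kernel_zero[OF uF]) (rule form_domD(5)[OF uF r])
  then show False using u(2) by (simp add: fun_eq_iff)
qed

lemma root_incident: "\<exists>x. x \<in> incident T (root T)"
proof -
  obtain v where v: "v \<in> verts (core T)" "v \<noteq> root T" using T by (auto simp: is_ray_tree_def leaves_def)
  obtain p where p: "G.awalk (root T) p v" using unique_walk[OF v(1)] by blast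
  then obtain e q where "p = e # q" using v(2) by (cases p) (auto simp: G.awalk_Nil_iff)
  then have "e \<in> arcs (core T)" "tail (core T) e = root T" using p by (simp_all add: G.awalk_Cons_iff)
  then have "Inl e \<in> incident T (root T)" by (simp add: incident_def edges_def InlI)
  then show ?thesis by blast
qed

text \<open>The constant 1 written as the Hermite polynomial of degree 0, so that
  \<open>hermite_eig_on\<close> provides its regularity and integrability.\<close>

definition unit_pair :: "('e + 'r) tpair" where
  "unit_pair = (\<lambda>x. if x \<in> E then cut (I x) (hermite 0) else (\<lambda>_. 0), \<lambda>_ _. 0)"

lemma unit_pair_value: "x \<in> E \<Longrightarrow> t \<in> I x \<Longrightarrow> fst unit_pair x t = 1"
  by (simp add: unit_pair_def cut_def)

lemma unit_pair_eigp:
  assumes "X = {}"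
  shows "unit_pair \<in> eigp T X 0"
proof -
  have e: "eig_on 0 (I x) (fst unit_pair x) (snd unit_pair x)" if x: "x \<in> E" for x
  proof -
    obtain b where "I x = {lo x..b} \<or> I x = {lo x..}" using span_form[OF x] by blast
    from hermite_eig_on[OF this span_props(7)[OF x], of 0] show ?thesis
      using x by (simp add: unit_pair_def cut_def[abs_def] cong: if_cong)
  qed
  have "unit_pair \<in> F"
  proof (rule form_domI)
    show "fst unit_pair x = (\<lambda>_. 0) \<and> snd unit_pair x = (\<lambda>_. 0)" if "x \<notin> E" for x
      using that by (simp add: unit_pair_def)
    show "H1_on (I x) (fst unit_pair x) (snd unit_pair x)" if "x \<in> E" for x
      using e[OF that] by (simp add: eig_on_def)
    show "fst unit_pair x (rad T v) = fst unit_pair y (rad T v)" if "x \<in> incident T v" "y \<in> incident T v" for v x y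
      using that by (simp add: unit_pair_value incident_E rad_in_span)
  qed (use assms in simp)
  moreover have "normal_deriv T (snd unit_pair) v x = 0" for v x by (simp add: normal_deriv_def unit_pair_def)
  ultimately show ?thesis using e by (simp add: eigp_def)
qed

text \<open>Subtracting the value at the root reduces the claim to \<open>kernel_zero\<close>; some
  edge at the root exists because there is a leaf different from it.\<close>

lemma kernel_constants:
  assumes "X = {}" and u: "u \<in> eigp T X 0"
  shows "\<exists>c. fst u = fscale c (fst unit_pair)"
proof -
  obtain y where y: "y \<in> incident T (root T)" using root_incident by blast
  define c where "c = fst u y (rad T (root T))"
  define w where "w = u + csc (- c) unit_pair"
  have w: "w \<in> eigp T X 0"
    unfolding w_def by (rule eigp_add[OF u eigp_csc[OF unit_pair_eigp[OF assms(1)]]])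
  have wF: "w \<in> F" by (rule eigp_F[OF w])
  have wv: "fst w x t = fst u x t - c * fst unit_pair x t" for x t by (simp add: w_def plus_fun_def)
  have "fst w x t = 0" for x t
  proof (rule kernel_zero[OF wF])
    show "fa T w w = 0" using green_tree[OF w wF] by simp
    fix x assume x: "x \<in> incident T (root T)"
    have "fst u x (rad T (root T)) = c"
      unfolding c_def by (rule form_domD(4)[OF eigp_F[OF u] root_in x y])
    then show "fst w x (rad T (root T)) = 0"
      using unit_pair_value[OF incident_E[OF x] rad_in_span[OF x]] by (simp add: wv)
  qed
  then have "fst u = fscale c (fst unit_pair)" by (simp add: wv fun_eq_iff fscale_def)
  then show ?thesis by blast
qed

text \<open>Simplicity is what separates the second eigenvalue from 0: with monotonicity, the single
  index carrying 0 must be 1.\<close>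

lemma zero_eigenvalue_simple:
  assumes en: "enumerates_eigenvalues (OU T X) lam" and X0: "X = {}"
  shows "card {n \<in> {1..}. lam n = 0} = 1"
proof -
  obtain B p where B: "\<And>c. finite (B c)" "\<And>c. card (B c) = card {n \<in> {1..}. lam n = c}"
    "\<And>c. finite {n \<in> {1..}. lam n = c}" "\<And>c. tfun.independent (B c)"
    "\<And>c. tfun.span (B c) = eigenspace (OU T X) (complex_of_real c)" "\<And>c f. f \<in> B c \<Longrightarrow> (f, p c f) \<in> eigp T X c"
    using eigen_basis[OF en] by blast
  let ?f = "fst unit_pair"
  have "B 0 \<subseteq> tfun.span {?f}"
  proof
    fix f assume "f \<in> B 0"
    then obtain c where "f = fscale c ?f" using kernel_constants[OF X0 B(6)] by auto
    then show "f \<in> tfun.span {?f}" using tfun.span_scale[OF tfun.span_base[of ?f "{?f}"]] by simp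
  qed
  then have "card (B 0) \<le> card {?f}" using tfun.independent_span_bound[OF _ B(4)] by blast
  moreover have "card (B 0) \<noteq> 0"
  proof
    assume "card (B 0) = 0"
    then have "B 0 = {}" using B(1) by simp
    then have "eigenspace (OU T X) (complex_of_real 0) = {0}" using B(5)[of 0] by simp
    moreover have "?f \<in> eigenspace (OU T X) (complex_of_real 0)"
      unfolding eigenspace_def using eigp_imp_OU[OF unit_pair_eigp[OF X0]] by simp
    ultimately have "?f = 0" by blast
    moreover obtain x where x: "x \<in> incident T (root T)" using root_incident by blast
    ultimately show False using unit_pair_value[OF incident_E[OF x] rad_in_span[OF x]] by simp
  qed
  ultimately show ?thesis using B(2)[of 0] by simp
qed

lemma first_eigenvalues:
  assumes en: "enumerates_eigenvalues (OU T X) lam" and X0: "X = {}"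
  shows "lam 1 = 0" "0 < lam 2"
proof -
  obtain j where j: "{n \<in> {1..}. lam n = 0} = {j}" using zero_eigenvalue_simple[OF assms] by (rule card_1_singletonE)
  have mono: "mono_on {1..} lam" using en unfolding enumerates_eigenvalues_def by blast
  have "j \<in> {n \<in> {1..}. lam n = 0}" unfolding j by simp
  then have "1 \<le> j" "lam j = 0" by simp_all
  then have "lam 1 \<le> 0" using mono_onD[OF mono, of 1 j] by simp
  then show l1: "lam 1 = 0" using eigenvalue_nonneg[OF en, of 1] by simp
  then have "1 \<in> {n \<in> {1..}. lam n = 0}" by simp
  then have "2 \<notin> {n \<in> {1..}. lam n = 0}" unfolding j by simp
  then have "lam 2 \<noteq> 0" by simp
  then show "0 < lam 2" using eigenvalue_nonneg[OF en, of 2] by simp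
qed

end

theorem proposition3p7:
  fixes T :: "('v, 'e, 'r) ray_tree"
    and lamD lamN :: "nat \<Rightarrow> real"
  assumes "is_ray_tree T"
    and "enumerates_eigenvalues (OU_D T) lamD"
    and "enumerates_eigenvalues (OU_N T) lamN"
  shows "0 < lamD 1 \<and> filterlim lamD at_top sequentially \<and>
         lamN 1 = 0 \<and> 0 < lamN 2 \<and> filterlim lamN at_top sequentially \<and>
         lamD \<sim>[sequentially] (\<lambda>n. 2 * real n / real (m_inf T)) \<and>
         lamN \<sim>[sequentially] (\<lambda>n. 2 * real n / real (m_inf T)) \<and>
         lamD \<in> O[sequentially](\<lambda>n. real n) \<and>
         lamN \<in> O[sequentially](\<lambda>n. real n)"
proof -
  interpret D: ou_tree T "{root T}"
    using assms(1) by unfold_locales (auto simp: is_ray_tree_def)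
  interpret N: ou_tree T "{}"
    using assms(1) by unfold_locales auto
  note eD = assms(2)[unfolded OU_D_eq] and eN = assms(3)[unfolded OU_N_eq]
  show ?thesis
    by (intro conjI D.eigenvalue_pos[OF eD] D.eigenvalue_asymptotics[OF eD]
        N.first_eigenvalues[OF eN refl] N.eigenvalue_asymptotics[OF eN] order.refl insertI1)
qed

end
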